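(* For every $T>0$ there is a finite constant $C=C(T,\nu,a,b,Q)$ such that $$\|S_T^*\xi\|_{E_b}^2\le C\,\|A_T^*\xi\|_{L^2(0,T;H)}^2,\qquad \xi\in E_b,$$ and there exists $K_T\in\mathcal L(E_b,L^2(0,T;H))$ such that $$S_T=A_TK_T,\qquad \|K_T\|\le\sqrt C .$$
   Context: $\mathbb T^2=(\mathbb R/2\pi\mathbb Z)^2$ carries normalised Lebesgue measure. $H^s$ is the space of mean-zero real distributions on $\mathbb T^2$ with $\|f\|_{H^s}^2=\sum_{k\ne0}|k|^{2s}|\widehat f(k)|^2<\infty$; $H=H^0$, norm $\|\cdot\|_2$. $\mathbb Z^2_+=\{k\in\mathbb Z^2\setminus\{0\}:k_1>0\text{ or }(k_1=0,k_2>0)\}$; $e_{k,\cos},e_{k,\sin}$ are the $L^2$-normalised real Fourier modes. $Kf=\nabla^\perp(-\Delta)^{-1}f$ with $\nabla^\perp=(-\partial_2,\partial_1)$, $B(f,g)=(Kf)\cdot\nabla g$. Fix $\nu>0$, $0<c_Q\le C_Q<\infty$, $a>14$, $b=(a-3)/2$; $Q$ is diagonal, $Qe_{k,\iota}=q_k^\iota e_{k,\iota}$, with $c_Q|k|^{-a/2}\le|q_k^\iota|\le C_Q|k|^{-a/2}$ for all $k\in\mathbb Z^2_+$, $\iota\in\{\cos,\sin\}$ (so $Q:H\to H^b$ is bounded). Let $\phi(x)=\cos x_1+\cos x_2$ (so $\|\phi\|_2=1$, $-\Delta\phi=\phi$), $\phi^\perp$ its orthogonal complement in $H$, $\Pi_{\phi^\perp}$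 the orthogonal projection, and $E_b=H^b\oplus\phi^\perp$ with the Hilbert sum norm. Define $$\mathcal L(\xi,\eta)=\bigl(\nu\Delta\xi,\ \nu(\Delta+1)\eta+C_\phi\xi\bigr),\qquad C_\phi\xi=-\Pi_{\phi^\perp}\bigl(B(\xi,\phi)+B(\phi,\xi)\bigr),$$ where $C_\phi:H^b\to H$ is bounded. $S_T=e^{T\mathcal L}$ on $E_b$. For $v\in L^2(0,T;H)$, $A_Tv=u(T)\in E_b$, where $\partial_tu=\mathcal Lu+(Qv,0)$, $u(0)=0$. Adjoints are Hilbert space adjoints with respect to $E_b$ and $L^2(0,T;H)$. *)

theory Defs
  imports "HOL-Analysis.Analysis"
begin

subsection \<open>Mean-zero square-integrable functions on the torus\<close>

text \<open>A function on $T^2 = (R/2\pi Z)^2$ is given by its values on the fundamental square; the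
  measure below is normalised Lebesgue measure, so values off the square are irrelevant.\<close>

definition torus :: "(real \<times> real) measure" where
  "torus = uniform_measure lborel (cbox (0, 0) (2 * pi, 2 * pi))"

definition sq_integrable :: "(real \<times> real \<Rightarrow> real) \<Rightarrow> bool" where
  "sq_integrable f \<longleftrightarrow> f \<in> borel_measurable torus \<and> integrable torus (\<lambda>x. (f x)\<^sup>2)"

lemma sets_torus [measurable_cong, simp]: "sets torus = sets borel"
  by (simp add: torus_def)

lemma space_torus [simp]: "space torus = UNIV"
  by (simp add: torus_def)

lemma emeasure_torus_box:
  "emeasure lborel (cbox (0, 0) (2 * pi, 2 * pi :: real)) = ennreal (4 * pi\<^sup>2)"
proof -
  have "emeasure lborel (cbox (0, 0) (2 * pi, 2 * pi :: real))
      = ennreal (\<Prod>i\<in>Basis. ((2 * pi, 2 * pi) - (0, 0)) \<bullet> i)"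
    by (rule emeasure_lborel_cbox) (auto simp: Basis_prod_def)
  also have "(\<Prod>i\<in>Basis. ((2 * pi, 2 * pi) - (0, 0)) \<bullet> (i :: real \<times> real)) = 4 * pi\<^sup>2"
    by (simp add: Basis_prod_def prod.union_disjoint prod.reindex inj_on_def power2_eq_square)
  finally show ?thesis .
qed

interpretation torus: finite_measure torus
proof
  have "emeasure torus (space torus) \<le> 1"
    unfolding torus_def space_uniform_measure
    by (subst emeasure_uniform_measure) (auto simp: emeasure_torus_box)
  then show "emeasure torus (space torus) \<noteq> \<infinity>"
    by (metis infinity_ennreal_def neq_top_trans ennreal_one_neq_top)
qed

lemma measure_torus: "measure torus UNIV = 1"
  unfolding torus_def
  by (subst measure_uniform_measure) (auto simp: emeasure_torus_box measure_def)

lemma AE_torusI: "AE x in lborel. P x \<Longrightarrow> AE x in torus. P x"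
  unfolding torus_def by (rule AE_uniform_measureI) auto

lemma sq_integrable_mult:
  assumes "sq_integrable f" "sq_integrable g"
  shows "integrable torus (\<lambda>x. f x * g x)"
proof (rule Bochner_Integration.integrable_bound)
  show "integrable torus (\<lambda>x. (f x)\<^sup>2 + (g x)\<^sup>2)"
    using assms by (auto simp: sq_integrable_def)
  show "(\<lambda>x. f x * g x) \<in> borel_measurable torus"
    using assms by (auto simp: sq_integrable_def)
  show "AE x in torus. norm (f x * g x) \<le> norm ((f x)\<^sup>2 + (g x)\<^sup>2)"
  proof (rule AE_I2)
    fix x
    have "2 * \<bar>f x * g x\<bar> \<le> (f x)\<^sup>2 + (g x)\<^sup>2"
      using sum_squares_bound[of "\<bar>f x\<bar>" "\<bar>g x\<bar>"] by (simp add: abs_mult)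
    then show "norm (f x * g x) \<le> norm ((f x)\<^sup>2 + (g x)\<^sup>2)"
      by simp
  qed
qed

lemma sq_integrable_const [simp]: "sq_integrable (\<lambda>_. c)"
  by (simp add: sq_integrable_def)

lemma sq_integrable_imp_integrable: "sq_integrable f \<Longrightarrow> integrable torus f"
  using sq_integrable_mult[of f "\<lambda>_. 1"] by simp

lemma sq_integrable_add:
  assumes "sq_integrable f" "sq_integrable g"
  shows "sq_integrable (\<lambda>x. f x + g x)"
  using sq_integrable_mult[OF assms] assms
  by (auto simp: sq_integrable_def power2_sum mult.assoc)

lemma sq_integrable_scale: "sq_integrable f \<Longrightarrow> sq_integrable (\<lambda>x. c * f x)"
  by (auto simp: sq_integrable_def power_mult_distrib)

lemma sq_integrable_minus: "sq_integrable f \<Longrightarrow> sq_integrable (\<lambda>x. - f x)"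
  by (auto simp: sq_integrable_def)

lemma sq_integrable_diff:
  "sq_integrable f \<Longrightarrow> sq_integrable g \<Longrightarrow> sq_integrable (\<lambda>x. f x - g x)"
  using sq_integrable_add[OF _ sq_integrable_minus, of f g] by simp

lemma sq_integrable_bounded:
  assumes "f \<in> borel_measurable torus" "AE x in torus. \<bar>f x\<bar> \<le> B"
  shows "sq_integrable f"
proof -
  have "integrable torus (\<lambda>x. (f x)\<^sup>2)"
  proof (rule torus.integrable_const_bound)
    show "AE x in torus. norm ((f x)\<^sup>2) \<le> B\<^sup>2"
      using assms(2)
    proof eventually_elim
      case (elim x)
      then have "\<bar>f x\<bar> \<le> \<bar>B\<bar>" by linarith
      then show ?case by (simp add: abs_le_square_iff)
    qed
  qed (use assms in measurable)
  then show ?thesis using assms by (simp add: sq_integrable_def)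
qed

definition mean_zero_L2 :: "(real \<times> real \<Rightarrow> real) \<Rightarrow> bool" where
  "mean_zero_L2 f \<longleftrightarrow> sq_integrable f \<and> (LINT x|torus. f x) = 0"

text \<open>The Hilbert space $H = H^0$: real mean-zero square-integrable functions modulo equality
  almost everywhere.\<close>

quotient_type H = "real \<times> real \<Rightarrow> real" / partial:
  "\<lambda>f g. mean_zero_L2 f \<and> mean_zero_L2 g \<and> (AE x in torus. f x = g x)"
proof (rule part_equivpI)
  show "\<exists>f. mean_zero_L2 f \<and> mean_zero_L2 f \<and> (AE x in torus. f x = f x)"
    by (rule exI[of _ "\<lambda>_. 0"]) (simp add: mean_zero_L2_def)
  show "symp (\<lambda>f g. mean_zero_L2 f \<and> mean_zero_L2 g \<and> (AE x in torus. f x = g x))"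
    by (auto simp: symp_def elim: AE_mp)
  show "transp (\<lambda>f g. mean_zero_L2 f \<and> mean_zero_L2 g \<and> (AE x in torus. f x = g x))"
    unfolding transp_def
  proof (intro allI impI conjI; elim conjE)
    fix f g h :: "real \<times> real \<Rightarrow> real"
    assume "AE x in torus. f x = g x" "AE x in torus. g x = h x"
    then show "AE x in torus. f x = h x" by eventually_elim simp
  qed
qed

lemma rep_H: "mean_zero_L2 (rep_H f)"
  using Quotient3_H[THEN Quotient3_rep_reflp, of f] by simp

lemma abs_H_eq_iff:
  "mean_zero_L2 f \<Longrightarrow> mean_zero_L2 g \<Longrightarrow> abs_H f = abs_H g \<longleftrightarrow> (AE x in torus. f x = g x)"
  using Quotient3_rel[OF Quotient3_H, of f g] by auto

lemma abs_rep_H [simp]: "abs_H (rep_H f) = f"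
  by (rule Quotient3_abs_rep[OF Quotient3_H])

lemma rep_abs_H: "mean_zero_L2 f \<Longrightarrow> AE x in torus. rep_H (abs_H f) x = f x"
  using abs_H_eq_iff[of "rep_H (abs_H f)" f] rep_H by simp

lemma H_eqI: "(AE x in torus. rep_H f x = rep_H g x) \<Longrightarrow> f = g"
  using abs_H_eq_iff[of "rep_H f" "rep_H g"] rep_H by simp

lemma mean_zero_L2_zero: "mean_zero_L2 (\<lambda>_. 0)"
  by (simp add: mean_zero_L2_def)

lemma mean_zero_L2_add: "mean_zero_L2 f \<Longrightarrow> mean_zero_L2 g \<Longrightarrow> mean_zero_L2 (\<lambda>x. f x + g x)"
  by (simp add: mean_zero_L2_def sq_integrable_add sq_integrable_imp_integrable)

lemma mean_zero_L2_scale: "mean_zero_L2 f \<Longrightarrow> mean_zero_L2 (\<lambda>x. c * f x)"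
  by (simp add: mean_zero_L2_def sq_integrable_scale)

lemma mean_zero_L2_minus: "mean_zero_L2 f \<Longrightarrow> mean_zero_L2 (\<lambda>x. - f x)"
  by (simp add: mean_zero_L2_def sq_integrable_minus)

lemma mean_zero_L2_diff: "mean_zero_L2 f \<Longrightarrow> mean_zero_L2 g \<Longrightarrow> mean_zero_L2 (\<lambda>x. f x - g x)"
  using mean_zero_L2_add[OF _ mean_zero_L2_minus, of f g] by simp

instantiation H :: real_inner
begin

definition zero_H :: H where "0 = abs_H (\<lambda>_. 0)"
definition plus_H :: "H \<Rightarrow> H \<Rightarrow> H" where "f + g = abs_H (\<lambda>x. rep_H f x + rep_H g x)"
definition minus_H :: "H \<Rightarrow> H \<Rightarrow> H" where "f - g = abs_H (\<lambda>x. rep_H f x - rep_H g x)"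
definition uminus_H :: "H \<Rightarrow> H" where "- f = abs_H (\<lambda>x. - rep_H f x)"
definition scaleR_H :: "real \<Rightarrow> H \<Rightarrow> H" where "c *\<^sub>R f = abs_H (\<lambda>x. c * rep_H f x)"
definition inner_H :: "H \<Rightarrow> H \<Rightarrow> real" where "f \<bullet> g = (LINT x|torus. rep_H f x * rep_H g x)"
definition norm_H :: "H \<Rightarrow> real" where "norm (f :: H) = sqrt (f \<bullet> f)"
definition sgn_H :: "H \<Rightarrow> H" where "sgn (f :: H) = scaleR (inverse (norm f)) f"
definition dist_H :: "H \<Rightarrow> H \<Rightarrow> real" where "dist (f :: H) g = norm (f - g)"
definition uniformity_H :: "(H \<times> H) filter" where
  "uniformity = (INF e\<in>{0<..}. principal {(f :: H, g). dist f g < e})"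
definition open_H :: "H set \<Rightarrow> bool" where
  "open (U :: H set) = (\<forall>f\<in>U. \<forall>\<^sub>F (f', g) in uniformity. f' = f \<longrightarrow> g \<in> U)"

lemma rep_H_zero: "AE x in torus. rep_H 0 x = 0"
  unfolding zero_H_def by (rule rep_abs_H[OF mean_zero_L2_zero])

lemma rep_H_plus: "AE x in torus. rep_H (f + g) x = rep_H f x + rep_H g x"
  unfolding plus_H_def by (rule rep_abs_H[OF mean_zero_L2_add[OF rep_H rep_H]])

lemma rep_H_minus: "AE x in torus. rep_H (f - g) x = rep_H f x - rep_H g x"
  unfolding minus_H_def by (rule rep_abs_H[OF mean_zero_L2_diff[OF rep_H rep_H]])

lemma rep_H_uminus: "AE x in torus. rep_H (- f) x = - rep_H f x"
  unfolding uminus_H_def by (rule rep_abs_H[OF mean_zero_L2_minus[OF rep_H]])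

lemma rep_H_scaleR: "AE x in torus. rep_H (c *\<^sub>R f) x = c * rep_H f x"
  unfolding scaleR_H_def by (rule rep_abs_H[OF mean_zero_L2_scale[OF rep_H]])

lemma sq_integrable_rep_H: "sq_integrable (rep_H f)"
  using rep_H[of f] by (simp add: mean_zero_L2_def)

lemma rep_H_measurable [measurable]: "rep_H f \<in> borel_measurable torus"
  using sq_integrable_rep_H[of f] by (simp add: sq_integrable_def)

lemma integrable_rep_H_mult: "integrable torus (\<lambda>x. rep_H f x * rep_H g x)"
  by (rule sq_integrable_mult[OF sq_integrable_rep_H sq_integrable_rep_H])

instance
proof
  fix f g h :: H and c d :: real
  show "f + g + h = f + (g + h)"
    by (rule H_eqI) (use rep_H_plus[of "f + g" h] rep_H_plus[of f g] rep_H_plus[of f "g + h"] rep_H_plus[of g h] in eventually_elim, simp)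
  show "f + g = g + f"
    by (rule H_eqI) (use rep_H_plus[of f g] rep_H_plus[of g f] in eventually_elim, simp)
  show "0 + f = f"
    by (rule H_eqI) (use rep_H_plus[of 0 f] rep_H_zero in eventually_elim, simp)
  show "- f + f = 0"
    by (rule H_eqI) (use rep_H_plus[of "- f" f] rep_H_uminus[of f] rep_H_zero in eventually_elim, simp)
  show "f - g = f + - g"
    by (rule H_eqI) (use rep_H_plus[of f "- g"] rep_H_uminus[of g] rep_H_minus[of f g] in eventually_elim, simp)
  show "c *\<^sub>R (f + g) = c *\<^sub>R f + c *\<^sub>R g"
    by (rule H_eqI) (use rep_H_scaleR[of c "f + g"] rep_H_plus[of f g] rep_H_plus[of "c *\<^sub>R f" "c *\<^sub>R g"]
      rep_H_scaleR[of c f] rep_H_scaleR[of c g] in eventually_elim, simp add: algebra_simps)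
  show "(c + d) *\<^sub>R f = c *\<^sub>R f + d *\<^sub>R f"
    by (rule H_eqI) (use rep_H_scaleR[of "c + d" f] rep_H_plus[of "c *\<^sub>R f" "d *\<^sub>R f"]
      rep_H_scaleR[of c f] rep_H_scaleR[of d f] in eventually_elim, simp add: algebra_simps)
  show "c *\<^sub>R d *\<^sub>R f = (c * d) *\<^sub>R f"
    by (rule H_eqI) (use rep_H_scaleR[of c "d *\<^sub>R f"] rep_H_scaleR[of d f] rep_H_scaleR[of "c * d" f] in eventually_elim, simp)
  show "1 *\<^sub>R f = f"
    by (rule H_eqI) (use rep_H_scaleR[of 1 f] in eventually_elim, simp)
  show "dist f g = norm (f - g)" "sgn f = scaleR (inverse (norm f)) f" "norm f = sqrt (f \<bullet> f)"
    by (simp_all add: dist_H_def sgn_H_def norm_H_def)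
  show "uniformity = (INF e\<in>{0<..}. principal {(x, y :: H). dist x y < e})"
    by (rule uniformity_H_def)
  show "open U = (\<forall>x\<in>U. \<forall>\<^sub>F (x', y) in uniformity. x' = x \<longrightarrow> y \<in> U)" for U :: "H set"
    by (rule open_H_def)
  show "f \<bullet> g = g \<bullet> f"
    by (simp add: inner_H_def mult.commute)
  have "(f + g) \<bullet> h = (LINT x|torus. rep_H f x * rep_H h x + rep_H g x * rep_H h x)"
    unfolding inner_H_def
    by (intro integral_cong_AE) (measurable, use rep_H_plus[of f g] in eventually_elim, simp add: algebra_simps)
  then show "(f + g) \<bullet> h = f \<bullet> h + g \<bullet> h"
    by (simp add: inner_H_def integrable_rep_H_mult)
  have "(c *\<^sub>R f) \<bullet> g = (LINT x|torus. c * (rep_H f x * rep_H g x))"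
    unfolding inner_H_def
    by (intro integral_cong_AE) (measurable, use rep_H_scaleR[of c f] in eventually_elim, simp)
  then show "(c *\<^sub>R f) \<bullet> g = c * (f \<bullet> g)"
    by (simp add: inner_H_def)
  show "0 \<le> f \<bullet> f"
    unfolding inner_H_def by (rule integral_nonneg_AE) simp
  show "(f \<bullet> f = 0) = (f = 0)"
  proof
    assume "f \<bullet> f = 0"
    then have "AE x in torus. rep_H f x * rep_H f x = 0"
      unfolding inner_H_def
      by (subst (asm) integral_nonneg_eq_0_iff_AE) (auto simp: integrable_rep_H_mult)
    with rep_H_zero have "AE x in torus. rep_H f x = rep_H 0 x"
      by eventually_elim simp
    then show "f = 0"
      by (rule H_eqI)
  next
    assume "f = 0"
    have "(0 :: H) \<bullet> 0 = (LINT x|torus. 0)"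
      unfolding inner_H_def
      by (intro integral_cong_AE) (measurable, use rep_H_zero in eventually_elim, simp)
    then show "f \<bullet> f = 0" using \<open>f = 0\<close> by simp
  qed
qed

end

subsection \<open>Completeness and separability of $H$\<close>

lemma norm_H_sq: "(norm (f :: H))\<^sup>2 = (LINT x|torus. (rep_H f x)\<^sup>2)"
  unfolding power2_norm_eq_inner inner_H_def by (simp add: power2_eq_square)

lemma norm_abs_H_sq:
  assumes "mean_zero_L2 f"
  shows "(norm (abs_H f))\<^sup>2 = (LINT x|torus. (f x)\<^sup>2)"
proof -
  have [measurable]: "f \<in> borel_measurable torus"
    using assms by (simp add: mean_zero_L2_def sq_integrable_def)
  show ?thesis
    unfolding norm_H_sq
    by (intro integral_cong_AE) (measurable, use rep_abs_H[OF assms] in eventually_elim, simp)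
qed

lemma abs_H_minus:
  assumes "mean_zero_L2 f"
  shows "abs_H f - g = abs_H (\<lambda>x. f x - rep_H g x)"
proof (rule H_eqI)
  have "mean_zero_L2 (\<lambda>x. f x - rep_H g x)"
    using assms rep_H by (rule mean_zero_L2_diff)
  from rep_abs_H[OF this] rep_abs_H[OF assms] rep_H_minus[of "abs_H f" g]
  show "AE x in torus. rep_H (abs_H f - g) x = rep_H (abs_H (\<lambda>x. f x - rep_H g x)) x"
    by eventually_elim simp
qed

lemma sq_integrable_integral_abs_le:
  assumes "sq_integrable f"
  shows "(LINT x|torus. \<bar>f x\<bar>)\<^sup>2 \<le> (LINT x|torus. (f x)\<^sup>2)"
proof -
  define m where "m = (LINT x|torus. \<bar>f x\<bar>)"
  have i: "integrable torus (\<lambda>x. \<bar>f x\<bar>)" "integrable torus (\<lambda>x. (f x)\<^sup>2)"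
    using sq_integrable_imp_integrable[OF assms] assms by (auto simp: sq_integrable_def)
  have "0 \<le> (LINT x|torus. (\<bar>f x\<bar> - m)\<^sup>2)"
    by (rule integral_nonneg_AE) simp
  also have "(LINT x|torus. (\<bar>f x\<bar> - m)\<^sup>2) = (LINT x|torus. (f x)\<^sup>2 + m\<^sup>2 - 2 * m * \<bar>f x\<bar>)"
    by (intro Bochner_Integration.integral_cong) (auto simp: power2_diff)
  also have "\<dots> = (LINT x|torus. (f x)\<^sup>2) + m\<^sup>2 - 2 * m * m"
    using i by (simp add: measure_torus m_def)
  finally show ?thesis by (simp add: m_def power2_eq_square)
qed

instance H :: complete_space
proof
  fix X :: "nat \<Rightarrow> H"
  assume X: "Cauchy X"
  have "\<exists>N. \<forall>m\<ge>N. \<forall>n\<ge>N. dist (X m) (X n) < (1/2)^k" for k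
    using metric_CauchyD[OF X, of "(1/2)^k"] by simp
  then obtain N where N: "\<And>k m n. m \<ge> N k \<Longrightarrow> n \<ge> N k \<Longrightarrow> dist (X m) (X n) < (1/2)^k"
    by metis
  define r where "r = rec_nat (N 0) (\<lambda>k rk. Suc (max rk (N (Suc k))))"
  have rS: "r (Suc k) = Suc (max (r k) (N (Suc k)))" and r0: "r 0 = N 0" for k
    by (simp_all add: r_def)
  have r: "strict_mono r"
    unfolding strict_mono_Suc_iff by (auto simp: rS less_Suc_eq_le)
  have rN: "r k \<ge> N k" for k
    by (cases k) (simp_all add: r0 rS)
  define s where "s k = rep_H (X (r k))" for k
  have s_meas [measurable]: "s k \<in> borel_measurable torus" for k
    by (simp add: s_def)
  have s_sq: "sq_integrable (\<lambda>x. s m x - s n x)" for m n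
    unfolding s_def by (intro sq_integrable_diff sq_integrable_rep_H)
  have s_norm: "(LINT x|torus. (s m x - s n x)\<^sup>2) = (dist (X (r m)) (X (r n)))\<^sup>2" for m n
    unfolding dist_norm norm_H_sq s_def
    by (intro integral_cong_AE)
      (measurable, use rep_H_minus[of "X (r m)" "X (r n)"] in eventually_elim, simp)
  have s_small: "(LINT x|torus. (s m x - s n x)\<^sup>2) \<le> ((1/2)^k)\<^sup>2" if "k \<le> m" "k \<le> n" for k m n
  proof -
    have "r m \<ge> N k" "r n \<ge> N k"
      using that rN[of k] strict_mono_less_eq[OF r, of k m] strict_mono_less_eq[OF r, of k n]
      by linarith+
    then have "dist (X (r m)) (X (r n)) \<le> (1/2)^k"
      using N less_imp_le by blast
    then show ?thesis unfolding s_norm by (intro power_mono) auto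
  qed
  have s_nn: "(\<integral>\<^sup>+x. ennreal ((s m x - s n x)\<^sup>2) \<partial>torus) = ennreal (LINT x|torus. (s m x - s n x)\<^sup>2)" for m n
    using s_sq[of m n] by (intro nn_integral_eq_integral) (auto simp: sq_integrable_def)
  have s_L1: "(\<integral>\<^sup>+x. ennreal \<bar>s (Suc n) x - s n x\<bar> \<partial>torus) \<le> ennreal ((1/2)^n)" for n
  proof -
    have "(LINT x|torus. \<bar>s (Suc n) x - s n x\<bar>)\<^sup>2 \<le> ((1/2)^n)\<^sup>2"
      using sq_integrable_integral_abs_le[OF s_sq] s_small[of n "Suc n" n] by (meson le_SucI order.trans order_refl)
    then have "(LINT x|torus. \<bar>s (Suc n) x - s n x\<bar>) \<le> (1/2)^n"
      by (rule power2_le_imp_le) simp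
    moreover have "(\<integral>\<^sup>+x. ennreal \<bar>s (Suc n) x - s n x\<bar> \<partial>torus)
        = ennreal (LINT x|torus. \<bar>s (Suc n) x - s n x\<bar>)"
      using sq_integrable_imp_integrable[OF s_sq] by (intro nn_integral_eq_integral) auto
    ultimately show ?thesis by (simp add: ennreal_leI)
  qed
  have "(\<integral>\<^sup>+x. (\<Sum>n. ennreal \<bar>s (Suc n) x - s n x\<bar>) \<partial>torus)
      = (\<Sum>n. \<integral>\<^sup>+x. ennreal \<bar>s (Suc n) x - s n x\<bar> \<partial>torus)"
    by (rule nn_integral_suminf) measurable
  also have "\<dots> \<le> (\<Sum>n. ennreal ((1/2)^n))"
    by (intro suminf_le s_L1) auto
  also have "\<dots> = ennreal (\<Sum>n. (1/2)^n)"
    by (rule suminf_ennreal2) (auto intro: summable_geometric)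
  finally have "(\<integral>\<^sup>+x. (\<Sum>n. ennreal \<bar>s (Suc n) x - s n x\<bar>) \<partial>torus) \<noteq> \<infinity>"
    by (metis ennreal_neq_top infinity_ennreal_def neq_top_trans)
  then have "AE x in torus. (\<Sum>n. ennreal \<bar>s (Suc n) x - s n x\<bar>) \<noteq> \<infinity>"
    by (intro nn_integral_PInf_AE) measurable
  then have conv: "AE x in torus. convergent (\<lambda>n. s n x)"
  proof eventually_elim
    case (elim x)
    then have "summable (\<lambda>n. \<bar>s (Suc n) x - s n x\<bar>)"
      by (intro summable_suminf_not_top) auto
    then have "summable (\<lambda>n. s (Suc n) x - s n x)"
      by (rule summable_rabs_cancel)
    then have "(\<lambda>n. \<Sum>i<n. s (Suc i) x - s i x) \<longlonglongrightarrow> (\<Sum>n. s (Suc n) x - s n x)"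
      by (rule summable_LIMSEQ)
    then have "(\<lambda>n. (\<Sum>i<n. s (Suc i) x - s i x) + s 0 x) \<longlonglongrightarrow> (\<Sum>n. s (Suc n) x - s n x) + s 0 x"
      by (intro tendsto_intros)
    then show ?case
      by (auto simp: sum_lessThan_telescope[of "\<lambda>i. s i x"] convergent_def)
  qed
  define F where "F x = lim (\<lambda>n. s n x)" for x
  have F_meas [measurable]: "F \<in> borel_measurable torus"
    unfolding F_def by measurable
  have F_nn: "(\<integral>\<^sup>+x. ennreal ((F x - s k x)\<^sup>2) \<partial>torus) \<le> ennreal (((1/2)^k)\<^sup>2)" for k
  proof -
    have "(\<integral>\<^sup>+x. ennreal ((F x - s k x)\<^sup>2) \<partial>torus)
        = (\<integral>\<^sup>+x. liminf (\<lambda>m. ennreal ((s m x - s k x)\<^sup>2)) \<partial>torus)"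
    proof (rule nn_integral_cong_AE, use conv in eventually_elim)
      case (elim x)
      then have "(\<lambda>m. s m x) \<longlonglongrightarrow> F x"
        by (simp add: F_def convergent_LIMSEQ_iff)
      then have "(\<lambda>m. ennreal ((s m x - s k x)\<^sup>2)) \<longlonglongrightarrow> ennreal ((F x - s k x)\<^sup>2)"
        by (intro tendsto_intros)
      then show ?case
        using lim_imp_Liminf[OF sequentially_bot] by metis
    qed
    also have "\<dots> \<le> liminf (\<lambda>m. \<integral>\<^sup>+x. ennreal ((s m x - s k x)\<^sup>2) \<partial>torus)"
      by (rule nn_integral_liminf) measurable
    also have "\<dots> \<le> liminf (\<lambda>m. ennreal (((1/2)^k)\<^sup>2))"
      by (rule Liminf_mono)
        (auto simp: s_nn eventually_sequentially intro!: exI[of _ k] ennreal_leI s_small)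
    also have "\<dots> = ennreal (((1/2)^k)\<^sup>2)"
      by (rule Liminf_const) simp
    finally show ?thesis .
  qed
  have Fs: "sq_integrable (\<lambda>x. F x - s k x)" for k
    unfolding sq_integrable_def
    using F_nn[of k] le_less_trans[OF _ ennreal_less_top]
    by (auto intro!: integrableI_nonneg)
  have Fs_le: "(LINT x|torus. (F x - s k x)\<^sup>2) \<le> ((1/2)^k)\<^sup>2" for k
    using F_nn[of k] Fs[of k]
    by (subst (asm) nn_integral_eq_integral) (auto simp: sq_integrable_def)
  have F_sq: "sq_integrable F"
    using sq_integrable_add[OF Fs[of 0] sq_integrable_rep_H[of "X (r 0)"]] by (simp add: s_def)
  have "\<bar>LINT x|torus. F x\<bar> \<le> (1/2)^k" for k
  proof -
    have "(LINT x|torus. F x) = (LINT x|torus. F x - s k x)"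
      using rep_H[of "X (r k)"]
      by (subst Bochner_Integration.integral_diff)
        (auto simp: s_def mean_zero_L2_def sq_integrable_imp_integrable F_sq)
    then have "\<bar>LINT x|torus. F x\<bar> \<le> (LINT x|torus. \<bar>F x - s k x\<bar>)"
      by (simp add: integral_abs_bound)
    moreover have "(LINT x|torus. \<bar>F x - s k x\<bar>) \<le> (1/2)^k"
      by (rule power2_le_imp_le[OF order_trans[OF sq_integrable_integral_abs_le[OF Fs] Fs_le]]) simp
    ultimately show ?thesis by linarith
  qed
  then have "\<bar>LINT x|torus. F x\<bar> \<le> 0"
    by (intro LIMSEQ_le_const[OF LIMSEQ_power_zero[of "1/2 :: real"]]) auto
  with F_sq have F: "mean_zero_L2 F"
    by (simp add: mean_zero_L2_def)
  have "norm (X (r k) - abs_H F) \<le> (1/2)^k" for k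
  proof (rule power2_le_imp_le)
    have "norm (X (r k) - abs_H F) = norm (abs_H (\<lambda>x. F x - s k x))"
      by (simp add: norm_minus_commute abs_H_minus[OF F] s_def)
    moreover have "mean_zero_L2 (\<lambda>x. F x - s k x)"
      unfolding s_def by (rule mean_zero_L2_diff[OF F rep_H])
    ultimately show "(norm (X (r k) - abs_H F))\<^sup>2 \<le> ((1/2)^k)\<^sup>2"
      using Fs_le by (simp add: norm_abs_H_sq)
  qed simp
  then have "(\<lambda>k. X (r k) - abs_H F) \<longlonglongrightarrow> 0"
    by (intro Lim_null_comparison[OF _ LIMSEQ_power_zero[of "1/2 :: real"]]) auto
  then have "(X \<circ> r) \<longlonglongrightarrow> abs_H F"
    using LIM_zero_iff by (simp add: o_def LIM_zero_iff)
  then have "X \<longlonglongrightarrow> abs_H F"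
    by (rule Cauchy_converges_subseq[OF X r])
  then show "convergent X"
    by (auto simp: convergent_def)
qed

instance H :: banach ..

lemma sq_sum3_le: "(a + b + c)\<^sup>2 \<le> 3 * (a\<^sup>2 + b\<^sup>2 + (c :: real)\<^sup>2)"
proof -
  have "0 \<le> (a - b)\<^sup>2 + (b - c)\<^sup>2 + (a - c)\<^sup>2" by simp
  then show ?thesis by (simp add: power2_eq_square algebra_simps)
qed

definition clip :: "nat \<Rightarrow> real \<Rightarrow> real" where
  "clip N y = max (- real N) (min (real N) y)"

lemma abs_clip: "\<bar>clip N y\<bar> \<le> real N"
  by (auto simp: clip_def max_def min_def)

lemma clip_measurable [measurable]: "clip N \<in> borel_measurable borel"
  unfolding clip_def by measurable

lemma clip_lim: "(\<lambda>N. clip N y) \<longlonglongrightarrow> y"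
proof (rule tendsto_eventually)
  have "eventually (\<lambda>N. \<bar>y\<bar> \<le> real N) sequentially"
    by (rule eventually_sequentiallyI[of "nat \<lceil>\<bar>y\<bar>\<rceil>"]) linarith
  then show "eventually (\<lambda>N. clip N y = y) sequentially"
    by eventually_elim (auto simp: clip_def)
qed

definition step_fun :: "nat \<Rightarrow> ((int \<times> int) \<times> rat) list \<Rightarrow> real \<times> real \<Rightarrow> real" where
  "step_fun n l x =
    (case map_of l (\<lfloor>real n * fst x\<rfloor>, \<lfloor>real n * snd x\<rfloor>) of Some q \<Rightarrow> real_of_rat q | None \<Rightarrow> 0)"

lemma step_fun_measurable [measurable]: "step_fun n l \<in> borel_measurable torus"
proof -
  have c: "(\<lambda>x. real n * fst x) \<in> borel_measurable torus" "(\<lambda>x. real n * snd x) \<in> borel_measurable torus"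
    by (simp_all cong: measurable_cong_sets)
      (intro borel_measurable_continuous_onI continuous_intros)+
  have fl: "(\<lambda>x. \<lfloor>real n * fst x\<rfloor>) \<in> measurable torus (count_space UNIV)"
    "(\<lambda>x. \<lfloor>real n * snd x\<rfloor>) \<in> measurable torus (count_space UNIV)"
    using c by measurable
  have [measurable]: "(\<lambda>x. (\<lfloor>real n * fst x\<rfloor>, \<lfloor>real n * snd x\<rfloor>)) \<in> measurable torus (count_space UNIV)"
    unfolding measurable_count_space_eq2_countable
  proof (intro conjI ballI)
    fix a :: "int \<times> int"
    have "(\<lambda>x. (\<lfloor>real n * fst x\<rfloor>, \<lfloor>real n * snd x\<rfloor>)) -` {a} \<inter> space torus
        = ((\<lambda>x. \<lfloor>real n * fst x\<rfloor>) -` {fst a} \<inter> space torus)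
          \<inter> ((\<lambda>x. \<lfloor>real n * snd x\<rfloor>) -` {snd a} \<inter> space torus)"
      by (auto simp: prod_eq_iff)
    also have "\<dots> \<in> sets torus"
      by (intro sets.Int measurable_sets[OF fl(1)] measurable_sets[OF fl(2)]) auto
    finally show "(\<lambda>x. (\<lfloor>real n * fst x\<rfloor>, \<lfloor>real n * snd x\<rfloor>)) -` {a} \<inter> space torus \<in> sets torus" .
  qed auto
  show ?thesis
    unfolding step_fun_def by measurable
qed

lemma step_fun_bounded: "\<exists>B. \<forall>x. \<bar>step_fun n l x\<bar> \<le> B"
proof -
  have "finite (insert 0 ((\<lambda>p. real_of_rat (snd p)) ` set l))" by simp
  moreover have "step_fun n l x \<in> insert 0 ((\<lambda>p. real_of_rat (snd p)) ` set l)" for x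
    unfolding step_fun_def by (force split: option.split dest: map_of_SomeD)
  ultimately have "bounded (range (step_fun n l))"
    by (meson bounded_subset finite_imp_bounded image_subsetI)
  then show ?thesis by (auto simp: bounded_iff)
qed

lemma sq_integrable_step_fun: "sq_integrable (step_fun n l)"
proof -
  obtain B where "\<forall>x. \<bar>step_fun n l x\<bar> \<le> B" using step_fun_bounded by blast
  then show ?thesis by (intro sq_integrable_bounded[of _ B]) auto
qed

lemma AE_torus_box: "AE x in torus. x \<in> cbox (0, 0) (2 * pi, 2 * pi)"
  unfolding torus_def by (rule AE_uniform_measureI) auto

lemma step_fun_approx:
  assumes h: "continuous_on UNIV h" and e: "0 < e"
  shows "\<exists>n l. \<forall>x\<in>cbox (0, 0) (2 * pi, 2 * pi :: real). \<bar>h x - step_fun n l x\<bar> \<le> e"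
proof -
  have uc: "uniformly_continuous_on (cbox (-1, -1) (2 * pi, 2 * pi)) h"
    by (intro compact_uniformly_continuous continuous_on_subset[OF h] compact_cbox) auto
  have "\<exists>d>0. \<forall>x\<in>cbox (-1, -1) (2 * pi, 2 * pi). \<forall>y\<in>cbox (-1, -1) (2 * pi, 2 * pi).
      dist y x < d \<longrightarrow> dist (h y) (h x) < e / 2"
    using uc half_gt_zero[OF e] unfolding uniformly_continuous_on_def by (elim allE impE) assumption+
  then obtain d where d: "0 < d"
    "\<And>x y. x \<in> cbox (-1, -1) (2 * pi, 2 * pi) \<Longrightarrow> y \<in> cbox (-1, -1) (2 * pi, 2 * pi)
      \<Longrightarrow> dist y x < d \<Longrightarrow> dist (h y) (h x) < e / 2"
    by auto
  obtain n0 :: nat where n0: "2 / d < real n0" using reals_Archimedean2 by blast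
  define n where "n = Suc n0"
  have n: "real n \<ge> 1" "2 / d < real n" using n0 by (auto simp: n_def)
  define M where "M = \<lceil>real n * (2 * pi)\<rceil>"
  define g where "g k = (SOME q :: rat. \<bar>real_of_rat q - h (real_of_int (fst k) / n, real_of_int (snd k) / n)\<bar> < e / 2)" for k
  have g: "\<bar>real_of_rat (g k) - h (real_of_int (fst k) / n, real_of_int (snd k) / n)\<bar> < e / 2" for k
  proof -
    obtain q :: rat where "h (real_of_int (fst k) / n, real_of_int (snd k) / n) - e / 2 < real_of_rat q"
      "real_of_rat q < h (real_of_int (fst k) / n, real_of_int (snd k) / n) + e / 2"
      using of_rat_dense[of "h (real_of_int (fst k) / n, real_of_int (snd k) / n) - e / 2"
          "h (real_of_int (fst k) / n, real_of_int (snd k) / n) + e / 2"] e by auto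
    then have "\<bar>real_of_rat q - h (real_of_int (fst k) / n, real_of_int (snd k) / n)\<bar> < e / 2"
      by linarith
    then have "\<exists>q :: rat. \<bar>real_of_rat q - h (real_of_int (fst k) / n, real_of_int (snd k) / n)\<bar> < e / 2"
      by blast
    then show ?thesis
      unfolding g_def by (rule someI_ex)
  qed
  define l where "l = map (\<lambda>k. (k, g k)) (List.product [0..M] [0..M])"
  have "\<bar>h x - step_fun n l x\<bar> \<le> e" if "x \<in> cbox (0, 0) (2 * pi, 2 * pi)" for x
  proof -
    obtain x1 x2 where x: "x = (x1, x2)" by (cases x)
    have b: "0 \<le> x1" "x1 \<le> 2 * pi" "0 \<le> x2" "x2 \<le> 2 * pi"
      using that by (auto simp: x cbox_Pair_eq)
    define i j where "i = \<lfloor>real n * x1\<rfloor>" and "j = \<lfloor>real n * x2\<rfloor>"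
    have nb: "real n * y \<le> real n * (2 * pi)" if "y \<le> 2 * pi" for y
      using that n by (intro mult_left_mono) auto
    have ij: "0 \<le> i" "i \<le> M" "0 \<le> j" "j \<le> M"
      using b nb[OF b(2)] nb[OF b(4)] unfolding i_def j_def M_def by (simp_all, linarith+)
    have inj: "map_of l k = (if k \<in> {0..M} \<times> {0..M} then Some (g k) else None)" for k
      unfolding l_def map_of_map_restrict restrict_map_def by auto
    have step: "step_fun n l x = real_of_rat (g (i, j))"
      using ij by (simp add: step_fun_def inj x i_def[symmetric] j_def[symmetric])
    have fl: "real_of_int \<lfloor>real n * y\<rfloor> / n \<le> y \<and> y < real_of_int \<lfloor>real n * y\<rfloor> / n + 1 / n" for y
    proof -
      have "real_of_int \<lfloor>real n * y\<rfloor> \<le> real n * y" "real n * y < real_of_int \<lfloor>real n * y\<rfloor> + 1"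
        by linarith+
      then show ?thesis using n by (simp add: field_simps)
    qed
    define y where "y = (real_of_int i / n, real_of_int j / n)"
    have y: "0 \<le> fst y" "fst y \<le> x1" "x1 - fst y < 1 / n" "0 \<le> snd y" "snd y \<le> x2" "x2 - snd y < 1 / n"
      using fl[of x1] fl[of x2] ij n by (auto simp: y_def i_def[symmetric] j_def[symmetric])
    have "dist x y \<le> dist x1 (fst y) + dist x2 (snd y)"
      unfolding x dist_prod_def fst_conv snd_conv by (rule sqrt_sum_squares_le_sum) auto
    also have "\<dots> < 2 / n"
      using y by (simp add: dist_real_def)
    also have "2 / n < d"
      using n d(1) by (simp add: field_simps)
    finally have "dist x y < d" .
    then have "dist (h x) (h y) < e / 2"
      using that y b by (intro d(2)) (auto simp: x cbox_Pair_eq y_def)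
    moreover have "\<bar>real_of_rat (g (i, j)) - h y\<bar> < e / 2"
      using g[of "(i, j)"] by (simp add: y_def)
    ultimately show ?thesis
      unfolding step dist_real_def by linarith
  qed
  then show ?thesis by blast
qed

lemma tendsto_imp_less_ex:
  fixes X :: "nat \<Rightarrow> real"
  assumes "X \<longlonglongrightarrow> 0" "0 < e"
  shows "\<exists>n. X n < e"
  using order_tendstoD(2)[OF assms] by (auto simp: eventually_sequentially)

lemma step_fun_dense:
  assumes f: "sq_integrable f" and e: "0 < e"
  shows "\<exists>n l. (LINT x|torus. (f x - step_fun n l x)\<^sup>2) < e"
proof -
  have f_meas [measurable]: "f \<in> borel_measurable torus"
    and f_int: "integrable torus (\<lambda>x. (f x)\<^sup>2)"
    using f by (auto simp: sq_integrable_def)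
  have "(\<lambda>N. LINT x|torus. (f x - clip N (f x))\<^sup>2) \<longlonglongrightarrow> (LINT x|torus. 0)"
  proof (rule integral_dominated_convergence[where w = "\<lambda>x. (f x)\<^sup>2"])
    show "AE x in torus. (\<lambda>N. (f x - clip N (f x))\<^sup>2) \<longlonglongrightarrow> 0"
    proof (rule AE_I2)
      fix x
      have "(\<lambda>N. (f x - clip N (f x))\<^sup>2) \<longlonglongrightarrow> (f x - f x)\<^sup>2"
        by (intro tendsto_intros clip_lim)
      then show "(\<lambda>N. (f x - clip N (f x))\<^sup>2) \<longlonglongrightarrow> 0" by simp
    qed
    show "AE x in torus. norm ((f x - clip N (f x))\<^sup>2) \<le> (f x)\<^sup>2" for N
    proof (rule AE_I2)
      fix x
      have "\<bar>f x - clip N (f x)\<bar> \<le> \<bar>f x\<bar>"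
        by (auto simp: clip_def max_def min_def)
      then show "norm ((f x - clip N (f x))\<^sup>2) \<le> (f x)\<^sup>2"
        by (simp add: abs_le_square_iff)
    qed
  qed (use f_int in measurable)
  from tendsto_imp_less_ex[OF this[simplified], of "e / 9"] e
  obtain N where N: "(LINT x|torus. (f x - clip N (f x))\<^sup>2) < e / 9" by auto
  have "f \<in> borel_measurable lebesgue"
    using f_meas by (intro measurable_completion) (simp cong: measurable_cong_sets)
  then have "f measurable_on UNIV"
    by (intro lebesgue_measurable_imp_measurable_on) auto
  then obtain Z h where Z: "negligible Z" and h: "\<And>n. continuous_on UNIV (h n)"
    and hlim: "\<And>x. x \<notin> Z \<Longrightarrow> (\<lambda>n. h n x) \<longlonglongrightarrow> f x"
    unfolding measurable_on_def by auto
  have [measurable]: "h n \<in> borel_measurable torus" for n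
    using borel_measurable_continuous_onI[OF h] by (simp cong: measurable_cong_sets)
  have clip_cont: "continuous_on UNIV (clip N)" for N
    unfolding clip_def by (intro continuous_intros)
  have "AE x in lebesgue. x \<notin> Z"
    using Z by (auto simp: negligible_iff_null_sets intro: AE_not_in)
  then have "AE x in lborel. x \<notin> Z"
    by (simp add: AE_completion_iff)
  then have Zt: "AE x in torus. x \<notin> Z"
    by (rule AE_torusI)
  have "(\<lambda>n. LINT x|torus. (clip N (f x) - clip N (h n x))\<^sup>2) \<longlonglongrightarrow> (LINT x|torus. 0)"
  proof (rule integral_dominated_convergence[where w = "\<lambda>x. (2 * real N)\<^sup>2"])
    show "AE x in torus. (\<lambda>n. (clip N (f x) - clip N (h n x))\<^sup>2) \<longlonglongrightarrow> 0"
      using Zt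
    proof eventually_elim
      case (elim x)
      have "(\<lambda>n. (clip N (f x) - clip N (h n x))\<^sup>2) \<longlonglongrightarrow> (clip N (f x) - clip N (f x))\<^sup>2"
        by (intro tendsto_intros continuous_on_tendsto_compose[OF clip_cont hlim[OF elim]]) auto
      then show ?case by simp
    qed
    show "AE x in torus. norm ((clip N (f x) - clip N (h n x))\<^sup>2) \<le> (2 * real N)\<^sup>2" for n
    proof (rule AE_I2)
      fix x
      have "\<bar>clip N (f x) - clip N (h n x)\<bar> \<le> \<bar>2 * real N\<bar>"
        using abs_clip[of N "f x"] abs_clip[of N "h n x"] by linarith
      then show "norm ((clip N (f x) - clip N (h n x))\<^sup>2) \<le> (2 * real N)\<^sup>2"
        unfolding abs_le_square_iff by simp
    qed
  qed auto
  from tendsto_imp_less_ex[OF this[simplified], of "e / 9"] e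
  obtain n where n: "(LINT x|torus. (clip N (f x) - clip N (h n x))\<^sup>2) < e / 9" by auto
  define k where "k x = clip N (h n x)" for x
  have k_cont: "continuous_on UNIV k"
    unfolding k_def using continuous_on_compose[OF h continuous_on_subset[OF clip_cont]] by (simp add: o_def)
  have "0 < sqrt (e / 18)" using e by simp
  from step_fun_approx[OF k_cont this] obtain m l
    where ml: "\<And>x. x \<in> cbox (0, 0) (2 * pi, 2 * pi) \<Longrightarrow> \<bar>k x - step_fun m l x\<bar> \<le> sqrt (e / 18)"
    by blast
  have k_sq: "sq_integrable k"
    unfolding k_def by (rule sq_integrable_bounded[of _ "real N"]) (auto simp: abs_clip)
  have c_sq: "sq_integrable (\<lambda>x. clip N (f x))"
    by (rule sq_integrable_bounded[of _ "real N"]) (auto simp: abs_clip)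
  have ints: "integrable torus (\<lambda>x. (f x - clip N (f x))\<^sup>2)"
    "integrable torus (\<lambda>x. (clip N (f x) - k x)\<^sup>2)"
    "integrable torus (\<lambda>x. (k x - step_fun m l x)\<^sup>2)"
    "integrable torus (\<lambda>x. (f x - step_fun m l x)\<^sup>2)"
    using sq_integrable_diff[OF f c_sq] sq_integrable_diff[OF c_sq k_sq]
      sq_integrable_diff[OF k_sq sq_integrable_step_fun] sq_integrable_diff[OF f sq_integrable_step_fun]
    by (auto simp: sq_integrable_def)
  have "(LINT x|torus. (k x - step_fun m l x)\<^sup>2) \<le> (LINT x|torus. e / 18)"
  proof (rule integral_mono_AE)
    show "AE x in torus. (k x - step_fun m l x)\<^sup>2 \<le> e / 18"
      using AE_torus_box
    proof eventually_elim
      case (elim x)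
      have "(\<bar>k x - step_fun m l x\<bar>)\<^sup>2 \<le> (sqrt (e / 18))\<^sup>2"
        by (intro power_mono ml elim) auto
      then show ?case using e by simp
    qed
  qed (use ints in auto)
  then have k3: "(LINT x|torus. (k x - step_fun m l x)\<^sup>2) < e / 9"
    using e by (simp add: measure_torus)
  have "(LINT x|torus. (f x - step_fun m l x)\<^sup>2)
      \<le> (LINT x|torus. 3 * ((f x - clip N (f x))\<^sup>2 + (clip N (f x) - k x)\<^sup>2 + (k x - step_fun m l x)\<^sup>2))"
  proof (rule integral_mono)
    show "(f x - step_fun m l x)\<^sup>2
        \<le> 3 * ((f x - clip N (f x))\<^sup>2 + (clip N (f x) - k x)\<^sup>2 + (k x - step_fun m l x)\<^sup>2)" for x
      using sq_sum3_le[of "f x - clip N (f x)" "clip N (f x) - k x" "k x - step_fun m l x"] by simp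
  qed (use ints in auto)
  also have "\<dots> = 3 * ((LINT x|torus. (f x - clip N (f x))\<^sup>2) + (LINT x|torus. (clip N (f x) - k x)\<^sup>2)
      + (LINT x|torus. (k x - step_fun m l x)\<^sup>2))"
    using ints by simp
  also have "\<dots> < e"
    using N n k3 unfolding k_def by simp
  finally show ?thesis by blast
qed

lemma H_separable: "\<exists>D :: H set. countable D \<and> (\<forall>f e. 0 < e \<longrightarrow> (\<exists>d\<in>D. dist f d < e))"
proof (intro exI conjI allI impI)
  define p where "p = (\<lambda>(n, l) x. step_fun n l x - (LINT y|torus. step_fun n l y))"
  show "countable (range (\<lambda>nl. abs_H (p nl)))"
    by (intro countable_image countableI_type)
  have p: "mean_zero_L2 (p nl)" for nl
  proof -
    obtain n l where nl: "nl = (n, l)" by (cases nl)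
    show ?thesis
      unfolding mean_zero_L2_def nl p_def prod.case
      using sq_integrable_step_fun[of n l] sq_integrable_imp_integrable[OF sq_integrable_step_fun[of n l]]
      by (auto simp: measure_torus intro!: sq_integrable_diff)
  qed
  fix f :: H and e :: real assume e: "0 < e"
  then have "0 < e\<^sup>2" by simp
  from step_fun_dense[OF sq_integrable_rep_H[of f] this]
  obtain n l where nl: "(LINT x|torus. (rep_H f x - step_fun n l x)\<^sup>2) < e\<^sup>2"
    by blast
  define g where "g x = rep_H f x - step_fun n l x" for x
  define c where "c = (LINT x|torus. step_fun n l x)"
  have g: "sq_integrable g"
    unfolding g_def by (intro sq_integrable_diff sq_integrable_rep_H sq_integrable_step_fun)
  have gint: "(LINT x|torus. g x) = - c"
    unfolding g_def c_def using rep_H[of f]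
    by (subst Bochner_Integration.integral_diff)
      (auto simp: mean_zero_L2_def intro: sq_integrable_imp_integrable sq_integrable_step_fun)
  have "(dist f (abs_H (p (n, l))))\<^sup>2 = (norm (abs_H (\<lambda>x. p (n, l) x - rep_H f x)))\<^sup>2"
    unfolding dist_norm norm_minus_commute[of f] abs_H_minus[OF p] ..
  also have "\<dots> = (LINT x|torus. (p (n, l) x - rep_H f x)\<^sup>2)"
    by (rule norm_abs_H_sq[OF mean_zero_L2_diff[OF p rep_H]])
  also have "\<dots> = (LINT x|torus. (g x)\<^sup>2 + 2 * c * g x + c\<^sup>2)"
    by (intro Bochner_Integration.integral_cong)
      (auto simp: p_def g_def c_def power2_eq_square algebra_simps)
  also have "\<dots> = (LINT x|torus. (g x)\<^sup>2) - c\<^sup>2"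
    using g sq_integrable_imp_integrable[OF g]
    by (simp add: sq_integrable_def gint measure_torus power2_eq_square)
  also have "\<dots> < e\<^sup>2"
    using nl unfolding g_def by (smt (verit) zero_le_power2)
  finally have "dist f (abs_H (p (n, l))) < e"
    using e by (intro power2_less_imp_less[of _ e]) auto
  then show "\<exists>d\<in>range (\<lambda>nl. abs_H (p nl)). dist f d < e"
    by blast
qed

instance H :: second_countable_topology
proof
  obtain D :: "H set" where D: "countable D" "\<And>f e. 0 < e \<Longrightarrow> \<exists>d\<in>D. dist f d < e"
    using H_separable by blast
  define B where "B = (\<lambda>(d, q). ball d (real_of_rat q)) ` (D \<times> UNIV)"
  have "topological_basis B"
  proof (rule topological_basisI)
    fix U :: "H set" and f assume "open U" "f \<in> U"
    then obtain e where e: "e > 0" "ball f e \<subseteq> U"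
      by (auto simp: open_contains_ball)
    obtain q :: rat where q: "0 < real_of_rat q" "real_of_rat q < e / 2"
      using of_rat_dense[of 0 "e / 2"] e by auto
    obtain d where d: "d \<in> D" "dist f d < real_of_rat q"
      using D(2) q by blast
    have "ball d (real_of_rat q) \<subseteq> ball f e"
    proof
      fix g assume "g \<in> ball d (real_of_rat q)"
      then have "dist f g < e"
        using d q dist_triangle[of f g d] by simp
      then show "g \<in> ball f e" by simp
    qed
    with e d show "\<exists>B'\<in>B. f \<in> B' \<and> B' \<subseteq> U"
      by (intro bexI[of _ "ball d (real_of_rat q)"]) (auto simp: B_def dist_commute)
  qed (auto simp: B_def)
  moreover have "countable B"
    unfolding B_def using D(1) by (intro countable_image countable_SIGMA) auto
  ultimately show "\<exists>B :: H set set. countable B \<and> open = generate_topology B"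
    using topological_basis_imp_subbasis by blast
qed

subsection \<open>Fourier coefficients and Sobolev spaces\<close>

definition wave :: "int \<times> int \<Rightarrow> real \<times> real \<Rightarrow> real" where
  "wave k x = of_int (fst k) * fst x + of_int (snd k) * snd x"

definition freq_norm :: "int \<times> int \<Rightarrow> real" where
  "freq_norm k = sqrt ((of_int (fst k))\<^sup>2 + (of_int (snd k))\<^sup>2)"

definition fourier_coeff :: "H \<Rightarrow> int \<times> int \<Rightarrow> complex" where
  "fourier_coeff f k = (LINT x|torus. of_real (rep_H f x) * cis (- wave k x))"

text \<open>Only $s \ge 0$ is used. A mean-zero real distribution with finite $H^s$ norm, $s \ge 0$, is a
  function in $L^2$, so $H^s$ is a subset of $H$.\<close>

definition Hs :: "real \<Rightarrow> H set" where
  "Hs s = {f. (\<lambda>k. freq_norm k powr (2 * s) * (cmod (fourier_coeff f k))\<^sup>2) summable_on (- {(0, 0)})}"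

definition Hs_inner :: "real \<Rightarrow> H \<Rightarrow> H \<Rightarrow> real" where
  "Hs_inner s f g =
    (\<Sum>\<^sub>\<infinity>k\<in>- {(0, 0)}. freq_norm k powr (2 * s) * Re (fourier_coeff f k * cnj (fourier_coeff g k)))"

text \<open>Distributional derivatives on the torus act on Fourier coefficients by multiplication with
  $i k_j$. The result is meaningful only when it is again in $H$.\<close>

definition partial1 :: "H \<Rightarrow> H" where
  "partial1 f = (THE g. \<forall>k. fourier_coeff g k = \<i> * of_int (fst k) * fourier_coeff f k)"

definition partial2 :: "H \<Rightarrow> H" where
  "partial2 f = (THE g. \<forall>k. fourier_coeff g k = \<i> * of_int (snd k) * fourier_coeff f k)"

definition laplacian :: "H \<Rightarrow> H" where
  "laplacian f = partial1 (partial1 f) + partial2 (partial2 f)"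

definition inv_neg_laplacian :: "H \<Rightarrow> H" where
  "inv_neg_laplacian = inv_into (Hs 2) (\<lambda>g. - laplacian g)"

definition biot_savart :: "H \<Rightarrow> H \<times> H" where
  "biot_savart f = (- partial2 (inv_neg_laplacian f), partial1 (inv_neg_laplacian f))"

text \<open>The pointwise product $(Kf) \cdot \nabla g$; meaningful when it is square integrable with mean
  zero, as for $f, g \in H^b$.\<close>

definition advect :: "H \<Rightarrow> H \<Rightarrow> H" where
  "advect f g = abs_H (\<lambda>x. rep_H (fst (biot_savart f)) x * rep_H (partial1 g) x
                        + rep_H (snd (biot_savart f)) x * rep_H (partial2 g) x)"

definition Z2_plus :: "(int \<times> int) set" where
  "Z2_plus = {k. k \<noteq> (0, 0) \<and> (fst k > 0 \<or> (fst k = 0 \<and> snd k > 0))}"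

datatype parity = Cos | Sin

fun mode :: "int \<times> int \<Rightarrow> parity \<Rightarrow> H" where
  "mode k Cos = abs_H (\<lambda>x. sqrt 2 * cos (wave k x))"
| "mode k Sin = abs_H (\<lambda>x. sqrt 2 * sin (wave k x))"

definition phi :: H where
  "phi = abs_H (\<lambda>x. cos (fst x) + cos (snd x))"

definition phi_perp :: "H set" where
  "phi_perp = {f. f \<bullet> phi = 0}"

definition proj_phi_perp :: "H \<Rightarrow> H" where
  "proj_phi_perp f = f - ((f \<bullet> phi) / (phi \<bullet> phi)) *\<^sub>R phi"

subsection \<open>The space $E_b$, the operator $L$ and its semigroup\<close>

definition E :: "real \<Rightarrow> (H \<times> H) set" where
  "E b = Hs b \<times> phi_perp"

definition E_inner :: "real \<Rightarrow> H \<times> H \<Rightarrow> H \<times> H \<Rightarrow> real" where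
  "E_inner b x y = Hs_inner b (fst x) (fst y) + snd x \<bullet> snd y"

definition E_norm :: "real \<Rightarrow> H \<times> H \<Rightarrow> real" where
  "E_norm b x = sqrt (E_inner b x x)"

definition C_phi :: "H \<Rightarrow> H" where
  "C_phi \<xi> = - proj_phi_perp (advect \<xi> phi + advect phi \<xi>)"

definition gen :: "real \<Rightarrow> H \<times> H \<Rightarrow> H \<times> H" where
  "gen \<nu> x = (\<nu> *\<^sub>R laplacian (fst x), \<nu> *\<^sub>R (laplacian (snd x) + snd x) + C_phi (fst x))"

text \<open>The natural domain of $L$ as an unbounded operator on $E_b$.\<close>

definition gen_dom :: "real \<Rightarrow> (H \<times> H) set" where
  "gen_dom b = E b \<inter> (Hs (b + 2) \<times> Hs 2)"

definition C0_semigroup_on :: "'a::real_vector set \<Rightarrow> ('a \<Rightarrow> real) \<Rightarrow> (real \<Rightarrow> 'a \<Rightarrow> 'a) \<Rightarrow> bool" where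
  "C0_semigroup_on X n S \<longleftrightarrow>
    (\<forall>t\<ge>0. (\<forall>x\<in>X. S t x \<in> X)
      \<and> (\<forall>x\<in>X. \<forall>y\<in>X. S t (x + y) = S t x + S t y)
      \<and> (\<forall>c. \<forall>x\<in>X. S t (c *\<^sub>R x) = c *\<^sub>R S t x)
      \<and> (\<exists>M. \<forall>x\<in>X. n (S t x) \<le> M * n x))
    \<and> (\<forall>x\<in>X. S 0 x = x)
    \<and> (\<forall>s\<ge>0. \<forall>t\<ge>0. \<forall>x\<in>X. S (s + t) x = S s (S t x))
    \<and> (\<forall>x\<in>X. ((\<lambda>t. n (S t x - x)) \<longlongrightarrow> 0) (at_right 0))"

definition has_generator_on ::
  "'a::real_vector set \<Rightarrow> ('a \<Rightarrow> real) \<Rightarrow> (real \<Rightarrow> 'a \<Rightarrow> 'a) \<Rightarrow> 'a set \<Rightarrow> ('a \<Rightarrow> 'a) \<Rightarrow> bool" where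
  "has_generator_on X n S D A \<longleftrightarrow>
    (\<forall>x\<in>X. \<forall>y\<in>X. ((\<lambda>h. n ((S h x - x) /\<^sub>R h - y)) \<longlongrightarrow> 0) (at_right 0) \<longleftrightarrow> x \<in> D \<and> y = A x)"

text \<open>$S_t = e^{tL}$, the strongly continuous semigroup on $E_b$ with generator $L$. Its restriction to
  $t \ge 0$ and $E_b$ is unique; other values are unspecified.\<close>

definition flow :: "real \<Rightarrow> real \<Rightarrow> real \<Rightarrow> H \<times> H \<Rightarrow> H \<times> H" where
  "flow \<nu> b = (SOME S. C0_semigroup_on (E b) (E_norm b) S
                      \<and> has_generator_on (E b) (E_norm b) S (gen_dom b) (gen \<nu>))"

subsection \<open>Controls\<close>

definition time_measure :: "real \<Rightarrow> real measure" where
  "time_measure T = restrict_space lborel {0<..<T}"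

text \<open>Representatives of elements of $L^2(0,T;H)$; they are identified when equal almost everywhere.\<close>

definition L2_time :: "real \<Rightarrow> (real \<Rightarrow> H) set" where
  "L2_time T = {v. v \<in> borel_measurable (time_measure T) \<and> integrable (time_measure T) (\<lambda>t. (norm (v t))\<^sup>2)}"

definition L2_time_inner :: "real \<Rightarrow> (real \<Rightarrow> H) \<Rightarrow> (real \<Rightarrow> H) \<Rightarrow> real" where
  "L2_time_inner T v w = (LINT t|time_measure T. v t \<bullet> w t)"

definition L2_time_norm :: "real \<Rightarrow> (real \<Rightarrow> H) \<Rightarrow> real" where
  "L2_time_norm T v = sqrt (L2_time_inner T v v)"

text \<open>$u$ solves $\partial_t u = L u + (Q v, 0)$, $u(0) = 0$, on $[0,T]$ in the mild sense: the equation
  holds after integration in time. The $H \times H$-valued Bochner integrals agree with the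
  $E_b$-valued ones because $E_b$ embeds continuously into $H \times H$ for $b \ge 0$.\<close>

definition is_solution ::
  "real \<Rightarrow> real \<Rightarrow> (H \<Rightarrow> H) \<Rightarrow> real \<Rightarrow> (real \<Rightarrow> H) \<Rightarrow> (real \<Rightarrow> H \<times> H) \<Rightarrow> bool" where
  "is_solution \<nu> b Q T v u \<longleftrightarrow>
    (\<forall>t\<in>{0..T}. u t \<in> E b \<and> ((\<lambda>s. E_norm b (u s - u t)) \<longlongrightarrow> 0) (at t within {0..T}))
    \<and> u 0 = 0
    \<and> (\<forall>t\<in>{0..T}. (LINT s:{0<..<t}|lborel. u s) \<in> gen_dom b
        \<and> u t = gen \<nu> (LINT s:{0<..<t}|lborel. u s) + (LINT s:{0<..<t}|lborel. (Q (v s), 0)))"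

definition control_map :: "real \<Rightarrow> real \<Rightarrow> (H \<Rightarrow> H) \<Rightarrow> real \<Rightarrow> (real \<Rightarrow> H) \<Rightarrow> H \<times> H" where
  "control_map \<nu> b Q T v = (THE x. \<exists>u. is_solution \<nu> b Q T v u \<and> u T = x)"

subsection \<open>Adjoints and operator norms\<close>

text \<open>The Hilbert space adjoint of \<open>A\<close>, from the space with carrier \<open>X\<close> and inner product \<open>ipX\<close> to one
  with inner product \<open>ipY\<close>. For \<open>L2_time\<close> the value is a representative, unique almost everywhere.\<close>

definition adjoint_on ::
  "'a set \<Rightarrow> ('a \<Rightarrow> 'a \<Rightarrow> real) \<Rightarrow> ('b \<Rightarrow> 'b \<Rightarrow> real) \<Rightarrow> ('a \<Rightarrow> 'b) \<Rightarrow> 'b \<Rightarrow> 'a" where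
  "adjoint_on X ipX ipY A y = (SOME x. x \<in> X \<and> (\<forall>z\<in>X. ipY (A z) y = ipX z x))"

definition flow_adjoint :: "real \<Rightarrow> real \<Rightarrow> real \<Rightarrow> H \<times> H \<Rightarrow> H \<times> H" where
  "flow_adjoint \<nu> b T = adjoint_on (E b) (E_inner b) (E_inner b) (flow \<nu> b T)"

definition control_adjoint :: "real \<Rightarrow> real \<Rightarrow> (H \<Rightarrow> H) \<Rightarrow> real \<Rightarrow> H \<times> H \<Rightarrow> real \<Rightarrow> H" where
  "control_adjoint \<nu> b Q T =
    adjoint_on (L2_time T) (L2_time_inner T) (E_inner b) (control_map \<nu> b Q T)"

text \<open>Bounded linear operators from $E_b$ to $L^2(0,T;H)$; linearity is that of the classes modulo
  equality almost everywhere.\<close>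

definition bounded_op_E_L2 :: "real \<Rightarrow> real \<Rightarrow> (H \<times> H \<Rightarrow> real \<Rightarrow> H) \<Rightarrow> bool" where
  "bounded_op_E_L2 b T K \<longleftrightarrow>
    (\<forall>x\<in>E b. K x \<in> L2_time T)
    \<and> (\<forall>x\<in>E b. \<forall>y\<in>E b. AE t in time_measure T. K (x + y) t = K x t + K y t)
    \<and> (\<forall>c. \<forall>x\<in>E b. AE t in time_measure T. K (c *\<^sub>R x) t = c *\<^sub>R K x t)
    \<and> (\<exists>M. \<forall>x\<in>E b. L2_time_norm T (K x) \<le> M * E_norm b x)"

definition op_norm_E_L2 :: "real \<Rightarrow> real \<Rightarrow> (H \<times> H \<Rightarrow> real \<Rightarrow> H) \<Rightarrow> real" where
  "op_norm_E_L2 b T K = (SUP x\<in>{x \<in> E b. E_norm b x \<le> 1}. L2_time_norm T (K x))"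

end

(* In Fourier variables L is diagonal up to the coupling C_phi of a mode k to its four neighbours
   k + d, so S_T is explicit: heat factors for xi, and heat factors plus Duhamel coefficients for
   eta.  It suffices to construct a bounded K with S_T = A_T K, since then
   ||S_T^* xi||^2 = <K S_T^* xi, A_T^* xi>.

   The control K w vanishes on [0, T/2], and the heat factors of that half interval absorb every
   power of |k| lost afterwards (in inverting Q, in passing from H to H^b, and in time derivatives).
   On [T/2, T] one prescribes the trajectory of the first component, from 0 to its target, and reads
   the control off the equation.  What remains of the target of eta_k is transferred through a single
   neighbour m of k that lies off the axes and diagonals.  The four neighbours of such an m have
   distinct lengths, hence distinct decay rates, and a time profile whose moments against the
   exponentials of the other three vanish acts on eta_k alone.  Modes with |k| = 1 cannot be reached
   like this; they are transferred through the diagonal points (+-1, +-1), where the one missing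
   degree of freedom is exactly the component along phi. *)
theory Submission
  imports Defs
begin

subsection \<open>Trigonometric polynomials on the torus\<close>

text \<open>The flow, the control map, the adjoints and even the derivatives are given by choice or
  description operators, so each has to be identified before it can be computed with. For the flow
  this means that an arbitrary semigroup with the given generator must be shown to agree with the
  explicit one. This is done in one fixed Hilbert space: \<Lambda>^b on the first component, where
  \<Lambda> = (-\<Delta>)^(1/2), maps E_b isometrically onto H times the orthogonal complement of
  \<phi>. There all operators of the evolution are matrices on Z^2 with five nonzero diagonals and
  bounded entries, and strong limits can be taken entry by entry. The obstacle for the control is
  that only \<xi> is forced, and a mode m of \<xi> feeds all its neighbours in \<eta> at once. The
  coupling of k to m = k + d is (k x d) (1 - |m|^(-2)) / 2, with k x d the cross product. It
  vanishes when d is parallel to k and when |m| = 1, which for |k| = 1 leaves only diagonal points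
  m; each of these feeds a horizontal and a vertical unit mode with opposite coefficients.\<close>

abbreviation fc :: "H \<Rightarrow> int \<times> int \<Rightarrow> complex" where
  "fc \<equiv> fourier_coeff"

lemma wave_add: "wave (j + k) x = wave j x + wave k x"
  and wave_minus: "wave (- k) x = - wave k x"
  and wave_diff: "wave (j - k) x = wave j x - wave k x"
  and wave_zero [simp]: "wave 0 x = 0"
  by (auto simp: wave_def algebra_simps)

lemma continuous_on_wave [continuous_intros]: "continuous_on A (wave k)"
  unfolding wave_def by (intro continuous_intros)

lemma continuous_on_cis_wave [continuous_intros]: "continuous_on A (\<lambda>x. cis (wave k x))"
  unfolding cis_conv_exp by (intro continuous_intros)

lemma wave_measurable [measurable]: "wave k \<in> borel_measurable borel"
  by (intro borel_measurable_continuous_onI continuous_intros)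

lemma cis_measurable [measurable]: "cis \<in> borel_measurable borel"
  by (intro borel_measurable_continuous_onI) (auto simp: cis_conv_exp intro!: continuous_intros)

lemma torus_density:
  "torus = density lborel (\<lambda>x. ennreal (indicator (cbox (0, 0) (2 * pi, 2 * pi)) x / (4 * pi\<^sup>2)))"
  unfolding torus_def uniform_measure_def emeasure_torus_box
  by (intro arg_cong[where f = "density lborel"] ext)
    (simp add: divide_ennreal ennreal_indicator[symmetric])

text \<open>Passing to a Henstock-Kurzweil integral over the square makes iterated integration and
  the fundamental theorem of calculus available for exponentials.\<close>

lemma integral_torus_continuous:
  fixes g :: "real \<times> real \<Rightarrow> complex"
  assumes g: "continuous_on UNIV g"
  shows "(LINT x|torus. g x) = integral (cbox (0, 0) (2 * pi, 2 * pi)) g /\<^sub>R (4 * pi\<^sup>2)"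
proof -
  have gm [measurable]: "g \<in> borel_measurable borel"
    using g by (rule borel_measurable_continuous_onI)
  have si: "set_integrable lborel (cbox (0, 0) (2 * pi, 2 * pi)) g"
    unfolding set_integrable_def
    by (intro borel_integrable_compact continuous_on_subset[OF g]) auto
  have "(LINT x|torus. g x)
      = (LINT x|lborel. (indicator (cbox (0, 0) (2 * pi, 2 * pi)) x / (4 * pi\<^sup>2)) *\<^sub>R g x)"
    unfolding torus_density by (rule integral_density) auto
  also have "\<dots> = (LINT x:cbox (0, 0) (2 * pi, 2 * pi)|lborel. g x) /\<^sub>R (4 * pi\<^sup>2)"
    unfolding set_lebesgue_integral_def
    by (subst integral_scaleR_right[symmetric]) (simp add: field_simps)
  also have "(LINT x:cbox (0, 0) (2 * pi, 2 * pi)|lborel. g x) = integral (cbox (0, 0) (2 * pi, 2 * pi)) g"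
    by (rule set_borel_integral_eq_integral(2)[OF si])
  finally show ?thesis .
qed

lemma integral_cis_int:
  "integral {0..2 * pi} (\<lambda>y. cis (of_int n * y)) = (if n = 0 then 2 * pi else 0)"
proof (cases "n = 0")
  case False
  have h: "((\<lambda>y. cis (of_int n * y)) has_integral
      cis (of_int n * (2 * pi)) / (\<i> * of_int n) - cis (of_int n * 0) / (\<i> * of_int n)) {0..2 * pi}"
  proof (rule fundamental_theorem_of_calculus)
    fix x :: real
    have "((\<lambda>z. exp (\<i> * of_int n * z) / (\<i> * of_int n)) has_field_derivative exp (\<i> * of_int n * of_real x)) (at (of_real x))"
      using False by (auto intro!: derivative_eq_intros)
    from has_vector_derivative_real_field[OF this, of "{0..2 * pi}"]
    show "((\<lambda>y. cis (of_int n * y) / (\<i> * of_int n)) has_vector_derivative cis (of_int n * x)) (at x within {0..2 * pi})"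
      by (simp add: cis_conv_exp mult.assoc)
  qed simp
  moreover have "cis (of_int n * (2 * pi)) = 1"
    using cis_multiple_2pi[of "of_int n"] by (simp add: mult.commute)
  ultimately show ?thesis
    using False integral_unique[OF h] by simp
qed (simp add: scaleR_conv_of_real)

lemma integral_cis_wave: "(LINT x|torus. cis (wave k x)) = (if k = 0 then 1 else 0)"
proof -
  have "integral (cbox (0, 0) (2 * pi, 2 * pi)) (\<lambda>x. cis (wave k x))
      = integral (cbox 0 (2 * pi)) (\<lambda>x. integral (cbox 0 (2 * pi)) (\<lambda>y. cis (wave k (x, y))))"
    by (intro integral_prod_continuous continuous_intros)
  also have "\<dots> = integral {0..2 * pi} (\<lambda>x. cis (of_int (fst k) * x) * integral {0..2 * pi} (\<lambda>y. cis (of_int (snd k) * y)))"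
    by (simp add: wave_def flip: cis_mult)
  also have "\<dots> = (if k = 0 then 4 * pi\<^sup>2 else 0)"
    by (simp add: integral_cis_int zero_prod_def prod_eq_iff power2_eq_square)
  finally show ?thesis
    by (subst integral_torus_continuous) (auto intro!: continuous_intros simp: scaleR_conv_of_real)
qed

lemma integrable_cis_wave:
  assumes "integrable torus f"
  shows "integrable torus (\<lambda>x. of_real (f x) * cis (wave k x))"
proof (rule Bochner_Integration.integrable_bound[OF assms])
  have [measurable]: "f \<in> borel_measurable torus" using assms by auto
  show "(\<lambda>x. of_real (f x) * cis (wave k x)) \<in> borel_measurable torus" by measurable
qed (auto simp: norm_mult)

lemma integrable_rep_H: "integrable torus (rep_H f)"
  by (intro sq_integrable_imp_integrable sq_integrable_rep_H)

lemma fc_alt: "fc f k = (LINT x|torus. of_real (rep_H f x) * cis (wave (- k) x))"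
  by (simp add: fourier_coeff_def wave_minus)

lemma fc_abs_H:
  assumes "mean_zero_L2 g"
  shows "fc (abs_H g) k = (LINT x|torus. of_real (g x) * cis (wave (- k) x))"
proof -
  have [measurable]: "g \<in> borel_measurable torus"
    using assms by (auto simp: mean_zero_L2_def sq_integrable_def)
  show ?thesis
    unfolding fc_alt
    by (intro integral_cong_AE) (measurable, use rep_abs_H[OF assms] in eventually_elim, simp)
qed

lemma fc_add: "fc (f + g) k = fc f k + fc g k"
proof -
  have "fc (f + g) k = (LINT x|torus. of_real (rep_H f x + rep_H g x) * cis (wave (- k) x))"
    unfolding fc_alt
    by (intro integral_cong_AE) (measurable, use rep_H_plus[of f g] in eventually_elim, simp)
  then show ?thesis
    using integrable_cis_wave[OF integrable_rep_H, of f "-k"] integrable_cis_wave[OF integrable_rep_H, of g "-k"]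
    by (simp add: fc_alt algebra_simps)
qed

lemma fc_scaleR: "fc (c *\<^sub>R f) k = c *\<^sub>R fc f k"
proof -
  have "fc (c *\<^sub>R f) k = (LINT x|torus. c *\<^sub>R (of_real (rep_H f x) * cis (wave (- k) x)))"
    unfolding fc_alt
    by (intro integral_cong_AE)
      (measurable, use rep_H_scaleR[of c f] in eventually_elim, simp add: scaleR_conv_of_real)
  then show ?thesis by (simp add: fc_alt)
qed

lemma fc_zero_freq [simp]: "fc f 0 = 0"
  using rep_H[of f] by (simp add: fc_alt mean_zero_L2_def del: integral_complex_of_real) (simp add: integral_complex_of_real)

lemma fc_minus_freq: "fc f (- k) = cnj (fc f k)"
proof -
  have "cnj (fc f k) = (LINT x|torus. cnj (of_real (rep_H f x) * cis (wave (- k) x)))"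
    unfolding fc_alt by (rule Bochner_Integration.integral_cnj[symmetric])
  then show ?thesis by (simp add: fc_alt wave_minus cis_cnj)
qed

lemma norm_fc_le: "cmod (fc f k) \<le> norm f"
proof -
  have "cmod (fc f k) \<le> (LINT x|torus. \<bar>rep_H f x\<bar>)"
    unfolding fc_alt
    by (rule order_trans[OF integral_norm_bound]) (simp add: norm_mult)
  also have "\<dots> \<le> norm f"
  proof (rule power2_le_imp_le)
    show "(LINT x|torus. \<bar>rep_H f x\<bar>)\<^sup>2 \<le> (norm f)\<^sup>2"
      using sq_integrable_integral_abs_le[OF sq_integrable_rep_H[of f]] by (simp add: norm_H_sq)
  qed simp
  finally show ?thesis .
qed

lemma bounded_linear_fc: "bounded_linear (\<lambda>f. fc f k)"
  by (rule bounded_linear_intro[where K = 1]) (auto simp: fc_add fc_scaleR norm_fc_le)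

lemmas fc_zero [simp] = linear_0[OF bounded_linear.linear[OF bounded_linear_fc]]
lemmas fc_uminus = linear_neg[OF bounded_linear.linear[OF bounded_linear_fc]]
lemmas fc_diff = linear_diff[OF bounded_linear.linear[OF bounded_linear_fc]]
lemmas fc_sum = linear_sum[OF bounded_linear.linear[OF bounded_linear_fc]]

text \<open>The real mode Re (z exp (i k.x)). As k and -k give the same functions, each coefficient
  of a sum over all of Z^2 comes half from k and half from -k, so f is the sum of
  \<open>trig k (fc f k)\<close> without a normalising factor. The zero mode is set to 0 to stay
  mean-zero.\<close>

definition trig :: "int \<times> int \<Rightarrow> complex \<Rightarrow> H" where
  "trig k z = (if k = 0 then 0 else abs_H (\<lambda>x. Re (z * cis (wave k x))))"

lemma mean_zero_trig:
  assumes "k \<noteq> 0"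
  shows "mean_zero_L2 (\<lambda>x. Re (z * cis (wave k x)))"
proof -
  have "(LINT x|torus. Re (z * cis (wave k x))) = Re (LINT x|torus. z * cis (wave k x))"
    by (rule integral_Re) (auto intro!: integrable_mult_right integrable_cis_wave[of "\<lambda>_. 1", simplified])
  also have "(LINT x|torus. z * cis (wave k x)) = 0"
    using assms by (simp add: integral_cis_wave)
  finally have "(LINT x|torus. Re (z * cis (wave k x))) = 0" by simp
  moreover have "\<bar>Re (z * cis (wave k x))\<bar> \<le> cmod z" for x
    using abs_Re_le_cmod[of "z * cis (wave k x)"] by (simp add: norm_mult)
  then have "sq_integrable (\<lambda>x. Re (z * cis (wave k x)))"
    by (intro sq_integrable_bounded[of _ "cmod z"] AE_I2) (auto simp: measurable_cong_sets[OF sets_torus refl])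
  ultimately show ?thesis by (simp add: mean_zero_L2_def)
qed

lemma fc_trig:
  assumes "k \<noteq> 0"
  shows "fc (trig k z) j = ((if j = k then z else 0) + (if j = - k then cnj z else 0)) / 2"
proof -
  have i: "integrable torus (\<lambda>x. cis (wave m x))" for m
    using integrable_cis_wave[of "\<lambda>_. 1"] by simp
  have "fc (trig k z) j = (LINT x|torus. of_real (Re (z * cis (wave k x))) * cis (wave (- j) x))"
    unfolding trig_def by (simp only: fc_abs_H[OF mean_zero_trig[OF assms]] if_False assms)
  also have "\<dots> = (LINT x|torus. (z / 2) * cis (wave (k - j) x) + (cnj z / 2) * cis (wave (- k - j) x))"
  proof (intro Bochner_Integration.integral_cong refl)
    fix x
    have "complex_of_real (Re (z * cis (wave k x))) = (z * cis (wave k x) + cnj z * cis (wave (- k) x)) / 2"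
      using complex_add_cnj[of "z * cis (wave k x)"] by (simp add: wave_minus cis_cnj)
    then have "of_real (Re (z * cis (wave k x))) * cis (wave (- j) x)
        = (z / 2) * (cis (wave k x) * cis (wave (- j) x)) + (cnj z / 2) * (cis (wave (- k) x) * cis (wave (- j) x))"
      by (simp only:) (simp add: field_simps del: Re_complex_of_real)
    then show "of_real (Re (z * cis (wave k x))) * cis (wave (- j) x)
        = (z / 2) * cis (wave (k - j) x) + (cnj z / 2) * cis (wave (- k - j) x)"
      unfolding cis_mult wave_diff wave_minus by simp
  qed
  also have "\<dots> = (z / 2) * (LINT x|torus. cis (wave (k - j) x)) + (cnj z / 2) * (LINT x|torus. cis (wave (- k - j) x))"
    using i by simp
  finally show ?thesis
    by (auto simp: integral_cis_wave eq_neg_iff_add_eq_0 neg_eq_iff_add_eq_0 add.commute)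
qed

lemma inner_trig: "k \<noteq> 0 \<Longrightarrow> f \<bullet> trig k z = Re (fc f k * cnj z)"
proof -
  assume k: "k \<noteq> 0"
  have i: "integrable torus (\<lambda>x. z * (of_real (rep_H f x) * cis (wave k x)))"
    by (intro integrable_mult_right integrable_cis_wave integrable_rep_H)
  have [measurable]: "(\<lambda>x. Re (z * cis (wave k x))) \<in> borel_measurable torus"
    using mean_zero_trig[OF k] by (simp add: mean_zero_L2_def sq_integrable_def)
  have "f \<bullet> trig k z = (LINT x|torus. rep_H f x * Re (z * cis (wave k x)))"
    unfolding inner_H_def trig_def using k
    by (simp, intro integral_cong_AE) (measurable, use rep_abs_H[OF mean_zero_trig[OF k, of z]] in eventually_elim, simp)
  also have "\<dots> = (LINT x|torus. Re (z * (of_real (rep_H f x) * cis (wave k x))))"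
    by (intro Bochner_Integration.integral_cong) (auto simp: algebra_simps)
  also have "\<dots> = Re (LINT x|torus. z * (of_real (rep_H f x) * cis (wave k x)))"
    using i by (rule integral_Re)
  also have "\<dots> = Re (z * fc f (- k))"
    by (simp add: fc_alt)
  finally show ?thesis by (simp add: fc_minus_freq)
qed

subsection \<open>Completeness\<close>

text \<open>Closed under sums by construction and under products by \<open>trig_poly_mult\<close>,
  which are the algebraic hypotheses of Stone-Weierstrass.\<close>

inductive trig_poly :: "(real \<times> real \<Rightarrow> complex) \<Rightarrow> bool" where
  wave: "trig_poly (\<lambda>x. c * cis (wave k x))"
| add: "trig_poly f \<Longrightarrow> trig_poly g \<Longrightarrow> trig_poly (\<lambda>x. f x + g x)"

lemma trig_poly_mult:
  assumes "trig_poly f" "trig_poly g"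
  shows "trig_poly (\<lambda>x. f x * g x)"
  using assms(1)
proof induction
  case (wave c k)
  show ?case
    using assms(2)
  proof induction
    case (wave d j)
    show ?case
      using trig_poly.wave[of "c * d" "k + j"] by (simp add: wave_add algebra_simps flip: cis_mult)
  next
    case (add f g)
    then show ?case using trig_poly.add by (simp add: algebra_simps)
  qed
next
  case (add f g)
  then show ?case using trig_poly.add by (simp add: algebra_simps)
qed

lemma trig_poly_orthogonal:
  assumes "trig_poly p" and f: "\<And>k. fc f k = 0"
  shows "integrable torus (\<lambda>x. of_real (rep_H f x) * p x) \<and> (LINT x|torus. of_real (rep_H f x) * p x) = 0"
  using assms(1)
proof induction
  case (wave c k)
  have "integrable torus (\<lambda>x. c * (of_real (rep_H f x) * cis (wave k x)))"
    by (intro integrable_mult_right integrable_cis_wave integrable_rep_H)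
  moreover have "(LINT x|torus. c * (of_real (rep_H f x) * cis (wave k x))) = c * fc f (- k)"
    by (simp add: fc_alt)
  ultimately show ?case
    using f by (simp add: mult.left_commute)
qed (simp add: algebra_simps)

text \<open>On the closed square, trigonometric polynomials do not separate opposite edges. In the
  product of two unit circles they become restrictions of polynomials in the coordinates, which
  separate points of a compact set.\<close>

definition torus_emb :: "real \<times> real \<Rightarrow> complex \<times> complex" where
  "torus_emb x = (cis (fst x), cis (snd x))"

lemma continuous_on_torus_emb [continuous_intros]: "continuous_on A torus_emb"
  unfolding torus_emb_def cis_conv_exp by (intro continuous_intros)

lemma box_Pair_eq: "box (a, b) (c, d) = box a c \<times> box b d"
  by (force simp: box_def Basis_prod_def)

text \<open>One of the points must lie in the open square, since points of the edges have further
  preimages.\<close>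

lemma torus_emb_inj:
  assumes "x \<in> box (0, 0) (2 * pi, 2 * pi)" "y \<in> cbox (0, 0) (2 * pi, 2 * pi)" "torus_emb x = torus_emb y"
  shows "x = y"
proof -
  have *: "s = t" if st: "0 < s" "s < 2 * pi" "0 \<le> t" "t \<le> 2 * pi" "cis s = cis t" for s t :: real
  proof -
    have "sin s = sin t \<and> cos s = cos t"
      using that by (auto simp: complex_eq_iff)
    then obtain n :: int where n: "s = t + 2 * pi * n"
      using sin_cos_eq_iff by metis
    have "2 * pi * n < 2 * pi * 1" "2 * pi * (-1) < 2 * pi * n"
      using st n by linarith+
    then have "n = 0"
      by (subst (asm) (1 2) mult_less_cancel_left_pos) auto
    then show ?thesis using n by simp
  qed
  show ?thesis
    using assms by (cases x; cases y) (auto simp: torus_emb_def box_Pair_eq cbox_Pair_eq intro: *)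
qed

text \<open>By Stone-Weierstrass, F is within e of some G that is a trigonometric polynomial on the
  torus. G integrates to 0 against f, and the remainder contributes at most e times the L^1 norm of
  f.\<close>

lemma orthogonal_continuous:
  assumes f: "\<And>k. fc f k = 0" and F: "continuous_on (sphere 0 1 \<times> sphere 0 1) F"
  shows "(LINT x|torus. rep_H f x * F (torus_emb x)) = 0"
proof -
  let ?S = "sphere 0 1 \<times> sphere 0 1 :: (complex \<times> complex) set"
  have emb: "torus_emb x \<in> ?S" for x
    by (simp add: torus_emb_def)
  define P where "P G \<longleftrightarrow> continuous_on ?S G \<and> trig_poly (\<lambda>x. of_real (G (torus_emb x)))"
    for G :: "complex \<times> complex \<Rightarrow> real"
  have Fm: "(\<lambda>x. G (torus_emb x)) \<in> borel_measurable torus" if "continuous_on ?S G" for G :: "complex \<times> complex \<Rightarrow> real"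
    using continuous_on_compose2[OF that continuous_on_torus_emb, of UNIV] emb
    by (subst measurable_cong_sets[OF sets_torus refl])
      (blast intro: borel_measurable_continuous_onI)
  have coord: "P (\<lambda>p. Re (g p))" "P (\<lambda>p. Im (g p))"
    if g: "continuous_on ?S g" "\<And>x. g (torus_emb x) = cis (wave k x)" for g k
  proof -
    have "trig_poly (\<lambda>x. (1/2) * cis (wave k x) + (1/2) * cis (wave (-k) x))"
      "trig_poly (\<lambda>x. (-\<i>/2) * cis (wave k x) + (\<i>/2) * cis (wave (-k) x))"
      by (intro trig_poly.intros)+
    moreover have "(\<lambda>x. (1/2) * cis (wave k x) + (1/2) * cis (wave (-k) x)) = (\<lambda>x. of_real (Re (g (torus_emb x))))"
      "(\<lambda>x. (-\<i>/2) * cis (wave k x) + (\<i>/2) * cis (wave (-k) x)) = (\<lambda>x. of_real (Im (g (torus_emb x))))"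
      by (auto simp: g(2) wave_minus complex_eq_iff)
    ultimately show "P (\<lambda>p. Re (g p))" "P (\<lambda>p. Im (g p))"
      using g(1) by (auto simp: P_def intro!: continuous_intros)
  qed
  have c: "P (\<lambda>p. Re (fst p))" "P (\<lambda>p. Im (fst p))" "P (\<lambda>p. Re (snd p))" "P (\<lambda>p. Im (snd p))"
    using coord[of fst "(1, 0)"] coord[of snd "(0, 1)"]
      continuous_on_fst[OF continuous_on_id, of ?S] continuous_on_snd[OF continuous_on_id, of ?S]
    by (simp_all add: torus_emb_def wave_def)
  have "\<bar>LINT x|torus. rep_H f x * F (torus_emb x)\<bar> \<le> e * (LINT x|torus. \<bar>rep_H f x\<bar>)" if e: "0 < e" for e
  proof -
    have "\<exists>G. P G \<and> (\<forall>p\<in>?S. \<bar>F p - G p\<bar> < e)"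
    proof (rule Stone_Weierstrass_HOL[of ?S P])
      show "P (\<lambda>x. r)" for r
        using trig_poly.wave[of "of_real r" 0] by (simp add: P_def)
      show "P (\<lambda>x. g x + h x)" if "P g \<and> P h" for g h
        using that trig_poly.add by (auto simp: P_def intro!: continuous_intros)
      show "P (\<lambda>x. g x * h x)" if "P g \<and> P h" for g h
        using that trig_poly_mult by (auto simp: P_def intro!: continuous_intros)
      show "\<exists>g. P g \<and> g x \<noteq> g y" if "x \<in> ?S \<and> y \<in> ?S \<and> x \<noteq> y" for x y
        using that c by (cases x; cases y) (auto simp: complex_eq_iff)
    qed (use F e in \<open>auto simp: P_def intro!: compact_Times\<close>)
    then obtain G where G: "P G" "\<And>p. p \<in> ?S \<Longrightarrow> \<bar>F p - G p\<bar> < e" by blast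
    have tp: "integrable torus (\<lambda>x. complex_of_real (rep_H f x * G (torus_emb x)))"
      "(LINT x|torus. complex_of_real (rep_H f x * G (torus_emb x))) = 0"
      using trig_poly_orthogonal[of "\<lambda>x. of_real (G (torus_emb x))" f] G(1) f by (auto simp: P_def)
    have Gi: "integrable torus (\<lambda>x. rep_H f x * G (torus_emb x))"
      "(LINT x|torus. rep_H f x * G (torus_emb x)) = 0"
      using tp integrable_Re[OF tp(1)] by (simp_all del: of_real_mult add: integral_complex_of_real)
    obtain B where B: "\<And>p. p \<in> ?S \<Longrightarrow> \<bar>F p\<bar> \<le> B"
      using compact_imp_bounded[OF compact_continuous_image[OF F]]
      by (auto simp: bounded_iff compact_Times)
    have Fi: "integrable torus (\<lambda>x. rep_H f x * F (torus_emb x))"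
    proof (rule Bochner_Integration.integrable_bound)
      show "integrable torus (\<lambda>x. B * rep_H f x)"
        using integrable_rep_H by auto
      show "AE x in torus. norm (rep_H f x * F (torus_emb x)) \<le> norm (B * rep_H f x)"
      proof (rule AE_I2)
        fix x
        have "\<bar>F (torus_emb x)\<bar> \<le> \<bar>B\<bar>" using B[OF emb[of x]] by linarith
        from mult_right_mono[OF this, of "\<bar>rep_H f x\<bar>"]
        show "norm (rep_H f x * F (torus_emb x)) \<le> norm (B * rep_H f x)"
          by (simp add: abs_mult mult.commute[of "\<bar>F (torus_emb x)\<bar>"])
      qed
    qed (use Fm[OF F] in measurable)
    have "\<bar>LINT x|torus. rep_H f x * F (torus_emb x)\<bar>
        = \<bar>LINT x|torus. rep_H f x * F (torus_emb x) - rep_H f x * G (torus_emb x)\<bar>"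
      using Fi Gi by simp
    also have "\<dots> \<le> (LINT x|torus. \<bar>rep_H f x * F (torus_emb x) - rep_H f x * G (torus_emb x)\<bar>)"
      by (rule integral_abs_bound)
    also have "\<dots> \<le> (LINT x|torus. e * \<bar>rep_H f x\<bar>)"
    proof (rule integral_mono)
      show "\<bar>rep_H f x * F (torus_emb x) - rep_H f x * G (torus_emb x)\<bar> \<le> e * \<bar>rep_H f x\<bar>" for x
        using G(2)[OF emb[of x]]
        by (simp add: abs_mult mult.commute[of e] mult_left_mono flip: right_diff_distrib)
    qed (use Fi Gi integrable_rep_H[of f] in auto)
    finally show ?thesis by simp
  qed
  then have bound: "\<bar>LINT x|torus. rep_H f x * F (torus_emb x)\<bar> \<le> e * (LINT x|torus. \<bar>rep_H f x\<bar>)" if "0 < e" for e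
    using that by blast
  have "\<bar>LINT x|torus. rep_H f x * F (torus_emb x)\<bar> \<le> 0"
  proof (rule field_le_epsilon)
    fix e :: real assume e: "0 < e"
    have I: "0 \<le> (LINT x|torus. \<bar>rep_H f x\<bar>)" by simp
    have le: "e / (I + 1) * I \<le> e" if "0 \<le> I" for I
      using e that by (simp add: field_simps)
    have "\<bar>LINT x|torus. rep_H f x * F (torus_emb x)\<bar>
        \<le> e / ((LINT x|torus. \<bar>rep_H f x\<bar>) + 1) * (LINT x|torus. \<bar>rep_H f x\<bar>)"
      by (rule bound) (intro divide_pos_pos e add_nonneg_pos I zero_less_one)
    also have "\<dots> \<le> e" by (rule le[OF I])
    finally show "\<bar>LINT x|torus. rep_H f x * F (torus_emb x)\<bar> \<le> 0 + e" by simp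
  qed
  then show ?thesis by simp
qed

text \<open>With K the image of the complement of U in the closed square, the functions min 1 (n
  dist (., K)) are continuous on the product of circles and tend to the indicator of U; dominated
  convergence applies. U stays inside the open square so that none of its points shares its image
  with a point outside U.\<close>

lemma orthogonal_open:
  assumes f: "\<And>k. fc f k = 0" and U: "open U" "U \<subseteq> box (0, 0) (2 * pi, 2 * pi)"
  shows "(LINT x:U|torus. rep_H f x) = 0"
proof -
  define K where "K = torus_emb ` (cbox (0, 0) (2 * pi, 2 * pi) - U)"
  have "compact (cbox (0, 0) (2 * pi, 2 * pi) - U)"
    using U(1) by (intro compact_diff) auto
  then have K: "closed K"
    unfolding K_def by (intro compact_imp_closed compact_continuous_image continuous_intros)
  \<comment> \<open>\<open>infdist\<close> to the empty set is 0, so K must be nonempty; the corner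
    of the square never lies in U.\<close>
  have "(0, 0) \<in> cbox (0, 0) (2 * pi, 2 * pi :: real) - U"
  proof -
    have "(0, 0) \<notin> box (0, 0) (2 * pi, 2 * pi :: real)" by (simp add: box_Pair_eq)
    moreover have "(0, 0) \<in> cbox (0, 0) (2 * pi, 2 * pi :: real)" by (simp add: cbox_Pair_eq)
    ultimately show ?thesis using U(2) by blast
  qed
  then have K_ne: "K \<noteq> {}" unfolding K_def by blast
  have [measurable]: "U \<in> sets borel" using U(1) by auto
  have lim: "(\<lambda>n. min 1 (real n * infdist (torus_emb x) K)) \<longlonglongrightarrow> indicator U x"
    if x: "x \<in> cbox (0, 0) (2 * pi, 2 * pi)" for x
  proof (cases "x \<in> U")
    case True
    then have "torus_emb x \<notin> K"
      using torus_emb_inj[of x] U(2) by (auto simp: K_def)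
    then have d: "infdist (torus_emb x) K > 0"
      using K K_ne by (intro infdist_pos_not_in_closed)
    obtain N :: nat where N: "1 / infdist (torus_emb x) K \<le> real N"
      using real_arch_simple by blast
    have "eventually (\<lambda>n. min 1 (real n * infdist (torus_emb x) K) = indicator U x) sequentially"
      unfolding eventually_sequentially
    proof (intro exI[of _ N] allI impI)
      fix n assume "N \<le> n"
      then have "1 / infdist (torus_emb x) K \<le> real n" using N by linarith
      then show "min 1 (real n * infdist (torus_emb x) K) = indicator U x"
        using d True by (simp add: field_simps)
    qed
    then show ?thesis by (rule tendsto_eventually)
  next
    case False
    then have "torus_emb x \<in> K" using x by (auto simp: K_def)
    then show ?thesis using False by (simp add: infdist_zero)
  qed
  have "(\<lambda>n. LINT x|torus. rep_H f x * min 1 (real n * infdist (torus_emb x) K))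
      \<longlonglongrightarrow> (LINT x|torus. rep_H f x * indicator U x)"
  proof (rule integral_dominated_convergence[where w = "\<lambda>x. \<bar>rep_H f x\<bar>"])
    show "AE x in torus. (\<lambda>n. rep_H f x * min 1 (real n * infdist (torus_emb x) K)) \<longlonglongrightarrow> rep_H f x * indicator U x"
      using AE_torus_box by eventually_elim (intro tendsto_intros lim)
    have "(\<lambda>x. min 1 (real n * infdist (torus_emb x) K)) \<in> borel_measurable torus" for n
      by (subst measurable_cong_sets[OF sets_torus refl])
        (intro borel_measurable_continuous_onI continuous_intros)
    then show "(\<lambda>x. rep_H f x * min 1 (real n * infdist (torus_emb x) K)) \<in> borel_measurable torus" for n
      by measurable
    show "AE x in torus. norm (rep_H f x * min 1 (real n * infdist (torus_emb x) K)) \<le> \<bar>rep_H f x\<bar>" for n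
      by (intro AE_I2) (auto simp: abs_mult infdist_nonneg intro!: mult_left_le)
  qed (use integrable_rep_H[of f] in auto)
  moreover have "(LINT x|torus. rep_H f x * min 1 (real n * infdist (torus_emb x) K)) = 0" for n
    by (rule orthogonal_continuous[OF f, where F = "\<lambda>p. min 1 (real n * infdist p K)"])
      (intro continuous_intros)
  ultimately have "(LINT x|torus. rep_H f x * indicator U x) = 0"
    using LIMSEQ_unique tendsto_const by (metis (no_types, lifting) ext)
  then show ?thesis
    by (simp add: set_lebesgue_integral_def mult.commute)
qed

lemma AE_torus_open_box: "AE x in torus. x \<in> box (0, 0) (2 * pi, 2 * pi)"
proof -
  have "AE x in lebesgue. x \<notin> cbox (0, 0) (2 * pi, 2 * pi) - box (0, 0) (2 * pi, 2 * pi :: real)"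
    using negligible_frontier_interval[of "(0, 0)" "(2 * pi, 2 * pi :: real)"]
    by (intro AE_not_in) (simp add: negligible_iff_null_sets)
  then have "AE x in torus. x \<notin> cbox (0, 0) (2 * pi, 2 * pi) - box (0, 0) (2 * pi, 2 * pi :: real)"
    by (intro AE_torusI) (simp add: AE_completion_iff)
  with AE_torus_box show ?thesis by eventually_elim auto
qed

text \<open>Integrals over open sets vanish, hence by the pi-lambda theorem integrals over all Borel
  sets, in particular over the sets where f is positive and where it is negative.\<close>

lemma fc_complete:
  assumes f: "\<And>k. fc f k = 0"
  shows "f = 0"
proof -
  have si: "set_integrable torus A (rep_H f)" if "A \<in> sets borel" for A
    unfolding set_integrable_def using that integrable_rep_H[of f]
    by (intro integrable_mult_indicator) auto
  have all: "(LINT x:A|torus. rep_H f x) = 0" if "A \<in> sets borel" for A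
  proof -
    have *: "Int_stable {S :: (real \<times> real) set. open S}"
      by (auto simp: Int_stable_def)
    have **: "{S :: (real \<times> real) set. open S} \<subseteq> Pow UNIV" by auto
    have "A \<in> sigma_sets UNIV {S. open S}"
      using that by (simp add: borel_def)
    then show ?thesis
    proof (induction rule: sigma_sets_induct_disjoint[OF * **, consumes 1, case_names basic empty compl union])
      case (basic U)
      \<comment> \<open>The boundary of the square is a null set, so U may be cut down to the open
        square.\<close>
      have "(LINT x:U|torus. rep_H f x) = (LINT x:U \<inter> box (0, 0) (2 * pi, 2 * pi)|torus. rep_H f x)"
        unfolding set_lebesgue_integral_def
      proof (intro integral_cong_AE)
        show "AE x in torus. indicat_real U x *\<^sub>R rep_H f x = indicat_real (U \<inter> box (0, 0) (2 * pi, 2 * pi)) x *\<^sub>R rep_H f x"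
          using AE_torus_open_box by eventually_elim (simp add: indicator_def)
      qed (use basic in \<open>auto intro!: borel_measurable_times borel_measurable_indicator\<close>)
      then show ?case
        using orthogonal_open[OF f, of "U \<inter> box (0, 0) (2 * pi, 2 * pi)"] basic by (simp add: open_Int open_box)
    next
      case empty
      show ?case by (simp add: set_lebesgue_integral_def)
    next
      case (compl A)
      then have A: "A \<in> sets borel" by (simp add: borel_def)
      have "(LINT x:UNIV|torus. rep_H f x) = (LINT x:A|torus. rep_H f x) + (LINT x:UNIV - A|torus. rep_H f x)"
        using A by (subst set_integral_Un[symmetric]) (auto intro!: si)
      moreover have "(LINT x:UNIV|torus. rep_H f x) = 0"
        using rep_H[of f] by (simp add: set_lebesgue_integral_def mean_zero_L2_def)
      ultimately show ?case using compl by simp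
    next
      case (union A)
      then have A: "A i \<in> sets borel" for i by (auto simp: borel_def)
      have "(LINT x:(\<Union>i. A i)|torus. rep_H f x) = (\<Sum>i. (LINT x:A i|torus. rep_H f x))"
        using union(1) A by (intro lebesgue_integral_countable_add) (auto simp: disjoint_family_on_def intro!: si)
      then show ?case using union by simp
    qed
  qed
  have pos: "{x. 0 < rep_H f x} \<in> sets borel" and neg: "{x. rep_H f x < 0} \<in> sets borel"
    using rep_H_measurable[of f]
    by (auto simp: measurable_cong_sets[OF sets_torus refl] borel_measurable_iff_greater borel_measurable_iff_less)
  have "AE x in torus. indicator {x. 0 < rep_H f x} x *\<^sub>R rep_H f x = 0"
    using all[OF pos] si[OF pos]
    unfolding set_lebesgue_integral_def set_integrable_def
    by (subst integral_nonneg_eq_0_iff_AE[symmetric]) (auto simp: indicator_def)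
  moreover have "AE x in torus. - (indicator {x. rep_H f x < 0} x *\<^sub>R rep_H f x) = 0"
    using all[OF neg] si[OF neg]
    unfolding set_lebesgue_integral_def set_integrable_def
    by (subst integral_nonneg_eq_0_iff_AE[symmetric]) (auto simp: indicator_def)
  ultimately have "AE x in torus. rep_H f x = rep_H 0 x"
    using rep_H_zero by eventually_elim (auto simp: indicator_def split: if_splits)
  then show ?thesis by (rule H_eqI)
qed

lemma fc_eqI: "(\<And>k. fc f k = fc g k) \<Longrightarrow> f = g"
  using fc_complete[of "f - g"] by (simp add: fc_diff)

subsection \<open>Parseval and Riesz--Fischer\<close>

declare split_paired_All [simp del] split_paired_Ex [simp del]

lemma has_sum_finite_sum:
  fixes f :: "'a \<Rightarrow> 'b \<Rightarrow> 'c::{topological_comm_monoid_add}"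
  assumes "finite A" "\<And>a. a \<in> A \<Longrightarrow> (f a has_sum s a) B"
  shows "((\<lambda>k. \<Sum>a\<in>A. f a k) has_sum (\<Sum>a\<in>A. s a)) B"
  using assms by (induction) (auto intro!: has_sum_add)

lemma freq_uminus_eq_iff [simp]: "- k = k \<longleftrightarrow> k = 0" "k = - k \<longleftrightarrow> k = 0"
  for k :: "int \<times> int"
  by (auto simp: prod_eq_iff zero_prod_def)

text \<open>Hermitian, mean-zero and square-summable: exactly the coefficient families of elements
  of H, by \<open>l2_coeffs_fc\<close> and \<open>fc_of_coeffs\<close>.\<close>

definition l2_coeffs :: "(int \<times> int \<Rightarrow> complex) \<Rightarrow> bool" where
  "l2_coeffs c \<longleftrightarrow> (\<forall>k. c (- k) = cnj (c k)) \<and> c 0 = 0 \<and> (\<lambda>k. (cmod (c k))\<^sup>2) summable_on UNIV"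

lemma trig_zero_freq [simp]: "trig 0 z = 0"
  by (simp add: trig_def)

lemma fc_trig': "k \<noteq> 0 \<Longrightarrow> fc (trig j z) k = ((if j = k then z else 0) + (if j = - k then cnj z else 0)) / 2"
  by (cases "j = 0") (auto simp: fc_trig)

lemma fc_trig_sum:
  assumes "finite F" "\<And>k. z (- k) = cnj (z k)" "k \<noteq> 0"
  shows "fc (\<Sum>j\<in>F. trig j (z j)) k = z k * of_real ((of_bool (k \<in> F) + of_bool (- k \<in> F)) / 2)"
proof -
  have "fc (\<Sum>j\<in>F. trig j (z j)) k
      = (\<Sum>j\<in>F. (if j = k then z j else 0) / 2 + (if j = - k then cnj (z j) else 0) / 2)"
    using assms(3) by (simp add: fc_sum fc_trig' add_divide_distrib)
  also have "\<dots> = (\<Sum>j\<in>F. if j = k then z j / 2 else 0) + (\<Sum>j\<in>F. if j = - k then cnj (z j) / 2 else 0)"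
    unfolding sum.distrib by (intro arg_cong2[of _ _ _ _ "(+)"] sum.cong) auto
  finally show ?thesis
    using assms by (simp add: sum.delta)
qed

text \<open>In general only an inequality: if F contains k but not -k, the coefficient of the sum at
  k is just z k / 2.\<close>

lemma norm_trig_sum_le:
  assumes F: "finite F" and z: "\<And>k. z (- k) = cnj (z k)"
  shows "(norm (\<Sum>j\<in>F. trig j (z j)))\<^sup>2 \<le> (\<Sum>j\<in>F. (cmod (z j))\<^sup>2)"
proof -
  let ?S = "\<Sum>j\<in>F. trig j (z j)"
  have "(norm ?S)\<^sup>2 = (\<Sum>k\<in>F. ?S \<bullet> trig k (z k))"
    by (simp add: power2_norm_eq_inner inner_sum_right)
  also have "\<dots> \<le> (\<Sum>k\<in>F. (cmod (z k))\<^sup>2)"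
  proof (rule sum_mono)
    fix k assume k: "k \<in> F"
    show "?S \<bullet> trig k (z k) \<le> (cmod (z k))\<^sup>2"
    proof (cases "k = 0")
      case False
      have "?S \<bullet> trig k (z k) = Re (z k * cnj (z k)) * ((of_bool (k \<in> F) + of_bool (- k \<in> F)) / 2)"
        unfolding inner_trig[OF False] fc_trig_sum[of F z k, OF F z False]
        by (simp add: algebra_simps)
      also have "\<dots> = (cmod (z k))\<^sup>2 * ((of_bool (k \<in> F) + of_bool (- k \<in> F)) / 2)"
        using cmod_power2[of "z k"] by (simp add: power2_eq_square)
      also have "\<dots> \<le> (cmod (z k))\<^sup>2"
        by (intro mult_left_le) auto
      finally show ?thesis .
    qed simp
  qed
  finally show ?thesis .
qed

text \<open>With A the left-hand side and S the partial sum, A = f . S \<le> |f| |S| \<le> |f| sqrt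
  A by \<open>norm_trig_sum_le\<close>.\<close>

lemma bessel:
  assumes F: "finite F"
  shows "(\<Sum>k\<in>F. (cmod (fc f k))\<^sup>2) \<le> (norm f)\<^sup>2"
proof -
  define A where "A = (\<Sum>k\<in>F. (cmod (fc f k))\<^sup>2)"
  let ?S = "\<Sum>k\<in>F. trig k (fc f k)"
  have "f \<bullet> trig k (fc f k) = (cmod (fc f k))\<^sup>2" for k
    by (cases "k = 0") (simp_all add: inner_trig cmod_power2, simp add: power2_eq_square)
  then have "A = f \<bullet> ?S"
    by (simp add: inner_sum_right A_def)
  then have "A \<le> norm f * norm ?S"
    by (metis norm_cauchy_schwarz)
  moreover have A: "0 \<le> A" by (simp add: A_def sum_nonneg)
  ultimately have "A\<^sup>2 \<le> (norm f * norm ?S)\<^sup>2"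
    by (intro power_mono)
  also have "\<dots> \<le> (norm f)\<^sup>2 * A"
    unfolding power_mult_distrib A_def
    by (intro mult_left_mono norm_trig_sum_le F) (auto simp: fc_minus_freq)
  finally have "A * A \<le> (norm f)\<^sup>2 * A" by (simp add: power2_eq_square)
  then show ?thesis
    using A unfolding A_def[symmetric] by (cases "A = 0") (auto dest: mult_right_le_imp_le)
qed

lemma l2_coeffs_fc: "l2_coeffs (fc f)"
  unfolding l2_coeffs_def
proof (intro conjI allI)
  have "bdd_above (sum (\<lambda>k. (cmod (fc f k))\<^sup>2) ` {F. F \<subseteq> UNIV \<and> finite F})"
    by (intro bdd_aboveI[of _ "(norm f)\<^sup>2"]) (auto intro: bessel)
  then show "(\<lambda>k. (cmod (fc f k))\<^sup>2) summable_on UNIV"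
    by (intro nonneg_bdd_above_summable_on) auto
qed (simp_all add: fc_minus_freq)

text \<open>The Cauchy criterion for unordered sums in the complete space H: tails of the series are
  dominated by tails of the summable squares.\<close>

lemma summable_on_trig:
  assumes "l2_coeffs c"
  shows "(\<lambda>k. trig k (c k)) summable_on UNIV"
proof -
  have sym: "\<And>k. c (- k) = cnj (c k)" and "(\<lambda>k. (cmod (c k))\<^sup>2) summable_on UNIV"
    using assms by (auto simp: l2_coeffs_def)
  then obtain s where s: "((\<lambda>k. (cmod (c k))\<^sup>2) has_sum s) UNIV"
    by (auto simp: summable_on_def)
  have "cauchy_filter (filtermap (sum (\<lambda>k. trig k (c k))) (finite_subsets_at_top UNIV))"
    unfolding cauchy_filter_metric_filtermap
  proof (intro allI impI)
    fix e :: real assume e: "0 < e"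
    \<comment> \<open>Two partial sums of squares within d of the limit differ by less than
      (e/2)^2.\<close>
    define d where "d = (e / 2)\<^sup>2 / 2"
    have d: "0 < d" using e by (simp add: d_def)
    have "eventually (\<lambda>F. dist (sum (\<lambda>k. (cmod (c k))\<^sup>2) F) s < d) (finite_subsets_at_top UNIV)"
      using s d unfolding has_sum_def by (rule tendstoD)
    then obtain F0 where F0: "finite F0"
      "\<And>F. finite F \<Longrightarrow> F0 \<subseteq> F \<Longrightarrow> dist (sum (\<lambda>k. (cmod (c k))\<^sup>2) F) s < d"
      by (auto simp: eventually_finite_subsets_at_top)
    have near: "dist (sum (\<lambda>k. trig k (c k)) F) (sum (\<lambda>k. trig k (c k)) F0) < e / 2"
      if F: "finite F" "F0 \<subseteq> F" for F
    proof -
      have "(norm (sum (\<lambda>k. trig k (c k)) (F - F0)))\<^sup>2 \<le> sum (\<lambda>k. (cmod (c k))\<^sup>2) (F - F0)"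
        using F sym by (intro norm_trig_sum_le) auto
      also have "\<dots> = sum (\<lambda>k. (cmod (c k))\<^sup>2) F - sum (\<lambda>k. (cmod (c k))\<^sup>2) F0"
        using F by (intro sum_diff) auto
      also have "\<dots> < (e / 2)\<^sup>2"
        using F0(2)[OF F] F0(2)[OF F0(1) order_refl] unfolding dist_real_def d_def by linarith
      finally have "norm (sum (\<lambda>k. trig k (c k)) (F - F0)) < e / 2"
        by (rule power2_less_imp_less) (use e in simp)
      then show ?thesis
        using F by (simp add: dist_norm sum_diff)
    qed
    show "\<exists>P. eventually P (finite_subsets_at_top UNIV) \<and>
        (\<forall>x y. P x \<and> P y \<longrightarrow> dist (\<Sum>k\<in>x. trig k (c k)) (\<Sum>k\<in>y. trig k (c k)) < e)"
    proof (intro exI[of _ "\<lambda>F. finite F \<and> F0 \<subseteq> F"] conjI allI impI)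
      show "eventually (\<lambda>F. finite F \<and> F0 \<subseteq> F) (finite_subsets_at_top UNIV)"
        using F0(1) by (auto simp: eventually_finite_subsets_at_top)
      fix F G assume "(finite F \<and> F0 \<subseteq> F) \<and> finite G \<and> F0 \<subseteq> G"
      then show "dist (\<Sum>k\<in>F. trig k (c k)) (\<Sum>k\<in>G. trig k (c k)) < e"
        by (intro dist_triangle_half_l[OF near near]) auto
    qed
  qed
  then obtain x where "filtermap (sum (\<lambda>k. trig k (c k))) (finite_subsets_at_top UNIV) \<le> nhds x"
    using cauchy_filter_complete_converges[of "filtermap (sum (\<lambda>k. trig k (c k))) (finite_subsets_at_top UNIV)" UNIV]
    by (auto simp: filtermap_bot_iff complete_UNIV)
  then show ?thesis
    by (auto simp: summable_on_def has_sum_def filterlim_def)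
qed

definition of_coeffs :: "(int \<times> int \<Rightarrow> complex) \<Rightarrow> H" where
  "of_coeffs c = (\<Sum>\<^sub>\<infinity>k. trig k (c k))"

lemma has_sum_trig: "l2_coeffs c \<Longrightarrow> ((\<lambda>k. trig k (c k)) has_sum of_coeffs c) UNIV"
  unfolding of_coeffs_def by (intro has_sum_infsum summable_on_trig)

lemma has_sum_bounded_linear:
  assumes "bounded_linear h" "(f has_sum s) A"
  shows "((\<lambda>x. h (f x)) has_sum h s) A"
proof -
  interpret h: bounded_linear h by fact
  have "((\<lambda>F. h (sum f F)) \<longlongrightarrow> h s) (finite_subsets_at_top A)"
    using assms(2) unfolding has_sum_def by (rule h.tendsto)
  then show ?thesis by (simp add: has_sum_def h.sum)
qed

lemma fc_of_coeffs:
  assumes c: "l2_coeffs c"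
  shows "fc (of_coeffs c) k = c k"
proof (cases "k = 0")
  case True
  then show ?thesis using c by (simp add: l2_coeffs_def)
next
  case False
  have "((\<lambda>j. fc (trig j (c j)) k) has_sum fc (of_coeffs c) k) UNIV"
    by (rule has_sum_bounded_linear[OF bounded_linear_fc has_sum_trig[OF c]])
  moreover have "((\<lambda>j. fc (trig j (c j)) k) has_sum (\<Sum>j\<in>{k, - k}. fc (trig j (c j)) k)) UNIV"
    by (rule has_sum_cong_neutral[THEN iffD1, OF _ _ _ has_sum_finite[of "{k, - k}"]])
      (use False in \<open>auto simp: fc_trig' minus_equation_iff[of k]\<close>)
  moreover have "(\<Sum>j\<in>{k, - k}. fc (trig j (c j)) k) = c k"
    using c fc_trig_sum[of "{k, - k}" c k] False by (simp add: l2_coeffs_def flip: fc_sum)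
  ultimately show ?thesis using has_sum_unique by metis
qed

lemma has_sum_fourier: "((\<lambda>k. trig k (fc f k)) has_sum f) UNIV"
proof -
  have "of_coeffs (fc f) = f"
    by (rule fc_eqI) (rule fc_of_coeffs[OF l2_coeffs_fc])
  then show ?thesis using has_sum_trig[OF l2_coeffs_fc[of f]] by simp
qed

lemma has_sum_parseval: "((\<lambda>k. Re (fc f k * cnj (fc g k))) has_sum f \<bullet> g) UNIV"
proof -
  have "((\<lambda>k. f \<bullet> trig k (fc g k)) has_sum f \<bullet> g) UNIV"
    by (rule has_sum_bounded_linear[OF bounded_linear_inner_right has_sum_fourier])
  moreover have "f \<bullet> trig k (fc g k) = Re (fc f k * cnj (fc g k))" for k
    by (cases "k = 0") (simp_all add: inner_trig)
  ultimately show ?thesis by (simp only:)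
qed

lemma has_sum_norm_sq: "((\<lambda>k. (cmod (fc f k))\<^sup>2) has_sum (norm f)\<^sup>2) UNIV"
proof -
  have "Re (fc f k * cnj (fc f k)) = (cmod (fc f k))\<^sup>2" for k
    by (simp add: cmod_power2) (simp add: power2_eq_square)
  then show ?thesis
    using has_sum_parseval[of f f] by (simp only: power2_norm_eq_inner)
qed

text \<open>f is the pointwise limit of its partial Fourier sums along an enumeration of Z^2, and
  each of these depends continuously on finitely many coefficients. All measurability of H-valued
  integrands is obtained from this.\<close>

lemma borel_measurable_fcI:
  fixes f :: "'a \<Rightarrow> H"
  assumes "\<And>k. (\<lambda>x. fc (f x) k) \<in> borel_measurable M"
  shows "f \<in> borel_measurable M"
proof -
  obtain e :: "nat \<Rightarrow> int \<times> int" where e: "bij e"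
    using countableE_infinite[of "UNIV :: (int \<times> int) set"] infinite_UNIV_char_0
    by (metis bij_betw_inv_into countableI_type finite_prod infinite_UNIV_int)
  have tr: "(\<lambda>x. trig k (fc (f x) k)) \<in> borel_measurable M" for k
  proof (cases "k = 0")
    case False
    have "bounded_linear (trig k)"
    proof (rule bounded_linear_intro[where K = 1])
      show "trig k (x + y) = trig k x + trig k y" for x y
        using False by (intro fc_eqI) (simp add: fc_add fc_trig algebra_simps add_divide_distrib)
      show "trig k (r *\<^sub>R x) = r *\<^sub>R trig k x" for r x
        using False by (intro fc_eqI) (simp add: fc_scaleR fc_trig scaleR_conv_of_real algebra_simps)
      show "norm (trig k x) \<le> norm x * 1" for x
      proof (rule power2_le_imp_le)
        have "(norm (trig k x))\<^sup>2 = Re (fc (trig k x) k * cnj x)"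
          using False by (simp add: power2_norm_eq_inner inner_trig)
        also have "\<dots> = (Re x * Re x + Im x * Im x) / 2"
          using False by (auto simp: fc_trig)
        also have "\<dots> \<le> (norm x)\<^sup>2"
          unfolding cmod_power2 by (simp add: power2_eq_square)
        finally show "(norm (trig k x))\<^sup>2 \<le> (norm x * 1)\<^sup>2" by simp
      qed simp
    qed
    then have "trig k \<in> borel_measurable borel"
      by (intro borel_measurable_continuous_onI) (simp add: linear_continuous_on)
    from measurable_compose[OF assms this] show ?thesis .
  qed simp
  have lim: "(\<lambda>n. \<Sum>i<n. trig (e i) (fc (f x) (e i))) \<longlonglongrightarrow> f x" for x
  proof -
    have "((\<lambda>i. trig (e i) (fc (f x) (e i))) has_sum f x) UNIV"
      using has_sum_reindex_bij_betw[OF e, of "\<lambda>k. trig k (fc (f x) k)" "f x"] has_sum_fourier by blast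
    then show ?thesis
      using has_sum_imp_sums sums_def by blast
  qed
  show ?thesis
    by (intro borel_measurable_LIMSEQ_metric[of "\<lambda>n x. \<Sum>i<n. trig (e i) (fc (f x) (e i))", OF _ lim]
        borel_measurable_sum tr)
qed

subsection \<open>Operators with a banded Fourier matrix\<close>

text \<open>The shifts of frequency caused by multiplication with a mode of \<phi>, together with 0,
  so that diagonal and coupling matrices fall under one notion.\<close>

definition offs :: "(int \<times> int) set" where
  "offs = {0, (1, 0), (- 1, 0), (0, 1), (0, - 1)}"

lemma finite_offs [simp]: "finite offs" and card_offs: "card offs = 5"
  and uminus_offs_iff [simp]: "- d \<in> offs \<longleftrightarrow> d \<in> offs" and zero_in_offs [simp]: "0 \<in> offs"
  by (auto simp: offs_def zero_prod_def minus_equation_iff[of d])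

lemma sum_offs_uminus: "(\<Sum>d\<in>offs. g (- d)) = (\<Sum>d\<in>offs. g d)"
  by (rule sum.reindex_bij_witness[of _ uminus uminus]) auto

text \<open>The reality condition: such a real matrix maps Hermitian coefficient families to
  Hermitian ones.\<close>

definition even_symbol :: "(int \<times> int \<Rightarrow> int \<times> int \<Rightarrow> real) \<Rightarrow> bool" where
  "even_symbol a \<longleftrightarrow> (\<forall>k d. a (- k) (- d) = a k d)"

text \<open>The row k = 0 is cut off in \<open>band_coeff\<close>, and the column k + d = 0 meets
  the vanishing mean. Exempting them lets exp (-\<nu> (|k|^2 - 1) t), which exceeds 1 at k = 0 for t
  > 0, count as bounded by 1.\<close>

definition symbol_bound :: "(int \<times> int \<Rightarrow> int \<times> int \<Rightarrow> real) \<Rightarrow> real \<Rightarrow> bool" where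
  "symbol_bound a M \<longleftrightarrow> (\<forall>k d. k \<noteq> 0 \<longrightarrow> d \<in> offs \<longrightarrow> k + d \<noteq> 0 \<longrightarrow> \<bar>a k d\<bar> \<le> M)"

definition band_coeff :: "(int \<times> int \<Rightarrow> int \<times> int \<Rightarrow> real) \<Rightarrow> H \<Rightarrow> int \<times> int \<Rightarrow> complex" where
  "band_coeff a f k = (if k = 0 then 0 else \<Sum>d\<in>offs. a k d *\<^sub>R fc f (k + d))"

definition band :: "(int \<times> int \<Rightarrow> int \<times> int \<Rightarrow> real) \<Rightarrow> H \<Rightarrow> H" where
  "band a f = of_coeffs (band_coeff a f)"

lemma symbol_boundD: "symbol_bound a M \<Longrightarrow> k \<noteq> 0 \<Longrightarrow> d \<in> offs \<Longrightarrow> cmod (a k d *\<^sub>R fc f (k + d)) \<le> M * cmod (fc f (k + d))"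
  by (cases "k + d = 0") (auto simp: symbol_bound_def mult_right_mono)

lemma bij_translation: "bij (\<lambda>k :: int \<times> int. k + d)"
  by (rule bij_betw_byWitness[of _ "\<lambda>k. k - d"]) auto

lemma has_sum_translate: "((\<lambda>k :: int \<times> int. g (k + d)) has_sum s) UNIV \<longleftrightarrow> (g has_sum s) UNIV"
  by (rule has_sum_reindex_bij_betw[OF bij_translation])

lemma band_coeff_sq_le:
  assumes M: "symbol_bound a M"
  shows "(cmod (band_coeff a f k))\<^sup>2 \<le> 5 * M\<^sup>2 * (\<Sum>d\<in>offs. (cmod (fc f (k + d)))\<^sup>2)"
proof (cases "k = 0")
  case False
  have "cmod (band_coeff a f k) \<le> (\<Sum>d\<in>offs. M * cmod (fc f (k + d)))"
    using False by (auto simp: band_coeff_def intro!: sum_norm_le symbol_boundD M)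
  then have "(cmod (band_coeff a f k))\<^sup>2 \<le> (\<Sum>d\<in>offs. M * cmod (fc f (k + d)))\<^sup>2"
    by (intro power_mono) auto
  also have "\<dots> \<le> (\<Sum>d\<in>offs. (M * cmod (fc f (k + d)))\<^sup>2) * card offs"
    by (rule sum_squared_le_sum_of_squares)
  finally show ?thesis
    by (simp add: card_offs power_mult_distrib sum_distrib_left algebra_simps)
qed (auto simp: band_coeff_def intro!: mult_nonneg_nonneg sum_nonneg)

lemma has_sum_offs_sq:
  "((\<lambda>k. \<Sum>d\<in>offs. (cmod (fc f (k + d)))\<^sup>2) has_sum 5 * (norm f)\<^sup>2) UNIV"
proof -
  have "((\<lambda>k. \<Sum>d\<in>offs. (cmod (fc f (k + d)))\<^sup>2) has_sum (\<Sum>d\<in>offs. (norm f)\<^sup>2)) UNIV"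
    using has_sum_norm_sq[of f] by (intro has_sum_finite_sum finite_offs) (simp add: has_sum_translate[where g = "\<lambda>k. (cmod (fc f k))\<^sup>2"])
  then show ?thesis by (simp add: card_offs)
qed

lemma l2_coeffs_band:
  assumes "even_symbol a" "symbol_bound a M"
  shows "l2_coeffs (band_coeff a f)"
  unfolding l2_coeffs_def
proof (intro conjI allI)
  fix k
  have "(\<Sum>d\<in>offs. a (- k) d *\<^sub>R fc f (- k + d)) = (\<Sum>d\<in>offs. a (- k) (- d) *\<^sub>R fc f (- k + - d))"
    by (rule sum_offs_uminus[symmetric])
  also have "\<dots> = (\<Sum>d\<in>offs. a k d *\<^sub>R cnj (fc f (k + d)))"
  proof (intro sum.cong refl)
    fix d
    have "- k + - d = - (k + d)" by simp
    then show "a (- k) (- d) *\<^sub>R fc f (- k + - d) = a k d *\<^sub>R cnj (fc f (k + d))"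
      using assms(1) by (simp only: even_symbol_def fc_minus_freq)
  qed
  finally show "band_coeff a f (- k) = cnj (band_coeff a f k)"
    by (simp add: band_coeff_def)
  show "(\<lambda>k. (cmod (band_coeff a f k))\<^sup>2) summable_on UNIV"
  proof (rule summable_on_comparison_test)
    show "(\<lambda>k. 5 * M\<^sup>2 * (\<Sum>d\<in>offs. (cmod (fc f (k + d)))\<^sup>2)) summable_on UNIV"
      using has_sum_offs_sq[of f] by (intro summable_on_cmult_right) (auto simp: summable_on_def)
  qed (use band_coeff_sq_le[OF assms(2)] in auto)
qed (simp add: band_coeff_def)

lemma fc_band:
  assumes "even_symbol a" "symbol_bound a M"
  shows "fc (band a f) k = (if k = 0 then 0 else \<Sum>d\<in>offs. a k d *\<^sub>R fc f (k + d))"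
  using fc_of_coeffs[OF l2_coeffs_band[OF assms]] by (simp add: band_def band_coeff_def)

text \<open>For the squares, Cauchy-Schwarz over the five offsets costs one factor 5, and every
  coefficient of f is met by five rows, which costs another.\<close>

lemma norm_band_le:
  assumes "even_symbol a" "symbol_bound a M" "0 \<le> M"
  shows "norm (band a f) \<le> 5 * M * norm f"
proof (rule power2_le_imp_le)
  have "((\<lambda>k. 5 * M\<^sup>2 * (\<Sum>d\<in>offs. (cmod (fc f (k + d)))\<^sup>2)) has_sum 5 * M\<^sup>2 * (5 * (norm f)\<^sup>2)) UNIV"
    by (intro has_sum_cmult_right has_sum_offs_sq)
  from has_sum_mono[OF has_sum_norm_sq[of "band a f"] this]
  show "(norm (band a f))\<^sup>2 \<le> (5 * M * norm f)\<^sup>2"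
    using band_coeff_sq_le[OF assms(2), of f] fc_of_coeffs[OF l2_coeffs_band[OF assms(1,2)], of f]
    by (simp add: band_def power_mult_distrib)
qed (use assms in auto)

lemma bounded_linear_band:
  assumes "even_symbol a" "symbol_bound a M" "0 \<le> M"
  shows "bounded_linear (band a)"
proof (rule bounded_linear_intro[where K = "5 * M"])
  show "band a (f + g) = band a f + band a g" for f g
    by (rule fc_eqI) (simp add: fc_band[OF assms(1,2)] fc_add algebra_simps sum.distrib)
  show "band a (r *\<^sub>R f) = r *\<^sub>R band a f" for r f
    by (rule fc_eqI) (simp add: fc_band[OF assms(1,2)] fc_scaleR scaleR_sum_right mult.commute)
  show "norm (band a f) \<le> norm f * (5 * M)" for f
    using norm_band_le[OF assms, of f] by (simp add: mult.commute)
qed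

definition adj_symbol :: "(int \<times> int \<Rightarrow> int \<times> int \<Rightarrow> real) \<Rightarrow> int \<times> int \<Rightarrow> int \<times> int \<Rightarrow> real" where
  "adj_symbol a k d = a (k + d) (- d)"

lemma even_adj_symbol: "even_symbol a \<Longrightarrow> even_symbol (adj_symbol a)"
  unfolding even_symbol_def adj_symbol_def by (metis minus_add_distrib)

lemma adj_symbol_bound: "symbol_bound a M \<Longrightarrow> symbol_bound (adj_symbol a) M"
  by (auto simp: symbol_bound_def adj_symbol_def)

text \<open>For each offset d the products are absolutely summable over k, so the sum may be
  translated by d; this moves every entry to its transposed position.\<close>

lemma band_adjoint:
  assumes "even_symbol a" "symbol_bound a M" "0 \<le> M"
  shows "band a f \<bullet> g = f \<bullet> band (adj_symbol a) g"
proof -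
  define u where "u d k = a k d * Re (fc f (k + d) * cnj (fc g k))" for d k
  have abs: "\<bar>u d k\<bar> \<le> M * ((cmod (fc f (k + d)))\<^sup>2 + (cmod (fc g k))\<^sup>2)" if d: "d \<in> offs" for d k
  proof (cases "k = 0 \<or> k + d = 0")
    case True
    then show ?thesis using assms(3) by (auto simp: u_def)
  next
    case False
    then have "\<bar>u d k\<bar> \<le> M * \<bar>Re (fc f (k + d) * cnj (fc g k))\<bar>"
      using assms(2) d by (auto simp: u_def symbol_bound_def abs_mult intro!: mult_right_mono)
    also have "\<bar>Re (fc f (k + d) * cnj (fc g k))\<bar> \<le> cmod (fc f (k + d)) * cmod (fc g k)"
      using abs_Re_le_cmod[of "fc f (k + d) * cnj (fc g k)"] by (simp add: norm_mult)
    also have "\<dots> \<le> (cmod (fc f (k + d)))\<^sup>2 + (cmod (fc g k))\<^sup>2"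
    proof -
      have "2 * cmod (fc f (k + d)) * cmod (fc g k) \<le> (cmod (fc f (k + d)))\<^sup>2 + (cmod (fc g k))\<^sup>2"
        by (rule sum_squares_bound)
      moreover have "0 \<le> cmod (fc f (k + d)) * cmod (fc g k)" by simp
      ultimately show ?thesis by linarith
    qed
    finally show ?thesis using assms(3) by (simp add: mult_left_mono)
  qed
  have "u d summable_on UNIV" if d: "d \<in> offs" for d
  proof -
    have "(\<lambda>k. M * ((cmod (fc f (k + d)))\<^sup>2 + (cmod (fc g k))\<^sup>2)) summable_on UNIV"
      using has_sum_norm_sq[of f] has_sum_norm_sq[of g]
      by (intro summable_on_cmult_right summable_on_add)
        (auto simp: summable_on_def has_sum_translate[where g = "\<lambda>k. (cmod (fc f k))\<^sup>2"])
    then have "(\<lambda>k. norm (u d k)) summable_on UNIV"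
      by (rule summable_on_comparison_test) (use abs[OF d] in auto)
    then show ?thesis by (rule abs_summable_summable)
  qed
  then have u: "(u d has_sum infsum (u d) UNIV) UNIV" if "d \<in> offs" for d
    using that by auto
  have "((\<lambda>k. \<Sum>d\<in>offs. u d k) has_sum (\<Sum>d\<in>offs. infsum (u d) UNIV)) UNIV"
    by (intro has_sum_finite_sum finite_offs u)
  moreover have "(\<Sum>d\<in>offs. u d k) = Re (fc (band a f) k * cnj (fc g k))" for k
    by (cases "k = 0") (simp_all add: u_def fc_band[OF assms(1,2)] sum_distrib_right sum_distrib_left algebra_simps sum_subtractf sum.distrib)
  ultimately have 1: "band a f \<bullet> g = (\<Sum>d\<in>offs. infsum (u d) UNIV)"
    using has_sum_unique[OF has_sum_parseval[of "band a f" g]] by simp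
  have "((\<lambda>k. \<Sum>d\<in>offs. u (- d) (k + d)) has_sum (\<Sum>d\<in>offs. infsum (u (- d)) UNIV)) UNIV"
    by (intro has_sum_finite_sum finite_offs) (simp add: has_sum_translate[where g = "u (- d)" for d] u)
  moreover have "(\<Sum>d\<in>offs. u (- d) (k + d)) = Re (fc f k * cnj (fc (band (adj_symbol a) g) k))" for k
    by (cases "k = 0")
      (simp_all add: u_def fc_band[OF even_adj_symbol[OF assms(1)] adj_symbol_bound[OF assms(2)]]
        adj_symbol_def sum_distrib_right sum_distrib_left algebra_simps sum_subtractf sum.distrib)
  ultimately have 2: "f \<bullet> band (adj_symbol a) g = (\<Sum>d\<in>offs. infsum (u (- d)) UNIV)"
    using has_sum_unique[OF has_sum_parseval[of f "band (adj_symbol a) g"]] by simp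
  show ?thesis
    unfolding 1 2 using sum_offs_uminus[of "\<lambda>d. infsum (u d) UNIV"] by simp
qed

text \<open>Only the columns of j and -j act on this mode. Hence the image is small once these
  finitely many entries are small, whatever the bound on the whole symbol.\<close>

lemma band_trig_le:
  assumes a: "even_symbol a" "symbol_bound a M" and j: "j \<noteq> 0"
  shows "norm (band a (trig j z)) \<le> 5 * (\<Sum>d\<in>offs. \<bar>a (j - d) d\<bar>) * norm (trig j z)"
proof -
  \<comment> \<open>Both columns, of j and of -j, are kept so that c remains even.\<close>
  define c where "c k d = (if k + d = j \<or> k + d = - j then a k d else 0)" for k d
  have neg: "a (- k) (- d) = a k d" for k d using a(1) by (simp add: even_symbol_def)
  have c: "even_symbol c"
    unfolding even_symbol_def c_def
  proof (intro allI)
    fix k d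
    have "- k + - d = j \<longleftrightarrow> k + d = - j" "- k + - d = - j \<longleftrightarrow> k + d = j"
      by (metis add.inverse_inverse minus_add_distrib)+
    then show "(if - k + - d = j \<or> - k + - d = - j then a (- k) (- d) else 0)
        = (if k + d = j \<or> k + d = - j then a k d else 0)"
      using neg by auto
  qed
  have c': "symbol_bound c (\<Sum>d\<in>offs. \<bar>a (j - d) d\<bar>)"
    unfolding symbol_bound_def
  proof (intro allI impI)
    fix k d assume d: "d \<in> offs"
    have le: "\<bar>a (j - d) d\<bar> \<le> (\<Sum>d\<in>offs. \<bar>a (j - d) d\<bar>)" if "d \<in> offs" for d
      using that member_le_sum[of d offs "\<lambda>d. \<bar>a (j - d) d\<bar>"] by auto
    have "a k d = a (j - - d) (- d)" if "k + d = - j"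
    proof -
      have "k = - j - d" using that[symmetric] by simp
      then have "k = - (j - - d)" by simp
      then show ?thesis using neg[of "j - - d" "- d"] by simp
    qed
    moreover have "a k d = a (j - d) d" if "k + d = j"
      using that by (metis add_diff_cancel)
    moreover have "0 \<le> (\<Sum>d\<in>offs. \<bar>a (j - d) d\<bar>)" by (simp add: sum_nonneg)
    ultimately show "\<bar>c k d\<bar> \<le> (\<Sum>d\<in>offs. \<bar>a (j - d) d\<bar>)"
      using le[OF d] le[of "- d"] d by (auto simp: c_def)
  qed
  have "band a (trig j z) = band c (trig j z)"
    by (rule fc_eqI) (auto simp: fc_band[OF a] fc_band[OF c c'] fc_trig[OF j] c_def intro!: sum.cong)
  then show ?thesis
    using norm_band_le[OF c c', of "trig j z"] by (simp add: sum_nonneg)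
qed

text \<open>Strong convergence from entrywise convergence and a uniform bound: f is approximated by
  a trigonometric polynomial, which sees finitely many entries, and the uniform bound controls the
  remainder.\<close>

lemma band_tendsto_zero:
  assumes a: "eventually (\<lambda>x. even_symbol (a x) \<and> symbol_bound (a x) M) F" and M: "0 \<le> M"
    and lim: "\<And>k d. k \<noteq> 0 \<Longrightarrow> d \<in> offs \<Longrightarrow> k + d \<noteq> 0 \<Longrightarrow> ((\<lambda>x. a x k d) \<longlongrightarrow> 0) F"
  shows "((\<lambda>x. band (a x) f) \<longlongrightarrow> 0) F"
proof (rule tendstoI)
  fix e :: real assume e: "0 < e"
  define S where "S G = (\<Sum>k\<in>G. trig k (fc f k))" for G
  define d where "d = e / (2 * (5 * M + 1))"
  have d: "0 < d" using e M by (simp add: d_def)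
  have "(S \<longlongrightarrow> f) (finite_subsets_at_top UNIV)"
    using has_sum_fourier[of f] by (simp add: has_sum_def S_def[abs_def])
  from tendstoD[OF this d] obtain G0 where G0: "finite G0" "dist (S G0) f < d"
    unfolding eventually_finite_subsets_at_top by auto
  \<comment> \<open>The zero mode contributes nothing; without it every column j in G is nonzero, as
    \<open>lim\<close> demands.\<close>
  define G where "G = G0 - {0}"
  have "S G = S G0" unfolding S_def G_def using G0(1) by (intro sum.mono_neutral_left) auto
  then have G: "finite G" "dist (S G) f < d" "0 \<notin> G" using G0 by (auto simp: G_def)
  define u where "u x = (\<Sum>j\<in>G. 5 * (\<Sum>d\<in>offs. (if j - d = 0 then 0 else \<bar>a x (j - d) d\<bar>)) * norm (trig j (fc f j)))" for x
  have "(u \<longlongrightarrow> (\<Sum>j\<in>G. 5 * (\<Sum>d\<in>offs. 0) * norm (trig j (fc f j)))) F"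
    unfolding u_def
  proof (intro tendsto_intros)
    fix j d assume j: "j \<in> G" "d \<in> offs"
    show "((\<lambda>x. if j - d = 0 then 0 else \<bar>a x (j - d) d\<bar>) \<longlongrightarrow> 0) F"
    proof (cases "j - d = 0")
      case False
      then have "((\<lambda>x. a x (j - d) d) \<longlongrightarrow> 0) F"
        using j G(3) by (intro lim) auto
      then show ?thesis using False by (auto intro: tendsto_rabs_zero)
    qed simp
  qed
  then have "(u \<longlongrightarrow> 0) F" by simp
  from order_tendstoD(2)[OF this, of "e / 2"] have "eventually (\<lambda>x. u x < e / 2) F" using e by simp
  with a show "eventually (\<lambda>x. dist (band (a x) f) 0 < e) F"
  proof eventually_elim
    case (elim x)
    \<comment> \<open>\<open>lim\<close> says nothing about the row k = 0, while
      \<open>band_trig_le\<close> sums over a whole column, so this row is cleared.\<close>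
    define a' where "a' k d = (if k = 0 then 0 else a x k d)" for k d
    have ax: "even_symbol (a x)" "symbol_bound (a x) M" using elim by auto
    have a': "even_symbol a'" "symbol_bound a' M"
      using ax unfolding even_symbol_def symbol_bound_def by (auto simp: a'_def)
    have eq: "band (a x) f = band a' f"
      by (rule fc_eqI) (simp add: fc_band[OF ax] fc_band[OF a'] a'_def)
    interpret b: bounded_linear "band a'" by (rule bounded_linear_band[OF a' M])
    have "band (a x) f = band a' (f - S G) + (\<Sum>j\<in>G. band a' (trig j (fc f j)))"
      unfolding eq b.diff by (simp add: S_def b.sum)
    then have "norm (band (a x) f) \<le> norm (band a' (f - S G)) + norm (\<Sum>j\<in>G. band a' (trig j (fc f j)))"
      by (simp add: norm_triangle_ineq)
    also have "norm (band a' (f - S G)) \<le> 5 * M * norm (f - S G)"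
      by (rule norm_band_le[OF a' M])
    also have "\<dots> \<le> 5 * M * d"
      using G(2) M by (intro mult_left_mono) (auto simp: dist_norm norm_minus_commute)
    also have "\<dots> < e / 2"
      using e M by (simp add: d_def field_simps)
    also have "norm (\<Sum>j\<in>G. band a' (trig j (fc f j))) \<le> u x"
      unfolding u_def
    proof (intro sum_norm_le)
      fix j assume "j \<in> G"
      then have "j \<noteq> 0" using G(3) by auto
      from band_trig_le[OF a' this, of "fc f j"]
      show "norm (band a' (trig j (fc f j))) \<le> 5 * (\<Sum>d\<in>offs. (if j - d = 0 then 0 else \<bar>a x (j - d) d\<bar>)) * norm (trig j (fc f j))"
        by (simp add: a'_def if_distrib cong: if_cong)
    qed
    finally show ?case using elim by simp
  qed
qed

lemma band_tendsto:
  assumes a: "eventually (\<lambda>x. even_symbol (a x) \<and> symbol_bound (a x) M) F" and M: "0 \<le> M"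
    and b: "even_symbol b" "symbol_bound b M"
    and lim: "\<And>k d. k \<noteq> 0 \<Longrightarrow> d \<in> offs \<Longrightarrow> k + d \<noteq> 0 \<Longrightarrow> ((\<lambda>x. a x k d) \<longlongrightarrow> b k d) F"
  shows "((\<lambda>x. band (a x) f) \<longlongrightarrow> band b f) F"
proof -
  have ab: "even_symbol (\<lambda>k d. a x k d - b k d)" "symbol_bound (\<lambda>k d. a x k d - b k d) (2 * M)"
    if "even_symbol (a x) \<and> symbol_bound (a x) M" for x
  proof -
    show "even_symbol (\<lambda>k d. a x k d - b k d)"
      using that b by (simp add: even_symbol_def)
    show "symbol_bound (\<lambda>k d. a x k d - b k d) (2 * M)"
      unfolding symbol_bound_def
    proof (intro allI impI)
      fix k d assume "k \<noteq> 0" "d \<in> offs" "k + d \<noteq> 0"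
      then have "\<bar>a x k d\<bar> \<le> M" "\<bar>b k d\<bar> \<le> M"
        using that b by (auto simp: symbol_bound_def)
      then show "\<bar>a x k d - b k d\<bar> \<le> 2 * M" by linarith
    qed
  qed
  have "((\<lambda>x. band (\<lambda>k d. a x k d - b k d) f) \<longlongrightarrow> 0) F"
  proof (rule band_tendsto_zero[where M = "2 * M"])
    show "\<forall>\<^sub>F x in F. even_symbol (\<lambda>k d. a x k d - b k d) \<and> symbol_bound (\<lambda>k d. a x k d - b k d) (2 * M)"
      using a by eventually_elim (use ab in blast)
  qed (use M in simp, rule LIM_zero[OF lim])
  moreover have "eventually (\<lambda>x. band (\<lambda>k d. a x k d - b k d) f = band (a x) f - band b f) F"
    using a
  proof eventually_elim
    case (elim x)
    then show ?case
      by (intro fc_eqI) (simp add: fc_band[OF ab[OF elim]] fc_band[OF b] fc_band[of "a x" M] fc_diff scaleR_left_diff_distrib sum_subtractf)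
  qed
  ultimately have "((\<lambda>x. band (a x) f - band b f) \<longlongrightarrow> 0) F"
    by (rule Lim_transform_eventually)
  then show ?thesis by (rule LIM_zero_cancel)
qed

section \<open>Fourier multipliers as band operators\<close>

definition diag :: "(int \<times> int \<Rightarrow> real) \<Rightarrow> int \<times> int \<Rightarrow> int \<times> int \<Rightarrow> real" where
  "diag g k d = (if d = 0 then g k else 0)"

lemma even_diag [simp]: "even_symbol (diag g) \<longleftrightarrow> (\<forall>k. g (- k) = g k)"
  by (auto simp: even_symbol_def diag_def)

lemma symbol_bound_diag: "(\<And>k. k \<noteq> 0 \<Longrightarrow> \<bar>g k\<bar> \<le> M) \<Longrightarrow> 0 \<le> M \<Longrightarrow> symbol_bound (diag g) M"
  by (auto simp: symbol_bound_def diag_def)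

lemma fc_band_diag:
  assumes "\<And>k. g (- k) = g k" "\<And>k. k \<noteq> 0 \<Longrightarrow> \<bar>g k\<bar> \<le> M"
  shows "fc (band (diag g) f) k = g k *\<^sub>R fc f k"
proof -
  have M: "0 \<le> M" using assms(2)[of "(1, 0)"] by (auto simp: zero_prod_def)
  have "(\<Sum>d\<in>offs. diag g k d *\<^sub>R fc f (k + d)) = (\<Sum>d\<in>offs. if d = 0 then g k *\<^sub>R fc f k else 0)"
    by (intro sum.cong) (auto simp: diag_def)
  then show ?thesis
    using assms fc_band[of "diag g" M f k] symbol_bound_diag[of g M] M by (auto simp: sum.delta)
qed

subsection \<open>Sobolev spaces and the operators of the equation in Fourier variables\<close>

lemma freq_norm_sq: "(freq_norm k)\<^sup>2 = (of_int (fst k))\<^sup>2 + (of_int (snd k))\<^sup>2"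
  by (simp add: freq_norm_def)

lemma freq_norm_nonneg [simp]: "0 \<le> freq_norm k"
  and freq_norm_uminus [simp]: "freq_norm (- k) = freq_norm k"
  and freq_norm_zero [simp]: "freq_norm 0 = 0"
  by (simp_all add: freq_norm_def)

lemma freq_norm_ge_1:
  assumes "k \<noteq> 0"
  shows "1 \<le> freq_norm k"
proof -
  have "1 \<le> (fst k)\<^sup>2 + (snd k)\<^sup>2"
  proof (cases "fst k = 0")
    case True
    then have "snd k \<noteq> 0" using assms by (auto simp: prod_eq_iff)
    then show ?thesis using zero_less_power2[of "snd k"] zero_le_power2[of "fst k"] by linarith
  next
    case False
    then show ?thesis using zero_less_power2[of "fst k"] zero_le_power2[of "snd k"] by linarith
  qed
  then have "real_of_int 1 \<le> real_of_int ((fst k)\<^sup>2 + (snd k)\<^sup>2)" by (simp only: of_int_le_iff)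
  then show ?thesis by (simp add: freq_norm_def)
qed

lemma freq_norm_sq_ge_1: "k \<noteq> 0 \<Longrightarrow> 1 \<le> (freq_norm k)\<^sup>2"
  using freq_norm_ge_1 by (simp add: one_le_power)

text \<open>A comparison test for square-summability; g carries the regularity of f when the family
  c arises from f by differentiation.\<close>

lemma ex_fc_eq:
  assumes "\<And>k. c (- k) = cnj (c k)" and "\<And>k. cmod (c k) \<le> M * cmod (fc g k)"
  shows "\<exists>h. \<forall>k. fc h k = c k"
proof -
  have "l2_coeffs c"
    unfolding l2_coeffs_def
  proof (intro conjI allI)
    show "(\<lambda>k. (cmod (c k))\<^sup>2) summable_on UNIV"
    proof (rule summable_on_comparison_test)
      show "(\<lambda>k. M\<^sup>2 * (cmod (fc g k))\<^sup>2) summable_on UNIV"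
        using has_sum_norm_sq[of g] by (intro summable_on_cmult_right) (auto simp: summable_on_def)
      show "(cmod (c k))\<^sup>2 \<le> M\<^sup>2 * (cmod (fc g k))\<^sup>2" for k
        unfolding power_mult_distrib[symmetric] by (intro power_mono assms) auto
    qed auto
    show "c 0 = 0" using assms(2)[of 0] by simp
  qed (rule assms(1))
  from fc_of_coeffs[OF this] show ?thesis by blast
qed

lemma freq_norm_powr_double: "freq_norm k powr (2 * s) = (freq_norm k powr s)\<^sup>2"
  by (simp add: power2_eq_square flip: powr_add)

text \<open>Membership in H^s becomes the existence of \<Lambda>^s f in H, so that later arguments
  compare coefficients instead of series.\<close>

lemma Hs_iff: "f \<in> Hs s \<longleftrightarrow> (\<exists>g. \<forall>k. fc g k = (freq_norm k powr s) *\<^sub>R fc f k)"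
proof -
  have sq: "freq_norm k powr (2 * s) * (cmod (fc f k))\<^sup>2 = (cmod ((freq_norm k powr s) *\<^sub>R fc f k))\<^sup>2" for k
    by (simp add: power_mult_distrib freq_norm_powr_double)
  have "f \<in> Hs s \<longleftrightarrow> (\<lambda>k. (cmod ((freq_norm k powr s) *\<^sub>R fc f k))\<^sup>2) summable_on UNIV"
    unfolding Hs_def mem_Collect_eq sq
    by (rule summable_on_cong_neutral) (auto simp flip: zero_prod_def)
  also have "\<dots> \<longleftrightarrow> l2_coeffs (\<lambda>k. (freq_norm k powr s) *\<^sub>R fc f k)"
    by (auto simp: l2_coeffs_def fc_minus_freq)
  also have "\<dots> \<longleftrightarrow> (\<exists>g. \<forall>k. fc g k = (freq_norm k powr s) *\<^sub>R fc f k)"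
  proof
    assume "l2_coeffs (\<lambda>k. (freq_norm k powr s) *\<^sub>R fc f k)"
    from fc_of_coeffs[OF this] show "\<exists>g. \<forall>k. fc g k = (freq_norm k powr s) *\<^sub>R fc f k" by blast
  next
    assume "\<exists>g. \<forall>k. fc g k = (freq_norm k powr s) *\<^sub>R fc f k"
    then obtain g where "fc g = (\<lambda>k. (freq_norm k powr s) *\<^sub>R fc f k)" by auto
    with l2_coeffs_fc[of g] show "l2_coeffs (\<lambda>k. (freq_norm k powr s) *\<^sub>R fc f k)" by simp
  qed
  finally show ?thesis .
qed

lemma Hs_inner_eq:
  assumes "\<And>k. fc f' k = (freq_norm k powr s) *\<^sub>R fc f k" "\<And>k. fc g' k = (freq_norm k powr s) *\<^sub>R fc g k"
  shows "Hs_inner s f g = f' \<bullet> g'"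
proof -
  have "((\<lambda>k. Re (fc f' k * cnj (fc g' k))) has_sum f' \<bullet> g') (- {(0, 0)})"
    by (rule has_sum_cong_neutral[THEN iffD1, OF _ _ _ has_sum_parseval])
      (auto simp flip: zero_prod_def)
  moreover have "Re (fc f' k * cnj (fc g' k)) = freq_norm k powr (2 * s) * Re (fc f k * cnj (fc g k))" for k
    unfolding assms freq_norm_powr_double by (simp add: power2_eq_square algebra_simps)
  ultimately show ?thesis
    unfolding Hs_inner_def by (simp add: infsumI)
qed

lemma Hs_mono:
  assumes "s \<le> t" "f \<in> Hs t"
  shows "f \<in> Hs s"
proof -
  obtain g where g: "\<And>k. fc g k = (freq_norm k powr t) *\<^sub>R fc f k"
    using assms(2) by (metis Hs_iff)
  have "\<exists>h. \<forall>k. fc h k = (freq_norm k powr s) *\<^sub>R fc f k"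
  proof (rule ex_fc_eq[where M = 1 and g = g])
    fix k show "cmod ((freq_norm k powr s) *\<^sub>R fc f k) \<le> 1 * cmod (fc g k)"
    proof (cases "k = 0")
      case False
      then show ?thesis
        using freq_norm_ge_1[OF False] assms(1) by (auto simp: g intro!: mult_right_mono powr_mono)
    qed simp
  qed (simp add: fc_minus_freq)
  then show ?thesis by (simp add: Hs_iff)
qed

section \<open>Derivatives, Laplacian and Biot-Savart law as multipliers\<close>

lemma fc_partial1:
  assumes "\<And>k. fc g k = \<i> * of_int (fst k) * fc f k"
  shows "partial1 f = g"
  unfolding partial1_def by (rule the_equality) (auto intro: fc_eqI simp: assms)

lemma fc_partial2:
  assumes "\<And>k. fc g k = \<i> * of_int (snd k) * fc f k"
  shows "partial2 f = g"
  unfolding partial2_def by (rule the_equality) (auto intro: fc_eqI simp: assms)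

lemma abs_fst_le_freq_norm: "\<bar>of_int (fst k)\<bar> \<le> freq_norm k"
  and abs_snd_le_freq_norm: "\<bar>of_int (snd k)\<bar> \<le> freq_norm k"
  by (simp_all add: freq_norm_def real_le_rsqrt)

lemma fc_partial1_ex:
  assumes "\<And>k. freq_norm k * cmod (fc f k) \<le> cmod (fc g k)"
  shows "fc (partial1 f) k = \<i> * of_int (fst k) * fc f k"
proof -
  have "\<exists>h. \<forall>k. fc h k = \<i> * of_int (fst k) * fc f k"
  proof (rule ex_fc_eq[where M = 1 and g = g])
    fix k
    show "cmod (\<i> * of_int (fst k) * fc f k) \<le> 1 * cmod (fc g k)"
      using order_trans[OF mult_right_mono[OF abs_fst_le_freq_norm[of k]] assms[of k]] by (simp add: norm_mult)
  qed (simp add: fc_minus_freq)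
  then obtain h where h: "\<And>k. fc h k = \<i> * of_int (fst k) * fc f k" by blast
  show ?thesis unfolding fc_partial1[OF h] by (rule h)
qed

lemma fc_partial2_ex:
  assumes "\<And>k. freq_norm k * cmod (fc f k) \<le> cmod (fc g k)"
  shows "fc (partial2 f) k = \<i> * of_int (snd k) * fc f k"
proof -
  have "\<exists>h. \<forall>k. fc h k = \<i> * of_int (snd k) * fc f k"
  proof (rule ex_fc_eq[where M = 1 and g = g])
    fix k
    show "cmod (\<i> * of_int (snd k) * fc f k) \<le> 1 * cmod (fc g k)"
      using order_trans[OF mult_right_mono[OF abs_snd_le_freq_norm[of k]] assms[of k]] by (simp add: norm_mult)
  qed (simp add: fc_minus_freq)
  then obtain h where h: "\<And>k. fc h k = \<i> * of_int (snd k) * fc f k" by blast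
  show ?thesis unfolding fc_partial2[OF h] by (rule h)
qed

lemma Hs_partial:
  assumes "f \<in> Hs 1"
  shows "fc (partial1 f) k = \<i> * of_int (fst k) * fc f k"
    and "fc (partial2 f) k = \<i> * of_int (snd k) * fc f k"
proof -
  obtain g where "\<And>k. fc g k = (freq_norm k powr 1) *\<^sub>R fc f k"
    using assms by (metis Hs_iff)
  then have *: "freq_norm k * cmod (fc f k) \<le> cmod (fc g k)" for k by simp
  show "fc (partial1 f) k = \<i> * of_int (fst k) * fc f k" by (rule fc_partial1_ex[OF *])
  show "fc (partial2 f) k = \<i> * of_int (snd k) * fc f k" by (rule fc_partial2_ex[OF *])
qed

lemma fc_laplacian:
  assumes "f \<in> Hs 2"
  shows "fc (laplacian f) k = - ((freq_norm k)\<^sup>2 *\<^sub>R fc f k)"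
proof -
  obtain g where g: "\<And>k. fc g k = (freq_norm k powr 2) *\<^sub>R fc f k"
    using assms by (metis Hs_iff)
  have f1: "f \<in> Hs 1" by (rule Hs_mono[OF _ assms]) simp
  have *: "freq_norm k * cmod (fc (partial1 f) k) \<le> cmod (fc g k)"
    "freq_norm k * cmod (fc (partial2 f) k) \<le> cmod (fc g k)" for k
    using mult_right_mono[OF mult_left_mono[OF abs_fst_le_freq_norm[of k], of "freq_norm k"], of "cmod (fc f k)"]
      mult_right_mono[OF mult_left_mono[OF abs_snd_le_freq_norm[of k], of "freq_norm k"], of "cmod (fc f k)"]
    by (simp_all add: Hs_partial[OF f1] g norm_mult power2_eq_square mult.assoc)
  have "fc (partial1 (partial1 f)) k = \<i> * of_int (fst k) * fc (partial1 f) k"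
    "fc (partial2 (partial2 f)) k = \<i> * of_int (snd k) * fc (partial2 f) k"
    by (rule fc_partial1_ex[OF *(1)], rule fc_partial2_ex[OF *(2)])
  then show ?thesis
    unfolding freq_norm_sq
    by (simp add: laplacian_def fc_add Hs_partial[OF f1] scaleR_conv_of_real power2_eq_square algebra_simps)
qed

text \<open>On H^2 the Laplacian is injective, as seen on coefficients, so \<open>inv_into\<close>
  returns the preimage constructed here.\<close>

lemma fc_inv_neg_laplacian: "fc (inv_neg_laplacian f) k = fc f k /\<^sub>R (freq_norm k)\<^sup>2"
proof -
  have "\<exists>h. \<forall>k. fc h k = fc f k /\<^sub>R (freq_norm k)\<^sup>2"
  proof (rule ex_fc_eq[where M = 1 and g = f])
    fix k show "cmod (fc f k /\<^sub>R (freq_norm k)\<^sup>2) \<le> 1 * cmod (fc f k)"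
    proof (cases "k = 0")
      case False
      have "inverse ((freq_norm k)\<^sup>2) * cmod (fc f k) \<le> 1 * cmod (fc f k)"
        using freq_norm_sq_ge_1[OF False] by (intro mult_right_mono) (auto simp: inverse_le_1_iff)
      then show ?thesis by (simp add: divide_inverse)
    qed simp
  qed (simp add: fc_minus_freq)
  then obtain g where g: "\<And>k. fc g k = fc f k /\<^sub>R (freq_norm k)\<^sup>2" by blast
  have ne: "freq_norm k \<noteq> 0" if "k \<noteq> 0" for k using freq_norm_ge_1[OF that] by simp
  have fg: "(freq_norm k)\<^sup>2 *\<^sub>R fc g k = fc f k" for k
    by (cases "k = 0") (simp_all add: g ne)
  have gH: "g \<in> Hs 2"
    unfolding Hs_iff by (rule exI[of _ f]) (use fg in \<open>simp add: powr_numeral\<close>)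
  have "inj_on (\<lambda>g. - laplacian g) (Hs 2)"
  proof (rule inj_onI, rule fc_eqI)
    fix u v k assume uv: "u \<in> Hs 2" "v \<in> Hs 2" "- laplacian u = - laplacian v"
    then have "fc (laplacian u) k = fc (laplacian v) k" by simp
    then show "fc u k = fc v k"
      using ne[of k] by (cases "k = 0") (simp_all add: fc_laplacian uv)
  qed
  then have "inv_neg_laplacian f = g"
    unfolding inv_neg_laplacian_def
    by (rule inv_into_f_eq[OF _ gH]) (rule fc_eqI, simp add: fc_uminus fc_laplacian[OF gH] fg)
  then show ?thesis by (simp add: g)
qed

lemma fc_biot_savart:
  "fc (fst (biot_savart f)) k = - (\<i> * of_int (snd k) * (fc f k /\<^sub>R (freq_norm k)\<^sup>2))"
  "fc (snd (biot_savart f)) k = \<i> * of_int (fst k) * (fc f k /\<^sub>R (freq_norm k)\<^sup>2)"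
proof -
  have *: "freq_norm k * cmod (fc (inv_neg_laplacian f) k) \<le> cmod (fc f k)" for k
  proof (cases "k = 0")
    case False
    have "freq_norm k * inverse ((freq_norm k)\<^sup>2) * cmod (fc f k) \<le> 1 * cmod (fc f k)"
      using freq_norm_ge_1[OF False] by (intro mult_right_mono) (auto simp: field_simps power2_eq_square)
    then show ?thesis by (simp add: fc_inv_neg_laplacian divide_inverse mult_ac)
  qed simp
  show "fc (fst (biot_savart f)) k = - (\<i> * of_int (snd k) * (fc f k /\<^sub>R (freq_norm k)\<^sup>2))"
    "fc (snd (biot_savart f)) k = \<i> * of_int (fst k) * (fc f k /\<^sub>R (freq_norm k)\<^sup>2)"
    unfolding biot_savart_def fst_conv snd_conv fc_uminus fc_partial1_ex[OF *] fc_partial2_ex[OF *]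
    by (simp_all add: fc_inv_neg_laplacian)
qed

section \<open>The stationary state \<phi> and products with a single mode\<close>

lemma phi_eq: "phi = trig (1, 0) 1 + trig (0, 1) 1"
proof -
  have ne: "(1, 0) \<noteq> (0 :: int \<times> int)" "(0, 1) \<noteq> (0 :: int \<times> int)" by (auto simp: zero_prod_def)
  have "trig (1, 0) 1 + trig (0, 1) 1
      = abs_H (\<lambda>x. rep_H (trig (1, 0) 1) x + rep_H (trig (0, 1) 1) x)"
    by (rule plus_H_def)
  also have "\<dots> = phi"
    unfolding phi_def
  proof (subst abs_H_eq_iff)
    have *: "mean_zero_L2 (\<lambda>x. cos (fst x))" "mean_zero_L2 (\<lambda>x. cos (snd x))"
      using mean_zero_trig[OF ne(1), of 1] mean_zero_trig[OF ne(2), of 1] by (simp_all add: wave_def)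
    show "mean_zero_L2 (\<lambda>x. cos (fst x) + cos (snd x))"
      using mean_zero_L2_add[OF *] .
    show "AE x in torus. rep_H (trig (1, 0) 1) x + rep_H (trig (0, 1) 1) x = cos (fst x) + cos (snd x)"
      using rep_abs_H[OF *(1)] rep_abs_H[OF *(2)]
      by eventually_elim (simp add: trig_def ne wave_def)
  qed (intro mean_zero_L2_add rep_H)
  finally show ?thesis by simp
qed

lemma inner_phi: "f \<bullet> phi = Re (fc f (1, 0)) + Re (fc f (0, 1))"
  by (simp add: phi_eq inner_add_right inner_trig zero_prod_def)

lemma fc_phi: "fc phi k = (if k \<in> offs - {0} then 1 / 2 else 0)"
  by (auto simp: phi_eq fc_add fc_trig offs_def zero_prod_def)

lemma partial_phi: "partial1 phi = trig (1, 0) \<i>" "partial2 phi = trig (0, 1) \<i>"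
  by (rule fc_partial1 fc_partial2, auto simp: fc_phi fc_trig offs_def zero_prod_def)+

lemma biot_savart_phi: "biot_savart phi = (trig (0, 1) (- \<i>), trig (1, 0) \<i>)"
proof (rule prod_eqI; unfold fst_conv snd_conv; rule fc_eqI)
  fix k
  show "fc (fst (biot_savart phi)) k = fc (trig (0, 1) (- \<i>)) k"
    by (auto simp: fc_biot_savart fc_phi fc_trig offs_def zero_prod_def freq_norm_def)
  show "fc (snd (biot_savart phi)) k = fc (trig (1, 0) \<i>) k"
    by (auto simp: fc_biot_savart fc_phi fc_trig offs_def zero_prod_def freq_norm_def)
qed

text \<open>A single mode is bounded. Since \<phi> consists of two modes, both advection terms are
  therefore square integrable as soon as \<xi> lies in H^1.\<close>

lemma sq_integrable_mult_trig: "sq_integrable (\<lambda>x. rep_H f x * rep_H (trig m z) x)"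
proof (cases "m = 0")
  case True
  have [measurable]: "(\<lambda>x. rep_H f x * rep_H (trig m z) x) \<in> borel_measurable torus" by measurable
  have "AE x in torus. \<bar>rep_H f x * rep_H (trig m z) x\<bar> \<le> 0"
    using rep_H_zero unfolding True trig_zero_freq by eventually_elim simp
  then show ?thesis by (intro sq_integrable_bounded[where B = 0]) measurable
next
  case False
  have "AE x in torus. \<bar>rep_H (trig m z) x\<bar> \<le> cmod z"
    using rep_abs_H[OF mean_zero_trig[OF False, of z]]
  proof eventually_elim
    case (elim x)
    then show ?case
      using False abs_Re_le_cmod[of "z * cis (wave m x)"] by (simp add: trig_def norm_mult)
  qed
  then have b: "AE x in torus. norm ((rep_H f x * rep_H (trig m z) x)\<^sup>2) \<le> norm ((cmod z)\<^sup>2 * (rep_H f x)\<^sup>2)"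
  proof eventually_elim
    case (elim x)
    then have "\<bar>rep_H (trig m z) x\<bar>\<^sup>2 \<le> (cmod z)\<^sup>2" by (intro power_mono) auto
    then show ?case by (simp add: power_mult_distrib mult.commute[of _ "(rep_H f x)\<^sup>2"] mult_left_mono)
  qed
  show ?thesis
    unfolding sq_integrable_def
  proof (intro conjI Bochner_Integration.integrable_bound[OF _ _ b])
    show "integrable torus (\<lambda>x. (cmod z)\<^sup>2 * (rep_H f x)\<^sup>2)"
      using sq_integrable_rep_H[of f] by (auto simp: sq_integrable_def)
  qed measurable
qed

lemma integral_mult_trig:
  assumes "m \<noteq> 0"
  shows "(LINT x|torus. of_real (rep_H f x * rep_H (trig m z) x) * cis (wave (- k) x))
    = (z * fc f (k - m) + cnj z * fc f (k + m)) / 2"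
proof -
  have i: "integrable torus (\<lambda>x. of_real (rep_H f x) * cis (wave j x))" for j
    by (intro integrable_cis_wave integrable_rep_H)
  have "(LINT x|torus. of_real (rep_H f x * rep_H (trig m z) x) * cis (wave (- k) x))
      = (LINT x|torus. (z / 2) * (of_real (rep_H f x) * cis (wave (- (k - m)) x))
          + (cnj z / 2) * (of_real (rep_H f x) * cis (wave (- (k + m)) x)))"
  proof (intro integral_cong_AE)
    show "AE x in torus. of_real (rep_H f x * rep_H (trig m z) x) * cis (wave (- k) x)
        = (z / 2) * (of_real (rep_H f x) * cis (wave (- (k - m)) x))
          + (cnj z / 2) * (of_real (rep_H f x) * cis (wave (- (k + m)) x))"
      using rep_abs_H[OF mean_zero_trig[OF assms, of z]]
    proof eventually_elim
      case (elim x)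
      have "complex_of_real (rep_H (trig m z) x) = (z * cis (wave m x) + cnj z * cis (wave (- m) x)) / 2"
        using elim assms complex_add_cnj[of "z * cis (wave m x)"]
        by (simp add: trig_def wave_minus cis_cnj)
      then have "of_real (rep_H f x * rep_H (trig m z) x) * cis (wave (- k) x)
          = (z / 2) * (of_real (rep_H f x) * (cis (wave m x) * cis (wave (- k) x)))
          + (cnj z / 2) * (of_real (rep_H f x) * (cis (wave (- m) x) * cis (wave (- k) x)))"
        unfolding of_real_mult by (simp only:) (simp add: field_simps)
      then show ?case
        unfolding cis_mult wave_add[symmetric] by (simp add: algebra_simps)
    qed
  qed measurable
  also have "\<dots> = (z / 2) * fc f (k - m) + (cnj z / 2) * fc f (k + m)"
    using i by (simp add: fc_alt)
  finally show ?thesis by (simp add: field_simps)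
qed

text \<open>\<open>abs_H\<close> is meaningful only for mean-zero functions; P 0 is the mean of h,
  and its vanishing legitimates the formula.\<close>

lemma fc_two_products:
  fixes f g :: H and m n :: "int \<times> int" and z w :: complex
  defines "h \<equiv> (\<lambda>x. rep_H f x * rep_H (trig m z) x + rep_H g x * rep_H (trig n w) x)"
  defines "P \<equiv> (\<lambda>k. (z * fc f (k - m) + cnj z * fc f (k + m) + w * fc g (k - n) + cnj w * fc g (k + n)) / 2)"
  assumes mn: "m \<noteq> 0" "n \<noteq> 0" and P0: "P 0 = 0"
  shows "fc (abs_H h) k = P k"
proof -
  have hs: "sq_integrable h"
    unfolding h_def by (intro sq_integrable_add sq_integrable_mult_trig)
  have i: "integrable torus (\<lambda>x. of_real (rep_H f x * rep_H (trig m z) x) * cis (wave j x))" for f m z j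
    by (intro integrable_cis_wave sq_integrable_imp_integrable sq_integrable_mult_trig)
  have int: "(LINT x|torus. of_real (h x) * cis (wave (- k) x)) = P k" for k
  proof -
    have "(LINT x|torus. of_real (h x) * cis (wave (- k) x))
      = (LINT x|torus. of_real (rep_H f x * rep_H (trig m z) x) * cis (wave (- k) x)
          + of_real (rep_H g x * rep_H (trig n w) x) * cis (wave (- k) x))"
      by (simp add: h_def algebra_simps)
    also have "\<dots> = (z * fc f (k - m) + cnj z * fc f (k + m)) / 2 + (w * fc g (k - n) + cnj w * fc g (k + n)) / 2"
      by (subst Bochner_Integration.integral_add[OF i i]) (simp only: integral_mult_trig[OF mn(1)] integral_mult_trig[OF mn(2)])
    finally show ?thesis by (simp add: P_def add_divide_distrib)
  qed
  have "complex_of_real (LINT x|torus. h x) = P 0"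
    using int[of 0] by (simp add: integral_complex_of_real)
  then have "mean_zero_L2 h"
    using hs P0 by (simp add: mean_zero_L2_def)
  then show ?thesis
    by (simp add: fc_abs_H int)
qed

text \<open>The Fourier matrix of \<open>C_phi\<close>. As \<phi> is its own stream function and
  (\<nabla>^perp f) . \<nabla>g is antisymmetric in f and g, the two advection terms add up to (K
  \<phi>) . \<nabla>(\<xi> - (-\<Delta>)^(-1) \<xi>). The cross product of k and d stems from (K
  \<phi>) . \<nabla>, the last factor from the difference in brackets.\<close>

definition coupling :: "int \<times> int \<Rightarrow> int \<times> int \<Rightarrow> real" where
  "coupling k d = (of_int (fst k) * of_int (snd d) - of_int (snd k) * of_int (fst d)) / 2
     * (1 - inverse ((freq_norm (k + d))\<^sup>2))"

lemma sum_offs: "(\<Sum>d\<in>offs. F d) = F 0 + F (1, 0) + F (- 1, 0) + F (0, 1) + F (0, - 1)"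
  for F :: "int \<times> int \<Rightarrow> 'a::comm_monoid_add"
  by (simp add: offs_def zero_prod_def add.assoc)

lemma coupling_zero [simp]: "coupling k 0 = 0" "coupling 0 d = 0"
  by (simp_all add: coupling_def)

text \<open>The modes (1,0) and (0,1) receive from (1,1) with opposite signs, and from the conjugate
  pair (1,-1), (-1,1) with opposite signs too; along the axes the coupling is 0. So the component
  along \<phi> is never fed. The weight W makes this usable for \<open>C_phi\<close>, for the
  semigroup and for \<open>y0\<close>, where at these entries it depends only on the lengths 1 of k
  and sqrt 2 of k + d.\<close>

lemma coupling_sum_perp_phi:
  assumes "W (1, 0) (0, 1) = c" "W (1, 0) (0, - 1) = c" "W (0, 1) (1, 0) = c" "W (0, 1) (- 1, 0) = c"
  shows "Re (\<Sum>d\<in>offs. (coupling (1, 0) d * W (1, 0) d) *\<^sub>R fc f ((1, 0) + d))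
    + Re (\<Sum>d\<in>offs. (coupling (0, 1) d * W (0, 1) d) *\<^sub>R fc f ((0, 1) + d)) = 0"
proof -
  have "fc f (1, - 1) = cnj (fc f (- 1, 1))"
    using fc_minus_freq[of f "(- 1, 1)"] by simp
  then show ?thesis
    by (simp add: sum_offs coupling_def freq_norm_sq assms algebra_simps)
qed

text \<open>By \<open>coupling_sum_perp_phi\<close> with weight 1 the advection terms are orthogonal
  to \<phi> already, so the projection in \<open>C_phi\<close> acts as the identity here.\<close>

lemma fc_C_phi:
  assumes f: "f \<in> Hs 1"
  shows "fc (C_phi f) k = (\<Sum>d\<in>offs. coupling k d *\<^sub>R fc f (k + d))"
proof -
  have ne: "(1, 0) \<noteq> (0 :: int \<times> int)" "(0, 1) \<noteq> (0 :: int \<times> int)" by (auto simp: zero_prod_def)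
  let ?u1 = "fst (biot_savart f)" and ?u2 = "snd (biot_savart f)"
  have a1: "fc (advect f phi) k = (\<i> * fc ?u1 (k - (1, 0)) + cnj \<i> * fc ?u1 (k + (1, 0))
      + \<i> * fc ?u2 (k - (0, 1)) + cnj \<i> * fc ?u2 (k + (0, 1))) / 2" for k
    unfolding advect_def partial_phi by (rule fc_two_products[OF ne]) (simp add: fc_biot_savart)
  have a2: "fc (advect phi f) k = ((- \<i>) * fc (partial1 f) (k - (0, 1)) + cnj (- \<i>) * fc (partial1 f) (k + (0, 1))
      + \<i> * fc (partial2 f) (k - (1, 0)) + cnj \<i> * fc (partial2 f) (k + (1, 0))) / 2" for k
    unfolding advect_def biot_savart_phi fst_conv snd_conv
    using fc_two_products[OF ne(2) ne(1), of "- \<i>" "partial1 f" \<i> "partial2 f" k]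
    by (simp add: Hs_partial[OF f] mult.commute)
  have eq: "- (fc (advect f phi) k + fc (advect phi f) k) = (\<Sum>d\<in>offs. coupling k d *\<^sub>R fc f (k + d))" for k
  proof -
    have m: "k - (1, 0) = k + (- 1, 0)" "k - (0, 1) = k + (0, - 1)" by (auto simp: prod_eq_iff)
    show ?thesis
      unfolding a1 a2 sum_offs Hs_partial[OF f] fc_biot_savart m coupling_def
      by (simp add: scaleR_conv_of_real field_simps)
  qed
  have "(advect f phi + advect phi f) \<bullet> phi = 0"
    using coupling_sum_perp_phi[of "\<lambda>_ _. 1" 1 f] unfolding mult_1_right eq[symmetric] inner_phi by (simp add: fc_add)
  then have "C_phi f = - (advect f phi + advect phi f)"
    by (simp add: C_phi_def proj_phi_perp_def)
  then show ?thesis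
    using eq[of k] by (simp add: fc_uminus fc_add fc_diff)
qed

subsection \<open>The semigroup\<close>

definition exp_int :: "real \<Rightarrow> real \<Rightarrow> real" where
  "exp_int c t = (if c = 0 then t else (exp (c * t) - 1) / c)"

text \<open>The integral of exp (-p (t - s)) exp (-q s) over s in [0, t]: the response of a mode
  with rate p to a source decaying with rate q. Resonance p = q does occur, for example between k =
  (1,2) and k + d = (0,2).\<close>

definition duhamel :: "real \<Rightarrow> real \<Rightarrow> real \<Rightarrow> real" where
  "duhamel p q t = exp (- p * t) * exp_int (p - q) t"

lemma DERIV_exp_int: "(exp_int c has_real_derivative exp (c * t)) (at t within A)"
  by (cases "c = 0") (auto simp: exp_int_def[abs_def] intro!: derivative_eq_intros)

lemma duhamel_zero [simp]: "duhamel p q 0 = 0"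
  by (simp add: duhamel_def exp_int_def)

lemma duhamel_diff: "(p - q) * duhamel p q t = exp (- q * t) - exp (- p * t)"
  by (auto simp: duhamel_def exp_int_def field_simps simp flip: exp_add)

lemma DERIV_duhamel:
  "(duhamel p q has_real_derivative exp (- q * t) - p * duhamel p q t) (at t within A)"
proof -
  have "((\<lambda>t. exp (- p * t) * exp_int (p - q) t) has_real_derivative
      - p * exp (- p * t) * exp_int (p - q) t + exp ((p - q) * t) * exp (- p * t)) (at t within A)"
    by (auto intro!: derivative_eq_intros DERIV_exp_int)
  moreover have "exp ((p - q) * t) * exp (- p * t) = exp (- q * t)"
    by (simp flip: exp_add add: algebra_simps)
  ultimately show ?thesis
    by (simp add: duhamel_def[abs_def] algebra_simps)
qed

text \<open>The integral behind \<open>duhamel\<close> is symmetric in p and q, in the form of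
  \<open>duhamel_diff\<close>. This second formula serves the integration by parts in time, in which
  the rate q of the source has to be removed.\<close>

lemma DERIV_duhamel':
  "(duhamel p q has_real_derivative exp (- p * t) - q * duhamel p q t) (at t within A)"
proof -
  have "exp (- q * t) - p * duhamel p q t = exp (- p * t) - q * duhamel p q t"
    using duhamel_diff[of p q t] by (simp add: algebra_simps)
  then show ?thesis using DERIV_duhamel[of p q t A] by simp
qed

lemma continuous_on_duhamel: "continuous_on A (duhamel p q)"
  by (rule DERIV_continuous_on[OF DERIV_duhamel])

text \<open>The law for the off-diagonal entry of a triangular 2 by 2 exponential; it yields the
  semigroup law of \<open>R\<close>.\<close>

lemma duhamel_add: "duhamel p q (s + t) = exp (- p * s) * duhamel p q t + duhamel p q s * exp (- q * t)"
proof (cases "p = q")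
  case True
  then show ?thesis by (simp add: duhamel_def exp_int_def algebra_simps flip: exp_add)
next
  case False
  then have D: "duhamel p q x = (exp (- q * x) - exp (- p * x)) / (p - q)" for x
    using duhamel_diff[of p q x] by (simp add: field_simps)
  show ?thesis
  proof -
    have e: "exp (- r * (s + t)) = exp (- r * s) * exp (- r * t)" for r
      by (simp flip: exp_add add: algebra_simps)
    show ?thesis
      unfolding D e by (simp only: diff_divide_distrib right_diff_distrib left_diff_distrib times_divide_eq_right times_divide_eq_left)
  qed
qed

text \<open>A product of two exponentials bounded by 1 is integrated over [0, t]. The bound is
  uniform in both rates and thus in the frequencies.\<close>

lemma duhamel_bounds:
  assumes "0 \<le> p" "0 \<le> q" "0 \<le> t"
  shows "0 \<le> duhamel p q t" "duhamel p q t \<le> t"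
proof -
  have "0 \<le> exp_int (p - q) t"
  proof (cases "p < q")
    case True
    then have "exp ((p - q) * t) \<le> 1" using assms by (simp add: mult_nonpos_nonneg)
    then show ?thesis using True by (simp add: exp_int_def divide_nonpos_neg)
  next
    case False
    then have "1 \<le> exp ((p - q) * t)" using assms by simp
    then show ?thesis using False assms by (simp add: exp_int_def)
  qed
  then show "0 \<le> duhamel p q t" by (simp add: duhamel_def)
  show "duhamel p q t \<le> t"
  proof (cases "p \<le> q")
    case True
    have "exp_int (p - q) t \<le> t"
    proof (cases "p = q")
      case False
      have "(p - q) * t \<le> exp ((p - q) * t) - 1"
        using exp_ge_add_one_self[of "(p - q) * t"] by linarith
      moreover have "p - q < 0" using False True by simp
      ultimately show ?thesis using False by (simp add: exp_int_def divide_le_eq mult.commute)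
    qed (simp add: exp_int_def)
    then have "duhamel p q t \<le> exp (- p * t) * t"
      unfolding duhamel_def by (intro mult_left_mono) auto
    also have "\<dots> \<le> 1 * t"
      using assms by (intro mult_right_mono) (auto simp: mult_nonneg_nonneg)
    finally show ?thesis by simp
  next
    case False
    have "1 - (p - q) * t \<le> exp (- ((p - q) * t))"
      using exp_ge_add_one_self[of "- ((p - q) * t)"] by simp
    then have "(p - q) * duhamel p q t \<le> exp (- q * t) * ((p - q) * t)"
    proof -
      have "exp (- p * t) = exp (- q * t) * exp (- ((p - q) * t))"
        by (simp flip: exp_add add: algebra_simps)
      then have "(p - q) * duhamel p q t = exp (- q * t) * (1 - exp (- ((p - q) * t)))"
        unfolding duhamel_diff by (simp add: algebra_simps)
      also have "\<dots> \<le> exp (- q * t) * ((p - q) * t)"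
        using \<open>1 - (p - q) * t \<le> exp (- ((p - q) * t))\<close> by (intro mult_left_mono) auto
      finally show ?thesis .
    qed
    also have "\<dots> \<le> 1 * ((p - q) * t)"
      using assms False by (intro mult_right_mono) auto
    finally show ?thesis using False by simp
  qed
qed

lemma coupling_uminus [simp]: "coupling (- k) (- d) = coupling k d"
proof -
  have "freq_norm (- k + - d) = freq_norm (k + d)"
    using freq_norm_uminus[of "k + d"] by (simp del: freq_norm_uminus)
  then show ?thesis by (simp add: coupling_def)
qed

text \<open>\<open>C_phi\<close> loses one derivative; the loss is measured at the source frequency
  k + d, where the weight of H^b can pay for it.\<close>

lemma abs_coupling_le:
  assumes "d \<in> offs" "k + d \<noteq> 0"
  shows "\<bar>coupling k d\<bar> \<le> freq_norm (k + d)"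
proof -
  let ?j = "k + d"
  have 1: "0 \<le> 1 - inverse ((freq_norm ?j)\<^sup>2)" "1 - inverse ((freq_norm ?j)\<^sup>2) \<le> 1"
    using freq_norm_sq_ge_1[OF assms(2)] by (auto simp: inverse_le_1_iff)
  have "\<bar>of_int (fst k) * of_int (snd d) - of_int (snd k) * of_int (fst d) :: real\<bar> \<le> freq_norm ?j"
    using abs_fst_le_freq_norm[of ?j] abs_snd_le_freq_norm[of ?j] assms(1) by (auto simp: offs_def)
  then have "\<bar>(of_int (fst k) * of_int (snd d) - of_int (snd k) * of_int (fst d)) / 2\<bar> * \<bar>1 - inverse ((freq_norm ?j)\<^sup>2)\<bar>
      \<le> freq_norm ?j * 1"
    using 1 by (intro mult_mono) auto
  then show ?thesis by (simp only: coupling_def abs_mult mult_1_right)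
qed

section \<open>Transport of E_b to a fixed Hilbert space\<close>

locale linearised_vorticity =
  fixes nu b :: real
  assumes nu_pos: "0 < nu" and b_ge: "1 \<le> b"
begin

definition al :: "int \<times> int \<Rightarrow> real" where "al k = nu * (freq_norm k)\<^sup>2"
definition ka :: "int \<times> int \<Rightarrow> real" where "ka k = nu * ((freq_norm k)\<^sup>2 - 1)"
text \<open>The matrix of \<open>C_phi\<close> composed with \<Lambda>^(-b), that is, acting on
  \<Lambda>^b \<xi>. As b \<ge> 1, its entries are bounded by 1.\<close>

definition cw :: "int \<times> int \<Rightarrow> int \<times> int \<Rightarrow> real" where
  "cw k d = coupling k d * freq_norm (k + d) powr (- b)"
definition duh :: "int \<times> int \<Rightarrow> int \<times> int \<Rightarrow> real \<Rightarrow> real" where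
  "duh k d = duhamel (ka k) (al (k + d))"

text \<open>\<open>lift\<close> is an isometry of $H \times \phi^\perp$ onto $E_b$.\<close>

definition lift :: "H \<times> H \<Rightarrow> H \<times> H" where
  "lift w = (band (diag (\<lambda>k. freq_norm k powr (- b))) (fst w), snd w)"

definition unlift :: "H \<times> H \<Rightarrow> H \<times> H" where
  "unlift x = (SOME g. \<forall>k. fc g k = (freq_norm k powr b) *\<^sub>R fc (fst x) k, snd x)"

definition Z :: "(H \<times> H) set" where "Z = UNIV \<times> phi_perp"

lemma al_nonneg: "0 \<le> al k" and al_uminus [simp]: "al (- k) = al k" and ka_uminus [simp]: "ka (- k) = ka k"
  and al_zero [simp]: "al 0 = 0" and al_eq: "al k = ka k + nu"
  using nu_pos by (auto simp: al_def ka_def algebra_simps)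

lemma ka_nonneg: "k \<noteq> 0 \<Longrightarrow> 0 \<le> ka k"
  using nu_pos freq_norm_sq_ge_1[of k] by (simp add: ka_def)

lemma cw_uminus [simp]: "cw (- k) (- d) = cw k d"
  using freq_norm_uminus[of "k + d"] by (simp add: cw_def)

lemma duh_uminus [simp]: "duh (- k) (- d) = duh k d"
  using al_uminus[of "k + d"] by (simp add: duh_def)

lemma cw_zero [simp]: "cw 0 d = 0"
  by (simp add: cw_def)

lemma abs_cw_le: "d \<in> offs \<Longrightarrow> k + d \<noteq> 0 \<Longrightarrow> \<bar>cw k d\<bar> \<le> 1"
proof -
  assume d: "d \<in> offs" "k + d \<noteq> 0"
  have 1: "1 \<le> freq_norm (k + d)" by (rule freq_norm_ge_1[OF d(2)])
  have "\<bar>cw k d\<bar> \<le> freq_norm (k + d) * freq_norm (k + d) powr (- b)"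
    unfolding cw_def abs_mult by (intro mult_mono abs_coupling_le d) auto
  also have "\<dots> = freq_norm (k + d) powr (1 - b)"
    using 1 by (simp add: powr_diff powr_minus_divide)
  also have "\<dots> \<le> freq_norm (k + d) powr 0"
    using 1 b_ge by (intro powr_mono) auto
  finally show ?thesis using 1 by simp
qed

lemma duh_bounds:
  assumes "k \<noteq> 0" "0 \<le> t"
  shows "0 \<le> duh k d t" "duh k d t \<le> t"
  using duhamel_bounds[OF ka_nonneg[OF assms(1)] al_nonneg assms(2)] by (simp_all add: duh_def)

lemma powr_minus_b_le: "\<bar>freq_norm k powr (- b)\<bar> \<le> 1"
proof (cases "k = 0")
  case False
  have "freq_norm k powr (- b) \<le> freq_norm k powr 0"
    using freq_norm_ge_1[OF False] b_ge by (intro powr_mono) auto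
  then show ?thesis using freq_norm_ge_1[OF False] by simp
qed simp

lemma fc_lift [simp]:
  "fc (fst (lift w)) k = (freq_norm k powr (- b)) *\<^sub>R fc (fst w) k" "snd (lift w) = snd w"
  unfolding lift_def fst_conv snd_conv
  by (rule fc_band_diag[where M = 1]) (use powr_minus_b_le in auto)

lemma lift_eqI:
  "(\<And>k. fc (fst x) k = (freq_norm k powr (- b)) *\<^sub>R fc (fst w) k) \<Longrightarrow> snd x = snd w \<Longrightarrow> lift w = x"
  by (rule prod_eqI) (auto intro: fc_eqI)

lemma freq_powr_cancel: "k \<noteq> 0 \<Longrightarrow> freq_norm k powr b * freq_norm k powr (- b) = 1"
  using freq_norm_ge_1[of k] by (simp flip: powr_add)

lemma fc_lift_cancel: "(freq_norm k powr b) *\<^sub>R fc (fst (lift w)) k = fc (fst w) k"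
  by (cases "k = 0") (simp_all add: freq_powr_cancel)

lemma lift_add: "lift (v + w) = lift v + lift w"
  by (rule lift_eqI) (simp_all add: fc_add scaleR_add_right)

lemma lift_scaleR: "lift (c *\<^sub>R w) = c *\<^sub>R lift w"
  by (rule lift_eqI) (simp_all add: fc_scaleR mult.commute)

lemma lift_diff: "lift (v - w) = lift v - lift w"
  by (rule lift_eqI) (simp_all add: fc_diff scaleR_diff_right)

lemma bounded_linear_lift: "bounded_linear lift"
proof -
  have "bounded_linear (band (diag (\<lambda>k. freq_norm k powr (- b))))"
    by (rule bounded_linear_band[where M = 1]) (auto intro: symbol_bound_diag powr_minus_b_le)
  then show ?thesis
    unfolding lift_def[abs_def]
    by (intro bounded_linear_Pair bounded_linear_compose[OF _ bounded_linear_fst] bounded_linear_snd)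
qed

lemma unlift_lift [simp]: "unlift (lift w) = w"
proof -
  have "(SOME g. \<forall>k. fc g k = (freq_norm k powr b) *\<^sub>R fc (fst (lift w)) k) = fst w"
  proof (rule some_equality)
    show "\<forall>k. fc (fst w) k = (freq_norm k powr b) *\<^sub>R fc (fst (lift w)) k"
      by (intro allI fc_lift_cancel[symmetric])
    show "g = fst w" if "\<forall>k. fc g k = (freq_norm k powr b) *\<^sub>R fc (fst (lift w)) k" for g
      using that by (intro fc_eqI) (simp only: fc_lift_cancel)
  qed
  then show ?thesis by (simp add: unlift_def prod_eq_iff)
qed

lemma lift_in_E: "lift w \<in> E b \<longleftrightarrow> w \<in> Z"
proof -
  have "fst (lift w) \<in> Hs b"
    unfolding Hs_iff by (intro exI[of _ "fst w"] allI fc_lift_cancel[symmetric])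
  then show ?thesis by (simp add: E_def Z_def mem_Times_iff)
qed

lemma lift_unlift:
  assumes "x \<in> E b"
  shows "lift (unlift x) = x" "unlift x \<in> Z"
proof -
  have "fst x \<in> Hs b" using assms by (auto simp: E_def)
  then obtain g where g: "\<forall>k. fc g k = (freq_norm k powr b) *\<^sub>R fc (fst x) k"
    by (metis Hs_iff)
  have "lift (g, snd x) = x"
  proof (rule lift_eqI)
    show "fc (fst x) k = freq_norm k powr - b *\<^sub>R fc (fst (g, snd x)) k" for k
      using g freq_powr_cancel[of k] by (cases "k = 0") (simp_all add: mult.commute)
  qed simp
  then show "lift (unlift x) = x" by (metis unlift_lift)
  then show "unlift x \<in> Z" using assms lift_in_E by metis
qed

lemma E_eq_lift: "E b = lift ` Z"
  using lift_in_E lift_unlift by (auto simp: image_iff) metis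

lemma E_inner_lift [simp]: "E_inner b (lift v) (lift w) = v \<bullet> w"
proof -
  have "Hs_inner b (fst (lift v)) (fst (lift w)) = fst v \<bullet> fst w"
    by (rule Hs_inner_eq) (simp_all only: fc_lift_cancel)
  then show ?thesis by (simp add: E_inner_def inner_prod_def)
qed

lemma E_norm_lift [simp]: "E_norm b (lift w) = norm w"
  by (simp add: E_norm_def norm_eq_sqrt_inner)

lemma ZI: "snd w \<bullet> phi = 0 \<Longrightarrow> w \<in> Z"
  by (simp add: Z_def phi_perp_def mem_Times_iff)

lemma Z_iff: "w \<in> Z \<longleftrightarrow> snd w \<bullet> phi = 0"
  by (simp add: Z_def phi_perp_def mem_Times_iff)

lemma Z_diff: "v \<in> Z \<Longrightarrow> w \<in> Z \<Longrightarrow> v - w \<in> Z"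
  and Z_scaleR: "w \<in> Z \<Longrightarrow> c *\<^sub>R w \<in> Z"
  and Z_zero: "0 \<in> Z"
  by (simp_all add: Z_iff inner_diff_left)

text \<open>The exponential of t L read through \<open>lift\<close>. L is triangular, so the
  coupling enters exactly once, with the Duhamel coefficient for decay at rate
  \<open>al (k + d)\<close> before and \<open>ka k\<close> after the transfer.\<close>

definition R :: "real \<Rightarrow> H \<times> H \<Rightarrow> H \<times> H" where
  "R t w = (band (diag (\<lambda>k. exp (- al k * t))) (fst w),
    band (diag (\<lambda>k. exp (- ka k * t))) (snd w) + band (\<lambda>k d. cw k d * duh k d t) (fst w))"

lemma exp_al_le: "0 \<le> t \<Longrightarrow> \<bar>exp (- al k * t)\<bar> \<le> 1"
  using al_nonneg by simp

lemma exp_ka_le: "k \<noteq> 0 \<Longrightarrow> 0 \<le> t \<Longrightarrow> \<bar>exp (- ka k * t)\<bar> \<le> 1"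
  using ka_nonneg by simp

lemma even_cw_duh: "even_symbol (\<lambda>k d. cw k d * duh k d t)"
  by (simp add: even_symbol_def)

lemma bound_cw_duh: "0 \<le> t \<Longrightarrow> t \<le> M \<Longrightarrow> symbol_bound (\<lambda>k d. cw k d * duh k d t) M"
  unfolding symbol_bound_def abs_mult
proof (intro allI impI)
  fix k d assume t: "0 \<le> t" "t \<le> M" "k \<noteq> 0" "d \<in> offs" "k + d \<noteq> 0"
  have "\<bar>cw k d\<bar> * \<bar>duh k d t\<bar> \<le> 1 * M"
    using duh_bounds[OF t(3,1), of d] t by (intro mult_mono abs_cw_le) auto
  then show "\<bar>cw k d\<bar> * \<bar>duh k d t\<bar> \<le> M" by simp
qed

lemma even_cw: "even_symbol cw" and bound_cw: "symbol_bound cw 1"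
  by (simp_all add: even_symbol_def symbol_bound_def abs_cw_le)

lemma fc_R_fst: "0 \<le> t \<Longrightarrow> fc (fst (R t w)) k = exp (- al k * t) *\<^sub>R fc (fst w) k"
  unfolding R_def fst_conv by (rule fc_band_diag[where M = 1]) (use exp_al_le in auto)

lemma fc_R_snd:
  assumes "0 \<le> t"
  shows "fc (snd (R t w)) k = exp (- ka k * t) *\<^sub>R fc (snd w) k + (\<Sum>d\<in>offs. (cw k d * duh k d t) *\<^sub>R fc (fst w) (k + d))"
proof -
  have "fc (band (diag (\<lambda>k. exp (- ka k * t))) (snd w)) k = exp (- ka k * t) *\<^sub>R fc (snd w) k"
    by (rule fc_band_diag[where M = 1]) (use exp_ka_le assms in auto)
  then show ?thesis
    using assms by (simp add: R_def fc_add fc_band[OF even_cw_duh bound_cw_duh[of t t]])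
qed

lemma bounded_linear_R: "0 \<le> t \<Longrightarrow> bounded_linear (R t)"
  unfolding R_def[abs_def]
  by (intro bounded_linear_Pair bounded_linear_add
      bounded_linear_compose[OF bounded_linear_band bounded_linear_fst, of _ 1]
      bounded_linear_compose[OF bounded_linear_band bounded_linear_snd, of _ 1]
      bounded_linear_compose[OF bounded_linear_band bounded_linear_fst, of _ t]
      even_cw_duh bound_cw_duh symbol_bound_diag exp_al_le exp_ka_le) auto

lemma norm_R_le:
  assumes "0 \<le> t" "t \<le> M"
  shows "norm (R t w) \<le> (10 + 5 * M) * norm w"
proof -
  have "norm (R t w) \<le> norm (fst (R t w)) + norm (snd (R t w))"
    using norm_Pair_le[of "fst (R t w)" "snd (R t w)"] by simp
  also have "norm (fst (R t w)) \<le> 5 * 1 * norm (fst w)"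
    unfolding R_def fst_conv using assms
    by (intro norm_band_le symbol_bound_diag exp_al_le) auto
  also have "norm (snd (R t w)) \<le> 5 * 1 * norm (snd w) + 5 * M * norm (fst w)"
    unfolding R_def snd_conv using assms
    by (intro order_trans[OF norm_triangle_ineq] add_mono norm_band_le symbol_bound_diag exp_ka_le even_cw_duh bound_cw_duh) auto
  also have "5 * 1 * norm (fst w) + (5 * 1 * norm (snd w) + 5 * M * norm (fst w))
      \<le> 5 * 1 * norm w + (5 * 1 * norm w + 5 * M * norm w)"
    using assms norm_fst_le[of "fst w" "snd w"] norm_snd_le[of "snd w" "fst w"]
    by (intro add_mono mult_left_mono) auto
  finally show ?thesis by (simp add: algebra_simps)
qed

lemma H_pair_eqI: "(\<And>k. fc (fst v) k = fc (fst w) k) \<Longrightarrow> (\<And>k. fc (snd v) k = fc (snd w) k) \<Longrightarrow> v = w"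
  by (rule prod_eqI) (auto intro: fc_eqI)

lemma R_zero [simp]: "R 0 w = w"
  by (rule H_pair_eqI) (simp_all add: fc_R_fst fc_R_snd duh_def)

lemma R_add:
  assumes "0 \<le> s" "0 \<le> t"
  shows "R (s + t) w = R s (R t w)"
proof (rule H_pair_eqI)
  fix k
  show "fc (fst (R (s + t) w)) k = fc (fst (R s (R t w))) k"
    using assms by (simp add: fc_R_fst algebra_simps flip: exp_add)
  have "(\<Sum>d\<in>offs. (cw k d * duh k d (s + t)) *\<^sub>R fc (fst w) (k + d))
      = exp (- ka k * s) *\<^sub>R (\<Sum>d\<in>offs. (cw k d * duh k d t) *\<^sub>R fc (fst w) (k + d))
        + (\<Sum>d\<in>offs. (cw k d * duh k d s) *\<^sub>R (exp (- al (k + d) * t) *\<^sub>R fc (fst w) (k + d)))"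
    unfolding scaleR_sum_right sum.distrib[symmetric]
    by (intro sum.cong refl) (simp add: duh_def duhamel_add algebra_simps)
  then show "fc (snd (R (s + t) w)) k = fc (snd (R s (R t w))) k"
    using assms by (simp add: fc_R_fst fc_R_snd scaleR_add_right algebra_simps flip: exp_add)
qed

text \<open>At the modes of \<phi> the rate \<open>ka\<close> is 0, and by
  \<open>coupling_sum_perp_phi\<close> nothing is fed along \<phi>, so the component of the second
  entry along \<phi> is conserved.\<close>

lemma R_in_Z:
  assumes "0 \<le> t" "w \<in> Z"
  shows "R t w \<in> Z"
proof -
  have f1: "(freq_norm (1, 0))\<^sup>2 = 1" "(freq_norm (0, 1))\<^sup>2 = 1"
    and f2: "(freq_norm (1, 1))\<^sup>2 = 2" "(freq_norm (- 1, 1))\<^sup>2 = 2" "(freq_norm (1, - 1))\<^sup>2 = 2"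
    by (simp_all add: freq_norm_sq)
  have f3: "freq_norm (1, 1) = sqrt 2" "freq_norm (- 1, 1) = sqrt 2" "freq_norm (1, - 1) = sqrt 2"
    by (simp_all add: freq_norm_def)
  have k1: "ka (1, 0) = 0" "ka (0, 1) = 0" by (simp_all add: ka_def f1)
  define W where "W k d = freq_norm (k + d) powr (- b) * duh k d t" for k d
  have "Re (\<Sum>d\<in>offs. (coupling (1, 0) d * W (1, 0) d) *\<^sub>R fc (fst w) ((1, 0) + d))
      + Re (\<Sum>d\<in>offs. (coupling (0, 1) d * W (0, 1) d) *\<^sub>R fc (fst w) ((0, 1) + d)) = 0"
    by (rule coupling_sum_perp_phi[of _ "sqrt 2 powr (- b) * duhamel 0 (nu * 2) t"])
      (simp_all add: W_def duh_def al_def k1 f2 f3)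
  then have "snd (R t w) \<bullet> phi = snd w \<bullet> phi"
    using assms(1) by (simp add: inner_phi fc_R_snd k1 cw_def W_def mult.assoc)
  then show ?thesis using assms(2) by (simp add: Z_iff)
qed

lemma R_tendsto:
  assumes "0 \<le> t"
  shows "((\<lambda>s. R s w) \<longlongrightarrow> R t w) (at t within {0..})"
proof -
  have ev: "eventually (\<lambda>s. 0 \<le> s \<and> s \<le> t + 1) (at t within {0..})"
  proof -
    have "eventually (\<lambda>s. s < t + 1) (at t within {0..})"
      by (rule order_tendstoD[OF tendsto_ident_at]) simp
    moreover have "eventually (\<lambda>s. s \<in> {0..}) (at t within {0..})"
      by (simp add: eventually_at_filter)
    ultimately show ?thesis by eventually_elim auto
  qed
  have d: "((\<lambda>s. duh k d s) \<longlongrightarrow> duh k d t) (at t within {0..})" for k d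
    using continuous_on_duhamel[of "{0..}" "ka k" "al (k + d)"] assms
    by (auto simp: continuous_on_def duh_def)
  show ?thesis
    unfolding R_def
  proof (intro tendsto_Pair tendsto_add)
    show "((\<lambda>s. band (diag (\<lambda>k. exp (- al k * s))) (fst w)) \<longlongrightarrow> band (diag (\<lambda>k. exp (- al k * t))) (fst w)) (at t within {0..})"
    proof (rule band_tendsto[where M = 1])
      show "\<forall>\<^sub>F s in at t within {0..}. even_symbol (diag (\<lambda>k. exp (- al k * s))) \<and> symbol_bound (diag (\<lambda>k. exp (- al k * s))) 1"
        using ev by eventually_elim (auto intro!: symbol_bound_diag simp: al_nonneg)
      show "((\<lambda>s. diag (\<lambda>k. exp (- al k * s)) k d) \<longlongrightarrow> diag (\<lambda>k. exp (- al k * t)) k d) (at t within {0..})" for k d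
        unfolding diag_def by (cases "d = 0") (auto intro!: tendsto_intros)
    qed (use assms in \<open>auto intro!: symbol_bound_diag simp: al_nonneg\<close>)
    show "((\<lambda>s. band (diag (\<lambda>k. exp (- ka k * s))) (snd w)) \<longlongrightarrow> band (diag (\<lambda>k. exp (- ka k * t))) (snd w)) (at t within {0..})"
    proof (rule band_tendsto[where M = 1])
      show "\<forall>\<^sub>F s in at t within {0..}. even_symbol (diag (\<lambda>k. exp (- ka k * s))) \<and> symbol_bound (diag (\<lambda>k. exp (- ka k * s))) 1"
        using ev by eventually_elim (auto intro!: symbol_bound_diag simp: ka_nonneg)
      show "((\<lambda>s. diag (\<lambda>k. exp (- ka k * s)) k d) \<longlongrightarrow> diag (\<lambda>k. exp (- ka k * t)) k d) (at t within {0..})" for k d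
        unfolding diag_def by (cases "d = 0") (auto intro!: tendsto_intros)
    qed (use assms in \<open>auto intro!: symbol_bound_diag simp: ka_nonneg\<close>)
    show "((\<lambda>s. band (\<lambda>k d. cw k d * duh k d s) (fst w)) \<longlongrightarrow> band (\<lambda>k d. cw k d * duh k d t) (fst w)) (at t within {0..})"
    proof (rule band_tendsto[where M = "t + 1"])
      show "\<forall>\<^sub>F s in at t within {0..}. even_symbol (\<lambda>k d. cw k d * duh k d s) \<and> symbol_bound (\<lambda>k d. cw k d * duh k d s) (t + 1)"
        using ev by eventually_elim (auto intro: even_cw_duh bound_cw_duh)
    qed (use assms in \<open>auto intro!: even_cw_duh bound_cw_duh tendsto_intros d\<close>)
  qed
qed

lemma continuous_on_R: "continuous_on {0..} (\<lambda>t. R t w)"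
  unfolding continuous_on_def using R_tendsto by auto

text \<open>\<open>lift\<close> gains b derivatives in the first component, which turns the
  condition H^(b+2) into H^2.\<close>

lemma lift_gen_dom:
  assumes "w \<in> Z"
  shows "lift w \<in> gen_dom b \<longleftrightarrow> fst w \<in> Hs 2 \<and> snd w \<in> Hs 2"
proof -
  have "freq_norm k powr (b + 2) *\<^sub>R fc (fst (lift w)) k = freq_norm k powr 2 *\<^sub>R fc (fst w) k" for k
    using freq_powr_cancel[of k] by (cases "k = 0") (simp_all add: powr_add mult_ac)
  then have "fst (lift w) \<in> Hs (b + 2) \<longleftrightarrow> fst w \<in> Hs 2"
    unfolding Hs_iff by (simp only:)
  then show ?thesis
    using assms by (simp add: gen_dom_def lift_in_E mem_Times_iff)
qed

lemma fc_gen: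
  assumes "fst w \<in> Hs 2" "snd w \<in> Hs 2"
  shows "fc (fst (gen nu (lift w))) k = (freq_norm k powr (- b)) *\<^sub>R (- al k *\<^sub>R fc (fst w) k)"
    and "fc (snd (gen nu (lift w))) k = - ka k *\<^sub>R fc (snd w) k + (\<Sum>d\<in>offs. cw k d *\<^sub>R fc (fst w) (k + d))"
proof -
  obtain g where g: "\<And>k. fc g k = (freq_norm k powr 2) *\<^sub>R fc (fst w) k"
    using assms(1) by (metis Hs_iff)
  have "\<exists>h. \<forall>k. fc h k = freq_norm k powr 2 *\<^sub>R fc (fst (lift w)) k"
  proof (rule ex_fc_eq[where M = 1 and g = g])
    show "cmod (freq_norm k powr 2 *\<^sub>R fc (fst (lift w)) k) \<le> 1 * cmod (fc g k)" for k
      using mult_right_mono[OF powr_minus_b_le[of k], of "cmod (fc g k)"] by (simp add: g mult_ac)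
  qed (simp add: fc_minus_freq)
  then have l2: "fst (lift w) \<in> Hs 2" by (simp add: Hs_iff)
  then have l1: "fst (lift w) \<in> Hs 1" by (rule Hs_mono[rotated]) simp
  show "fc (fst (gen nu (lift w))) k = (freq_norm k powr (- b)) *\<^sub>R (- al k *\<^sub>R fc (fst w) k)"
    by (simp add: gen_def fc_scaleR fc_laplacian[OF l2] al_def mult_ac)
  show "fc (snd (gen nu (lift w))) k = - ka k *\<^sub>R fc (snd w) k + (\<Sum>d\<in>offs. cw k d *\<^sub>R fc (fst w) (k + d))"
    by (simp add: gen_def fc_add fc_scaleR fc_laplacian[OF assms(2)] fc_C_phi[OF l1] ka_def cw_def algebra_simps)
qed

end

subsection \<open>Generator and uniqueness of the semigroup\<close>

text \<open>Banach-Steinhaus from the Baire category theorem. Sequences suffice, as it serves the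
  argument by contradiction in \<open>T_locally_bounded\<close>.\<close>

lemma uniform_boundedness:
  fixes A :: "nat \<Rightarrow> 'a::banach \<Rightarrow> 'b::real_normed_vector"
  assumes lin: "\<And>n. bounded_linear (A n)" and pt: "\<And>x. \<exists>c. \<forall>n. norm (A n x) \<le> c"
  shows "\<exists>M\<ge>0. \<forall>n x. norm (A n x) \<le> M * norm x"
proof -
  define F where "F N = {x. \<forall>n. norm (A n x) \<le> real N}" for N :: nat
  have cl: "closed (F N)" for N
  proof -
    have "F N = (\<Inter>n. {x. norm (A n x) \<le> real N})" by (auto simp: F_def)
    moreover have "closed {x. norm (A n x) \<le> real N}" for n
      by (intro closed_Collect_le continuous_intros linear_continuous_on lin)
    ultimately show ?thesis by auto
  qed
  have "(\<Union>N. F N) = UNIV"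
  proof -
    have "\<exists>N. x \<in> F N" for x
    proof -
      obtain c where c: "\<And>n. norm (A n x) \<le> c" using pt by blast
      obtain N :: nat where "c \<le> real N" using real_arch_simple by blast
      then have "x \<in> F N" using c by (auto simp: F_def intro: order_trans)
      then show ?thesis by blast
    qed
    then show ?thesis by auto
  qed
  have mc: "Met_TC.mcomplete TYPE('a)"
    unfolding Met_TC.mcomplete_def by (auto simp: convergent_eq_Cauchy[symmetric] Cauchy_convergent_iff convergent_def)
  have "\<exists>N. interior (F N) \<noteq> {}"
  proof (rule ccontr)
    assume "\<nexists>N. interior (F N) \<noteq> {}"
    then have "euclidean interior_of \<Union>(range F) = {}"
      using cl Met_TC.metric_Baire_category_alt[of "range F", OF mc] by auto
    then show False using \<open>(\<Union>N. F N) = UNIV\<close> by simp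
  qed
  then obtain N x0 where "x0 \<in> interior (F N)" by blast
  then obtain r where r: "0 < r" "ball x0 r \<subseteq> F N"
    by (meson mem_interior)
  \<comment> \<open>A vector shorter than r is a difference of two points of the ball, both of which
    lie in F N.\<close>
  have small: "norm (A n y) \<le> 2 * real N" if "norm y < r" for n y
  proof -
    interpret bounded_linear "A n" by (rule lin)
    have "x0 + y \<in> F N" "x0 \<in> F N" using r that by (auto simp: dist_norm)
    then have "norm (A n (x0 + y)) \<le> real N" "norm (A n x0) \<le> real N" by (auto simp: F_def)
    moreover have "A n y = A n (x0 + y) - A n x0" by (simp add: add)
    ultimately show ?thesis using norm_triangle_ineq4[of "A n (x0 + y)" "A n x0"] by simp
  qed
  show ?thesis
  proof (intro exI[of _ "4 * real N / r"] conjI allI)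
    fix n x
    interpret bounded_linear "A n" by (rule lin)
    show "norm (A n x) \<le> 4 * real N / r * norm x"
    proof (cases "x = 0")
      case False
      define c where "c = r / (2 * norm x)"
      have c: "0 < c" using r False by (simp add: c_def)
      have "norm (c *\<^sub>R x) < r" using r False by (simp add: c_def)
      then have "norm (A n (c *\<^sub>R x)) \<le> 2 * real N" by (rule small)
      then have "c * norm (A n x) \<le> 2 * real N" using c by (simp add: scaleR)
      then show ?thesis using r False by (simp add: c_def field_simps)
    qed (simp add: zero)
  qed (use r in simp)
qed

text \<open>The integrating factor exp (c s) turns y into a constant.\<close>

lemma exp_decay_unique:
  fixes y :: "real \<Rightarrow> complex"
  assumes y: "\<And>s. 0 \<le> s \<Longrightarrow> s \<le> t \<Longrightarrow> (y has_vector_derivative (- c) *\<^sub>R y s) (at s within {0..t})" and t: "0 \<le> t"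
  shows "y t = exp (- c * t) *\<^sub>R y 0"
proof -
  have "\<exists>k. \<forall>s\<in>{0..t}. exp (c * s) *\<^sub>R y s = k"
  proof (rule has_vector_derivative_zero_constant[of "{0..t}" "\<lambda>s. exp (c * s) *\<^sub>R y s"])
    fix s :: real assume "s \<in> {0..t}"
    then have "((\<lambda>s. exp (c * s) *\<^sub>R y s) has_vector_derivative exp (c * s) *\<^sub>R ((- c) *\<^sub>R y s) + (c * exp (c * s)) *\<^sub>R y s) (at s within {0..t})"
      by (intro has_vector_derivative_scaleR y) (auto intro!: derivative_eq_intros)
    then show "((\<lambda>s. exp (c * s) *\<^sub>R y s) has_vector_derivative 0) (at s within {0..t})"
      by (simp add: algebra_simps)
  qed (simp, blast)
  then obtain k where k: "\<And>s. 0 \<le> s \<Longrightarrow> s \<le> t \<Longrightarrow> exp (c * s) *\<^sub>R y s = k" by auto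
  have "y t = exp (- c * t) *\<^sub>R (exp (c * t) *\<^sub>R y t)" by (simp flip: exp_add)
  also have "exp (c * t) *\<^sub>R y t = y 0" using k[of 0] k[of t] t by simp
  finally show ?thesis .
qed

lemma at_right_diff_quotient:
  fixes f :: "real \<Rightarrow> real"
  assumes "(f has_real_derivative D) (at 0)"
  shows "((\<lambda>h. (f h - f 0) / h) \<longlongrightarrow> D) (at_right 0)"
  using assms by (auto simp: has_field_derivative_iff intro: filterlim_at_split[THEN iffD1, THEN conjunct2])

context linearised_vorticity
begin

lemma generator_quotient_limits:
  "((\<lambda>h. (exp (- c * h) - 1) / h) \<longlongrightarrow> - c) (at_right (0 :: real))"
  "((\<lambda>h. duh k d h / h) \<longlongrightarrow> 1) (at_right 0)"
proof -
  have "((\<lambda>h. exp (- c * h)) has_real_derivative - c) (at 0)"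
    by (auto intro!: derivative_eq_intros)
  from at_right_diff_quotient[OF this] show "((\<lambda>h. (exp (- c * h) - 1) / h) \<longlongrightarrow> - c) (at_right 0)"
    by simp
  from at_right_diff_quotient[OF DERIV_duhamel[of "ka k" "al (k + d)" 0]]
  show "((\<lambda>h. duh k d h / h) \<longlongrightarrow> 1) (at_right 0)" by (simp add: duh_def)
qed

text \<open>The relation u = L w on coefficients: g1 and g2 witness that w lies in H^2 x H^2. As a
  relation it avoids \<open>gen\<close> at arguments outside its domain, where the derivatives are
  unspecified.\<close>

definition gen_rel :: "H \<times> H \<Rightarrow> H \<times> H \<Rightarrow> bool" where
  "gen_rel w u \<longleftrightarrow> (\<exists>g1 g2. (\<forall>k. fc g1 k = (freq_norm k)\<^sup>2 *\<^sub>R fc (fst w) k) \<and> (\<forall>k. fc g2 k = (freq_norm k)\<^sup>2 *\<^sub>R fc (snd w) k))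
    \<and> (\<forall>k. fc (fst u) k = - al k *\<^sub>R fc (fst w) k)
    \<and> (\<forall>k. fc (snd u) k = - ka k *\<^sub>R fc (snd w) k + (\<Sum>d\<in>offs. cw k d *\<^sub>R fc (fst w) (k + d)))"

lemma gen_rel_iff:
  assumes w: "w \<in> Z"
  shows "gen_rel w u \<longleftrightarrow> lift w \<in> gen_dom b \<and> lift u = gen nu (lift w)"
proof -
  have dom: "lift w \<in> gen_dom b \<longleftrightarrow> (\<exists>g1 g2. (\<forall>k. fc g1 k = (freq_norm k)\<^sup>2 *\<^sub>R fc (fst w) k) \<and> (\<forall>k. fc g2 k = (freq_norm k)\<^sup>2 *\<^sub>R fc (snd w) k))"
    unfolding lift_gen_dom[OF w] Hs_iff by simp
  have "lift u = gen nu (lift w) \<longleftrightarrow>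
      (\<forall>k. fc (fst u) k = - al k *\<^sub>R fc (fst w) k)
    \<and> (\<forall>k. fc (snd u) k = - ka k *\<^sub>R fc (snd w) k + (\<Sum>d\<in>offs. cw k d *\<^sub>R fc (fst w) (k + d)))"
    if "lift w \<in> gen_dom b"
  proof -
    have g: "fst w \<in> Hs 2" "snd w \<in> Hs 2" using that lift_gen_dom[OF w] by auto
    have "lift u = gen nu (lift w) \<longleftrightarrow> (\<forall>k. fc (fst (lift u)) k = fc (fst (gen nu (lift w))) k) \<and> (\<forall>k. fc (snd (lift u)) k = fc (snd (gen nu (lift w))) k)"
      by (blast intro: H_pair_eqI arg_cong[where f = "\<lambda>x. fc (fst x) _"] arg_cong[where f = "\<lambda>x. fc (snd x) _"])
    also have "(\<forall>k. fc (fst (lift u)) k = fc (fst (gen nu (lift w))) k) \<longleftrightarrow> (\<forall>k. fc (fst u) k = - al k *\<^sub>R fc (fst w) k)"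
    proof (intro iff_allI)
      fix k
      show "fc (fst (lift u)) k = fc (fst (gen nu (lift w))) k \<longleftrightarrow> fc (fst u) k = - al k *\<^sub>R fc (fst w) k"
      proof (cases "k = 0")
        case False
        then have "freq_norm k powr - b \<noteq> 0" using freq_norm_ge_1[of k] by simp
        then show ?thesis unfolding fc_gen[OF g] fc_lift by (simp only: scaleR_cancel_left simp_thms)
      qed simp
    qed
    finally show ?thesis unfolding fc_lift fc_gen[OF g] .
  qed
  then show ?thesis unfolding gen_rel_def dom[symmetric] by blast
qed

text \<open>The difference quotient and its limit are band operators with uniformly bounded symbols
  applied to the fixed elements g1, g2 and fst w, so \<open>band_tendsto\<close> applies.\<close>

lemma gen_rel_imp_limit:
  assumes "gen_rel w u"
  shows "((\<lambda>h. (R h w - w) /\<^sub>R h) \<longlongrightarrow> u) (at_right 0)"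
proof -
  obtain g1 g2 where g1: "\<And>k. fc g1 k = (freq_norm k)\<^sup>2 *\<^sub>R fc (fst w) k" and g2: "\<And>k. fc g2 k = (freq_norm k)\<^sup>2 *\<^sub>R fc (snd w) k"
    and u1: "\<And>k. fc (fst u) k = - al k *\<^sub>R fc (fst w) k"
    and u2: "\<And>k. fc (snd u) k = - ka k *\<^sub>R fc (snd w) k + (\<Sum>d\<in>offs. cw k d *\<^sub>R fc (fst w) (k + d))"
    using assms unfolding gen_rel_def by metis
  have ne: "freq_norm k \<noteq> 0" if "k \<noteq> 0" for k using freq_norm_ge_1[OF that] by simp
  \<comment> \<open>Dividing by |k|^2 makes the symbol bounded by nu uniformly in h, because 1 - exp
    (-c h) \<le> c h and c \<le> nu |k|^2; the factor |k|^2 is contained in g1 and g2.\<close>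
  define p where "p c h k = (exp (- c k * h) - 1) / h / (freq_norm k)\<^sup>2" for c :: "int \<times> int \<Rightarrow> real" and h k
  have p_bound: "\<bar>p c h k\<bar> \<le> nu" if c: "\<And>k. k \<noteq> 0 \<Longrightarrow> 0 \<le> c k \<and> c k \<le> al k" and hk: "0 < h" "k \<noteq> 0" for c h k
  proof -
    have ck: "0 \<le> c k" "c k \<le> al k" using c hk by auto
    have "1 - exp (- c k * h) \<le> c k * h" "exp (- c k * h) \<le> 1"
      using exp_ge_add_one_self[of "- c k * h"] ck hk by simp_all
    then have "\<bar>exp (- c k * h) - 1\<bar> \<le> c k * h" by simp
    also have "\<dots> \<le> nu * (freq_norm k)\<^sup>2 * h" using ck hk by (simp add: al_def)
    finally show ?thesis
      using hk ne[OF hk(2)] by (simp add: p_def abs_divide divide_le_eq mult_ac)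
  qed
  have pe: "p c h k * (freq_norm k)\<^sup>2 = (exp (- c k * h) - 1) / h" if "k \<noteq> 0" for c h k
    using ne[OF that] by (simp add: p_def)
  have p_lim: "((\<lambda>h. p c h k) \<longlongrightarrow> - c k / (freq_norm k)\<^sup>2) (at_right 0)" if "k \<noteq> 0" for c k
    unfolding p_def using ne[OF that] by (intro tendsto_intros generator_quotient_limits) auto
  have p_band: "((\<lambda>h. band (diag (p c h)) g) \<longlongrightarrow> band (diag (\<lambda>k. - c k / (freq_norm k)\<^sup>2)) g) (at_right 0)"
    if c: "\<And>k. k \<noteq> 0 \<Longrightarrow> 0 \<le> c k \<and> c k \<le> al k" "\<And>k. c (- k) = c k" for c g
  proof (rule band_tendsto[where M = nu])
    show "\<forall>\<^sub>F h in at_right 0. even_symbol (diag (p c h)) \<and> symbol_bound (diag (p c h)) nu"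
    proof (rule eventually_at_right_less[THEN eventually_mono], rule conjI)
      fix h :: real assume "0 < h"
      then show "symbol_bound (diag (p c h)) nu"
        using nu_pos by (intro symbol_bound_diag p_bound c) auto
      show "even_symbol (diag (p c h))" using c(2) by (simp add: p_def)
    qed
    show "((\<lambda>h. diag (p c h) k d) \<longlongrightarrow> diag (\<lambda>k. - c k / (freq_norm k)\<^sup>2) k d) (at_right 0)" if "k \<noteq> 0" for k d
      using p_lim[OF that, of c] by (cases "d = 0") (auto simp: diag_def)
    show "symbol_bound (diag (\<lambda>k. - c k / (freq_norm k)\<^sup>2)) nu"
    proof (rule symbol_bound_diag)
      fix k :: "int \<times> int" assume "k \<noteq> 0"
      then show "\<bar>- c k / (freq_norm k)\<^sup>2\<bar> \<le> nu"
        using c(1)[of k] ne[of k] by (simp add: al_def divide_le_eq)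
    qed (use nu_pos in simp)
  qed (use c nu_pos in auto)
  have al_c: "k \<noteq> 0 \<Longrightarrow> 0 \<le> al k \<and> al k \<le> al k" and ka_c: "k \<noteq> 0 \<Longrightarrow> 0 \<le> ka k \<and> ka k \<le> al k" for k
    using al_nonneg ka_nonneg nu_pos by (auto simp: al_eq)
  have fc_p: "fc (band (diag (p c h)) g) k = p c h k *\<^sub>R fc g k"
    if "\<And>k. k \<noteq> 0 \<Longrightarrow> 0 \<le> c k \<and> c k \<le> al k" "\<And>k. c (- k) = c k" "0 < h" for c h g k
  proof (rule fc_band_diag[where M = nu])
    show "p c h (- k) = p c h k" for k using that(2) by (simp add: p_def)
  qed (intro p_bound that)
  have fc_lim: "fc (band (diag (\<lambda>k. - c k / (freq_norm k)\<^sup>2)) g) k = (- c k / (freq_norm k)\<^sup>2) *\<^sub>R fc g k"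
    if "\<And>k. k \<noteq> 0 \<Longrightarrow> 0 \<le> c k \<and> c k \<le> al k" "\<And>k. c (- k) = c k" for c g k
  proof (rule fc_band_diag[where M = nu])
    fix k :: "int \<times> int" assume "k \<noteq> 0"
    then show "\<bar>- c k / (freq_norm k)\<^sup>2\<bar> \<le> nu"
      using that(1)[of k] ne[of k] by (simp add: al_def divide_le_eq)
  qed (use that in auto)
  have even: "even_symbol (\<lambda>k d. cw k d * (duh k d h / h))" for h
    by (simp add: even_symbol_def)
  have bnd: "symbol_bound (\<lambda>k d. cw k d * (duh k d h / h)) 1" if "0 < h" for h
    unfolding symbol_bound_def abs_mult
  proof (intro allI impI mult_le_one)
    fix k d assume "k \<noteq> 0" "d \<in> offs" "k + d \<noteq> 0"
    then show "\<bar>cw k d\<bar> \<le> 1" "\<bar>duh k d h / h\<bar> \<le> 1"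
      using duh_bounds[of k h d] that by (auto intro: abs_cw_le)
  qed auto
  have c_band: "((\<lambda>h. band (\<lambda>k d. cw k d * (duh k d h / h)) (fst w)) \<longlongrightarrow> band cw (fst w)) (at_right 0)"
  proof (rule band_tendsto[where M = 1])
    show "\<forall>\<^sub>F h in at_right 0. even_symbol (\<lambda>k d. cw k d * (duh k d h / h)) \<and> symbol_bound (\<lambda>k d. cw k d * (duh k d h / h)) 1"
      using eventually_at_right_less by (rule eventually_mono) (use even bnd in auto)
    show "((\<lambda>h. cw k d * (duh k d h / h)) \<longlongrightarrow> cw k d) (at_right 0)" for k d
      using tendsto_mult_left[OF generator_quotient_limits(2), of "cw k d" k d] by (simp only: mult_1_right)
  qed (auto intro: even_cw bound_cw)
  have u_eq: "u = (band (diag (\<lambda>k. - al k / (freq_norm k)\<^sup>2)) g1, band (diag (\<lambda>k. - ka k / (freq_norm k)\<^sup>2)) g2 + band cw (fst w))"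
  proof (rule H_pair_eqI; unfold fst_conv snd_conv)
    fix k
    show "fc (fst u) k = fc (band (diag (\<lambda>k. - al k / (freq_norm k)\<^sup>2)) g1) k"
      by (subst fc_lim, use al_c in blast, simp, cases "k = 0") (auto simp: u1 g1 ne)
    show "fc (snd u) k = fc (band (diag (\<lambda>k. - ka k / (freq_norm k)\<^sup>2)) g2 + band cw (fst w)) k"
      unfolding fc_add fc_band[OF even_cw bound_cw]
      by (subst fc_lim, use ka_c in blast, simp, cases "k = 0") (auto simp: u2 g2 ne)
  qed
  have "eventually (\<lambda>h. (band (diag (p al h)) g1, band (diag (p ka h)) g2 + band (\<lambda>k d. cw k d * (duh k d h / h)) (fst w))
      = (R h w - w) /\<^sub>R h) (at_right 0)"
  proof (rule eventually_mono[OF eventually_at_right_less])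
    fix h :: real assume h: "0 < h"
    show "(band (diag (p al h)) g1, band (diag (p ka h)) g2 + band (\<lambda>k d. cw k d * (duh k d h / h)) (fst w)) = (R h w - w) /\<^sub>R h"
    proof (rule H_pair_eqI; unfold fst_conv snd_conv)
      fix k
      show "fc (band (diag (p al h)) g1) k = fc (fst ((R h w - w) /\<^sub>R h)) k"
        using h by (subst fc_p, use al_c in blast, simp, simp, cases "k = 0") (simp_all add: g1 pe fc_scaleR fc_diff fc_R_fst scaleR_diff_left scaleR_diff_right diff_divide_distrib right_diff_distrib divide_inverse mult_ac)
      have "(\<Sum>d\<in>offs. (cw k d * (duh k d h / h)) *\<^sub>R fc (fst w) (k + d)) = (\<Sum>d\<in>offs. (cw k d * duh k d h) *\<^sub>R fc (fst w) (k + d)) /\<^sub>R h"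
        unfolding scaleR_sum_right by (intro sum.cong) (simp_all add: divide_inverse mult_ac)
      then show "fc (band (diag (p ka h)) g2 + band (\<lambda>k d. cw k d * (duh k d h / h)) (fst w)) k = fc (snd ((R h w - w) /\<^sub>R h)) k"
        using h unfolding fc_add fc_band[OF even bnd[OF h]]
        by (subst fc_p, use ka_c in blast, simp, simp, cases "k = 0") (simp_all add: g2 pe fc_scaleR fc_diff fc_R_snd scaleR_diff_left scaleR_diff_right scaleR_add_right diff_divide_distrib right_diff_distrib divide_inverse mult_ac)
    qed
  qed
  moreover have "((\<lambda>h. (band (diag (p al h)) g1, band (diag (p ka h)) g2 + band (\<lambda>k d. cw k d * (duh k d h / h)) (fst w))) \<longlongrightarrow> u) (at_right 0)"
    unfolding u_eq by (intro tendsto_Pair tendsto_add p_band c_band al_c ka_c al_uminus ka_uminus)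
  ultimately show ?thesis by (rule Lim_transform_eventually[rotated])
qed

text \<open>The two formulas already force w into H^2 x H^2: solved for |k|^2 times the coefficients
  of w, they express these by elements of H.\<close>

lemma gen_relI:
  assumes u1: "\<And>k. fc (fst u) k = - al k *\<^sub>R fc (fst w) k"
    and u2: "\<And>k. fc (snd u) k = - ka k *\<^sub>R fc (snd w) k + (\<Sum>d\<in>offs. cw k d *\<^sub>R fc (fst w) (k + d))"
  shows "gen_rel w u"
proof -
  have "fc ((- 1 / nu) *\<^sub>R fst u) k = (freq_norm k)\<^sup>2 *\<^sub>R fc (fst w) k" for k
    unfolding fc_scaleR u1 using nu_pos by (simp add: al_def)
  moreover have "fc (snd w + (1 / nu) *\<^sub>R (band cw (fst w) - snd u)) k = (freq_norm k)\<^sup>2 *\<^sub>R fc (snd w) k" for k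
    using nu_pos
    by (cases "k = 0") (simp_all add: fc_add fc_diff fc_scaleR u2 ka_def fc_band[OF even_cw bound_cw] algebra_simps)
  ultimately show ?thesis
    unfolding gen_rel_def using u1 u2 by blast
qed

text \<open>Norm convergence gives convergence of each coefficient, where the limits are elementary,
  and \<open>gen_relI\<close> adds the H^2 regularity. Hence the domain of the generator is no
  larger than \<open>gen_dom\<close>.\<close>

lemma limit_imp_gen_rel:
  assumes lim: "((\<lambda>h. (R h w - w) /\<^sub>R h) \<longlongrightarrow> u) (at_right 0)"
  shows "gen_rel w u"
proof -
  have h0: "eventually (\<lambda>h::real. 0 < h) (at_right 0)" by (rule eventually_at_right_less)
  have u1: "fc (fst u) k = - al k *\<^sub>R fc (fst w) k" for k
  proof (rule tendsto_unique[OF _ bounded_linear.tendsto[OF bounded_linear_compose[OF bounded_linear_fc bounded_linear_fst] lim]])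
    have "((\<lambda>h. ((exp (- al k * h) - 1) / h) *\<^sub>R fc (fst w) k) \<longlongrightarrow> - al k *\<^sub>R fc (fst w) k) (at_right 0)"
      by (intro tendsto_intros generator_quotient_limits)
    then show "((\<lambda>h. fc (fst ((R h w - w) /\<^sub>R h)) k) \<longlongrightarrow> - al k *\<^sub>R fc (fst w) k) (at_right 0)"
      by (rule Lim_transform_eventually)
        (use h0 in eventually_elim, simp add: fc_scaleR fc_diff fc_R_fst algebra_simps divide_inverse)
  qed simp
  have u2: "fc (snd u) k = - ka k *\<^sub>R fc (snd w) k + (\<Sum>d\<in>offs. cw k d *\<^sub>R fc (fst w) (k + d))" for k
  proof (rule tendsto_unique[OF _ bounded_linear.tendsto[OF bounded_linear_compose[OF bounded_linear_fc bounded_linear_snd] lim]])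
    have "((\<lambda>h. ((exp (- ka k * h) - 1) / h) *\<^sub>R fc (snd w) k + (\<Sum>d\<in>offs. (cw k d * (duh k d h / h)) *\<^sub>R fc (fst w) (k + d)))
        \<longlongrightarrow> - ka k *\<^sub>R fc (snd w) k + (\<Sum>d\<in>offs. (cw k d * 1) *\<^sub>R fc (fst w) (k + d))) (at_right 0)"
      by (intro tendsto_intros generator_quotient_limits)
    then have "((\<lambda>h. fc (snd ((R h w - w) /\<^sub>R h)) k) \<longlongrightarrow> - ka k *\<^sub>R fc (snd w) k + (\<Sum>d\<in>offs. (cw k d * 1) *\<^sub>R fc (fst w) (k + d))) (at_right 0)"
    proof (rule Lim_transform_eventually)
      show "\<forall>\<^sub>F h in at_right 0. ((exp (- ka k * h) - 1) / h) *\<^sub>R fc (snd w) k + (\<Sum>d\<in>offs. (cw k d * (duh k d h / h)) *\<^sub>R fc (fst w) (k + d))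
          = fc (snd ((R h w - w) /\<^sub>R h)) k"
        using h0
      proof eventually_elim
        case (elim h)
        have "(\<Sum>d\<in>offs. (cw k d * (duh k d h / h)) *\<^sub>R fc (fst w) (k + d)) = (\<Sum>d\<in>offs. (cw k d * duh k d h) *\<^sub>R fc (fst w) (k + d)) /\<^sub>R h"
          unfolding scaleR_sum_right by (intro sum.cong) (simp_all add: divide_inverse mult_ac)
        then show ?case
          using elim by (simp add: fc_scaleR fc_diff fc_R_snd algebra_simps divide_inverse)
      qed
    qed
    then show "((\<lambda>h. fc (snd ((R h w - w) /\<^sub>R h)) k) \<longlongrightarrow> - ka k *\<^sub>R fc (snd w) k + (\<Sum>d\<in>offs. cw k d *\<^sub>R fc (fst w) (k + d))) (at_right 0)"
      by simp
  qed simp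
  show ?thesis by (rule gen_relI[OF u1 u2])
qed

section \<open>Existence of a semigroup with generator L\<close>

definition S0 :: "real \<Rightarrow> H \<times> H \<Rightarrow> H \<times> H" where "S0 t x = lift (R t (unlift x))"

lemma S0_lift [simp]: "S0 t (lift w) = lift (R t w)"
  by (simp add: S0_def)

lemma C0_S0: "C0_semigroup_on (E b) (E_norm b) S0"
proof -
  have lim: "((\<lambda>t. norm (R t w - w)) \<longlongrightarrow> 0) (at_right 0)" for w
  proof -
    have "((\<lambda>t. R t w) \<longlongrightarrow> R 0 w) (at_right 0)"
      by (rule tendsto_within_subset[OF R_tendsto]) auto
    then show ?thesis by (auto intro: tendsto_norm_zero LIM_zero)
  qed
  show ?thesis
    unfolding C0_semigroup_on_def E_eq_lift
  proof (intro conjI allI impI; (intro ballI)?; (elim imageE)?; hypsubst?)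
    fix t :: real assume t: "0 \<le> t"
    interpret Rt: bounded_linear "R t" by (rule bounded_linear_R[OF t])
    { fix w assume w: "w \<in> Z"
      show "S0 t (lift w) \<in> lift ` Z" using R_in_Z[OF t w] by auto
      show "S0 t (c *\<^sub>R lift w) = c *\<^sub>R S0 t (lift w)" for c
        by (simp add: Rt.scaleR flip: lift_scaleR)
      fix v
      show "S0 t (lift w + lift v) = S0 t (lift w) + S0 t (lift v)"
        by (simp add: Rt.add flip: lift_add) }
    show "\<exists>M. \<forall>x\<in>lift ` Z. E_norm b (S0 t x) \<le> M * E_norm b x"
      using norm_R_le[OF t order_refl] by (intro exI[of _ "10 + 5 * t"]) auto
    fix s w assume s: "0 \<le> (s :: real)"
    show "S0 (t + s) (lift w) = S0 t (S0 s (lift w))"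
      using s t by (simp add: R_add)
  next
    fix w
    show "S0 0 (lift w) = lift w" by simp
    show "((\<lambda>t. E_norm b (S0 t (lift w) - lift w)) \<longlongrightarrow> 0) (at_right 0)"
      using lim by (simp flip: lift_diff)
  qed
qed

lemma generator_S0: "has_generator_on (E b) (E_norm b) S0 (gen_dom b) (gen nu)"
  unfolding has_generator_on_def E_eq_lift
proof (intro ballI, elim imageE, hypsubst)
  fix v w assume Z: "w \<in> Z" "v \<in> Z"
  have "E_norm b ((S0 h (lift w) - lift w) /\<^sub>R h - lift v) = norm ((R h w - w) /\<^sub>R h - v)" for h
    by (simp flip: lift_diff lift_scaleR)
  then have "((\<lambda>h. E_norm b ((S0 h (lift w) - lift w) /\<^sub>R h - lift v)) \<longlongrightarrow> 0) (at_right 0)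
      \<longleftrightarrow> ((\<lambda>h. (R h w - w) /\<^sub>R h) \<longlongrightarrow> v) (at_right 0)"
    by (simp add: tendsto_norm_zero_iff LIM_zero_iff)
  also have "\<dots> \<longleftrightarrow> gen_rel w v"
    using gen_rel_imp_limit limit_imp_gen_rel by blast
  finally show "((\<lambda>h. E_norm b ((S0 h (lift w) - lift w) /\<^sub>R h - lift v)) \<longlongrightarrow> 0) (at_right 0)
      \<longleftrightarrow> lift w \<in> gen_dom b \<and> lift v = gen nu (lift w)"
    unfolding gen_rel_iff[OF Z(1)] .
qed

end

section \<open>Uniqueness of the semigroup with generator L\<close>

lemma phi_inner_phi: "phi \<bullet> phi = 1"
  by (simp add: inner_phi fc_phi offs_def zero_prod_def)

lemma proj_phi_perp_eq: "proj_phi_perp f = f - (f \<bullet> phi) *\<^sub>R phi"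
  by (simp add: proj_phi_perp_def phi_inner_phi)

lemma bounded_linear_proj_phi_perp: "bounded_linear proj_phi_perp"
  unfolding proj_phi_perp_eq[abs_def]
  by (intro bounded_linear_sub bounded_linear_ident bounded_linear_compose[OF bounded_linear_scaleR_left bounded_linear_inner_left])

context linearised_vorticity
begin

text \<open>Banach-Steinhaus speaks of operators on a whole Banach space, whereas a semigroup
  transported by \<open>lift\<close> acts on Z only; composition with this projection extends
  it.\<close>

definition projZ :: "H \<times> H \<Rightarrow> H \<times> H" where "projZ w = (fst w, proj_phi_perp (snd w))"

lemma projZ_in_Z [simp]: "projZ w \<in> Z"
  by (simp add: Z_iff projZ_def proj_phi_perp_eq inner_diff_left phi_inner_phi)

lemma projZ_ident [simp]: "w \<in> Z \<Longrightarrow> projZ w = w"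
  by (simp add: Z_iff projZ_def proj_phi_perp_eq)

lemma bounded_linear_projZ: "bounded_linear projZ"
  unfolding projZ_def[abs_def]
  by (intro bounded_linear_Pair bounded_linear_fst bounded_linear_compose[OF bounded_linear_proj_phi_perp bounded_linear_snd])

lemma gen_rel_in_Z:
  assumes "gen_rel w u" "w \<in> Z"
  shows "u \<in> Z"
proof -
  have lim: "((\<lambda>h. snd ((R h w - w) /\<^sub>R h) \<bullet> phi) \<longlongrightarrow> snd u \<bullet> phi) (at_right 0)"
    by (intro tendsto_intros gen_rel_imp_limit assms)
  have ev: "eventually (\<lambda>h. snd ((R h w - w) /\<^sub>R h) \<bullet> phi = 0) (at_right 0)"
    using eventually_at_right_less
  proof (rule eventually_mono)
    fix h :: real assume "0 < h"
    then have "(R h w - w) /\<^sub>R h \<in> Z" using assms by (intro Z_scaleR Z_diff R_in_Z) auto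
    then show "snd ((R h w - w) /\<^sub>R h) \<bullet> phi = 0" by (simp only: Z_iff)
  qed
  have "snd u \<bullet> phi = 0"
    by (rule tendsto_unique[OF trivial_limit_at_right_real lim tendsto_eventually[OF ev]])
  then show ?thesis by (rule ZI)
qed

text \<open>Truncations lie in the domain of the generator and converge strongly to the identity, so
  bounded operators that agree on the domain agree on Z.\<close>

definition trunc :: "nat \<Rightarrow> H \<times> H \<Rightarrow> H \<times> H" where
  "trunc N w = (band (diag (\<lambda>k. of_bool (freq_norm k \<le> real N))) (fst w), band (diag (\<lambda>k. of_bool (freq_norm k \<le> real N))) (snd w))"

lemma fc_trunc:
  "fc (fst (trunc N w)) k = of_bool (freq_norm k \<le> real N) *\<^sub>R fc (fst w) k"
  "fc (snd (trunc N w)) k = of_bool (freq_norm k \<le> real N) *\<^sub>R fc (snd w) k"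
  unfolding trunc_def fst_conv snd_conv by (rule fc_band_diag[where M = 1]; simp)+

lemma trunc_tendsto: "(\<lambda>N. trunc N w) \<longlonglongrightarrow> w"
proof -
  have "(\<lambda>N. band (diag (\<lambda>k. of_bool (freq_norm k \<le> real N))) f) \<longlonglongrightarrow> band (diag (\<lambda>k. 1)) f" for f
  proof (rule band_tendsto[where M = 1])
    show "(\<lambda>N. diag (\<lambda>k. of_bool (freq_norm k \<le> real N)) k d) \<longlonglongrightarrow> diag (\<lambda>k. 1) k d" for k d
    proof (rule tendsto_eventually)
      have "eventually (\<lambda>N. freq_norm k \<le> real N) sequentially"
      proof -
        obtain n where n: "freq_norm k \<le> real n" using real_arch_simple by blast
        then have "freq_norm k \<le> real N" if "n \<le> N" for N
          using that by (meson of_nat_mono order_trans)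
        then show ?thesis by (auto simp: eventually_sequentially)
      qed
      then show "eventually (\<lambda>N. diag (\<lambda>k. of_bool (freq_norm k \<le> real N)) k d = diag (\<lambda>k. 1) k d) sequentially"
        by eventually_elim (simp add: diag_def)
    qed
  qed (simp_all add: symbol_bound_diag)
  moreover have "band (diag (\<lambda>k. 1)) f = f" for f
    by (rule fc_eqI) (simp add: fc_band_diag[where M = 1])
  ultimately have "(\<lambda>N. trunc N w) \<longlonglongrightarrow> (fst w, snd w)"
    unfolding trunc_def by (intro tendsto_Pair) auto
  then show ?thesis by simp
qed

lemma trunc_in_dom:
  assumes "w \<in> Z" "1 \<le> N"
  shows "trunc N w \<in> Z" "\<exists>u. gen_rel (trunc N w) u"
proof -
  \<comment> \<open>For N \<ge> 1 the modes (1,0) and (0,1) survive the truncation, so orthogonality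
    to \<phi> is preserved.\<close>
  have "freq_norm (1, 0) = 1" "freq_norm (0, 1) = 1" by (simp_all add: freq_norm_def)
  then show Z: "trunc N w \<in> Z"
    using assms by (simp add: Z_iff inner_phi fc_trunc)
  have H2: "f \<in> Hs 2" if f: "\<And>k. fc f k = of_bool (freq_norm k \<le> real N) *\<^sub>R fc g k" for f g
  proof -
    have "\<exists>h. \<forall>k. fc h k = (freq_norm k powr 2) *\<^sub>R fc f k"
    proof (rule ex_fc_eq[where g = g and M = "(real N)\<^sup>2"])
      fix k
      have "freq_norm k \<le> real N \<Longrightarrow> (freq_norm k)\<^sup>2 \<le> (real N)\<^sup>2" by (intro power_mono) auto
      then show "cmod ((freq_norm k powr 2) *\<^sub>R fc f k) \<le> (real N)\<^sup>2 * cmod (fc g k)"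
        by (auto simp: f mult_right_mono)
    qed (simp add: fc_minus_freq)
    then show ?thesis by (simp add: Hs_iff)
  qed
  obtain g2 where g2: "\<And>k. fc g2 k = (freq_norm k powr 2) *\<^sub>R fc (snd (trunc N w)) k"
    using H2[OF fc_trunc(2)] by (metis Hs_iff)
  obtain g1 where g1: "\<And>k. fc g1 k = (freq_norm k powr 2) *\<^sub>R fc (fst (trunc N w)) k"
    using H2[OF fc_trunc(1)] by (metis Hs_iff)
  let ?u = "(- nu *\<^sub>R g1, nu *\<^sub>R (snd (trunc N w) - g2) + band cw (fst (trunc N w)))"
  have "gen_rel (trunc N w) ?u"
  proof (rule gen_relI)
    show "fc (snd ?u) k = - ka k *\<^sub>R fc (snd (trunc N w)) k + (\<Sum>d\<in>offs. cw k d *\<^sub>R fc (fst (trunc N w)) (k + d))" for k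
      by (cases "k = 0") (simp_all add: fc_add fc_scaleR fc_diff g2 fc_band[OF even_cw bound_cw] ka_def algebra_simps)
  qed (simp add: g1 fc_scaleR al_def fc_uminus)
  then show "\<exists>u. gen_rel (trunc N w) u" by blast
qed

end

text \<open>\<open>flow\<close> is an unspecified choice among the semigroups with generator L. An
  arbitrary one is considered here and shown to be \<open>R\<close> read through
  \<open>lift\<close>.\<close>

locale E_semigroup = linearised_vorticity +
  fixes S :: "real \<Rightarrow> H \<times> H \<Rightarrow> H \<times> H"
  assumes C0: "C0_semigroup_on (E b) (E_norm b) S"
    and gen: "has_generator_on (E b) (E_norm b) S (gen_dom b) (gen nu)"
begin

definition T :: "real \<Rightarrow> H \<times> H \<Rightarrow> H \<times> H" where
  "T t w = unlift (S t (lift (projZ w)))"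

lemma S_in_E: "0 \<le> t \<Longrightarrow> x \<in> E b \<Longrightarrow> S t x \<in> E b"
  and S_plus: "0 \<le> t \<Longrightarrow> x \<in> E b \<Longrightarrow> y \<in> E b \<Longrightarrow> S t (x + y) = S t x + S t y"
  and S_scaleR: "0 \<le> t \<Longrightarrow> x \<in> E b \<Longrightarrow> S t (c *\<^sub>R x) = c *\<^sub>R S t x"
  and S_zero: "x \<in> E b \<Longrightarrow> S 0 x = x"
  and S_add: "0 \<le> s \<Longrightarrow> 0 \<le> t \<Longrightarrow> x \<in> E b \<Longrightarrow> S (s + t) x = S s (S t x)"
  and S_bounded: "0 \<le> t \<Longrightarrow> \<exists>M. \<forall>x\<in>E b. E_norm b (S t x) \<le> M * E_norm b x"
  and S_tendsto: "x \<in> E b \<Longrightarrow> ((\<lambda>t. E_norm b (S t x - x)) \<longlongrightarrow> 0) (at_right 0)"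
  using C0 unfolding C0_semigroup_on_def by blast+

lemma lift_T: "0 \<le> t \<Longrightarrow> lift (T t w) = S t (lift (projZ w))" and T_in_Z: "0 \<le> t \<Longrightarrow> T t w \<in> Z"
  unfolding T_def using S_in_E[of t "lift (projZ w)"] lift_unlift by (auto simp: lift_in_E)

lemma lift_inject: "lift v = lift w \<longleftrightarrow> v = w"
  by (metis unlift_lift)

lemma T_zero: "w \<in> Z \<Longrightarrow> T 0 w = w"
  by (simp add: T_def S_zero lift_in_E)

lemma T_add: "0 \<le> s \<Longrightarrow> 0 \<le> t \<Longrightarrow> T (s + t) w = T s (T t w)"
  by (rule lift_inject[THEN iffD1]) (simp add: lift_T T_in_Z lift_in_E S_add)

lemma bounded_linear_T:
  assumes t: "0 \<le> t"
  shows "bounded_linear (T t)"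
proof -
  interpret P: bounded_linear projZ by (rule bounded_linear_projZ)
  obtain M where M: "\<And>x. x \<in> E b \<Longrightarrow> E_norm b (S t x) \<le> M * E_norm b x"
    using S_bounded[OF t] by auto
  obtain K where K: "\<And>w. norm (projZ w) \<le> norm w * K" using P.bounded by blast
  show ?thesis
  proof (rule bounded_linear_intro[where K = "\<bar>K\<bar> * \<bar>M\<bar>"])
    show "T t (v + w) = T t v + T t w" for v w
      by (rule lift_inject[THEN iffD1], unfold lift_add lift_T[OF t] P.add) (simp add: S_plus t lift_in_E)
    show "T t (c *\<^sub>R w) = c *\<^sub>R T t w" for c w
      by (rule lift_inject[THEN iffD1], unfold lift_scaleR lift_T[OF t] P.scaleR) (simp add: S_scaleR t lift_in_E)
    show "norm (T t w) \<le> norm w * (\<bar>K\<bar> * \<bar>M\<bar>)" for w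
    proof -
      have "norm (T t w) = E_norm b (S t (lift (projZ w)))"
        by (simp flip: lift_T[OF t])
      also have "\<dots> \<le> M * norm (projZ w)"
        using M[of "lift (projZ w)"] by (simp add: lift_in_E)
      also have "\<dots> \<le> \<bar>M\<bar> * (norm w * \<bar>K\<bar>)"
      proof (intro mult_mono)
        show "norm (projZ w) \<le> norm w * \<bar>K\<bar>"
          by (rule order_trans[OF K]) (simp add: mult_left_mono)
      qed auto
      finally show ?thesis by (simp add: mult_ac)
    qed
  qed
qed

lemma T_tendsto: "w \<in> Z \<Longrightarrow> ((\<lambda>t. T t w) \<longlongrightarrow> w) (at_right 0)"
proof -
  assume w: "w \<in> Z"
  have "((\<lambda>t. E_norm b (S t (lift w) - lift w)) \<longlongrightarrow> 0) (at_right 0)"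
    using w by (intro S_tendsto) (simp add: lift_in_E)
  then have "((\<lambda>t. norm (T t w - w)) \<longlongrightarrow> 0) (at_right 0)"
  proof (rule Lim_transform_eventually)
    show "\<forall>\<^sub>F t in at_right 0. E_norm b (S t (lift w) - lift w) = norm (T t w - w)"
    proof (rule eventually_mono[OF eventually_at_right_less])
      fix t :: real assume "0 < t"
      then have "S t (lift w) = lift (T t w)" using w by (simp add: lift_T)
      then show "E_norm b (S t (lift w) - lift w) = norm (T t w - w)"
        by (simp flip: lift_diff)
    qed
  qed
  then show ?thesis by (simp add: tendsto_norm_zero_iff LIM_zero_iff)
qed

lemma T_generator:
  assumes "w \<in> Z" "u \<in> Z"
  shows "((\<lambda>h. (T h w - w) /\<^sub>R h) \<longlongrightarrow> u) (at_right 0) \<longleftrightarrow> gen_rel w u"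
proof -
  have "((\<lambda>h. (T h w - w) /\<^sub>R h) \<longlongrightarrow> u) (at_right 0)
      \<longleftrightarrow> ((\<lambda>h. norm ((T h w - w) /\<^sub>R h - u)) \<longlongrightarrow> 0) (at_right 0)"
    by (simp add: tendsto_norm_zero_iff LIM_zero_iff)
  also have "\<dots> \<longleftrightarrow> ((\<lambda>h. E_norm b ((S h (lift w) - lift w) /\<^sub>R h - lift u)) \<longlongrightarrow> 0) (at_right 0)"
  proof (rule tendsto_cong, rule eventually_mono[OF eventually_at_right_less])
    fix h :: real assume "0 < h"
    then have "S h (lift w) = lift (T h w)" using assms by (simp add: lift_T)
    then show "norm ((T h w - w) /\<^sub>R h - u) = E_norm b ((S h (lift w) - lift w) /\<^sub>R h - lift u)"
      by (simp flip: lift_diff lift_scaleR)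
  qed
  also have "\<dots> \<longleftrightarrow> gen_rel w u"
    using gen assms unfolding has_generator_on_def gen_rel_iff[OF assms(1)] by (simp add: lift_in_E)
  finally show ?thesis .
qed

text \<open>Otherwise there are t n tending to 0 along which the operator norms are unbounded. By
  strong continuity at 0 every orbit is bounded along this sequence, which contradicts
  Banach-Steinhaus.\<close>

lemma T_locally_bounded: "\<exists>\<delta>>0. \<exists>M\<ge>1. \<forall>t\<in>{0..\<delta>}. \<forall>w. norm (T t w) \<le> M * norm w"
proof (rule ccontr)
  assume neg: "\<not> ?thesis"
  have "\<exists>t w. 0 \<le> t \<and> t \<le> 1 / real (Suc n) \<and> \<not> norm (T t w) \<le> real (Suc n) * norm w" for n
  proof -
    have "\<not> (\<forall>t\<in>{0..1 / real (Suc n)}. \<forall>w. norm (T t w) \<le> real (Suc n) * norm w)"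
    proof
      assume "\<forall>t\<in>{0..1 / real (Suc n)}. \<forall>w. norm (T t w) \<le> real (Suc n) * norm w"
      moreover have "0 < 1 / real (Suc n)" "1 \<le> real (Suc n)" by auto
      ultimately show False using neg by blast
    qed
    then show ?thesis by auto
  qed
  then obtain t w where t: "\<And>n. 0 \<le> t n" "\<And>n. t n \<le> 1 / real (Suc n)"
    and w: "\<And>n. \<not> norm (T (t n) (w n)) \<le> real (Suc n) * norm (w n)" by metis
  have t0: "t \<longlonglongrightarrow> 0"
    by (rule tendsto_sandwich[OF _ _ tendsto_const LIMSEQ_Suc[OF lim_inverse_n']]) (use t in auto)
  have "\<exists>M\<ge>0. \<forall>n x. norm (T (t n) x) \<le> M * norm x"
  proof (rule uniform_boundedness)
    show "bounded_linear (T (t n))" for n by (rule bounded_linear_T[OF t(1)])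
    fix x
    have eq: "T s x = T s (projZ x)" for s by (simp add: T_def)
    have "eventually (\<lambda>s. dist (T s (projZ x)) (projZ x) < 1) (at_right 0)"
      by (rule tendstoD[OF T_tendsto]) auto
    then obtain d where d: "0 < d" "\<And>s. 0 < s \<Longrightarrow> s < d \<Longrightarrow> dist (T s (projZ x)) (projZ x) < 1"
      by (auto simp: eventually_at_right_field)
    have "eventually (\<lambda>n. t n < d) sequentially" by (rule order_tendstoD(2)[OF t0 d(1)])
    then have "eventually (\<lambda>n. norm (T (t n) x) \<le> norm (projZ x) + 1) sequentially"
    proof eventually_elim
      case (elim n)
      have "dist (T (t n) (projZ x)) (projZ x) \<le> 1"
        using d(2)[of "t n"] elim t(1)[of n] T_zero[of "projZ x"] by (cases "t n = 0") auto
      then show ?case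
        unfolding eq[of "t n"] using norm_triangle_sub[of "T (t n) (projZ x)" "projZ x"] by (simp add: dist_norm)
    qed
    then have "Bseq (\<lambda>n. T (t n) x)" by (rule BfunI)
    then show "\<exists>c. \<forall>n. norm (T (t n) x) \<le> c" unfolding Bseq_def by blast
  qed
  then obtain M where M: "\<And>n x. norm (T (t n) x) \<le> M * norm x" by blast
  obtain n :: nat where "M \<le> real n" using real_arch_simple by blast
  then have "M * norm (w n) \<le> real (Suc n) * norm (w n)" by (intro mult_right_mono) auto
  then show False using w[of n] M[of n "w n"] by linarith
qed

lemma T_bounded:
  obtains K where "1 \<le> K" "\<And>s w. 0 \<le> s \<Longrightarrow> s \<le> t \<Longrightarrow> norm (T s w) \<le> K * norm w"
proof -
  obtain \<delta> M where \<delta>: "0 < \<delta>" and M: "1 \<le> M" and bd: "\<And>s w. 0 \<le> s \<Longrightarrow> s \<le> \<delta> \<Longrightarrow> norm (T s w) \<le> M * norm w"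
    using T_locally_bounded by auto
  have pow: "norm (T s w) \<le> M ^ Suc n * norm w" if "0 \<le> s" "s \<le> real (Suc n) * \<delta>" for n s w
    using that
  proof (induction n arbitrary: s)
    case 0
    then show ?case using bd by simp
  next
    case (Suc n)
    show ?case
    proof (cases "s \<le> \<delta>")
      case True
      have "M * norm w \<le> M ^ Suc (Suc n) * norm w"
        using M one_le_power[OF M, of "Suc n"] by (intro mult_right_mono) (auto simp: mult_le_cancel_left1)
      then show ?thesis using bd[OF Suc.prems(1) True, of w] by linarith
    next
      case False
      have "T s w = T \<delta> (T (s - \<delta>) w)"
        using False \<delta> T_add[of \<delta> "s - \<delta>" w] by simp
      also have "norm \<dots> \<le> M * norm (T (s - \<delta>) w)" using \<delta> by (intro bd) auto
      also have "\<dots> \<le> M * (M ^ Suc n * norm w)"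
        using Suc False M by (intro mult_left_mono Suc.IH) (auto simp: algebra_simps)
      finally show ?thesis by simp
    qed
  qed
  obtain n :: nat where "t / \<delta> \<le> real n" using real_arch_simple by blast
  then have n: "t \<le> real (Suc n) * \<delta>" using \<delta> by (simp add: field_simps)
  show thesis
    by (rule that[OF one_le_power[OF M, of "Suc n"]], rule pow) (use n in auto)
qed

text \<open>From the right, the error is T t applied to the error at time 0. From the left, the
  operator is T s with s < t varying, so a norm bound uniform on [0, t] is needed.\<close>

lemma T_derivative:
  assumes w: "w \<in> Z" and wu: "gen_rel w u" and t: "0 \<le> t"
  shows "((\<lambda>s. T s w) has_vector_derivative T t u) (at t within {0..})"
  unfolding has_vector_derivative_def has_derivative_within_alt
proof (intro conjI allI impI)
  show "bounded_linear (\<lambda>s. s *\<^sub>R T t u)" by (rule bounded_linear_scaleR_left)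
  fix e :: real assume e: "0 < e"
  have u: "u \<in> Z" by (rule gen_rel_in_Z[OF wu w])
  obtain K where K: "1 \<le> K" "\<And>s w. 0 \<le> s \<Longrightarrow> s \<le> t \<Longrightarrow> norm (T s w) \<le> K * norm w"
    using T_bounded[of t] by metis
  define e' where "e' = e / (2 * K)"
  have e': "0 < e'" using e K(1) by (simp add: e'_def)
  have "eventually (\<lambda>h. dist ((T h w - w) /\<^sub>R h) u < e') (at_right 0)"
    using T_generator[OF w u] wu e' by (intro tendstoD) auto
  moreover have "eventually (\<lambda>h. dist (T h u) u < e') (at_right 0)"
    by (rule tendstoD[OF T_tendsto[OF u] e'])
  ultimately have "eventually (\<lambda>h. dist ((T h w - w) /\<^sub>R h) u < e' \<and> dist (T h u) u < e') (at_right 0)"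
    by (rule eventually_conj)
  then obtain d where d: "0 < d" "\<And>h. 0 < h \<Longrightarrow> h < d \<Longrightarrow> dist ((T h w - w) /\<^sub>R h) u < e' \<and> dist (T h u) u < e'"
    by (auto simp: eventually_at_right_field)
  have d1: "norm (T h w - w - h *\<^sub>R u) \<le> h * e'" "norm (T h u - u) \<le> e'" if h: "0 < h" "h < d" for h
  proof -
    have "T h w - w - h *\<^sub>R u = h *\<^sub>R ((T h w - w) /\<^sub>R h - u)" using h by (simp add: algebra_simps)
    then show "norm (T h w - w - h *\<^sub>R u) \<le> h * e'"
      using d(2)[OF h] h by (simp add: dist_norm)
    show "norm (T h u - u) \<le> e'" using d(2)[OF h] by (simp add: dist_norm)
  qed
  show "\<exists>d>0. \<forall>s\<in>{0..}. norm (s - t) < d \<longrightarrow> norm (T s w - T t w - (s - t) *\<^sub>R T t u) \<le> e * norm (s - t)"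
  proof (intro exI[of _ d] conjI ballI impI d(1))
    fix s :: real assume s: "s \<in> {0..}" "norm (s - t) < d"
    consider "s = t" | "t < s" | "s < t" by linarith
    then show "norm (T s w - T t w - (s - t) *\<^sub>R T t u) \<le> e * norm (s - t)"
    proof cases
      case 2
      define h where "h = s - t"
      have h: "0 < h" "h < d" using 2 s by (auto simp: h_def)
      interpret Tt: bounded_linear "T t" by (rule bounded_linear_T[OF t])
      have "T s w = T t (T h w)" using T_add[of t h w] t h by (simp add: h_def)
      then have "T s w - T t w - (s - t) *\<^sub>R T t u = T t (T h w - w - h *\<^sub>R u)"
        by (simp add: Tt.diff Tt.scaleR h_def)
      also have "norm \<dots> \<le> K * (h * e')"
        using K(1) by (intro order_trans[OF K(2)] mult_left_mono d1 h) (use t in auto)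
      also have "\<dots> \<le> e * h" using K(1) h e by (simp add: e'_def field_simps)
      finally show ?thesis using h by (simp add: h_def)
    next
      case 3
      define h where "h = t - s"
      have h: "0 < h" "h < d" "0 \<le> s" "s \<le> t" using 3 s by (auto simp: h_def)
      interpret Ts: bounded_linear "T s" by (rule bounded_linear_T[OF h(3)])
      have "T t w = T s (T h w)" "T t u = T s (T h u)"
        using T_add[of s h w] T_add[of s h u] h by (simp_all add: h_def)
      \<comment> \<open>The derivative at t is T t u = T s (T h u) and not T s u; the additional
        error h (T h u - u) is small by strong continuity at u.\<close>
      then have "T s w - T t w - (s - t) *\<^sub>R T t u = - T s (T h w - w - h *\<^sub>R u - h *\<^sub>R (T h u - u))"
      proof -
        have 1: "T h w - w - h *\<^sub>R u - h *\<^sub>R (T h u - u) = T h w - w - h *\<^sub>R T h u" by (simp add: algebra_simps)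
        have 2: "s - t = - h" by (simp add: h_def)
        show ?thesis
          unfolding 1 2 \<open>T t w = T s (T h w)\<close> \<open>T t u = T s (T h u)\<close> by (simp add: Ts.diff Ts.scaleR)
      qed
      then have "norm (T s w - T t w - (s - t) *\<^sub>R T t u) = norm (T s (T h w - w - h *\<^sub>R u - h *\<^sub>R (T h u - u)))"
        by simp
      also have "\<dots> \<le> K * norm (T h w - w - h *\<^sub>R u - h *\<^sub>R (T h u - u))"
        by (rule K(2)[OF h(3,4)])
      also have "\<dots> \<le> K * (h * e' + h * e')"
      proof (rule mult_left_mono)
        have "norm (h *\<^sub>R (T h u - u)) \<le> h * e'" using d1(2)[OF h(1,2)] h(1) by simp
        then show "norm (T h w - w - h *\<^sub>R u - h *\<^sub>R (T h u - u)) \<le> h * e' + h * e'"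
          using d1(1)[OF h(1,2)] norm_triangle_ineq4[of "T h w - w - h *\<^sub>R u" "h *\<^sub>R (T h u - u)"] by linarith
      qed (use K(1) in simp)
      also have "\<dots> = e * h" using K(1) by (simp add: e'_def field_simps)
      finally show ?thesis using h by (simp add: h_def abs_minus_commute)
    qed simp
  qed
qed

text \<open>T t commutes with T h, hence with the difference quotients, and it is
  continuous.\<close>

lemma gen_rel_T:
  assumes w: "w \<in> Z" and wu: "gen_rel w u" and t: "0 \<le> t"
  shows "gen_rel (T t w) (T t u)"
proof -
  have u: "u \<in> Z" by (rule gen_rel_in_Z[OF wu w])
  interpret Tt: bounded_linear "T t" by (rule bounded_linear_T[OF t])
  have "((\<lambda>h. T t ((T h w - w) /\<^sub>R h)) \<longlongrightarrow> T t u) (at_right 0)"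
    using T_generator[OF w u] wu by (intro Tt.tendsto) simp
  then have "((\<lambda>h. (T h (T t w) - T t w) /\<^sub>R h) \<longlongrightarrow> T t u) (at_right 0)"
  proof (rule Lim_transform_eventually)
    show "\<forall>\<^sub>F h in at_right 0. T t ((T h w - w) /\<^sub>R h) = (T h (T t w) - T t w) /\<^sub>R h"
    proof (rule eventually_mono[OF eventually_at_right_less])
      fix h :: real assume "0 < h"
      then have "T h (T t w) = T t (T h w)"
        using T_add[of h t w] T_add[of t h w] t by (simp add: add.commute)
      then show "T t ((T h w - w) /\<^sub>R h) = (T h (T t w) - T t w) /\<^sub>R h"
        by (simp add: Tt.scaleR Tt.diff)
    qed
  qed
  then show ?thesis using T_generator[OF T_in_Z[OF t] T_in_Z[OF t]] by blast
qed

text \<open>On the domain the coefficients solve scalar linear equations. Those of the first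
  component decay freely; with these inserted, subtracting the Duhamel terms from a coefficient of
  the second gives \<open>z\<close>, which solves a homogeneous equation.\<close>

lemma T_eq_R_dom:
  assumes w: "w \<in> Z" and wu: "gen_rel w u" and t: "0 \<le> t"
  shows "T t w = R t w"
proof (rule H_pair_eqI)
  fix k
  have 1: "fc (fst (T s w)) j = exp (- al j * s) *\<^sub>R fc (fst w) j" if "0 \<le> s" for s j
  proof -
    have "fc (fst (T s w)) j = exp (- al j * s) *\<^sub>R fc (fst (T 0 w)) j"
    proof (rule exp_decay_unique[OF _ that])
      fix r :: real assume r: "0 \<le> r"
      have "fc (fst (T r u)) j = - al j *\<^sub>R fc (fst (T r w)) j"
        using gen_rel_T[OF w wu r] by (simp add: gen_rel_def)
      with bounded_linear.has_vector_derivative[OF bounded_linear_compose[OF bounded_linear_fc bounded_linear_fst] T_derivative[OF w wu r], of j]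
      show "((\<lambda>s. fc (fst (T s w)) j) has_vector_derivative - al j *\<^sub>R fc (fst (T r w)) j) (at r within {0..s})"
        by (auto intro: has_vector_derivative_within_subset)
    qed
    then show ?thesis by (simp add: T_zero w)
  qed
  then show "fc (fst (T t w)) k = fc (fst (R t w)) k" using t by (simp add: fc_R_fst)
  define z where "z s = fc (snd (T s w)) k - (\<Sum>d\<in>offs. (cw k d * duh k d s) *\<^sub>R fc (fst w) (k + d))" for s
  have "z t = exp (- ka k * t) *\<^sub>R z 0"
  proof (rule exp_decay_unique[OF _ t])
    fix r :: real assume r: "0 \<le> r"
    have eq: "fc (snd (T r u)) k = - ka k *\<^sub>R fc (snd (T r w)) k + (\<Sum>d\<in>offs. cw k d *\<^sub>R (exp (- al (k + d) * r) *\<^sub>R fc (fst w) (k + d)))"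
      using gen_rel_T[OF w wu r] by (simp add: gen_rel_def 1[OF r])
    have "((\<lambda>s. fc (snd (T s w)) k) has_vector_derivative fc (snd (T r u)) k) (at r within {0..})"
      by (rule bounded_linear.has_vector_derivative[OF bounded_linear_compose[OF bounded_linear_fc bounded_linear_snd] T_derivative[OF w wu r]])
    moreover have "((\<lambda>s. \<Sum>d\<in>offs. (cw k d * duh k d s) *\<^sub>R fc (fst w) (k + d)) has_vector_derivative
        (\<Sum>d\<in>offs. (cw k d * (exp (- al (k + d) * r) - ka k * duh k d r)) *\<^sub>R fc (fst w) (k + d))) (at r within {0..})"
    proof (intro has_vector_derivative_sum)
      fix d
      have "((\<lambda>s. cw k d * duh k d s) has_real_derivative cw k d * (exp (- al (k + d) * r) - ka k * duh k d r)) (at r within {0..})"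
        unfolding duh_def by (intro DERIV_cmult DERIV_duhamel)
      from has_vector_derivative_scaleR[OF this has_vector_derivative_const[of "fc (fst w) (k + d)"]]
      show "((\<lambda>s. (cw k d * duh k d s) *\<^sub>R fc (fst w) (k + d)) has_vector_derivative
          (cw k d * (exp (- al (k + d) * r) - ka k * duh k d r)) *\<^sub>R fc (fst w) (k + d)) (at r within {0..})"
        by simp
    qed
    ultimately have "(z has_vector_derivative fc (snd (T r u)) k
        - (\<Sum>d\<in>offs. (cw k d * (exp (- al (k + d) * r) - ka k * duh k d r)) *\<^sub>R fc (fst w) (k + d))) (at r within {0..})"
      unfolding z_def[abs_def] by (rule has_vector_derivative_diff)
    moreover have "fc (snd (T r u)) k - (\<Sum>d\<in>offs. (cw k d * (exp (- al (k + d) * r) - ka k * duh k d r)) *\<^sub>R fc (fst w) (k + d))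
        = - ka k *\<^sub>R z r"
      unfolding eq z_def
      by (simp add: right_diff_distrib scaleR_diff_left sum_subtractf scaleR_diff_right scaleR_sum_right mult_ac sum_negf)
    ultimately show "(z has_vector_derivative - ka k *\<^sub>R z r) (at r within {0..t})"
      by (auto intro: has_vector_derivative_within_subset)
  qed
  then show "fc (snd (T t w)) k = fc (snd (R t w)) k"
    using t by (simp add: z_def fc_R_snd T_zero w duh_def algebra_simps)
qed

lemma S_eq_R:
  assumes w: "w \<in> Z" and t: "0 \<le> t"
  shows "S t (lift w) = lift (R t w)"
proof -
  have "(\<lambda>N. T t (trunc N w)) \<longlonglongrightarrow> T t w"
    by (intro bounded_linear.tendsto[OF bounded_linear_T[OF t]] trunc_tendsto)
  moreover have "(\<lambda>N. R t (trunc N w)) \<longlonglongrightarrow> R t w"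
    by (intro bounded_linear.tendsto[OF bounded_linear_R[OF t]] trunc_tendsto)
  moreover have "eventually (\<lambda>N. T t (trunc N w) = R t (trunc N w)) sequentially"
    unfolding eventually_sequentially
  proof (intro exI[of _ 1] allI impI)
    fix N :: nat assume N: "1 \<le> N"
    obtain u where "gen_rel (trunc N w) u" using trunc_in_dom(2)[OF w N] by blast
    then show "T t (trunc N w) = R t (trunc N w)" by (intro T_eq_R_dom trunc_in_dom(1)[OF w N] t)
  qed
  ultimately have "T t w = R t w"
    by (intro LIMSEQ_unique[OF Lim_transform_eventually])
  then show ?thesis using lift_T[OF t, of w] w by simp
qed

end

context linearised_vorticity
begin

lemma flow_lift:
  assumes "w \<in> Z" "0 \<le> t"
  shows "flow nu b t (lift w) = lift (R t w)"
proof -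
  have "C0_semigroup_on (E b) (E_norm b) (flow nu b) \<and> has_generator_on (E b) (E_norm b) (flow nu b) (gen_dom b) (gen nu)"
    unfolding flow_def by (rule someI[of _ S0]) (use C0_S0 generator_S0 in blast)
  then interpret E_semigroup nu b "flow nu b"
    by unfold_locales auto
  show ?thesis using S_eq_R assms .
qed

end

subsection \<open>Mild solutions\<close>

lemma set_integral_Ioo_eq_integral:
  fixes f :: "real \<Rightarrow> 'a::euclidean_space"
  assumes "continuous_on {a..b} f"
  shows "set_integrable lborel {a<..<b} f" "(LINT s:{a<..<b}|lborel. f s) = integral {a..b} f"
proof -
  show si: "set_integrable lborel {a<..<b} f"
    by (rule set_integrable_subset[OF borel_integrable_atLeastAtMost'[OF assms]]) auto
  show "(LINT s:{a<..<b}|lborel. f s) = integral {a..b} f"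
    using set_borel_integral_eq_integral(2)[OF si] by (simp add: integral_open_interval_real)
qed

lemma set_integral_bounded_linear:
  assumes "bounded_linear L" "set_integrable M A f"
  shows "(LINT x:A|M. L (f x)) = L (LINT x:A|M. f x)" "set_integrable M A (\<lambda>x. L (f x))"
proof -
  interpret bounded_linear L by fact
  have eq: "indicator A x *\<^sub>R L (f x) = L (indicator A x *\<^sub>R f x)" for x by (simp add: scaleR)
  show "(LINT x:A|M. L (f x)) = L (LINT x:A|M. f x)"
    unfolding set_lebesgue_integral_def eq
    by (rule integral_bounded_linear[OF assms(1)]) (use assms(2) in \<open>simp add: set_integrable_def\<close>)
  show "set_integrable M A (\<lambda>x. L (f x))"
    unfolding set_integrable_def eq
    by (rule integrable_bounded_linear[OF assms(1)]) (use assms(2) in \<open>simp add: set_integrable_def\<close>)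
qed

lemma set_integral_sum:
  fixes f :: "'i \<Rightarrow> 'a \<Rightarrow> 'b::{banach, second_countable_topology}"
  assumes "\<And>i. i \<in> I \<Longrightarrow> set_integrable M A (f i)"
  shows "(LINT x:A|M. (\<Sum>i\<in>I. f i x)) = (\<Sum>i\<in>I. LINT x:A|M. f i x)"
  using assms unfolding set_lebesgue_integral_def set_integrable_def scaleR_sum_right
  by (rule Bochner_Integration.integral_sum)

lemma continuous_on_Icc_bounded:
  fixes p :: "real \<Rightarrow> real"
  assumes "continuous_on {a..b} p"
  shows "\<exists>C. \<forall>s\<in>{a..b}. \<bar>p s\<bar> \<le> C"
  using compact_imp_bounded[OF compact_continuous_image[OF assms compact_Icc]]
  by (simp add: bounded_iff)

lemma set_integrable_continuous_scaleR:
  fixes g :: "real \<Rightarrow> 'a::{banach, second_countable_topology}"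
  assumes g: "integrable lborel g" and p: "continuous_on UNIV p"
  shows "set_integrable lborel {a<..<b} (\<lambda>s. p s *\<^sub>R g s)"
proof -
  have [measurable]: "g \<in> borel_measurable lborel" "p \<in> borel_measurable borel"
    using g borel_measurable_continuous_onI[OF p] by auto
  obtain C where C: "\<And>s. s \<in> {a..b} \<Longrightarrow> \<bar>p s\<bar> \<le> C"
    using continuous_on_Icc_bounded[OF continuous_on_subset[OF p subset_UNIV]] by metis
  show ?thesis
    unfolding set_integrable_def
  proof (rule Bochner_Integration.integrable_bound)
    show "integrable lborel (\<lambda>s. \<bar>C\<bar> *\<^sub>R norm (g s))" using g by auto
    show "AE s in lborel. norm (indicat_real {a<..<b} s *\<^sub>R p s *\<^sub>R g s) \<le> norm (\<bar>C\<bar> *\<^sub>R norm (g s))"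
    proof (rule AE_I2)
      fix s
      show "norm (indicat_real {a<..<b} s *\<^sub>R p s *\<^sub>R g s) \<le> norm (\<bar>C\<bar> *\<^sub>R norm (g s))"
      proof (cases "s \<in> {a<..<b}")
        case True
        then have "\<bar>p s\<bar> \<le> \<bar>C\<bar>" using C[of s] by auto
        then show ?thesis using True by (simp add: mult_right_mono)
      qed auto
    qed
  qed measurable
qed

section \<open>Time integrals of convolutions\<close>

lemma integrable_convolution:
  fixes g :: "real \<Rightarrow> complex" and K' :: "real \<Rightarrow> real" and t :: real
  assumes g: "integrable lborel g" and cont: "continuous_on UNIV K'"
  defines "F \<equiv> (\<lambda>(r, s). if 0 < s \<and> s < r \<and> r < t then K' (r - s) *\<^sub>R g s else 0)"
  shows "integrable (lborel \<Otimes>\<^sub>M lborel) F"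
    and "indicator {0<..<t} r *\<^sub>R (LINT s:{0<..<r}|lborel. K' (r - s) *\<^sub>R g s) = (LINT s|lborel. F (r, s))"
    and "set_integrable lborel {0<..<t} (\<lambda>r. LINT s:{0<..<r}|lborel. K' (r - s) *\<^sub>R g s)"
proof -
  have gm [measurable]: "g \<in> borel_measurable lborel" using g by auto
  have Km [measurable]: "K' \<in> borel_measurable borel" using cont by (rule borel_measurable_continuous_onI)
  have Fm [measurable]: "F \<in> borel_measurable (lborel \<Otimes>\<^sub>M lborel)"
    unfolding F_def by measurable
  obtain C where C: "\<And>s. s \<in> {0..t} \<Longrightarrow> \<bar>K' s\<bar> \<le> C"
    using continuous_on_Icc_bounded[OF continuous_on_subset[OF cont subset_UNIV]] by metis
  have Fb: "norm (F (r, s)) \<le> indicator {0<..<t} r * (\<bar>C\<bar> * norm (g s))" for r s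
  proof (cases "0 < s \<and> s < r \<and> r < t")
    case True
    then have "\<bar>K' (r - s)\<bar> \<le> \<bar>C\<bar>" using C[of "r - s"] by auto
    then show ?thesis using True by (simp add: F_def mult_right_mono)
  qed (auto simp: F_def)
  have Fr: "integrable lborel (\<lambda>s. F (r, s))" for r
  proof (rule Bochner_Integration.integrable_bound)
    show "integrable lborel (\<lambda>s. indicator {0<..<t} r * (\<bar>C\<bar> * norm (g s)))" using g by auto
    show "AE s in lborel. norm (F (r, s)) \<le> norm (indicator {0<..<t} r * (\<bar>C\<bar> * norm (g s)))"
      using Fb by (auto intro!: AE_I2 order_trans[OF Fb])
  qed measurable
  show Fi: "integrable (lborel \<Otimes>\<^sub>M lborel) F"
  proof (rule lborel_pair.Fubini_integrable[OF Fm])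
    show "AE r in lborel. integrable lborel (\<lambda>s. F (r, s))" using Fr by simp
    show "integrable lborel (\<lambda>r. LINT s|lborel. norm (F (r, s)))"
    proof (rule Bochner_Integration.integrable_bound)
      show "integrable lborel (\<lambda>r. indicator {0<..<t} r * (\<bar>C\<bar> * (LINT s|lborel. norm (g s))))"
      proof -
        have "integrable lborel (indicator {0<..<t} :: real \<Rightarrow> real)"
          by (cases "0 \<le> t") (auto intro: integrable_real_indicator)
        then show ?thesis by (intro integrable_mult_left)
      qed
      show "AE r in lborel. norm (LINT s|lborel. norm (F (r, s))) \<le> norm (indicator {0<..<t} r * (\<bar>C\<bar> * (LINT s|lborel. norm (g s))))"
      proof (rule AE_I2)
        fix r
        have "(LINT s|lborel. norm (F (r, s))) \<le> (LINT s|lborel. indicator {0<..<t} r * (\<bar>C\<bar> * norm (g s)))"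
          by (rule integral_mono) (use Fr g Fb in auto)
        then show "norm (LINT s|lborel. norm (F (r, s))) \<le> norm (indicator {0<..<t} r * (\<bar>C\<bar> * (LINT s|lborel. norm (g s))))"
          by simp
      qed
    qed measurable
  qed
  show eq: "indicator {0<..<t} r *\<^sub>R (LINT s:{0<..<r}|lborel. K' (r - s) *\<^sub>R g s) = (LINT s|lborel. F (r, s))" for r
    unfolding set_lebesgue_integral_def
    by (cases "r \<in> {0<..<t}") (auto simp: F_def indicator_def intro!: Bochner_Integration.integral_cong integral_eq_zero_AE)
  show "set_integrable lborel {0<..<t} (\<lambda>r. LINT s:{0<..<r}|lborel. K' (r - s) *\<^sub>R g s)"
    unfolding set_integrable_def eq by (rule lborel_pair.integrable_fst'[OF Fi])
qed

text \<open>Fubini on the triangle s < r < t, followed by the fundamental theorem of calculus in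
  r.\<close>

lemma integral_convolution:
  fixes g :: "real \<Rightarrow> complex" and K K' :: "real \<Rightarrow> real"
  assumes g: "integrable lborel g" and K: "\<And>r. (K has_real_derivative K' r) (at r)"
    and cont: "continuous_on UNIV K'"
  shows "(LINT r:{0<..<t}|lborel. LINT s:{0<..<r}|lborel. K' (r - s) *\<^sub>R g s)
    = (LINT s:{0<..<t}|lborel. (K (t - s) - K 0) *\<^sub>R g s)"
proof -
  define F where "F = (\<lambda>(r, s). if 0 < s \<and> s < r \<and> r < t then K' (r - s) *\<^sub>R g s else 0)"
  note conv = integrable_convolution[OF g cont, of t, folded F_def]
  have swap: "(LINT s|lborel. LINT r|lborel. F (r, s)) = (LINT r|lborel. LINT s|lborel. F (r, s))"
    using lborel_pair.Fubini_integral[of "\<lambda>r s. F (r, s)"] conv(1) by simp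
  have "(LINT r:{0<..<t}|lborel. LINT s:{0<..<r}|lborel. K' (r - s) *\<^sub>R g s) = (LINT r|lborel. LINT s|lborel. F (r, s))"
    unfolding conv(2)[symmetric] set_lebesgue_integral_def ..
  also have "\<dots> = (LINT s|lborel. LINT r|lborel. F (r, s))" by (rule swap[symmetric])
  also have "\<dots> = (LINT s:{0<..<t}|lborel. (K (t - s) - K 0) *\<^sub>R g s)"
    unfolding set_lebesgue_integral_def
  proof (intro Bochner_Integration.integral_cong refl)
    fix s
    show "(LINT r|lborel. F (r, s)) = indicator {0<..<t} s *\<^sub>R (K (t - s) - K 0) *\<^sub>R g s"
    proof (cases "s \<in> {0<..<t}")
      case True
      have c: "continuous_on {s..t} (\<lambda>r. K' (r - s))"
        by (intro continuous_on_compose2[OF cont] continuous_intros) auto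
      have "((\<lambda>r. K' (r - s)) has_integral K (t - s) - K (s - s)) {s..t}"
      proof (rule fundamental_theorem_of_calculus)
        fix r
        have "((\<lambda>r. K (r - s)) has_real_derivative K' (r - s) * 1) (at r)"
          by (rule DERIV_chain2[OF K]) (auto intro!: derivative_eq_intros)
        then show "((\<lambda>r. K (r - s)) has_vector_derivative K' (r - s)) (at r within {s..t})"
          by (simp add: has_real_derivative_iff_has_vector_derivative has_vector_derivative_at_within)
      qed (use True in auto)
      then have i: "(LINT r:{s<..<t}|lborel. K' (r - s)) = K (t - s) - K 0"
        using set_integral_Ioo_eq_integral(2)[OF c] by (simp add: integral_unique)
      have "F (r, s) = (indicator {s<..<t} r *\<^sub>R K' (r - s)) *\<^sub>R g s" for r
        using True by (auto simp: F_def indicator_def)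
      then have "(LINT r|lborel. F (r, s)) = (LINT r:{s<..<t}|lborel. K' (r - s)) *\<^sub>R g s"
        using set_integral_Ioo_eq_integral(1)[OF c] unfolding set_lebesgue_integral_def set_integrable_def
        by simp
      then show ?thesis using True i by simp
    next
      case False
      then have "F (r, s) = 0" for r by (auto simp: F_def)
      then show ?thesis using False by simp
    qed
  qed
  finally show ?thesis .
qed

context linearised_vorticity
begin

text \<open>Variation of constants for a source in the first component only. Read through
  \<open>lift\<close>, the source h stands for \<Lambda>^b Q v.\<close>

definition U :: "(real \<Rightarrow> H) \<Rightarrow> real \<Rightarrow> H \<times> H" where
  "U h t = (LINT s:{0<..<t}|lborel. R (t - s) (h s, 0))"

lemma borel_measurable_pair_fcI:
  fixes f :: "'a \<Rightarrow> H \<times> H"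
  assumes "\<And>k. (\<lambda>x. fc (fst (f x)) k) \<in> borel_measurable M" "\<And>k. (\<lambda>x. fc (snd (f x)) k) \<in> borel_measurable M"
  shows "f \<in> borel_measurable M"
proof -
  have "(\<lambda>x. (fst (f x), snd (f x))) \<in> borel_measurable M"
    by (intro borel_measurable_Pair borel_measurable_fcI assms)
  then show ?thesis by simp
qed

lemma fc_measurable [measurable]: "(\<lambda>f. fc f k) \<in> borel_measurable borel"
  by (intro borel_measurable_continuous_onI linear_continuous_on bounded_linear_fc)

lemma duh_measurable [measurable]: "duh k d \<in> borel_measurable borel"
  unfolding duh_def by (intro borel_measurable_continuous_onI continuous_on_duhamel)

lemma U_integrand:
  assumes h: "integrable lborel h"
  shows "set_integrable lborel {0<..<t} (\<lambda>s. R (t - s) (h s, 0))"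
    and "(\<lambda>s. indicat_real {0<..<t} s *\<^sub>R R (t - s) (h s, 0)) \<in> borel_measurable lborel"
    and "t \<le> T \<Longrightarrow> 0 \<le> T \<Longrightarrow> norm (indicat_real {0<..<t} s *\<^sub>R R (t - s) (h s, 0)) \<le> (10 + 5 * T) * norm (h s)"
proof -
  have [measurable]: "h \<in> borel_measurable lborel" using h by auto
  have eq1: "fc (fst (indicat_real {0<..<t} s *\<^sub>R R (t - s) (h s, 0))) k
      = indicat_real {0<..<t} s *\<^sub>R (exp (- al k * (t - s)) *\<^sub>R fc (h s) k)" for s k
    by (auto simp: indicator_def fc_R_fst)
  have eq2: "fc (snd (indicat_real {0<..<t} s *\<^sub>R R (t - s) (h s, 0))) k
      = indicat_real {0<..<t} s *\<^sub>R (\<Sum>d\<in>offs. (cw k d * duh k d (t - s)) *\<^sub>R fc (h s) (k + d))" for s k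
    by (auto simp: indicator_def fc_R_snd)
  show m: "(\<lambda>s. indicat_real {0<..<t} s *\<^sub>R R (t - s) (h s, 0)) \<in> borel_measurable lborel"
    by (rule borel_measurable_pair_fcI; unfold eq1 eq2; measurable)
  have bound: "norm (indicat_real {0<..<t} s *\<^sub>R R (t - s) (h s, 0)) \<le> (10 + 5 * T) * norm (h s)" if "t \<le> T" "0 \<le> T" for s t T
  proof (cases "s \<in> {0<..<t}")
    case True
    then show ?thesis
      using norm_R_le[of "t - s" T "(h s, 0)"] that by (simp add: norm_Pair)
  qed (use that in auto)
  show "t \<le> T \<Longrightarrow> 0 \<le> T \<Longrightarrow> norm (indicat_real {0<..<t} s *\<^sub>R R (t - s) (h s, 0)) \<le> (10 + 5 * T) * norm (h s)"
    by (rule bound)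
  show "set_integrable lborel {0<..<t} (\<lambda>s. R (t - s) (h s, 0))"
    unfolding set_integrable_def
  proof (rule Bochner_Integration.integrable_bound[OF _ m])
    show "integrable lborel (\<lambda>s. (10 + 5 * \<bar>t\<bar>) * norm (h s))" using h by auto
    show "AE s in lborel. norm (indicat_real {0<..<t} s *\<^sub>R R (t - s) (h s, 0)) \<le> norm ((10 + 5 * \<bar>t\<bar>) * norm (h s))"
      using bound[of t "\<bar>t\<bar>"] by (intro AE_I2) (auto intro: order_trans[OF _ abs_ge_self] simp del: norm_scaleR)
  qed
qed

lemma fc_U_fst:
  assumes h: "integrable lborel h"
  shows "fc (fst (U h t)) k = (LINT s:{0<..<t}|lborel. exp (- al k * (t - s)) *\<^sub>R fc (h s) k)"
proof -
  have "fc (fst (U h t)) k = (LINT s:{0<..<t}|lborel. fc (fst (R (t - s) (h s, 0))) k)"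
    unfolding U_def
    by (rule set_integral_bounded_linear(1)[OF bounded_linear_compose[OF bounded_linear_fc bounded_linear_fst] U_integrand(1)[OF h], symmetric])
  also have "\<dots> = (LINT s:{0<..<t}|lborel. exp (- al k * (t - s)) *\<^sub>R fc (h s) k)"
    by (rule set_lebesgue_integral_cong) (auto simp: fc_R_fst)
  finally show ?thesis .
qed

lemma integrable_fc: "integrable lborel h \<Longrightarrow> integrable lborel (\<lambda>s. fc (h s) k)"
  by (rule integrable_bounded_linear[OF bounded_linear_fc])

lemma fc_U_snd:
  assumes h: "integrable lborel h"
  shows "fc (snd (U h t)) k = (\<Sum>d\<in>offs. cw k d *\<^sub>R (LINT s:{0<..<t}|lborel. duh k d (t - s) *\<^sub>R fc (h s) (k + d)))"
proof -
  have c: "continuous_on UNIV (\<lambda>s. duh k d (t - s))" for d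
    unfolding duh_def by (intro continuous_on_compose2[OF continuous_on_duhamel[of UNIV]] continuous_intros) auto
  have i: "set_integrable lborel {0<..<t} (\<lambda>s. duh k d (t - s) *\<^sub>R fc (h s) (k + d))" for d
    by (intro set_integrable_continuous_scaleR integrable_fc h c)
  have "fc (snd (U h t)) k = (LINT s:{0<..<t}|lborel. fc (snd (R (t - s) (h s, 0))) k)"
    unfolding U_def
    by (rule set_integral_bounded_linear(1)[OF bounded_linear_compose[OF bounded_linear_fc bounded_linear_snd] U_integrand(1)[OF h], symmetric])
  also have "\<dots> = (LINT s:{0<..<t}|lborel. \<Sum>d\<in>offs. cw k d *\<^sub>R (duh k d (t - s) *\<^sub>R fc (h s) (k + d)))"
    by (rule set_lebesgue_integral_cong) (auto simp: fc_R_snd)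
  also have "\<dots> = (\<Sum>d\<in>offs. LINT s:{0<..<t}|lborel. cw k d *\<^sub>R (duh k d (t - s) *\<^sub>R fc (h s) (k + d)))"
    by (rule set_integral_sum) (rule set_integral_bounded_linear(2)[OF bounded_linear_scaleR_right i])
  also have "\<dots> = (\<Sum>d\<in>offs. cw k d *\<^sub>R (LINT s:{0<..<t}|lborel. duh k d (t - s) *\<^sub>R fc (h s) (k + d)))"
    by (simp only: set_integral_bounded_linear(1)[OF bounded_linear_scaleR_right i])
  finally show ?thesis .
qed

lemma Z_integral:
  assumes "set_integrable lborel A f" "\<And>s. s \<in> A \<Longrightarrow> f s \<in> Z"
  shows "(LINT s:A|lborel. f s) \<in> Z"
proof -
  have "snd (LINT s:A|lborel. f s) \<bullet> phi = (LINT s:A|lborel. snd (f s) \<bullet> phi)"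
    by (rule set_integral_bounded_linear(1)[OF bounded_linear_compose[OF bounded_linear_inner_left bounded_linear_snd] assms(1), symmetric])
  also have "\<dots> = (LINT s:A|lborel. 0)"
    unfolding set_lebesgue_integral_def
    by (intro Bochner_Integration.integral_cong refl) (use assms(2) in \<open>auto simp: indicator_def Z_iff\<close>)
  finally show ?thesis by (simp add: Z_iff set_lebesgue_integral_def)
qed

lemma U_in_Z: "integrable lborel h \<Longrightarrow> U h t \<in> Z"
  unfolding U_def by (intro Z_integral U_integrand R_in_Z) (auto intro: ZI)

lemma U_zero [simp]: "U h 0 = 0"
  by (simp add: U_def set_lebesgue_integral_def)

text \<open>Dominated convergence: extended by the indicator of its interval, the integrand
  converges for every s except s = t.\<close>

lemma continuous_on_U:
  assumes h: "integrable lborel h"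
  shows "continuous_on {0..T} (U h)"
  unfolding continuous_on_sequentially
proof (intro allI ballI impI; elim conjE)
  fix X t assume t: "t \<in> {0..T}" and X: "\<forall>n. X n \<in> {0..T}" "X \<longlonglongrightarrow> t"
  have "(\<lambda>n. LINT s|lborel. indicat_real {0<..<X n} s *\<^sub>R R (X n - s) (h s, 0))
      \<longlonglongrightarrow> (LINT s|lborel. indicat_real {0<..<t} s *\<^sub>R R (t - s) (h s, 0))"
  proof (rule integral_dominated_convergence[where w = "\<lambda>s. (10 + 5 * T) * norm (h s)"])
    show "AE s in lborel. (\<lambda>n. indicat_real {0<..<X n} s *\<^sub>R R (X n - s) (h s, 0)) \<longlonglongrightarrow> indicat_real {0<..<t} s *\<^sub>R R (t - s) (h s, 0)"
      using AE_lborel_singleton[of t]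
    proof eventually_elim
      case (elim s)
      consider "s < t" | "t < s" using elim by linarith
      then show ?case
      proof cases
        case 1
        have ev: "eventually (\<lambda>n. s < X n) sequentially" by (rule order_tendstoD(1)[OF X(2) 1])
        \<comment> \<open>Continuity of \<open>R\<close> is known for nonnegative times, so the
          argument is clipped at 0; the clipping is eventually inactive.\<close>
        have "((\<lambda>r. R r (h s, 0)) \<circ> (\<lambda>n. max 0 (X n - s))) \<longlonglongrightarrow> R (max 0 (t - s)) (h s, 0)"
          by (rule continuous_on_sequentially[THEN iffD1, OF continuous_on_R, rule_format])
            (auto intro!: tendsto_intros X)
        then have "(\<lambda>n. indicat_real {0<..<t} s *\<^sub>R R (max 0 (X n - s)) (h s, 0)) \<longlonglongrightarrow> indicat_real {0<..<t} s *\<^sub>R R (t - s) (h s, 0)"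
          using 1 by (intro tendsto_scaleR tendsto_const) (simp add: o_def)
        then show ?thesis
        proof (rule Lim_transform_eventually)
          show "\<forall>\<^sub>F n in sequentially. indicat_real {0<..<t} s *\<^sub>R R (max 0 (X n - s)) (h s, 0) = indicat_real {0<..<X n} s *\<^sub>R R (X n - s) (h s, 0)"
            using ev by eventually_elim (use 1 in \<open>auto simp: indicator_def\<close>)
        qed
      next
        case 2
        have "eventually (\<lambda>n. X n < s) sequentially" by (rule order_tendstoD(2)[OF X(2) 2])
        then have "eventually (\<lambda>n. indicat_real {0<..<X n} s *\<^sub>R R (X n - s) (h s, 0) = indicat_real {0<..<t} s *\<^sub>R R (t - s) (h s, 0)) sequentially"
          by eventually_elim (use 2 in \<open>auto simp: indicator_def\<close>)
        then show ?thesis by (rule tendsto_eventually)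
      qed
    qed
    show "AE s in lborel. norm (indicat_real {0<..<X n} s *\<^sub>R R (X n - s) (h s, 0)) \<le> (10 + 5 * T) * norm (h s)" for n
      using X(1) t by (intro AE_I2 U_integrand(3)[OF h]) auto
    show "integrable lborel (\<lambda>s. (10 + 5 * T) * norm (h s))" using h by auto
  qed (rule U_integrand(2)[OF h])+
  then show "(U h \<circ> X) \<longlonglongrightarrow> U h t"
    by (simp add: U_def set_lebesgue_integral_def o_def)
qed

lemma set_integrable_continuous:
  fixes f :: "real \<Rightarrow> H \<times> H"
  assumes "continuous_on {0..T} f" "t \<le> T"
  shows "set_integrable lborel {0<..<t} f"
  by (rule set_integrable_subset[OF borel_integrable_atLeastAtMost'[OF continuous_on_subset[OF assms(1)], of 0 t]]) (use assms(2) in auto)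

text \<open>The integrated equation. On coefficients both kernels of \<open>R\<close> solve
  first-order linear equations in time, so applying L under the time integral produces their
  derivatives, which \<open>integral_convolution\<close> integrates.\<close>

lemma gen_rel_integral_U:
  assumes h: "integrable lborel h" and t: "0 \<le> t" "t \<le> T"
  shows "gen_rel (LINT r:{0<..<t}|lborel. U h r) (U h t - (LINT s:{0<..<t}|lborel. (h s, 0)))"
proof -
  let ?W = "LINT r:{0<..<t}|lborel. U h r"
  have Ui: "set_integrable lborel {0<..<t} (U h)"
    by (rule set_integrable_continuous[OF continuous_on_U[OF h] t(2)])
  have hi: "set_integrable lborel {0<..<t} (\<lambda>s. (h s, 0 :: H))"
  proof -
    have "set_integrable lborel {0<..<t} h"
      using h by (auto simp: set_integrable_def intro!: integrable_mult_indicator)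
    from set_integral_bounded_linear(2)[OF bounded_linear_Pair[OF bounded_linear_ident bounded_linear_zero] this]
    show ?thesis .
  qed
  have h1: "fc (fst (LINT s:{0<..<t}|lborel. (h s, 0 :: H))) k = (LINT s:{0<..<t}|lborel. fc (h s) k)"
    "fc (snd (LINT s:{0<..<t}|lborel. (h s, 0 :: H))) k = 0" for k
    using set_integral_bounded_linear(1)[OF bounded_linear_compose[OF bounded_linear_fc bounded_linear_fst] hi, of k]
      set_integral_bounded_linear(1)[OF bounded_linear_compose[OF bounded_linear_fc bounded_linear_snd] hi, of k]
    by (simp_all add: set_lebesgue_integral_def)
  have W1: "fc (fst ?W) k = (LINT r:{0<..<t}|lborel. LINT s:{0<..<r}|lborel. exp (- al k * (r - s)) *\<^sub>R fc (h s) k)" for k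
    using set_integral_bounded_linear(1)[OF bounded_linear_compose[OF bounded_linear_fc bounded_linear_fst] Ui, of k]
    by (simp add: fc_U_fst[OF h])
  have ec: "continuous_on UNIV (\<lambda>s. exp (- c * s))" for c :: real by (intro continuous_intros)
  have cont_int: "set_integrable lborel {0<..<t} (\<lambda>r. LINT s:{0<..<r}|lborel. p (r - s) *\<^sub>R fc (h s) j)"
    if "continuous_on UNIV p" for p j
    by (rule integrable_convolution(3)[OF integrable_fc[OF h] that])
  have si: "set_integrable lborel {0<..<t} (\<lambda>s. p (t - s) *\<^sub>R fc (h s) k)" if "continuous_on UNIV p" for p k
    by (intro set_integrable_continuous_scaleR integrable_fc h continuous_on_compose2[OF that] continuous_intros) auto
  show ?thesis
  proof (rule gen_relI)
    fix k
    have i0: "set_integrable lborel {0<..<r} (\<lambda>s. exp (- al k * (r - s)) *\<^sub>R fc (h s) k)" for r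
      by (intro set_integrable_continuous_scaleR integrable_fc h continuous_intros)
    have "- al k *\<^sub>R fc (fst ?W) k = (LINT r:{0<..<t}|lborel. - al k *\<^sub>R (LINT s:{0<..<r}|lborel. exp (- al k * (r - s)) *\<^sub>R fc (h s) k))"
      unfolding W1 by (rule set_integral_bounded_linear(1)[OF bounded_linear_scaleR_right cont_int[OF ec], symmetric])
    also have "\<dots> = (LINT r:{0<..<t}|lborel. LINT s:{0<..<r}|lborel. (- al k * exp (- al k * (r - s))) *\<^sub>R fc (h s) k)"
      unfolding set_integral_bounded_linear(1)[OF bounded_linear_scaleR_right i0, symmetric] by simp
    also have "\<dots> = (LINT s:{0<..<t}|lborel. (exp (- al k * (t - s)) - exp (- al k * 0)) *\<^sub>R fc (h s) k)"
      by (rule integral_convolution[OF integrable_fc[OF h], of "\<lambda>s. exp (- al k * s)"])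
        (auto intro!: derivative_eq_intros continuous_intros)
    also have "\<dots> = (LINT s:{0<..<t}|lborel. exp (- al k * (t - s)) *\<^sub>R fc (h s) k) - (LINT s:{0<..<t}|lborel. fc (h s) k)"
      using set_integral_diff(2)[OF si[OF ec[of "al k"], of k] si[OF continuous_on_const[of _ 1], of k]]
      by (simp add: scaleR_diff_left)
    finally show "fc (fst (U h t - (LINT s:{0<..<t}|lborel. (h s, 0)))) k = - al k *\<^sub>R fc (fst ?W) k"
      by (simp add: fc_diff h1 fc_U_fst[OF h])
  next
    fix k
    define D where "D d = (LINT r:{0<..<t}|lborel. LINT s:{0<..<r}|lborel. duh k d (r - s) *\<^sub>R fc (h s) (k + d))" for d
    have dc: "continuous_on UNIV (duh k d)" for d unfolding duh_def by (rule continuous_on_duhamel)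
    have "fc (snd ?W) k = (LINT r:{0<..<t}|lborel. \<Sum>d\<in>offs. cw k d *\<^sub>R (LINT s:{0<..<r}|lborel. duh k d (r - s) *\<^sub>R fc (h s) (k + d)))"
      using set_integral_bounded_linear(1)[OF bounded_linear_compose[OF bounded_linear_fc bounded_linear_snd] Ui, of k]
      by (simp add: fc_U_snd[OF h])
    also have "\<dots> = (\<Sum>d\<in>offs. cw k d *\<^sub>R D d)"
      unfolding D_def
      by (subst set_integral_sum)
        (simp_all only: set_integral_bounded_linear[OF bounded_linear_scaleR_right cont_int[OF dc]])
    finally have W2: "fc (snd ?W) k = (\<Sum>d\<in>offs. cw k d *\<^sub>R D d)" .
    \<comment> \<open>Together the two terms form the derivative of the kernel
      \<open>duh k d\<close>, which vanishes at 0 and so leaves no boundary term.\<close>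
    have conv: "- ka k *\<^sub>R D d + fc (fst ?W) (k + d) = (LINT s:{0<..<t}|lborel. duh k d (t - s) *\<^sub>R fc (h s) (k + d))" for d
    proof -
      have "- ka k *\<^sub>R D d = (LINT r:{0<..<t}|lborel. - ka k *\<^sub>R (LINT s:{0<..<r}|lborel. duh k d (r - s) *\<^sub>R fc (h s) (k + d)))"
        unfolding D_def by (rule set_integral_bounded_linear(1)[OF bounded_linear_scaleR_right cont_int[OF dc], symmetric])
      then have "- ka k *\<^sub>R D d + fc (fst ?W) (k + d)
          = (LINT r:{0<..<t}|lborel. - ka k *\<^sub>R (LINT s:{0<..<r}|lborel. duh k d (r - s) *\<^sub>R fc (h s) (k + d))
              + (LINT s:{0<..<r}|lborel. exp (- al (k + d) * (r - s)) *\<^sub>R fc (h s) (k + d)))"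
        unfolding W1
        by (simp only: set_integral_add(2)[OF set_integral_bounded_linear(2)[OF bounded_linear_scaleR_right cont_int[OF dc]] cont_int[OF ec]])
      also have "\<dots> = (LINT r:{0<..<t}|lborel. LINT s:{0<..<r}|lborel. (exp (- al (k + d) * (r - s)) - ka k * duh k d (r - s)) *\<^sub>R fc (h s) (k + d))"
      proof (rule set_lebesgue_integral_cong)
        show "\<forall>r. r \<in> {0<..<t} \<longrightarrow> - ka k *\<^sub>R (LINT s:{0<..<r}|lborel. duh k d (r - s) *\<^sub>R fc (h s) (k + d))
              + (LINT s:{0<..<r}|lborel. exp (- al (k + d) * (r - s)) *\<^sub>R fc (h s) (k + d))
            = (LINT s:{0<..<r}|lborel. (exp (- al (k + d) * (r - s)) - ka k * duh k d (r - s)) *\<^sub>R fc (h s) (k + d))"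
        proof (intro allI impI)
          fix r
          have i1: "set_integrable lborel {0<..<r} (\<lambda>s. duh k d (r - s) *\<^sub>R fc (h s) (k + d))"
            by (intro set_integrable_continuous_scaleR integrable_fc h continuous_on_compose2[OF dc] continuous_intros) auto
          have i2: "set_integrable lborel {0<..<r} (\<lambda>s. exp (- al (k + d) * (r - s)) *\<^sub>R fc (h s) (k + d))"
            by (intro set_integrable_continuous_scaleR integrable_fc h continuous_intros)
          show "- ka k *\<^sub>R (LINT s:{0<..<r}|lborel. duh k d (r - s) *\<^sub>R fc (h s) (k + d))
              + (LINT s:{0<..<r}|lborel. exp (- al (k + d) * (r - s)) *\<^sub>R fc (h s) (k + d))
            = (LINT s:{0<..<r}|lborel. (exp (- al (k + d) * (r - s)) - ka k * duh k d (r - s)) *\<^sub>R fc (h s) (k + d))"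
            unfolding set_integral_bounded_linear(1)[OF bounded_linear_scaleR_right i1, symmetric]
              set_integral_add(2)[OF set_integral_bounded_linear(2)[OF bounded_linear_scaleR_right i1] i2, symmetric]
            by (simp add: scaleR_diff_left)
        qed
      qed simp
      also have "\<dots> = (LINT s:{0<..<t}|lborel. (duh k d (t - s) - duh k d 0) *\<^sub>R fc (h s) (k + d))"
      proof (rule integral_convolution[OF integrable_fc[OF h], of "duh k d"])
        show "(duh k d has_real_derivative exp (- al (k + d) * r) - ka k * duh k d r) (at r)" for r
          unfolding duh_def using DERIV_duhamel[of "ka k" "al (k + d)" r UNIV] by simp
        show "continuous_on UNIV (\<lambda>r. exp (- al (k + d) * r) - ka k * duh k d r)"
          by (intro continuous_intros dc)
      qed
      finally show ?thesis by (simp add: duh_def)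
    qed
    have "fc (snd (U h t)) k = (\<Sum>d\<in>offs. cw k d *\<^sub>R (- ka k *\<^sub>R D d + fc (fst ?W) (k + d)))"
      unfolding fc_U_snd[OF h] conv ..
    then show "fc (snd (U h t - (LINT s:{0<..<t}|lborel. (h s, 0)))) k
        = - ka k *\<^sub>R fc (snd ?W) k + (\<Sum>d\<in>offs. cw k d *\<^sub>R fc (fst ?W) (k + d))"
      by (simp add: fc_diff h1 W2 scaleR_diff_right scaleR_sum_right sum_subtractf sum_negf mult_ac sum.distrib scaleR_add_right)
  qed
qed

lemma is_solution_U:
  assumes h: "integrable lborel h" and hv: "\<And>s. 0 < s \<Longrightarrow> s < T \<Longrightarrow> lift (h s, 0) = (Q (v s), 0)"
  shows "is_solution nu b Q T v (\<lambda>t. lift (U h t))"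
  unfolding is_solution_def
proof (intro conjI ballI)
  fix t assume t: "t \<in> {0..T}"
  show "lift (U h t) \<in> E b" by (simp add: lift_in_E U_in_Z h)
  have "((\<lambda>s. U h s) \<longlongrightarrow> U h t) (at t within {0..T})"
    using continuous_on_U[OF h, of T] t by (simp add: continuous_on_def)
  then have "((\<lambda>s. norm (U h s - U h t)) \<longlongrightarrow> 0) (at t within {0..T})"
    by (intro tendsto_norm_zero LIM_zero)
  then show "((\<lambda>s. E_norm b (lift (U h s) - lift (U h t))) \<longlongrightarrow> 0) (at t within {0..T})"
    by (simp flip: lift_diff)
  have Ui: "set_integrable lborel {0<..<t} (U h)"
    by (rule set_integrable_continuous[OF continuous_on_U[OF h]]) (use t in auto)
  have WZ: "(LINT s:{0<..<t}|lborel. U h s) \<in> Z"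
    by (rule Z_integral[OF Ui]) (rule U_in_Z[OF h])
  have W: "(LINT s:{0<..<t}|lborel. lift (U h s)) = lift (LINT s:{0<..<t}|lborel. U h s)"
    by (rule set_integral_bounded_linear(1)[OF bounded_linear_lift Ui])
  have g: "lift (LINT r:{0<..<t}|lborel. U h r) \<in> gen_dom b"
    "lift (U h t - (LINT s:{0<..<t}|lborel. (h s, 0))) = gen nu (lift (LINT r:{0<..<t}|lborel. U h r))"
    using gen_rel_integral_U[OF h, of t T] t gen_rel_iff[OF WZ] by auto
  show "(LINT s:{0<..<t}|lborel. lift (U h s)) \<in> gen_dom b" unfolding W by (rule g)
  have hi: "set_integrable lborel {0<..<t} (\<lambda>s. (h s, 0 :: H))"
  proof -
    have "set_integrable lborel {0<..<t} h"
      using h by (auto simp: set_integrable_def intro!: integrable_mult_indicator)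
    from set_integral_bounded_linear(2)[OF bounded_linear_Pair[OF bounded_linear_ident bounded_linear_zero] this]
    show ?thesis .
  qed
  have "(LINT s:{0<..<t}|lborel. (Q (v s), 0)) = (LINT s:{0<..<t}|lborel. lift (h s, 0))"
    using t by (intro set_lebesgue_integral_cong) (auto simp: hv)
  also have "\<dots> = lift (LINT s:{0<..<t}|lborel. (h s, 0))"
    by (rule set_integral_bounded_linear(1)[OF bounded_linear_lift hi])
  finally show "lift (U h t) = gen nu (LINT s:{0<..<t}|lborel. lift (U h s)) + (LINT s:{0<..<t}|lborel. (Q (v s), 0))"
    unfolding W g(2)[symmetric] by (simp add: lift_diff)
next
  show "lift (U h 0) = 0" using lift_scaleR[of 0 0] by simp
qed

section \<open>Uniqueness of mild solutions\<close>

lemma solution_unlift: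
  assumes u: "is_solution nu b Q T v u" and t: "t \<in> {0..T}"
  shows "lift (unlift (u t)) = u t" "unlift (u t) \<in> Z"
    and "continuous_on {0..T} (\<lambda>s. unlift (u s))"
    and "(LINT s:{0<..<t}|lborel. u s) = lift (LINT s:{0<..<t}|lborel. unlift (u s))"
    and "(LINT s:{0<..<t}|lborel. unlift (u s)) \<in> Z"
proof -
  have E: "u s \<in> E b" if "s \<in> {0..T}" for s using u that unfolding is_solution_def by blast
  then have l: "lift (unlift (u s)) = u s" "unlift (u s) \<in> Z" if "s \<in> {0..T}" for s
    using lift_unlift that by auto
  show "lift (unlift (u t)) = u t" "unlift (u t) \<in> Z" using l t by auto
  show c: "continuous_on {0..T} (\<lambda>s. unlift (u s))"
    unfolding continuous_on_def
  proof (intro ballI)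
    fix r assume r: "r \<in> {0..T}"
    have "((\<lambda>s. E_norm b (u s - u r)) \<longlongrightarrow> 0) (at r within {0..T})"
      using u r unfolding is_solution_def by blast
    then have "((\<lambda>s. norm (unlift (u s) - unlift (u r))) \<longlongrightarrow> 0) (at r within {0..T})"
    proof (rule Lim_transform_eventually)
      show "\<forall>\<^sub>F s in at r within {0..T}. E_norm b (u s - u r) = norm (unlift (u s) - unlift (u r))"
        unfolding eventually_at_filter
      proof (intro always_eventually allI impI)
        fix s assume "s \<in> {0..T}"
        then have "u s - u r = lift (unlift (u s) - unlift (u r))" using r by (simp add: lift_diff l)
        then show "E_norm b (u s - u r) = norm (unlift (u s) - unlift (u r))" by simp
      qed
    qed
    then show "((\<lambda>s. unlift (u s)) \<longlongrightarrow> unlift (u r)) (at r within {0..T})"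
      by (simp add: tendsto_norm_zero_iff LIM_zero_iff)
  qed
  have i: "set_integrable lborel {0<..<t} (\<lambda>s. unlift (u s))"
    by (rule set_integrable_continuous[OF c]) (use t in auto)
  show "(LINT s:{0<..<t}|lborel. unlift (u s)) \<in> Z"
    by (rule Z_integral[OF i]) (use l t in auto)
  have "(LINT s:{0<..<t}|lborel. u s) = (LINT s:{0<..<t}|lborel. lift (unlift (u s)))"
    by (intro set_lebesgue_integral_cong) (use l t in auto)
  then show "(LINT s:{0<..<t}|lborel. u s) = lift (LINT s:{0<..<t}|lborel. unlift (u s))"
    using set_integral_bounded_linear(1)[OF bounded_linear_lift i] by simp
qed

text \<open>The primitive Y of y solves Y' = -c Y with Y(0) = 0.\<close>

lemma integral_eq_decay_imp_zero:
  fixes y :: "real \<Rightarrow> complex"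
  assumes y: "continuous_on {0..T} y" and eq: "\<And>t. t \<in> {0..T} \<Longrightarrow> y t = - c *\<^sub>R integral {0..t} y"
    and t: "t \<in> {0..T}"
  shows "y t = 0" "integral {0..t} y = 0"
proof -
  have "integral {0..t} y = exp (- c * t) *\<^sub>R integral {0..0} y"
  proof (rule exp_decay_unique)
    fix s assume s: "0 \<le> s" "s \<le> t"
    have "((\<lambda>u. integral {0..u} y) has_vector_derivative y s) (at s within {0..t})"
      by (rule integral_has_vector_derivative) (use s t in \<open>auto intro: continuous_on_subset[OF y]\<close>)
    then show "((\<lambda>u. integral {0..u} y) has_vector_derivative - c *\<^sub>R integral {0..s} y) (at s within {0..t})"
      using eq[of s] s t by simp
  qed (use t in simp)
  then show "integral {0..t} y = 0" by simp
  then show "y t = 0" using eq[OF t] by simp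
qed

text \<open>The difference D of two solutions equals L applied to its time integral W. The equations
  for the first component are closed and give 0; this removes the coupling from the second
  component, to which the same argument applies.\<close>

lemma solution_unique:
  assumes u: "is_solution nu b Q T v u" and u': "is_solution nu b Q T v u'" and t: "t \<in> {0..T}"
  shows "u t = u' t"
proof -
  define D where "D s = unlift (u s) - unlift (u' s)" for s
  define W where "W t = (LINT s:{0<..<t}|lborel. D s)" for t
  have c: "continuous_on {0..T} D"
    unfolding D_def by (intro continuous_intros solution_unlift(3)[OF u t] solution_unlift(3)[OF u' t])
  have Di: "set_integrable lborel {0<..<r} D" if "r \<in> {0..T}" for r
    by (rule set_integrable_continuous[OF c]) (use that in auto)
  have rel: "fc (fst (D r)) k = - al k *\<^sub>R fc (fst (W r)) k"
    "fc (snd (D r)) k = - ka k *\<^sub>R fc (snd (W r)) k + (\<Sum>d\<in>offs. cw k d *\<^sub>R fc (fst (W r)) (k + d))"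
    if r: "r \<in> {0..T}" for r k
  proof -
    let ?W1 = "LINT s:{0<..<r}|lborel. unlift (u s)" and ?W2 = "LINT s:{0<..<r}|lborel. unlift (u' s)"
    note s1 = solution_unlift[OF u r] and s2 = solution_unlift[OF u' r]
    have "set_integrable lborel {0<..<r} (\<lambda>s. unlift (u s))" "set_integrable lborel {0<..<r} (\<lambda>s. unlift (u' s))"
      by (rule set_integrable_continuous[OF s1(3)] set_integrable_continuous[OF s2(3)], use r in auto)+
    then have W: "W r = ?W1 - ?W2" unfolding W_def D_def by (rule set_integral_diff(2))
    have d: "lift ?W1 \<in> gen_dom b" "lift ?W2 \<in> gen_dom b"
      using u u' r unfolding is_solution_def s1(4)[symmetric] s2(4)[symmetric] by blast+
    then have H2: "fst ?W1 \<in> Hs 2" "snd ?W1 \<in> Hs 2" "fst ?W2 \<in> Hs 2" "snd ?W2 \<in> Hs 2"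
      using lift_gen_dom[OF s1(5)] lift_gen_dom[OF s2(5)] by auto
    have "u r - u' r = gen nu (lift ?W1) - gen nu (lift ?W2)"
      using u u' r unfolding is_solution_def s1(4)[symmetric] s2(4)[symmetric] by auto
    then have L: "lift (D r) = gen nu (lift ?W1) - gen nu (lift ?W2)"
      by (simp add: D_def lift_diff s1(1) s2(1))
    have "fc (fst (lift (D r))) k = (freq_norm k powr (- b)) *\<^sub>R (- al k *\<^sub>R fc (fst (W r)) k)"
      unfolding L W fst_diff fc_diff fc_gen[OF H2(1,2)] fc_gen[OF H2(3,4)] by (simp add: scaleR_diff_right)
    then have "(freq_norm k powr b) *\<^sub>R fc (fst (lift (D r))) k = (freq_norm k powr b * freq_norm k powr (- b)) *\<^sub>R (- al k *\<^sub>R fc (fst (W r)) k)"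
      by (simp only: scaleR_scaleR mult.assoc)
    then show "fc (fst (D r)) k = - al k *\<^sub>R fc (fst (W r)) k"
      unfolding fc_lift_cancel using freq_powr_cancel[of k] by (cases "k = 0") simp_all
    have "fc (snd (lift (D r))) k = fc (snd (gen nu (lift ?W1))) k - fc (snd (gen nu (lift ?W2))) k"
      unfolding L by (simp add: fc_diff)
    then show "fc (snd (D r)) k = - ka k *\<^sub>R fc (snd (W r)) k + (\<Sum>d\<in>offs. cw k d *\<^sub>R fc (fst (W r)) (k + d))"
      unfolding fc_gen[OF H2(1,2)] fc_gen[OF H2(3,4)] W
      by (simp add: fc_diff scaleR_diff_right sum_subtractf)
  qed
  have int: "fc (fst (W r)) k = integral {0..r} (\<lambda>s. fc (fst (D s)) k)" "fc (snd (W r)) k = integral {0..r} (\<lambda>s. fc (snd (D s)) k)"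
    and cont: "continuous_on {0..T} (\<lambda>s. fc (fst (D s)) k)" "continuous_on {0..T} (\<lambda>s. fc (snd (D s)) k)"
    if r: "r \<in> {0..T}" for r k
  proof -
    have l: "bounded_linear (\<lambda>w. fc (fst w) k)" "bounded_linear (\<lambda>w. fc (snd w) k)"
      by (intro bounded_linear_compose[OF bounded_linear_fc bounded_linear_fst] bounded_linear_compose[OF bounded_linear_fc bounded_linear_snd])+
    show cc: "continuous_on {0..T} (\<lambda>s. fc (fst (D s)) k)" "continuous_on {0..T} (\<lambda>s. fc (snd (D s)) k)"
      by (rule bounded_linear.continuous_on[OF l(1) c] bounded_linear.continuous_on[OF l(2) c])+
    show "fc (fst (W r)) k = integral {0..r} (\<lambda>s. fc (fst (D s)) k)" "fc (snd (W r)) k = integral {0..r} (\<lambda>s. fc (snd (D s)) k)"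
      unfolding W_def set_integral_bounded_linear(1)[OF l(1) Di[OF r], symmetric] set_integral_bounded_linear(1)[OF l(2) Di[OF r], symmetric]
      by (rule set_integral_Ioo_eq_integral(2)[OF continuous_on_subset[OF cc(1)]] set_integral_Ioo_eq_integral(2)[OF continuous_on_subset[OF cc(2)]], use r in auto)+
  qed
  have z1: "fc (fst (D r)) k = 0" "fc (fst (W r)) k = 0" if r: "r \<in> {0..T}" for r k
    using integral_eq_decay_imp_zero[OF cont(1)[OF t] _ r, of k "al k"] rel(1)[of _ k] int(1)[of _ k] r by auto
  have z2: "fc (snd (D r)) k = 0" if r: "r \<in> {0..T}" for r k
    using integral_eq_decay_imp_zero(1)[OF cont(2)[OF t] _ r, of k "ka k"] rel(2)[of _ k] int(2)[of _ k] z1(2) by auto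
  have "D t = 0"
    by (rule H_pair_eqI) (simp_all add: z1(1)[OF t] z2[OF t])
  then have "unlift (u t) = unlift (u' t)" unfolding D_def by (rule right_minus_eq[THEN iffD1])
  then have "lift (unlift (u t)) = lift (unlift (u' t))" by (rule arg_cong)
  then show ?thesis
    unfolding solution_unlift(1)[OF u t] solution_unlift(1)[OF u' t] .
qed

theorem control_map_eq:
  assumes h: "integrable lborel h" and hv: "\<And>s. 0 < s \<Longrightarrow> s < T \<Longrightarrow> lift (h s, 0) = (Q (v s), 0)"
    and T: "0 \<le> T"
  shows "control_map nu b Q T v = lift (U h T)"
  unfolding control_map_def
proof (rule the_equality)
  have sol: "is_solution nu b Q T v (\<lambda>t. lift (U h t))" by (rule is_solution_U[of h T Q v, OF h hv])
  then show "\<exists>u. is_solution nu b Q T v u \<and> u T = lift (U h T)" by blast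
  show "x = lift (U h T)" if "\<exists>u. is_solution nu b Q T v u \<and> u T = x" for x
    using that solution_unique[OF _ sol, of _ T] T by auto
qed

end

subsection \<open>Operators diagonal in the real Fourier basis\<close>

text \<open>Q may scale cosine and sine modes of one frequency differently and is then not a complex
  multiplier. In coefficients, cosines are the real and sines the imaginary parts, scaled separately
  here.\<close>

definition real_diag :: "(int \<times> int \<Rightarrow> real) \<Rightarrow> (int \<times> int \<Rightarrow> real) \<Rightarrow> H \<Rightarrow> H" where
  "real_diag u v f = of_coeffs (\<lambda>k. Complex (u k * Re (fc f k)) (v k * Im (fc f k)))"

lemma cmod_Complex_mult_le:
  assumes "\<bar>p\<bar> \<le> M" "\<bar>q\<bar> \<le> M"
  shows "cmod (Complex (p * Re z) (q * Im z)) \<le> M * cmod z"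
proof (rule power2_le_imp_le)
  have "p\<^sup>2 \<le> M\<^sup>2" "q\<^sup>2 \<le> M\<^sup>2" using assms by (auto simp flip: abs_le_square_iff intro: order_trans[OF _ abs_ge_self])
  then have "p\<^sup>2 * (Re z)\<^sup>2 + q\<^sup>2 * (Im z)\<^sup>2 \<le> M\<^sup>2 * (Re z)\<^sup>2 + M\<^sup>2 * (Im z)\<^sup>2"
    by (intro add_mono mult_right_mono) auto
  then show "(cmod (Complex (p * Re z) (q * Im z)))\<^sup>2 \<le> (M * cmod z)\<^sup>2"
    by (simp add: cmod_power2 power_mult_distrib algebra_simps)
qed (use assms in auto)

locale real_multiplier =
  fixes u v :: "int \<times> int \<Rightarrow> real" and M :: real
  assumes even: "u (- k) = u k" "v (- k) = v k"
    and bound: "k \<noteq> 0 \<Longrightarrow> \<bar>u k\<bar> \<le> M" "k \<noteq> 0 \<Longrightarrow> \<bar>v k\<bar> \<le> M"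
begin

lemma M_nonneg: "0 \<le> M"
  using bound(1)[of "(1, 0)"] by (auto simp: zero_prod_def)

lemma coeff_le: "cmod (Complex (u k * Re (fc f k)) (v k * Im (fc f k))) \<le> M * cmod (fc f k)"
  using cmod_Complex_mult_le[of "u k" M "v k" "fc f k"] bound[of k] by (cases "k = 0") (simp_all add: cmod_def)

lemma fc_real_diag: "fc (real_diag u v f) k = Complex (u k * Re (fc f k)) (v k * Im (fc f k))"
proof -
  have "\<exists>h. \<forall>k. fc h k = Complex (u k * Re (fc f k)) (v k * Im (fc f k))"
    by (rule ex_fc_eq[where M = M and g = f]) (use coeff_le in \<open>auto simp: fc_minus_freq even complex_eq_iff\<close>)
  then obtain h where "fc h = (\<lambda>k. Complex (u k * Re (fc f k)) (v k * Im (fc f k)))" by auto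
  with l2_coeffs_fc[of h] have "l2_coeffs (\<lambda>k. Complex (u k * Re (fc f k)) (v k * Im (fc f k)))" by simp
  from fc_of_coeffs[OF this] show ?thesis by (simp add: real_diag_def)
qed

lemma norm_real_diag: "norm (real_diag u v f) \<le> M * norm f"
proof (rule power2_le_imp_le)
  have "((\<lambda>k. M\<^sup>2 * (cmod (fc f k))\<^sup>2) has_sum M\<^sup>2 * (norm f)\<^sup>2) UNIV"
    by (intro has_sum_cmult_right has_sum_norm_sq)
  from has_sum_mono[OF has_sum_norm_sq[of "real_diag u v f"] this]
  show "(norm (real_diag u v f))\<^sup>2 \<le> (M * norm f)\<^sup>2"
    unfolding fc_real_diag power_mult_distrib[symmetric] using power_mono[OF coeff_le] by auto
qed (simp add: M_nonneg)

lemma bounded_linear_real_diag: "bounded_linear (real_diag u v)"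
proof (rule bounded_linear_intro[where K = M])
  show "real_diag u v (f + g) = real_diag u v f + real_diag u v g" for f g
    by (rule fc_eqI) (simp add: fc_real_diag fc_add complex_eq_iff algebra_simps)
  show "real_diag u v (c *\<^sub>R f) = c *\<^sub>R real_diag u v f" for c f
    by (rule fc_eqI) (simp add: fc_real_diag fc_scaleR complex_eq_iff)
  show "norm (real_diag u v f) \<le> norm f * M" for f
    using norm_real_diag[of f] by (simp add: mult.commute)
qed

lemma real_diag_self_adjoint: "real_diag u v f \<bullet> g = f \<bullet> real_diag u v g"
proof -
  have "Re (fc (real_diag u v f) k * cnj (fc g k)) = Re (fc f k * cnj (fc (real_diag u v g) k))" for k
    by (simp add: fc_real_diag algebra_simps)
  then show ?thesis
    using has_sum_unique[OF has_sum_parseval[of "real_diag u v f" g]] has_sum_parseval[of f "real_diag u v g"] by simp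
qed

end

lemma Z2_plus_cases: "k \<noteq> 0 \<Longrightarrow> k \<in> Z2_plus \<or> - k \<in> Z2_plus" and Z2_plus_excl: "k \<in> Z2_plus \<Longrightarrow> - k \<notin> Z2_plus"
  by (auto simp: Z2_plus_def zero_prod_def prod_eq_iff)

lemma trig_uminus: "trig (- k) z = trig k (cnj z)"
  by (cases "k = 0") (auto intro!: fc_eqI simp: fc_trig)

lemma mode_eq_trig:
  assumes "k \<noteq> 0"
  shows "mode k Cos = trig k (of_real (sqrt 2))" "mode k Sin = trig k (- \<i> * of_real (sqrt 2))"
  using assms by (simp_all add: trig_def)

text \<open>The factors q are prescribed on \<open>Z2_plus\<close> only; the modes of k and -k agree
  up to sign, so the extension is even.\<close>

definition even_ext :: "(int \<times> int \<Rightarrow> real) \<Rightarrow> int \<times> int \<Rightarrow> real" where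
  "even_ext p k = p (if k \<in> Z2_plus then k else - k)"

lemma even_ext_uminus: "even_ext p (- k) = even_ext p k"
  using Z2_plus_cases[of k] Z2_plus_excl[of k] by (cases "k = 0") (auto simp: even_ext_def)

text \<open>The exponent is -a / 2, where a = 2 b + 3.\<close>

locale controlled = linearised_vorticity +
  fixes Q :: "H \<Rightarrow> H" and q :: "int \<times> int \<Rightarrow> parity \<Rightarrow> real" and cQ CQ :: real
  assumes cQ_pos: "0 < cQ"
    and Q_linear: "bounded_linear Q"
    and Q_mode: "k \<in> Z2_plus \<Longrightarrow> Q (mode k \<iota>) = q k \<iota> *\<^sub>R mode k \<iota>"
    and q_bounds: "k \<in> Z2_plus \<Longrightarrow> cQ * freq_norm k powr (- (2 * b + 3) / 2) \<le> \<bar>q k \<iota>\<bar>"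
      "k \<in> Z2_plus \<Longrightarrow> \<bar>q k \<iota>\<bar> \<le> CQ * freq_norm k powr (- (2 * b + 3) / 2)"
begin

definition qe :: "parity \<Rightarrow> int \<times> int \<Rightarrow> real" where "qe \<iota> = even_ext (\<lambda>k. q k \<iota>)"

lemma qe_uminus [simp]: "qe \<iota> (- k) = qe \<iota> k"
  by (simp add: qe_def even_ext_uminus)

lemma qe_bounds:
  assumes "k \<noteq> 0"
  shows "cQ * freq_norm k powr (- b - 3 / 2) \<le> \<bar>qe \<iota> k\<bar>" "\<bar>qe \<iota> k\<bar> \<le> CQ * freq_norm k powr (- b - 3 / 2)"
proof -
  have e: "- (2 * b + 3) / 2 = - b - 3 / 2" by (simp add: field_simps)
  have k: "(if k \<in> Z2_plus then k else - k) \<in> Z2_plus" (is "?k \<in> _") using Z2_plus_cases[OF assms] by auto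
  have "freq_norm ?k = freq_norm k" by auto
  then show "cQ * freq_norm k powr (- b - 3 / 2) \<le> \<bar>qe \<iota> k\<bar>" "\<bar>qe \<iota> k\<bar> \<le> CQ * freq_norm k powr (- b - 3 / 2)"
    using q_bounds[OF k, of \<iota>] unfolding e by (simp_all only: qe_def even_ext_def)
qed

lemma CQ_nonneg: "0 \<le> CQ"
  using qe_bounds[of "(1, 0)" Cos] by (auto simp: zero_prod_def freq_norm_def)

lemma qe_ne: "k \<noteq> 0 \<Longrightarrow> qe \<iota> k \<noteq> 0"
proof -
  assume k: "k \<noteq> 0"
  then have "0 < cQ * freq_norm k powr (- b - 3 / 2)" using cQ_pos freq_norm_ge_1[of k] by simp
  then show ?thesis using qe_bounds(1)[OF k, of \<iota>] by auto
qed

lemma Q_trig: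
  assumes "k \<noteq> 0"
  shows "Q (trig k z) = trig k (Complex (qe Cos k * Re z) (qe Sin k * Im z))"
proof -
  have plus: "Q (trig k z) = trig k (Complex (q k Cos * Re z) (q k Sin * Im z))" if k: "k \<in> Z2_plus" for k z
  proof -
    interpret Q: bounded_linear Q by (rule Q_linear)
    have k0: "k \<noteq> 0" using k by (auto simp: Z2_plus_def)
    have dec: "trig k z = (Re z / sqrt 2) *\<^sub>R mode k Cos + (- Im z / sqrt 2) *\<^sub>R mode k Sin" for z
      unfolding mode_eq_trig[OF k0]
      by (rule fc_eqI) (auto simp: fc_add fc_diff fc_scaleR fc_trig k0 complex_eq_iff)
    have "Q (trig k z) = (Re z / sqrt 2) *\<^sub>R Q (mode k Cos) + (- Im z / sqrt 2) *\<^sub>R Q (mode k Sin)"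
      unfolding dec[of z] by (simp only: Q.add Q.scaleR)
    then show ?thesis
      unfolding Q_mode[OF k] dec[of "Complex _ _"] by (simp add: mult.commute)
  qed
  show ?thesis
  proof (cases "k \<in> Z2_plus")
    case True
    then show ?thesis by (simp add: plus qe_def even_ext_def)
  next
    case False
    then have "- k \<in> Z2_plus" using Z2_plus_cases[OF assms] by auto
    from plus[OF this, of "cnj z"] False show ?thesis
      using trig_uminus[of "- k" z] trig_uminus[of "- k" "Complex (qe Cos k * Re z) (qe Sin k * Im z)"]
      by (simp add: qe_def even_ext_def complex_cnj)
  qed
qed

sublocale Qm: real_multiplier "qe Cos" "qe Sin" CQ
proof
  show "\<bar>qe Cos k\<bar> \<le> CQ" "\<bar>qe Sin k\<bar> \<le> CQ" if "k \<noteq> 0" for k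
  proof -
    have "freq_norm k powr (- b - 3 / 2) \<le> freq_norm k powr 0"
      using freq_norm_ge_1[OF that] b_ge by (intro powr_mono) auto
    then have "CQ * freq_norm k powr (- b - 3 / 2) \<le> CQ * 1"
      using freq_norm_ge_1[OF that] CQ_nonneg by (intro mult_left_mono) auto
    then show "\<bar>qe Cos k\<bar> \<le> CQ" "\<bar>qe Sin k\<bar> \<le> CQ"
      using qe_bounds(2)[OF that] by (auto intro: order_trans)
  qed
qed auto

text \<open>Q is bounded and linear and Fourier series converge in H, so its values on single modes
  determine it.\<close>

lemma fc_Q: "fc (Q f) k = Complex (qe Cos k * Re (fc f k)) (qe Sin k * Im (fc f k))"
proof -
  have "((\<lambda>j. Q (trig j (fc f j))) has_sum Q f) UNIV"
    by (rule has_sum_bounded_linear[OF Q_linear has_sum_fourier])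
  moreover have "Q (trig j (fc f j)) = trig j (fc (real_diag (qe Cos) (qe Sin) f) j)" for j
    by (cases "j = 0") (simp_all add: Q_trig Qm.fc_real_diag linear_0[OF bounded_linear.linear[OF Q_linear]])
  ultimately have "Q f = real_diag (qe Cos) (qe Sin) f"
    using has_sum_fourier[of "real_diag (qe Cos) (qe Sin) f"] has_sum_unique by simp
  then show ?thesis by (simp add: Qm.fc_real_diag)
qed

text \<open>\<open>Pu\<close> is $\Lambda^b Q$, and \<open>Bu\<close> satisfies $\Lambda^b Q \circ$ \<open>Bu\<close> $= \Lambda^{-3/2}$, where $\Lambda = (-\Delta)^{1/2}$.\<close>

definition Pu :: "parity \<Rightarrow> int \<times> int \<Rightarrow> real" where "Pu \<iota> k = freq_norm k powr b * qe \<iota> k"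
definition Bu :: "parity \<Rightarrow> int \<times> int \<Rightarrow> real" where "Bu \<iota> k = freq_norm k powr (- b - 3 / 2) / qe \<iota> k"

sublocale P: real_multiplier "Pu Cos" "Pu Sin" CQ
proof
  show "\<bar>Pu Cos k\<bar> \<le> CQ" "\<bar>Pu Sin k\<bar> \<le> CQ" if "k \<noteq> 0" for k
  proof -
    have "\<bar>Pu \<iota> k\<bar> \<le> CQ" for \<iota>
    proof -
      have "\<bar>Pu \<iota> k\<bar> \<le> freq_norm k powr b * (CQ * freq_norm k powr (- b - 3 / 2))"
        unfolding Pu_def abs_mult using qe_bounds(2)[OF that, of \<iota>] by (intro mult_mono) auto
      also have "\<dots> = CQ * freq_norm k powr (- 3 / 2)"
        using freq_norm_ge_1[OF that] by (simp add: algebra_simps flip: powr_add)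
      also have "\<dots> \<le> CQ * freq_norm k powr 0"
        using freq_norm_ge_1[OF that] CQ_nonneg by (intro mult_left_mono powr_mono) auto
      finally show ?thesis using freq_norm_ge_1[OF that] by simp
    qed
    then show "\<bar>Pu Cos k\<bar> \<le> CQ" "\<bar>Pu Sin k\<bar> \<le> CQ" by auto
  qed
qed (auto simp: Pu_def)

sublocale B: real_multiplier "Bu Cos" "Bu Sin" "1 / cQ"
proof
  show "\<bar>Bu Cos k\<bar> \<le> 1 / cQ" "\<bar>Bu Sin k\<bar> \<le> 1 / cQ" if "k \<noteq> 0" for k
  proof -
    have "\<bar>Bu \<iota> k\<bar> \<le> 1 / cQ" for \<iota>
      using qe_bounds(1)[OF that, of \<iota>] cQ_pos qe_ne[OF that, of \<iota>] by (simp add: Bu_def abs_divide field_simps)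
    then show "\<bar>Bu Cos k\<bar> \<le> 1 / cQ" "\<bar>Bu Sin k\<bar> \<le> 1 / cQ" by auto
  qed
qed (auto simp: Bu_def)

abbreviation P :: "H \<Rightarrow> H" where "P \<equiv> real_diag (Pu Cos) (Pu Sin)"
abbreviation B :: "H \<Rightarrow> H" where "B \<equiv> real_diag (Bu Cos) (Bu Sin)"

lemma lift_P: "lift (P f, 0) = (Q f, 0)"
proof (rule lift_eqI)
  fix k
  show "fc (fst (Q f, 0)) k = freq_norm k powr - b *\<^sub>R fc (fst (P f, 0)) k"
    using freq_powr_cancel[of k] by (cases "k = 0") (simp_all add: fc_Q P.fc_real_diag Pu_def complex_eq_iff algebra_simps)
qed simp

lemma fc_P_B: "fc (P (B f)) k = freq_norm k powr (- 3 / 2) *\<^sub>R fc f k"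
proof (cases "k = 0")
  case False
  have "Pu \<iota> k * Bu \<iota> k = freq_norm k powr (- 3 / 2)" for \<iota>
    using qe_ne[OF False] freq_norm_ge_1[OF False] by (simp add: Pu_def Bu_def flip: powr_add)
  then show ?thesis
    by (simp add: P.fc_real_diag B.fc_real_diag complex_eq_iff flip: mult.assoc)
qed simp

end

subsection \<open>Adjoints, and observability from a right inverse\<close>

lemma integrable_time_measure:
  fixes f :: "real \<Rightarrow> 'a::{banach, second_countable_topology}"
  shows "integrable (time_measure T) f \<longleftrightarrow> set_integrable lborel {0<..<T} f"
  unfolding time_measure_def set_integrable_def by (rule integrable_restrict_space) simp

lemma integral_time_measure:
  fixes f :: "real \<Rightarrow> 'a::{banach, second_countable_topology}"
  shows "(LINT t|time_measure T. f t) = (LINT t:{0<..<T}|lborel. f t)"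
  unfolding time_measure_def set_lebesgue_integral_def by (rule integral_restrict_space) simp

lemma space_time_measure: "space (time_measure T) = {0<..<T}"
  by (simp add: time_measure_def space_restrict_space)

lemma integrable_const_time: "0 \<le> T \<Longrightarrow> integrable (time_measure T) (\<lambda>_. c :: real)"
  unfolding integrable_time_measure by (rule set_integral_Ioo_eq_integral(1)) simp

lemma L2_time_bounded:
  assumes v: "v \<in> borel_measurable lborel" and C: "\<And>t. 0 < t \<Longrightarrow> t < T \<Longrightarrow> norm (v t) \<le> C" and T: "0 \<le> T"
  shows "v \<in> L2_time T" "0 \<le> C \<Longrightarrow> L2_time_norm T v \<le> sqrt T * C"
proof -
  have vm [measurable]: "v \<in> borel_measurable (time_measure T)"
    unfolding time_measure_def by (rule measurable_restrict_space1[OF v])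
  have vi: "integrable (time_measure T) (\<lambda>t. (norm (v t))\<^sup>2)"
  proof (rule Bochner_Integration.integrable_bound[OF integrable_const_time[OF T, of "C\<^sup>2"]])
    show "AE t in time_measure T. norm ((norm (v t))\<^sup>2) \<le> norm (C\<^sup>2)"
      using C by (intro AE_I2) (auto simp: space_time_measure intro!: power_mono)
  qed measurable
  then show "v \<in> L2_time T" by (simp add: L2_time_def vm)
  assume C0: "0 \<le> C"
  have "(LINT t|time_measure T. v t \<bullet> v t) \<le> (LINT t|time_measure T. C\<^sup>2)"
    using vi C by (intro integral_mono integrable_const_time T)
      (auto simp: power2_norm_eq_inner space_time_measure simp flip: power2_norm_eq_inner intro!: power_mono)
  also have "\<dots> = T * C\<^sup>2"
    unfolding integral_time_measure using T by (subst set_integral_Ioo_eq_integral(2)) auto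
  finally have "L2_time_norm T v \<le> sqrt (T * C\<^sup>2)"
    unfolding L2_time_norm_def L2_time_inner_def by (rule real_sqrt_le_mono)
  then show "L2_time_norm T v \<le> sqrt T * C" using C0 by (simp add: real_sqrt_mult)
qed

text \<open>Young's inequality with a free weight c, integrated over time. It is applied with c the
  square of a bound for the right inverse.\<close>

lemma L2_time_inner_le:
  assumes v: "v \<in> L2_time T" and w: "w \<in> L2_time T" and c: "0 < c"
  shows "2 * L2_time_inner T v w \<le> (L2_time_norm T v)\<^sup>2 / c + c * (L2_time_norm T w)\<^sup>2"
proof -
  have m [measurable]: "v \<in> borel_measurable (time_measure T)" "w \<in> borel_measurable (time_measure T)"
    and i: "integrable (time_measure T) (\<lambda>t. (norm (v t))\<^sup>2)" "integrable (time_measure T) (\<lambda>t. (norm (w t))\<^sup>2)"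
    using v w by (auto simp: L2_time_def)
  have pt: "2 * \<bar>v t \<bullet> w t\<bar> \<le> (norm (v t))\<^sup>2 / c + c * (norm (w t))\<^sup>2" for t
  proof -
    have "2 * (norm (v t) / sqrt c) * (sqrt c * norm (w t)) \<le> (norm (v t) / sqrt c)\<^sup>2 + (sqrt c * norm (w t))\<^sup>2"
      by (rule sum_squares_bound)
    then have "2 * (norm (v t) * norm (w t)) \<le> (norm (v t))\<^sup>2 / c + c * (norm (w t))\<^sup>2"
      using c by (simp add: power_divide power_mult_distrib)
    then show ?thesis using Cauchy_Schwarz_ineq2[of "v t" "w t"] by linarith
  qed
  have ib: "integrable (time_measure T) (\<lambda>t. (norm (v t))\<^sup>2 / c + c * (norm (w t))\<^sup>2)"
    using i by auto
  have "integrable (time_measure T) (\<lambda>t. 2 * (v t \<bullet> w t))"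
    by (rule Bochner_Integration.integrable_bound[OF ib])
      (measurable, use pt in \<open>auto simp: abs_mult intro!: AE_I2 order_trans[OF _ abs_ge_self]\<close>)
  then have "(LINT t|time_measure T. 2 * (v t \<bullet> w t)) \<le> (LINT t|time_measure T. (norm (v t))\<^sup>2 / c + c * (norm (w t))\<^sup>2)"
    using ib pt by (intro integral_mono) (auto intro: order_trans[OF _ pt])
  moreover have sq: "(L2_time_norm T u)\<^sup>2 = (LINT t|time_measure T. (norm (u t))\<^sup>2)" for u
    by (simp add: L2_time_norm_def L2_time_inner_def flip: power2_norm_eq_inner)
  ultimately show ?thesis
    unfolding sq L2_time_inner_def using i by simp
qed

lemma L2_time_integrable:
  assumes "v \<in> L2_time T" "0 \<le> T"
  shows "set_integrable lborel {0<..<T} v"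
  unfolding integrable_time_measure[symmetric]
proof (rule Bochner_Integration.integrable_bound)
  show "integrable (time_measure T) (\<lambda>t. 1 + (norm (v t))\<^sup>2)"
    using assms integrable_const_time[of T 1] by (auto simp: L2_time_def)
  show "AE t in time_measure T. norm (v t) \<le> norm (1 + (norm (v t))\<^sup>2)"
  proof (rule AE_I2)
    fix t
    have "2 * norm (v t) * 1 \<le> (norm (v t))\<^sup>2 + 1\<^sup>2" by (rule sum_squares_bound)
    then have "norm (v t) \<le> 1 + (norm (v t))\<^sup>2" using norm_ge_zero[of "v t"] by (simp only: mult_1_right one_power2)
    then show "norm (v t) \<le> norm (1 + (norm (v t))\<^sup>2)" by (rule order_trans) simp
  qed
qed (use assms in \<open>simp add: L2_time_def\<close>)

context linearised_vorticity
begin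

section \<open>Adjoints of the semigroup and of the control map\<close>

definition Radj :: "real \<Rightarrow> H \<times> H \<Rightarrow> H \<times> H" where
  "Radj t w = (band (diag (\<lambda>k. exp (- al k * t))) (fst w) + band (adj_symbol (\<lambda>k d. cw k d * duh k d t)) (snd w),
    band (diag (\<lambda>k. exp (- ka k * t))) (snd w))"

lemma adj_symbol_diag [simp]: "adj_symbol (diag g) = diag g"
  by (intro ext) (simp add: adj_symbol_def diag_def)

lemma R_adjoint:
  assumes t: "0 \<le> t"
  shows "R t w \<bullet> w' = w \<bullet> Radj t w'"
proof -
  have 1: "band (diag (\<lambda>k. exp (- al k * t))) f \<bullet> g = f \<bullet> band (diag (\<lambda>k. exp (- al k * t))) g" for f g
  proof -
    have "symbol_bound (diag (\<lambda>k. exp (- al k * t))) 1"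
      by (rule symbol_bound_diag) (use exp_al_le[OF t] in auto)
    from band_adjoint[OF _ this, of f g] show ?thesis by simp
  qed
  have 2: "band (diag (\<lambda>k. exp (- ka k * t))) f \<bullet> g = f \<bullet> band (diag (\<lambda>k. exp (- ka k * t))) g" for f g
  proof -
    have "symbol_bound (diag (\<lambda>k. exp (- ka k * t))) 1"
      by (rule symbol_bound_diag) (use exp_ka_le[OF _ t] in auto)
    from band_adjoint[OF _ this, of f g] show ?thesis by simp
  qed
  show ?thesis
    unfolding R_def Radj_def inner_prod_def fst_conv snd_conv inner_add_left inner_add_right 1 2
      band_adjoint[OF even_cw_duh bound_cw_duh[OF t order_refl] t] by simp
qed

text \<open>The adjoint inherits the bound of \<open>R\<close>, since the square of the norm of
  \<open>Radj t w\<close> is the inner product of \<open>R t (Radj t w)\<close> with w.\<close>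

lemma norm_Radj_le:
  assumes t: "0 \<le> t" "t \<le> M"
  shows "norm (Radj t w) \<le> (10 + 5 * M) * norm w"
proof (cases "Radj t w = 0")
  case False
  have "norm (Radj t w) * norm (Radj t w) = R t (Radj t w) \<bullet> w"
    using R_adjoint[OF t(1), of "Radj t w" w] by (simp add: dot_square_norm power2_eq_square)
  also have "\<dots> \<le> norm (R t (Radj t w)) * norm w" by (rule norm_cauchy_schwarz)
  also have "\<dots> \<le> ((10 + 5 * M) * norm (Radj t w)) * norm w"
    by (intro mult_right_mono norm_R_le t) auto
  finally have "norm (Radj t w) * norm (Radj t w) \<le> norm (Radj t w) * ((10 + 5 * M) * norm w)" by (simp add: mult_ac)
  then show ?thesis using False by (auto dest: mult_left_le_imp_le)
qed (use t in simp)

lemma Radj_in_Z: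
  assumes "0 \<le> t" "w \<in> Z"
  shows "Radj t w \<in> Z"
proof -
  have "freq_norm (1, 0) = 1" "freq_norm (0, 1) = 1" by (simp_all add: freq_norm_def)
  then have k: "ka (1, 0) = 0" "ka (0, 1) = 0" by (simp_all add: ka_def)
  have "fc (band (diag (\<lambda>k. exp (- ka k * t))) f) j = exp (- ka j * t) *\<^sub>R fc f j" for f j
    by (rule fc_band_diag[where M = 1]) (use exp_ka_le assms in auto)
  then show ?thesis using assms(2) by (simp add: Z_iff inner_phi Radj_def k)
qed

lemma measurable_Radj: "(\<lambda>s. indicat_real {0<..<T} s *\<^sub>R fst (Radj (T - s) w)) \<in> borel_measurable lborel"
proof (rule borel_measurable_fcI)
  fix k
  have "fc (indicat_real {0<..<T} s *\<^sub>R fst (Radj (T - s) w)) k = indicat_real {0<..<T} s *\<^sub>R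
    (exp (- al k * (T - s)) *\<^sub>R fc (fst w) k + (if k = 0 then 0 else
      \<Sum>d\<in>offs. (cw (k + d) (- d) * duh (k + d) (- d) (T - s)) *\<^sub>R fc (snd w) (k + d)))" for s
  proof (cases "s \<in> {0<..<T}")
    case True
    then have t: "0 \<le> T - s" by auto
    have "fc (band (diag (\<lambda>k. exp (- al k * (T - s)))) (fst w)) k = exp (- al k * (T - s)) *\<^sub>R fc (fst w) k"
      by (rule fc_band_diag[where M = 1]) (use exp_al_le t in auto)
    moreover have "fc (band (adj_symbol (\<lambda>k d. cw k d * duh k d (T - s))) (snd w)) k
        = (if k = 0 then 0 else \<Sum>d\<in>offs. (cw (k + d) (- d) * duh (k + d) (- d) (T - s)) *\<^sub>R fc (snd w) (k + d))"
      unfolding fc_band[OF even_adj_symbol[OF even_cw_duh] adj_symbol_bound[OF bound_cw_duh[OF t order_refl]]]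
      by (simp add: adj_symbol_def)
    ultimately show ?thesis using True by (simp add: Radj_def fc_add)
  qed simp
  then show "(\<lambda>s. fc (indicat_real {0<..<T} s *\<^sub>R fst (Radj (T - s) w)) k) \<in> borel_measurable lborel"
    by simp
qed

text \<open>\<open>adjoint_on\<close> is a choice, so an adjoint has to be exhibited; it is
  \<open>Radj\<close> read through \<open>lift\<close>.\<close>

lemma flow_adjoint:
  assumes T: "0 \<le> T" and x: "x \<in> E b"
  shows "flow_adjoint nu b T x \<in> E b" "z \<in> E b \<Longrightarrow> E_inner b (flow nu b T z) x = E_inner b z (flow_adjoint nu b T x)"
proof -
  obtain w where w: "w \<in> Z" "x = lift w" using x by (auto simp: E_eq_lift)
  have "lift (Radj T w) \<in> E b \<and> (\<forall>z\<in>E b. E_inner b (flow nu b T z) x = E_inner b z (lift (Radj T w)))"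
    using Radj_in_Z[OF T w(1)] R_adjoint[OF T] by (auto simp: E_eq_lift w flow_lift T)
  then have "flow_adjoint nu b T x \<in> E b \<and> (\<forall>z\<in>E b. E_inner b (flow nu b T z) x = E_inner b z (flow_adjoint nu b T x))"
    unfolding flow_adjoint_def adjoint_on_def by (rule someI)
  then show "flow_adjoint nu b T x \<in> E b" "z \<in> E b \<Longrightarrow> E_inner b (flow nu b T z) x = E_inner b z (flow_adjoint nu b T x)"
    by auto
qed

end

context controlled
begin

lemma control_map_P:
  assumes v: "v \<in> L2_time T" and T: "0 \<le> T"
  defines "h \<equiv> (\<lambda>s. indicat_real {0<..<T} s *\<^sub>R P (v s))"
  shows "integrable lborel h" "control_map nu b Q T v = lift (U h T)"
proof -
  show h: "integrable lborel h"
    using set_integral_bounded_linear(2)[OF P.bounded_linear_real_diag L2_time_integrable[OF v T]]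
    by (simp add: h_def set_integrable_def)
  show "control_map nu b Q T v = lift (U h T)"
    by (rule control_map_eq[OF h _ T]) (simp add: h_def lift_P)
qed

text \<open>For x = lift w, the adjoint is represented by s \<mapsto> P (fst (Radj (T - s) w)):
  inside the time integral \<open>R\<close> passes to its adjoint, and \<open>P\<close> is
  self-adjoint.\<close>

lemma control_adjoint:
  assumes T: "0 \<le> T" and x: "x \<in> E b"
  shows "control_adjoint nu b Q T x \<in> L2_time T"
    "v \<in> L2_time T \<Longrightarrow> E_inner b (control_map nu b Q T v) x = L2_time_inner T v (control_adjoint nu b Q T x)"
proof -
  obtain w where w: "w \<in> Z" "x = lift w" using x by (auto simp: E_eq_lift)
  define y where "y s = P (indicat_real {0<..<T} s *\<^sub>R fst (Radj (T - s) w))" for s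
  have "P \<in> borel_measurable borel"
    by (intro borel_measurable_continuous_onI linear_continuous_on P.bounded_linear_real_diag)
  from measurable_compose[OF measurable_Radj this] have ym: "y \<in> borel_measurable lborel"
    unfolding y_def[abs_def] by simp
  have yL: "y \<in> L2_time T"
  proof (rule L2_time_bounded(1)[OF ym _ T])
    fix t assume t: "0 < t" "t < T"
    have "norm (y t) \<le> CQ * norm (fst (Radj (T - t) w))"
      using P.norm_real_diag t by (simp add: y_def)
    also have "\<dots> \<le> CQ * norm (Radj (T - t) w)"
      using norm_fst_le[of "fst (Radj (T - t) w)" "snd (Radj (T - t) w)"] CQ_nonneg by (intro mult_left_mono) auto
    also have "\<dots> \<le> CQ * ((10 + 5 * T) * norm w)"
      using t CQ_nonneg by (intro mult_left_mono norm_Radj_le) auto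
    finally show "norm (y t) \<le> CQ * ((10 + 5 * T) * norm w)" .
  qed
  have ip: "E_inner b (control_map nu b Q T v) x = L2_time_inner T v y" if v: "v \<in> L2_time T" for v
  proof -
    let ?h = "\<lambda>s. indicat_real {0<..<T} s *\<^sub>R P (v s)"
    note cp = control_map_P[OF v T]
    have "E_inner b (control_map nu b Q T v) x = U ?h T \<bullet> w" by (simp add: cp(2) w)
    also have "\<dots> = (LINT s:{0<..<T}|lborel. R (T - s) (?h s, 0) \<bullet> w)"
      unfolding U_def by (rule set_integral_bounded_linear(1)[OF bounded_linear_inner_left U_integrand(1)[OF cp(1)], symmetric])
    also have "\<dots> = (LINT s:{0<..<T}|lborel. v s \<bullet> y s)"
    proof (rule set_lebesgue_integral_cong; (intro allI impI)?)
      fix s assume s: "s \<in> {0<..<T}"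
      then have "R (T - s) (?h s, 0) \<bullet> w = (?h s, 0) \<bullet> Radj (T - s) w" by (intro R_adjoint) auto
      also have "\<dots> = v s \<bullet> y s"
        using s by (simp add: inner_prod_def y_def P.real_diag_self_adjoint)
      finally show "R (T - s) (?h s, 0) \<bullet> w = v s \<bullet> y s" .
    qed simp
    finally show ?thesis by (simp add: L2_time_inner_def integral_time_measure)
  qed
  have "control_adjoint nu b Q T x \<in> L2_time T
      \<and> (\<forall>v\<in>L2_time T. E_inner b (control_map nu b Q T v) x = L2_time_inner T v (control_adjoint nu b Q T x))"
    unfolding control_adjoint_def adjoint_on_def by (rule someI[of _ y]) (use yL ip in blast)
  then show "control_adjoint nu b Q T x \<in> L2_time T"
    "v \<in> L2_time T \<Longrightarrow> E_inner b (control_map nu b Q T v) x = L2_time_inner T v (control_adjoint nu b Q T x)"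
    by auto
qed

text \<open>A bounded right inverse $K$ with $S_T = A_T K$ gives
  $\|S_T^*\xi\|^2 = \langle K S_T^*\xi, A_T^*\xi\rangle$, hence the observability inequality.\<close>

lemma observability_of_right_inverse:
  assumes T: "0 \<le> T" and M: "0 < M"
    and K_add: "\<And>v w t. K (v + w) t = K v t + K w t"
    and K_scale: "\<And>c w t. K (c *\<^sub>R w) t = c *\<^sub>R K w t"
    and K_meas: "\<And>w. K w \<in> borel_measurable lborel"
    and K_bound: "\<And>w t. 0 < t \<Longrightarrow> t < T \<Longrightarrow> norm (K w t) \<le> M * norm w"
    and K_control: "\<And>w. w \<in> Z \<Longrightarrow> control_map nu b Q T (K w) = lift (R T w)"
  shows "\<exists>C\<ge>0. (\<forall>x\<in>E b. (E_norm b (flow_adjoint nu b T x))\<^sup>2 \<le> C * (L2_time_norm T (control_adjoint nu b Q T x))\<^sup>2)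
    \<and> (\<exists>K. bounded_op_E_L2 b T K \<and> (\<forall>x\<in>E b. flow nu b T x = control_map nu b Q T (K x)) \<and> op_norm_E_L2 b T K \<le> sqrt C)"
proof -
  \<comment> \<open>On (0, T) a function bounded by M has L^2 norm at most sqrt T M. The summand 1
    keeps N positive for T = 0 too, so that division by N^2 is allowed.\<close>
  define N where "N = (sqrt T + 1) * M"
  have N: "0 < N" using T M by (simp add: N_def add_nonneg_pos)
  have L2: "K w \<in> L2_time T" for w
    by (rule L2_time_bounded(1)[OF K_meas _ T]) (rule K_bound)
  have nb: "L2_time_norm T (K w) \<le> N * norm w" for w
  proof -
    have "L2_time_norm T (K w) \<le> sqrt T * (M * norm w)"
      by (rule L2_time_bounded(2)[OF K_meas _ T]) (use K_bound M in auto)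
    also have "\<dots> \<le> N * norm w" using M by (simp add: N_def algebra_simps)
    finally show ?thesis .
  qed
  define K' where "K' x = K (unlift x)" for x
  have norm_K': "L2_time_norm T (K' x) \<le> N * E_norm b x" if "x \<in> E b" for x
    using nb[of "unlift x"] lift_unlift(1)[OF that] E_norm_lift[of "unlift x"] by (simp add: K'_def)
  have flow: "flow nu b T x = control_map nu b Q T (K' x)" if "x \<in> E b" for x
    using that by (auto simp: E_eq_lift K'_def flow_lift T K_control)
  have lin: "K' (x + y) t = K' x t + K' y t" "K' (c *\<^sub>R x) t = c *\<^sub>R K' x t" if "x \<in> E b" "y \<in> E b" for x y c t
  proof -
    have *: "x = lift (unlift x)" "y = lift (unlift y)" using that by (simp_all add: lift_unlift)
    obtain v w where "x = lift v" "y = lift w" by (rule that[OF *])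
    then show "K' (x + y) t = K' x t + K' y t" "K' (c *\<^sub>R x) t = c *\<^sub>R K' x t"
      by (simp_all add: K'_def K_add K_scale flip: lift_add lift_scaleR)
  qed
  have E0: "0 \<in> E b" "E_norm b 0 = 0"
    using lift_in_E[of 0] Z_zero lift_scaleR[of 0 0] E_norm_lift[of 0] by simp_all
  show ?thesis
  proof (intro exI[of _ "N\<^sup>2"] conjI ballI exI[of _ K'])
    fix x assume x: "x \<in> E b"
    define y where "y = flow_adjoint nu b T x"
    define z where "z = control_adjoint nu b Q T x"
    have y: "y \<in> E b" unfolding y_def by (rule flow_adjoint(1)[OF T x])
    have Ey: "(E_norm b y)\<^sup>2 = E_inner b y y"
      using y by (auto simp: E_eq_lift simp flip: power2_norm_eq_inner)
    have "E_inner b y y = E_inner b (flow nu b T y) x"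
      unfolding y_def by (rule flow_adjoint(2)[OF T x, symmetric]) (rule flow_adjoint(1)[OF T x])
    also have "\<dots> = L2_time_inner T (K' y) z"
      unfolding flow[OF y] z_def by (rule control_adjoint(2)[OF T x]) (simp add: K'_def L2)
    finally have eq: "(E_norm b y)\<^sup>2 = L2_time_inner T (K' y) z" by (simp add: Ey)
    \<comment> \<open>With weight N^2 the left side is twice the square of the norm of y, and the
      first term on the right is at most that square once.\<close>
    have "2 * L2_time_inner T (K' y) z \<le> (L2_time_norm T (K' y))\<^sup>2 / N\<^sup>2 + N\<^sup>2 * (L2_time_norm T z)\<^sup>2"
      by (rule L2_time_inner_le) (use N control_adjoint(1)[OF T x] in \<open>simp_all add: K'_def L2 z_def\<close>)
    also have "(L2_time_norm T (K' y))\<^sup>2 / N\<^sup>2 \<le> (E_norm b y)\<^sup>2"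
    proof -
      have "(L2_time_norm T (K' y))\<^sup>2 \<le> (N * E_norm b y)\<^sup>2"
        using norm_K'[OF y] by (intro power_mono) (auto simp: L2_time_norm_def L2_time_inner_def)
      then show ?thesis using N by (simp add: power_mult_distrib divide_le_eq mult.commute)
    qed
    finally show "(E_norm b (flow_adjoint nu b T x))\<^sup>2 \<le> N\<^sup>2 * (L2_time_norm T (control_adjoint nu b Q T x))\<^sup>2"
      unfolding eq[symmetric] by (simp add: y_def z_def)
  next
    show "bounded_op_E_L2 b T K'"
      unfolding bounded_op_E_L2_def
      using L2 lin norm_K' by (auto simp: K'_def[of "_ :: H \<times> H"] intro!: exI[of _ N])
    show "op_norm_E_L2 b T K' \<le> sqrt (N\<^sup>2)"
      unfolding op_norm_E_L2_def
    proof (rule cSUP_least)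
      show "{x \<in> E b. E_norm b x \<le> 1} \<noteq> {}" using E0 by force
      fix x assume x: "x \<in> {x \<in> E b. E_norm b x \<le> 1}"
      have "L2_time_norm T (K' x) \<le> N * E_norm b x" using norm_K' x by simp
      also have "\<dots> \<le> N * 1" using x N by (intro mult_left_mono) auto
      also have "\<dots> = sqrt (N\<^sup>2)" using N by simp
      finally show "L2_time_norm T (K' x) \<le> sqrt (N\<^sup>2)" .
    qed
  qed (use flow in auto)
qed

end

subsection \<open>Lattice arithmetic\<close>

text \<open>The squared length as an integer: equality of decay rates becomes arithmetic, and
  different rates differ by at least \<nu>.\<close>

definition isq :: "int \<times> int \<Rightarrow> int" where "isq k = (fst k)\<^sup>2 + (snd k)\<^sup>2"

lemma freq_norm_sq_isq: "(freq_norm k)\<^sup>2 = of_int (isq k)"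
  by (simp add: freq_norm_sq isq_def)

lemma isq_uminus [simp]: "isq (- k) = isq k"
  by (simp add: isq_def)

lemma isq_zero_iff [simp]: "isq k = 0 \<longleftrightarrow> k = 0"
  by (simp add: isq_def sum_power2_eq_zero_iff prod_eq_iff)

lemma isq_nonneg: "0 \<le> isq k"
  by (simp add: isq_def)

lemma int_sq_le_1: "(x :: int)\<^sup>2 \<le> 1 \<longleftrightarrow> \<bar>x\<bar> \<le> 1"
  using abs_le_square_iff[of x 1] by simp

lemma isq_le_1_imp_offs:
  assumes "isq k \<le> 1"
  shows "k \<in> offs"
proof -
  have "(fst k)\<^sup>2 \<le> 1" "(snd k)\<^sup>2 \<le> 1"
    using assms zero_le_power2[of "fst k"] zero_le_power2[of "snd k"] unfolding isq_def by linarith+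
  then have "fst k \<in> {-1, 0, 1}" "snd k \<in> {-1, 0, 1}" by (auto simp: int_sq_le_1)
  then show ?thesis using assms by (cases k) (auto simp: isq_def offs_def zero_prod_def)
qed

text \<open>\<open>dir k\<close> leads from \<open>k\<close> to a point off the axes and diagonals, whose four neighbours have
  four distinct lengths.\<close>

definition dir :: "int \<times> int \<Rightarrow> int \<times> int" where
  "dir k = (if snd k = 0 then (0, sgn (fst k))
    else if fst k = 0 then (sgn (snd k), 0)
    else if \<bar>snd k\<bar> \<le> \<bar>fst k\<bar> then (sgn (fst k), 0) else (0, sgn (snd k)))"

lemma dir_uminus [simp]: "dir (- k) = - dir k"
  by (simp add: dir_def)

text \<open>From an axis the step leaves the axis sideways, and the other coordinate exceeds 1 in
  modulus. Elsewhere it increases the coordinate that is at least as large in modulus, so the moduli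
  become or stay different. The last conclusion says that the cross product in
  \<open>coupling\<close> does not vanish.\<close>

lemma dir_props:
  assumes "1 < isq k"
  shows "dir k \<in> offs" "dir k \<noteq> 0" "fst (k + dir k) \<noteq> 0" "snd (k + dir k) \<noteq> 0"
    "\<bar>fst (k + dir k)\<bar> \<noteq> \<bar>snd (k + dir k)\<bar>"
    "fst k * snd (dir k) - snd k * fst (dir k) \<noteq> 0"
proof -
  obtain x y where k: "k = (x, y)" by (cases k)
  have nx: "\<bar>x\<bar> \<noteq> 1" if "y = 0" using assms that int_sq_le_1[of x] by (auto simp: k isq_def)
  have ny: "\<bar>y\<bar> \<noteq> 1" if "x = 0" using assms that int_sq_le_1[of y] by (auto simp: k isq_def)
  have n0: "x \<noteq> 0 \<or> y \<noteq> 0" using assms by (auto simp: k isq_def)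
  show "dir k \<in> offs" "dir k \<noteq> 0" "fst (k + dir k) \<noteq> 0" "snd (k + dir k) \<noteq> 0"
    "\<bar>fst (k + dir k)\<bar> \<noteq> \<bar>snd (k + dir k)\<bar>" "fst k * snd (dir k) - snd k * fst (dir k) \<noteq> 0"
    using nx ny n0 by (auto simp: dir_def k sgn_if offs_def zero_prod_def split: if_splits)
qed

text \<open>|m + d|^2 - |m|^2 = 2 m.d + 1, and m.d takes the values m_1, -m_1, m_2, -m_2, which are
  distinct off the axes and diagonals.\<close>

lemma neighbours_distinct:
  assumes "fst m \<noteq> 0" "snd m \<noteq> 0" "\<bar>fst m\<bar> \<noteq> \<bar>snd m\<bar>"
    and "d \<in> offs" "d \<noteq> 0" "e \<in> offs" "e \<noteq> 0" "isq (m + d) = isq (m + e)"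
  shows "d = e"
  using assms by (cases m) (auto simp: offs_def isq_def zero_prod_def power2_eq_square algebra_simps)

text \<open>Half of a nonzero integer cross product gives 1/2, and |k + dir k|^2 \<ge> 2 gives the
  other factor 1/2.\<close>

lemma abs_coupling_dir_ge:
  assumes "1 < isq k"
  shows "1 / 4 \<le> \<bar>coupling k (dir k)\<bar>"
proof -
  let ?m = "k + dir k"
  have "\<bar>fst k * snd (dir k) - snd k * fst (dir k)\<bar> \<ge> 1" using dir_props(6)[OF assms] by linarith
  then have "real_of_int 1 \<le> real_of_int \<bar>fst k * snd (dir k) - snd k * fst (dir k)\<bar>" by (simp only: of_int_le_iff)
  then have c: "1 \<le> \<bar>of_int (fst k) * of_int (snd (dir k)) - of_int (snd k) * of_int (fst (dir k)) :: real\<bar>" by simp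
  have "1 \<le> (fst ?m)\<^sup>2" "1 \<le> (snd ?m)\<^sup>2"
    using dir_props(3,4)[OF assms] zero_less_power2[of "fst ?m"] zero_less_power2[of "snd ?m"] by linarith+
  then have "2 \<le> isq ?m" by (simp add: isq_def)
  then have "real_of_int 2 \<le> real_of_int (isq ?m)" by (simp only: of_int_le_iff)
  then have "2 \<le> (freq_norm ?m)\<^sup>2" by (simp add: freq_norm_sq_isq)
  then have "inverse ((freq_norm ?m)\<^sup>2) \<le> inverse 2" by (intro le_imp_inverse_le) auto
  then have "1 / 2 \<le> \<bar>1 - inverse ((freq_norm ?m)\<^sup>2)\<bar>" by simp
  with c have "(1 / 2) * (1 / 2) \<le> \<bar>(of_int (fst k) * of_int (snd (dir k)) - of_int (snd k) * of_int (fst (dir k))) / 2\<bar>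
      * \<bar>1 - inverse ((freq_norm ?m)\<^sup>2)\<bar>"
    by (intro mult_mono) auto
  then show ?thesis by (simp only: coupling_def abs_mult)
qed

text \<open>How strongly the mode m of \<xi> is used to steer k = m + d in \<eta>. For |k| > 1 only
  m = k + dir k is used, with the reciprocal of the coupling. For |k| = 1 the diagonal points are
  used; there the couplings are 1/4 or -1/4, and the values \<plusminus>2 m_1 m_2 have matching
  signs, so that the two diagonal neighbours of k add up to weight 1.\<close>

definition weight :: "int \<times> int \<Rightarrow> int \<times> int \<Rightarrow> real" where
  "weight m d = (if d = 0 then 0
    else if isq (m + d) = 1
      then (if \<bar>fst m\<bar> = 1 \<and> \<bar>snd m\<bar> = 1 then (if snd (m + d) = 0 then 2 else - 2) * of_int (fst m * snd m) else 0)
    else if m = (m + d) + dir (m + d) then 1 / coupling (m + d) (dir (m + d)) else 0)"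

lemma weight_uminus [simp]: "weight (- m) (- d) = weight m d"
proof -
  have s: "- m + - d = - (m + d)" by simp
  have "- m = - (m + d) + - dir (m + d) \<longleftrightarrow> m = (m + d) + dir (m + d)"
    by (metis add.inverse_inverse minus_add_distrib)
  then show ?thesis
    unfolding weight_def s
    by (simp only: isq_uminus dir_uminus coupling_uminus fst_uminus snd_uminus neg_equal_0_iff_equal
        abs_minus_cancel minus_mult_minus)
qed

lemma abs_weight_le: "\<bar>weight m d\<bar> \<le> 4"
proof -
  let ?k = "m + d"
  have 1: "\<bar>1 / coupling ?k (dir ?k)\<bar> \<le> 4" if "isq ?k \<noteq> 1"
  proof (cases "?k = 0")
    case False
    then have "1 < isq ?k" using that isq_nonneg[of ?k] isq_zero_iff[of ?k] by linarith
    from abs_coupling_dir_ge[OF this] show ?thesis by (simp add: abs_divide field_simps)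
  qed simp
  have 2: "\<bar>(if b then 2 else - 2) * of_int (fst m * snd m) :: real\<bar> \<le> 4" if "\<bar>fst m\<bar> = 1 \<and> \<bar>snd m\<bar> = 1" for b
  proof -
    have "\<bar>real_of_int (fst m * snd m)\<bar> = of_int (\<bar>fst m\<bar> * \<bar>snd m\<bar>)" by (simp add: abs_mult)
    then have "\<bar>real_of_int (fst m * snd m)\<bar> = 1" using that by simp
    then show ?thesis by (simp only: abs_mult) simp
  qed
  show ?thesis
    unfolding weight_def using 1 2 by auto
qed

text \<open>At $|k| = 1$ the data $y_0 \perp \phi$ satisfy $\mathrm{Re}\,(y_0(1,0) + y_0(0,1)) = 0$, and the
  real parts enter through both diagonals; halving them compensates for this.\<close>

definition halve :: "H \<Rightarrow> H" where
  "halve = real_diag (\<lambda>k. if isq k = 1 then 1 / 2 else 1) (\<lambda>k. 1)"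

interpretation halve: real_multiplier "\<lambda>k. if isq k = 1 then 1 / 2 else 1" "\<lambda>k. 1" 1
  by unfold_locales auto

lemma fc_halve: "fc (halve f) k = Complex ((if isq k = 1 then 1 / 2 else 1) * Re (fc f k)) (Im (fc f k))"
  by (simp add: halve_def halve.fc_real_diag)

text \<open>The sum collects what the data of modes k' = k + d + e contribute to \<eta> at k through
  m = k + d; the moment conditions leave only |k'| = |k|. For |k| > 1, m is the \<open>dir\<close>
  neighbour of k', which forces k' = k; for |k| = 1 it is a finite computation.\<close>

lemma weight_inverts_coupling:
  assumes perp: "f \<bullet> phi = 0" and k: "k \<noteq> 0"
  shows "(\<Sum>d\<in>offs. \<Sum>e\<in>offs. (coupling k d * weight (k + d) e * of_bool (isq (k + d + e) = isq k)) *\<^sub>R fc (halve f) (k + d + e)) = fc f k"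
proof (cases "isq k = 1")
  case False
  then have k1: "1 < isq k" using k isq_nonneg[of k] isq_zero_iff[of k] by linarith
  note dp = dir_props[OF k1]
  have c0: "coupling k (dir k) \<noteq> 0" using abs_coupling_dir_ge[OF k1] by auto
  have "(coupling k d * weight (k + d) e * of_bool (isq (k + d + e) = isq k)) *\<^sub>R fc (halve f) (k + d + e)
      = (if d = dir k then (if e = - dir k then fc (halve f) k else 0) else 0)" if de: "d \<in> offs" "e \<in> offs" for d e
  proof (cases "d = dir k \<and> e = - dir k")
    case True
    have "weight (k + dir k) (- dir k) = 1 / coupling k (dir k)"
      using k1 dp(2) by (simp add: weight_def)
    then show ?thesis using True c0 by simp
  next
    case False
    have "coupling k d * weight (k + d) e * of_bool (isq (k + d + e) = isq k) = 0"
    proof (rule ccontr)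
      assume nz: "coupling k d * weight (k + d) e * of_bool (isq (k + d + e) = isq k) \<noteq> 0"
      then have d0: "d \<noteq> 0" and w: "weight (k + d) e \<noteq> 0" and q: "isq (k + d + e) = isq k"
        by (auto split: if_splits)
      let ?k' = "k + d + e"
      have e0: "e \<noteq> 0" and m: "k + d = ?k' + dir ?k'"
        using w q k1 unfolding weight_def by (auto split: if_splits)
      have k1': "1 < isq ?k'" using q k1 by simp
      \<comment> \<open>m = k + d lies off the axes and diagonals, so its neighbours k' and k, being
        of equal length, coincide.\<close>
      have "e = - d"
        by (rule neighbours_distinct[of "k + d"])
          (use dir_props(3-5)[OF k1'] d0 e0 de q in \<open>simp_all only: m[symmetric], simp_all\<close>)
      then have "?k' = k" by simp
      with m have "d = dir k" by simp
      with \<open>e = - d\<close> False show False by simp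
    qed
    then show ?thesis using False by auto
  qed
  then have "(\<Sum>d\<in>offs. \<Sum>e\<in>offs. (coupling k d * weight (k + d) e * of_bool (isq (k + d + e) = isq k)) *\<^sub>R fc (halve f) (k + d + e))
      = (\<Sum>d\<in>offs. \<Sum>e\<in>offs. if d = dir k then (if e = - dir k then fc (halve f) k else 0) else 0)"
    by (intro sum.cong refl) auto
  also have "\<dots> = (\<Sum>d\<in>offs. if d = dir k then (\<Sum>e\<in>offs. if e = - dir k then fc (halve f) k else 0) else 0)"
    by (intro sum.cong refl) auto
  also have "\<dots> = fc (halve f) k"
    using dp(1) by (simp add: sum.delta)
  also have "\<dots> = fc f k" using False by (simp add: fc_halve complex_eq_iff)
  finally show ?thesis .
next
  case True
  have "k \<in> offs" using True by (intro isq_le_1_imp_offs) simp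
  then have kk: "k = (1, 0) \<or> k = (- 1, 0) \<or> k = (0, 1) \<or> k = (0, - 1)"
    using k by (auto simp: offs_def)
  have p: "Re (fc f (1, 0)) + Re (fc f (0, 1)) = 0" using perp by (simp add: inner_phi)
  have m: "fc f (- 1, 0) = cnj (fc f (1, 0))" "fc f (0, - 1) = cnj (fc f (0, 1))"
    using fc_minus_freq[of f "(1, 0)"] fc_minus_freq[of f "(0, 1)"] by simp_all
  \<comment> \<open>The total that the unit modes inject into \<xi> at j.\<close>
  define Tt where "Tt j = (\<Sum>e\<in>offs. (weight j e * of_bool (isq (j + e) = 1)) *\<^sub>R fc (halve f) (j + e))" for j
  have inner: "(\<Sum>e\<in>offs. (c * weight j e * of_bool (isq (j + e) = 1)) *\<^sub>R fc (halve f) (j + e)) = c *\<^sub>R Tt j" for c j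
    by (simp add: Tt_def scaleR_sum_right mult.assoc)
  have S: "Tt (x, y) = (2 * of_int (x * y)) *\<^sub>R (fc (halve f) (x, 0) - fc (halve f) (0, y))"
    if "\<bar>x\<bar> = 1" "\<bar>y\<bar> = 1" for x y :: int
  proof -
    have "x = 1 \<or> x = - 1" "y = 1 \<or> y = - 1" using that by auto
    then show ?thesis
      by (elim disjE) (simp_all add: Tt_def sum_offs weight_def isq_def zero_prod_def algebra_simps)
  qed
  have c: "coupling (1, 0) (1, 0) = 0" "coupling (1, 0) (- 1, 0) = 0" "coupling (- 1, 0) (1, 0) = 0" "coupling (- 1, 0) (- 1, 0) = 0"
    "coupling (0, 1) (0, 1) = 0" "coupling (0, 1) (0, - 1) = 0" "coupling (0, - 1) (0, 1) = 0" "coupling (0, - 1) (0, - 1) = 0"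
    "coupling (1, 0) (0, 1) = 1 / 4" "coupling (1, 0) (0, - 1) = - 1 / 4" "coupling (- 1, 0) (0, 1) = - 1 / 4" "coupling (- 1, 0) (0, - 1) = 1 / 4"
    "coupling (0, 1) (1, 0) = - 1 / 4" "coupling (0, 1) (- 1, 0) = 1 / 4" "coupling (0, - 1) (1, 0) = 1 / 4" "coupling (0, - 1) (- 1, 0) = - 1 / 4"
    by (simp_all add: coupling_def freq_norm_sq)
  have h: "fc (halve f) (1, 0) = Complex (Re (fc f (1, 0)) / 2) (Im (fc f (1, 0)))"
    "fc (halve f) (- 1, 0) = Complex (Re (fc f (1, 0)) / 2) (- Im (fc f (1, 0)))"
    "fc (halve f) (0, 1) = Complex (Re (fc f (0, 1)) / 2) (Im (fc f (0, 1)))"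
    "fc (halve f) (0, - 1) = Complex (Re (fc f (0, 1)) / 2) (- Im (fc f (0, 1)))"
    by (simp_all add: fc_halve isq_def m)
  have p': "Re (fc f (0, 1)) = - Re (fc f (1, 0))" using p by linarith
  \<comment> \<open>For k = (1,0), say, the two diagonals together give the coefficient of
    \<open>halve f\<close> at k minus its real part at (0,1). By \<open>p'\<close> and the halving
    this is the coefficient of f.\<close>
  show ?thesis
    unfolding True inner using kk
    by (elim disjE; hypsubst; unfold sum_offs)
      (simp_all add: c S h m complex_eq_iff p' algebra_simps)
qed

subsection \<open>Auxiliary functions of time\<close>

text \<open>The polynomial \<open>p\<close> is the primitive of 630 x^4 (1 - x)^4. It rises from 0
  to 1 and is flat to fourth order at both ends, as \<open>bump\<close> combines derivatives of
  orders 1 to 4.\<close>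

lemma smooth_step_exists:
  assumes "t0 < (t1 :: real)"
  shows "\<exists>Psi :: nat \<Rightarrow> real \<Rightarrow> real. (\<forall>i s. (Psi i has_real_derivative Psi (Suc i) s) (at s))
    \<and> Psi 0 t0 = 0 \<and> Psi 0 t1 = 1 \<and> (\<forall>i\<in>{1..4}. Psi i t0 = 0 \<and> Psi i t1 = 0)"
proof -
  define p :: "real poly" where "p = [:0, 0, 0, 0, 0, 126, - 420, 540, - 315, 70:]"
  define L where "L = t1 - t0"
  have L: "L \<noteq> 0" using assms by (simp add: L_def)
  define Psi where "Psi i s = poly ((pderiv ^^ i) p) ((s - t0) / L) / L ^ i" for i s
  have D: "(Psi i has_real_derivative Psi (Suc i) s) (at s)" for i s
  proof -
    have "((\<lambda>s. poly ((pderiv ^^ i) p) ((s - t0) / L)) has_real_derivative poly (pderiv ((pderiv ^^ i) p)) ((s - t0) / L) * (1 / L)) (at s)"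
      by (rule DERIV_chain2[OF poly_DERIV]) (auto simp: L intro!: derivative_eq_intros)
    from DERIV_cdivide[OF this, of "L ^ i"] show ?thesis
      unfolding Psi_def[abs_def] using L by simp
  qed
  have e: "(t0 - t0) / L = 0" "(t1 - t0) / L = 1" using L by (simp_all add: L_def)
  have "Psi i t0 = 0 \<and> Psi i t1 = 0" if "i \<in> {1..4}" for i
  proof -
    have "i = 1 \<or> i = 2 \<or> i = 3 \<or> i = 4" using that by auto
    then show ?thesis
      unfolding Psi_def e by (elim disjE) (simp_all add: p_def pderiv_pCons numeral_eq_Suc)
  qed
  moreover have "Psi 0 t0 = 0" "Psi 0 t1 = 1"
    unfolding Psi_def e by (simp_all add: p_def)
  ultimately show ?thesis using D by blast
qed

text \<open>exp (c x^2) is the n-th power of exp (c x^2 / n), which is at least c x^2 / n; for n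
  above |p| its product dominates x^p.\<close>

lemma powr_exp_bounded:
  assumes "0 < c"
  shows "\<exists>C\<ge>0. \<forall>x\<ge>1. x powr p * exp (- c * x\<^sup>2) \<le> (C :: real)"
proof -
  obtain n :: nat where n: "\<bar>p\<bar> + 1 \<le> real n" using real_arch_simple by blast
  then have n0: "0 < n" by (cases n) auto
  have "x powr p * exp (- c * x\<^sup>2) \<le> (real n / c) ^ n" if x: "1 \<le> x" for x :: real
  proof -
    have "x powr p \<le> x powr real (2 * n)" using x n by (intro powr_mono) auto
    also have "\<dots> = x ^ (2 * n)" using x by (intro powr_realpow) simp
    also have "\<dots> = (x\<^sup>2) ^ n" by (rule power_mult)
    finally have 1: "x powr p \<le> (x\<^sup>2) ^ n" .
    have "c * x\<^sup>2 / n \<le> exp (c * x\<^sup>2 / n)" using exp_ge_add_one_self[of "c * x\<^sup>2 / n"] by linarith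
    then have "(c * x\<^sup>2 / n) ^ n \<le> exp (c * x\<^sup>2 / n) ^ n" using assms by (intro power_mono) auto
    also have "\<dots> = exp (c * x\<^sup>2)" using n0 by (simp flip: exp_of_nat_mult)
    finally have "(x\<^sup>2) ^ n * (c / n) ^ n \<le> exp (c * x\<^sup>2)"
      by (simp add: power_mult_distrib power_divide mult_ac)
    then have "(x\<^sup>2) ^ n \<le> (real n / c) ^ n * exp (c * x\<^sup>2)"
      using assms n0 by (simp add: power_divide field_simps)
    then have "x powr p \<le> (real n / c) ^ n * exp (c * x\<^sup>2)" using 1 by linarith
    then have "x powr p * exp (- c * x\<^sup>2) \<le> (real n / c) ^ n * exp (c * x\<^sup>2) * exp (- c * x\<^sup>2)"
      by (intro mult_right_mono) auto
    then show ?thesis by (simp add: mult.assoc flip: exp_add)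
  qed
  then show ?thesis using assms by (intro exI[of _ "(real n / c) ^ n"]) auto
qed

subsection \<open>The control\<close>

locale steering = controlled +
  fixes T :: real and Psi :: "nat \<Rightarrow> real \<Rightarrow> real"
  assumes T_pos: "0 < T"
    and Psi_deriv: "(Psi i has_real_derivative Psi (Suc i) s) (at s)"
    and Psi_ends: "Psi 0 (T / 2) = 0" "Psi 0 T = 1"
    and Psi_flat: "i \<in> {1..4} \<Longrightarrow> Psi i (T / 2) = 0" "i \<in> {1..4} \<Longrightarrow> Psi i T = 0"
begin

definition tau :: real where "tau = T / 2"

lemma tau: "0 < tau" "tau < T" "T = 2 * tau"
  using T_pos by (simp_all add: tau_def)

lemma continuous_Psi [continuous_intros]: "continuous_on A (Psi i)"
  by (meson DERIV_continuous_on DERIV_subset Psi_deriv subset_UNIV has_field_derivative_at_within)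

text \<open>Order 5 occurs in \<open>bump 1\<close>, the time derivative that enters the
  control.\<close>

lemma Psi_bounded: "\<exists>N\<ge>0. \<forall>i\<le>5. \<forall>s\<in>{tau..T}. \<bar>Psi i s\<bar> \<le> N"
proof -
  have "\<forall>i. \<exists>C. \<forall>s\<in>{tau..T}. \<bar>Psi i s\<bar> \<le> C"
    using continuous_on_Icc_bounded[OF continuous_Psi] by blast
  then obtain C where C: "\<And>i s. s \<in> {tau..T} \<Longrightarrow> \<bar>Psi i s\<bar> \<le> C i" by metis
  show ?thesis
  proof (intro exI[of _ "\<Sum>i\<le>5. \<bar>C i\<bar>"] conjI allI impI ballI)
    fix i :: nat and s assume "i \<le> 5" "s \<in> {tau..T}"
    then have "\<bar>Psi i s\<bar> \<le> \<bar>C i\<bar>" using C[of s i] by auto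
    also have "\<dots> \<le> (\<Sum>i\<le>5. \<bar>C i\<bar>)" using \<open>i \<le> 5\<close> by (intro member_le_sum) auto
    finally show "\<bar>Psi i s\<bar> \<le> (\<Sum>i\<le>5. \<bar>C i\<bar>)" .
  qed (simp add: sum_nonneg)
qed

text \<open>\<open>bump m d\<close> has moment 1 against $e^{\delta s}$ for the rate $\delta$ belonging to the neighbour
  $m + d$ of $m$, namely $\delta = 0$, and moment 0 for the rates of the other neighbours: applying
  $1 + r\,\partial_s$ with $r = 1/\delta$ kills $e^{\delta s}$.\<close>

definition rate :: "int \<times> int \<Rightarrow> int \<times> int \<Rightarrow> int \<times> int \<Rightarrow> real" where
  "rate m d e = ka (m + e) - ka (m + d)"

text \<open>The value 0 makes the factor 1 + r d/ds trivial where the rates coincide, in particular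
  for e = d.\<close>

definition rr :: "int \<times> int \<Rightarrow> int \<times> int \<Rightarrow> int \<times> int \<Rightarrow> real" where
  "rr m d e = (if rate m d e = 0 then 0 else 1 / rate m d e)"

text \<open>Elementary symmetric polynomials: \<open>bump\<close> is the expanded product of the
  four factors 1 + r d/ds applied to \<open>Psi 1\<close>. The fourth polynomial is absent because
  the reciprocal belonging to d itself is 0.\<close>

definition esym1 :: "real \<Rightarrow> real \<Rightarrow> real \<Rightarrow> real \<Rightarrow> real" where "esym1 x y z u = x + y + z + u"
definition esym2 :: "real \<Rightarrow> real \<Rightarrow> real \<Rightarrow> real \<Rightarrow> real" where
  "esym2 x y z u = x * y + x * z + x * u + y * z + y * u + z * u"
definition esym3 :: "real \<Rightarrow> real \<Rightarrow> real \<Rightarrow> real \<Rightarrow> real" where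
  "esym3 x y z u = x * y * z + x * y * u + x * z * u + y * z * u"

definition coef :: "(real \<Rightarrow> real \<Rightarrow> real \<Rightarrow> real \<Rightarrow> real) \<Rightarrow> int \<times> int \<Rightarrow> int \<times> int \<Rightarrow> real" where
  "coef p m d = p (rr m d (1, 0)) (rr m d (- 1, 0)) (rr m d (0, 1)) (rr m d (0, - 1))"

definition bump :: "nat \<Rightarrow> int \<times> int \<Rightarrow> int \<times> int \<Rightarrow> real \<Rightarrow> real" where
  "bump i m d s = Psi (Suc i) s + coef esym1 m d * Psi (Suc (Suc i)) s
    + coef esym2 m d * Psi (Suc (Suc (Suc i))) s + coef esym3 m d * Psi (Suc (Suc (Suc (Suc i)))) s"

lemma ka_eq_iff: "ka k = ka j \<longleftrightarrow> isq k = isq j"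
  using nu_pos by (simp add: ka_def freq_norm_sq_isq)

text \<open>Rates are nu times integers, so a nonzero rate is at least nu in modulus, uniformly in
  the frequency.\<close>

lemma abs_rr_le: "\<bar>rr m d e\<bar> \<le> 1 / nu"
proof (cases "rate m d e = 0")
  case False
  have r: "rate m d e = nu * of_int (isq (m + e) - isq (m + d))"
    by (simp add: rate_def ka_def freq_norm_sq_isq algebra_simps)
  then have "1 \<le> \<bar>isq (m + e) - isq (m + d)\<bar>" using False by auto
  then have "real_of_int 1 \<le> real_of_int \<bar>isq (m + e) - isq (m + d)\<bar>" by (simp only: of_int_le_iff)
  then have "nu * 1 \<le> \<bar>rate m d e\<bar>" unfolding r abs_mult using nu_pos by (intro mult_mono) auto
  then show ?thesis using False nu_pos by (simp add: rr_def abs_divide frac_le)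
qed (use nu_pos in \<open>simp add: rr_def\<close>)

lemma rr_uminus: "rr (- m) (- d) e = rr m d (- e)"
proof -
  have "ka (- m + e) = ka (m + - e)" using ka_uminus[of "m + - e"] by simp
  moreover have "ka (- m + - d) = ka (m + d)" using ka_uminus[of "m + d"] by simp
  ultimately show ?thesis by (simp only: rr_def rate_def)
qed

lemma coef_uminus: "coef esym1 (- m) (- d) = coef esym1 m d" "coef esym2 (- m) (- d) = coef esym2 m d"
  "coef esym3 (- m) (- d) = coef esym3 m d"
  unfolding coef_def rr_uminus by (simp_all add: esym1_def esym2_def esym3_def algebra_simps)

lemma coef_bounded: "\<exists>C\<ge>0. \<forall>m d. \<bar>coef esym1 m d\<bar> \<le> C \<and> \<bar>coef esym2 m d\<bar> \<le> C \<and> \<bar>coef esym3 m d\<bar> \<le> C"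
proof -
  define r where "r = 1 / nu"
  have r: "0 \<le> r" using nu_pos by (simp add: r_def)
  have p2: "\<bar>x * y\<bar> \<le> r * r" if "\<bar>x\<bar> \<le> r" "\<bar>y\<bar> \<le> r" for x y
    unfolding abs_mult using that r by (intro mult_mono) auto
  have p3: "\<bar>x * y * z\<bar> \<le> r * r * r" if "\<bar>x\<bar> \<le> r" "\<bar>y\<bar> \<le> r" "\<bar>z\<bar> \<le> r" for x y z
    unfolding abs_mult[of "x * y"] using that r p2 by (intro mult_mono) auto
  have tri: "\<bar>x + y\<bar> \<le> A + B" if "\<bar>x\<bar> \<le> A" "\<bar>y\<bar> \<le> B" for x y A B :: real using that by linarith
  have b: "\<bar>esym1 x y z u\<bar> \<le> r + r + r + r"
    "\<bar>esym2 x y z u\<bar> \<le> r * r + r * r + r * r + r * r + r * r + r * r"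
    "\<bar>esym3 x y z u\<bar> \<le> r * r * r + r * r * r + r * r * r + r * r * r"
    if "\<bar>x\<bar> \<le> r" "\<bar>y\<bar> \<le> r" "\<bar>z\<bar> \<le> r" "\<bar>u\<bar> \<le> r" for x y z u
    unfolding esym1_def esym2_def esym3_def by (intro tri p2 p3 that)+
  define C where "C = (r + r + r + r) + (r * r + r * r + r * r + r * r + r * r + r * r) + (r * r * r + r * r * r + r * r * r + r * r * r)"
  have le: "r + r + r + r \<le> C" "r * r + r * r + r * r + r * r + r * r + r * r \<le> C"
    "r * r * r + r * r * r + r * r * r + r * r * r \<le> C" "0 \<le> C"
    using r by (simp_all add: C_def)
  have rr: "\<bar>rr m d e\<bar> \<le> r" for m d e unfolding r_def by (rule abs_rr_le)
  show ?thesis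
    unfolding coef_def
    by (intro exI[of _ C] conjI allI le(4) order_trans[OF b(1)[OF rr rr rr rr] le(1)]
        order_trans[OF b(2)[OF rr rr rr rr] le(2)] order_trans[OF b(3)[OF rr rr rr rr] le(3)])
qed

lemma bump_deriv: "(bump i m d has_real_derivative bump (Suc i) m d s) (at s)"
  unfolding bump_def[abs_def] by (intro DERIV_add DERIV_cmult Psi_deriv)

lemma continuous_bump [continuous_intros]: "continuous_on A (bump i m d)"
  unfolding bump_def by (intro continuous_intros)

lemma bump_ends [simp]: "bump 0 m d tau = 0" "bump 0 m d T = 0"
  using Psi_flat[of 1] Psi_flat[of 2] Psi_flat[of 3] Psi_flat[of 4]
  by (simp_all add: bump_def tau_def numeral_eq_Suc)

lemma bump_uminus [simp]: "bump i (- m) (- d) = bump i m d"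
  unfolding bump_def coef_uminus ..

lemma bump_bounded: "\<exists>C\<ge>0. \<forall>m d. \<forall>s\<in>{tau..T}. \<bar>bump 0 m d s\<bar> \<le> C \<and> \<bar>bump 1 m d s\<bar> \<le> C"
proof -
  obtain N where N: "0 \<le> N" "\<And>i s. i \<le> 5 \<Longrightarrow> s \<in> {tau..T} \<Longrightarrow> \<bar>Psi i s\<bar> \<le> N" using Psi_bounded by blast
  obtain C where C: "0 \<le> C" "\<And>m d. \<bar>coef esym1 m d\<bar> \<le> C" "\<And>m d. \<bar>coef esym2 m d\<bar> \<le> C" "\<And>m d. \<bar>coef esym3 m d\<bar> \<le> C"
    using coef_bounded by blast
  have "\<bar>bump i m d s\<bar> \<le> N + C * N + C * N + C * N" if "i \<le> 1" "s \<in> {tau..T}" for i m d s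
  proof -
    have "\<bar>coef p m d * Psi j s\<bar> \<le> C * N" if "\<bar>coef p m d\<bar> \<le> C" "j \<le> 5" for p j
      unfolding abs_mult using that N \<open>s \<in> {tau..T}\<close> C(1) by (intro mult_mono) auto
    note * = this[OF C(2)] this[OF C(3)] this[OF C(4)]
    have "\<bar>Psi (Suc i) s\<bar> \<le> N" using that by (intro N) auto
    moreover have "\<bar>coef esym1 m d * Psi (Suc (Suc i)) s\<bar> \<le> C * N" "\<bar>coef esym2 m d * Psi (Suc (Suc (Suc i))) s\<bar> \<le> C * N"
      "\<bar>coef esym3 m d * Psi (Suc (Suc (Suc (Suc i)))) s\<bar> \<le> C * N"
      using that by (auto intro!: *)
    ultimately show ?thesis unfolding bump_def by linarith
  qed
  then show ?thesis using N(1) C(1) by (intro exI[of _ "N + C * N + C * N + C * N"]) auto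
qed

text \<open>With flat ends, integration by parts gives M (j + 1) = -\<delta> M j, so the moment is M
  1 times the product of the factors 1 - r \<delta>. For \<delta> \<noteq> 0 one factor vanishes;
  for \<delta> = 0 the moment is the increment 1 of \<open>Psi 0\<close>.\<close>

lemma bump_moment:
  assumes d: "d \<in> offs" "d \<noteq> 0" and e: "e \<in> offs" "e \<noteq> 0"
  shows "integral {tau..T} (\<lambda>s. exp (rate m d e * s) * bump 0 m d s) = of_bool (rate m d e = 0)"
proof -
  define \<delta> where "\<delta> = rate m d e"
  define M where "M j = integral {tau..T} (\<lambda>s. exp (\<delta> * s) * Psi j s)" for j
  have int: "(\<lambda>s. exp (\<delta> * s) * Psi j s) integrable_on {tau..T}" for j
    by (intro integrable_continuous_real continuous_intros)
  have "((\<lambda>s. \<delta> * (exp (\<delta> * s) * Psi j s) + exp (\<delta> * s) * Psi (Suc j) s) has_integral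
      exp (\<delta> * T) * Psi j T - exp (\<delta> * tau) * Psi j tau) {tau..T}" for j
  proof (rule fundamental_theorem_of_calculus)
    fix x
    have "((\<lambda>s. exp (\<delta> * s) * Psi j s) has_real_derivative \<delta> * (exp (\<delta> * x) * Psi j x) + exp (\<delta> * x) * Psi (Suc j) x) (at x)"
      by (rule derivative_eq_intros Psi_deriv refl)+ simp
    then show "((\<lambda>s. exp (\<delta> * s) * Psi j s) has_vector_derivative \<delta> * (exp (\<delta> * x) * Psi j x) + exp (\<delta> * x) * Psi (Suc j) x) (at x within {tau..T})"
      by (simp only: has_real_derivative_iff_has_vector_derivative) (rule has_vector_derivative_at_within)
  qed (use tau in simp)
  moreover have "((\<lambda>s. \<delta> * (exp (\<delta> * s) * Psi j s) + exp (\<delta> * s) * Psi (Suc j) s) has_integral \<delta> * M j + M (Suc j)) {tau..T}" for j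
    unfolding M_def by (intro has_integral_add has_integral_mult_right integrable_integral int)
  ultimately have rec: "\<delta> * M j + M (Suc j) = exp (\<delta> * T) * Psi j T - exp (\<delta> * tau) * Psi j tau" for j
    using has_integral_unique by blast
  have M2: "M 2 = - \<delta> * M 1" and M3: "M 3 = \<delta> * \<delta> * M 1" and M4: "M 4 = - (\<delta> * \<delta> * \<delta> * M 1)"
    using rec[of 1] rec[of 2] rec[of 3] Psi_flat[of 1] Psi_flat[of 2] Psi_flat[of 3]
    by (simp_all add: tau_def numeral_eq_Suc add_eq_0_iff)
  have 1: "integral {tau..T} (\<lambda>s. exp (\<delta> * s) * bump 0 m d s) = M 1 + coef esym1 m d * M 2 + coef esym2 m d * M 3 + coef esym3 m d * M 4"
  proof (rule integral_unique)
    have "((\<lambda>s. exp (\<delta> * s) * Psi 1 s + coef esym1 m d * (exp (\<delta> * s) * Psi 2 s) + coef esym2 m d * (exp (\<delta> * s) * Psi 3 s) + coef esym3 m d * (exp (\<delta> * s) * Psi 4 s))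
        has_integral M 1 + coef esym1 m d * M 2 + coef esym2 m d * M 3 + coef esym3 m d * M 4) {tau..T}"
      unfolding M_def by (intro has_integral_add has_integral_mult_right integrable_integral int)
    then show "((\<lambda>s. exp (\<delta> * s) * bump 0 m d s) has_integral M 1 + coef esym1 m d * M 2 + coef esym2 m d * M 3 + coef esym3 m d * M 4) {tau..T}"
      by (simp add: bump_def numeral_eq_Suc algebra_simps)
  qed
  show ?thesis
  proof (cases "\<delta> = 0")
    case True
    then have "M 1 = 1" using rec[of 0] Psi_ends by (simp add: tau_def)
    then show ?thesis using 1 M2 M3 M4 True by (simp add: \<delta>_def)
  next
    case False
    define x y z u where "x = rr m d (1, 0)" and "y = rr m d (- 1, 0)" and "z = rr m d (0, 1)" and "u = rr m d (0, - 1)"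
    have "rr m d d = 0" by (simp add: rr_def rate_def)
    \<comment> \<open>This is the fourth symmetric polynomial, needed to complete the expression to
      a product.\<close>
    then have 0: "x * y * z * u = 0"
      using d by (auto simp: offs_def x_def y_def z_def u_def)
    have "rr m d e * \<delta> = 1" using False by (simp add: rr_def \<delta>_def)
    then have f: "(1 - x * \<delta>) * (1 - y * \<delta>) * (1 - z * \<delta>) * (1 - u * \<delta>) = 0"
      using e by (auto simp: offs_def x_def y_def z_def u_def)
    have "M 1 + coef esym1 m d * M 2 + coef esym2 m d * M 3 + coef esym3 m d * M 4
        = M 1 * ((1 - x * \<delta>) * (1 - y * \<delta>) * (1 - z * \<delta>) * (1 - u * \<delta>) - x * y * z * u * (\<delta> * \<delta> * \<delta> * \<delta>))"
      unfolding M2 M3 M4 coef_def x_def[symmetric] y_def[symmetric] z_def[symmetric] u_def[symmetric] esym1_def esym2_def esym3_def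
      by (simp add: algebra_simps)
    also have "\<dots> = 0" unfolding f 0 by simp
    finally show ?thesis using 1 False by (simp add: \<delta>_def)
  qed
qed

text \<open>The share of \<Lambda>^b \<xi> at m that steers \<eta> at k = m + d. The exponential
  cancels the relaxation exp (-ka k (T - s)) up to a constant, so that only moments of
  \<open>bump\<close> matter. The shift by tau / 2 leaves decay over a time of at least tau / 2 on
  [tau, T].\<close>

definition X :: "int \<times> int \<Rightarrow> int \<times> int \<Rightarrow> real \<Rightarrow> real" where
  "X m d s = freq_norm m powr b * weight m d * exp (- ka (m + d) * (s - tau / 2)) * bump 0 m d s"

definition Xd :: "int \<times> int \<Rightarrow> int \<times> int \<Rightarrow> real \<Rightarrow> real" where
  "Xd m d s = freq_norm m powr b * weight m d * exp (- ka (m + d) * (s - tau / 2))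
    * (bump 1 m d s + (al m - ka (m + d)) * bump 0 m d s)"

lemma X_deriv: "(X m d has_real_derivative Xd m d s - al m * X m d s) (at s)"
  unfolding X_def[abs_def] Xd_def
  by (rule derivative_eq_intros bump_deriv refl)+ (simp add: algebra_simps)

lemma continuous_X [continuous_intros]: "continuous_on A (X m d)" "continuous_on A (Xd m d)"
  unfolding X_def Xd_def by (intro continuous_intros)+

lemma ka_uminus_add: "ka (- m + - d) = ka (m + d)"
  using ka_uminus[of "m + d"] by simp

lemma Xd_uminus: "Xd (- m) (- d) s = Xd m d s"
  unfolding Xd_def ka_uminus_add by simp

definition I0 :: "real \<Rightarrow> real \<Rightarrow> real" where
  "I0 p r = integral {tau..T} (\<lambda>s. exp (- p * (T - s)) * (Psi 0 s * exp (- r * s)))"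

text \<open>The Duhamel coefficient wanted at time T minus the one that the transition of \<xi>
  produces anyway, divided by the factor exp (-ka k (T - tau / 2)) that appears in
  \<open>integral_path\<close>.\<close>

definition J :: "int \<times> int \<Rightarrow> int \<times> int \<Rightarrow> real" where
  "J k d = exp (ka k * (T - tau / 2)) * (duhamel (ka k) (al (k + d)) T - I0 (ka k) (al (k + d)))"

lemma J_uminus: "J (- k) (- d) = J k d"
  using al_uminus[of "k + d"] by (simp add: J_def)

text \<open>\<open>duhamel_bounds\<close> for the nonnegative rates C and C - c.\<close>

lemma exp_int_le:
  assumes "c \<le> C" "0 \<le> C" "0 \<le> t"
  shows "0 \<le> exp_int c t" "exp_int c t \<le> t * exp (C * t)"
proof -
  have "duhamel C (C - c) t = exp (- C * t) * exp_int c t" by (simp add: duhamel_def)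
  moreover have "0 \<le> duhamel C (C - c) t" "duhamel C (C - c) t \<le> t" using assms by (auto intro: duhamel_bounds)
  ultimately have "0 \<le> exp (- C * t) * exp_int c t" "exp (- C * t) * exp_int c t \<le> t" by simp_all
  then show "0 \<le> exp_int c t" by (simp add: zero_le_mult_iff)
  have "exp (C * t) * (exp (- C * t) * exp_int c t) \<le> exp (C * t) * t"
    using \<open>exp (- C * t) * exp_int c t \<le> t\<close> by (intro mult_left_mono) auto
  moreover have "exp (C * t) * (exp (- C * t) * exp_int c t) = exp_int c t"
    by (simp add: mult.assoc[symmetric] flip: exp_add)
  ultimately show "exp_int c t \<le> t * exp (C * t)" by (simp only: mult.commute[of t])
qed

lemma freq_norm_add_offs:
  assumes "d \<in> offs"
  shows "(freq_norm k)\<^sup>2 - 2 * freq_norm k \<le> (freq_norm (k + d))\<^sup>2" "freq_norm (k + d) \<le> freq_norm k + 1"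
proof -
  have 1: "(freq_norm (k + d))\<^sup>2 \<le> (freq_norm k)\<^sup>2 + 2 * freq_norm k + 1 \<and> (freq_norm k)\<^sup>2 - 2 * freq_norm k \<le> (freq_norm (k + d))\<^sup>2"
    using assms abs_fst_le_freq_norm[of k] abs_snd_le_freq_norm[of k] freq_norm_nonneg[of k]
    unfolding freq_norm_sq offs_def by (auto simp: power2_eq_square algebra_simps)
  then show "(freq_norm k)\<^sup>2 - 2 * freq_norm k \<le> (freq_norm (k + d))\<^sup>2" by simp
  have "(freq_norm (k + d))\<^sup>2 \<le> (freq_norm k + 1)\<^sup>2" using 1 by (simp add: power2_eq_square algebra_simps)
  then show "freq_norm (k + d) \<le> freq_norm k + 1" by (rule power2_le_imp_le) simp
qed

text \<open>The growing exponential in \<open>J\<close> meets the decay in the integrals and leaves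
  exp (-ka k tau / 2) times exp ((ka k - al (k + d)) s). Since ka k - al (k + d) \<le> 2 nu |k|, the
  second factor is at most exp (2 nu |k| T), and the first, Gaussian in |k|, wins.\<close>

lemma J_bounded: "\<exists>C\<ge>0. symbol_bound (\<lambda>k d. cw k d * J k d) C"
proof -
  obtain N where N: "0 \<le> N" "\<And>s. s \<in> {tau..T} \<Longrightarrow> \<bar>Psi 0 s\<bar> \<le> N" using Psi_bounded by blast
  define C where "C = exp (5 * nu * T) * (T + N * T)"
  have C: "0 \<le> C" using N T_pos by (simp add: C_def)
  have "\<bar>cw k d * J k d\<bar> \<le> C" if kd: "k \<noteq> 0" "d \<in> offs" "k + d \<noteq> 0" for k d
  proof -
    define n where "n = freq_norm k"
    define p where "p = ka k"
    define qq where "qq = al (k + d)"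
    define C0 where "C0 = 2 * nu * n"
    have n: "1 \<le> n" using freq_norm_ge_1[OF kd(1)] by (simp add: n_def)
    have C0: "0 \<le> C0" using n nu_pos by (simp add: C0_def)
    have "nu * (n\<^sup>2 - 2 * n) \<le> nu * (freq_norm (k + d))\<^sup>2"
      using freq_norm_add_offs(1)[OF kd(2), of k] nu_pos by (intro mult_left_mono) (auto simp: n_def)
    then have pq: "p - qq \<le> C0"
      using nu_pos by (simp add: p_def qq_def ka_def al_def C0_def n_def[symmetric] algebra_simps)
    have E: "exp (- p * (tau / 2)) * exp (C0 * T) \<le> exp (5 * nu * T)"
    proof -
      \<comment> \<open>Completing the square in n bounds the exponent by 4 nu T; a further nu T / 4
        comes from the -1 in ka = nu (n^2 - 1).\<close>
      have "0 \<le> nu * (T / 4) * (n - 4)\<^sup>2" using nu_pos T_pos by simp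
      then have "2 * nu * n * T - nu * (T / 4) * n\<^sup>2 \<le> 4 * nu * T" by (simp add: power2_eq_square algebra_simps)
      moreover have "nu * T / 4 \<le> nu * T" using nu_pos T_pos by simp
      ultimately have "- p * (tau / 2) + C0 * T \<le> 5 * nu * T"
        by (simp add: p_def ka_def n_def[symmetric] C0_def tau_def algebra_simps)
      then show ?thesis by (simp flip: exp_add)
    qed
    have 1: "\<bar>exp (p * (T - tau / 2)) * duhamel p qq T\<bar> \<le> exp (5 * nu * T) * T"
    proof -
      have eq: "exp (p * (T - tau / 2)) * duhamel p qq T = exp (- p * (tau / 2)) * exp_int (p - qq) T"
      proof -
        have "exp (p * (T - tau / 2)) * exp (- p * T) = exp (- p * (tau / 2))"
          by (simp add: algebra_simps flip: exp_add)
        then show ?thesis by (simp only: duhamel_def mult.assoc[symmetric])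
      qed
      have "exp (- p * (tau / 2)) * exp_int (p - qq) T \<le> exp (- p * (tau / 2)) * (T * exp (C0 * T))"
        using exp_int_le[OF pq C0, of T] T_pos by (intro mult_left_mono) auto
      also have "\<dots> = (exp (- p * (tau / 2)) * exp (C0 * T)) * T" by simp
      also have "\<dots> \<le> exp (5 * nu * T) * T" using E T_pos by (intro mult_right_mono) auto
      finally show ?thesis unfolding eq using exp_int_le(1)[OF pq C0, of T] T_pos by simp
    qed
    have 2: "\<bar>exp (p * (T - tau / 2)) * I0 p qq\<bar> \<le> exp (5 * nu * T) * (N * T)"
    proof -
      have "exp (p * (T - tau / 2)) * I0 p qq = integral {tau..T} (\<lambda>s. exp (p * (T - tau / 2)) * (exp (- p * (T - s)) * (Psi 0 s * exp (- qq * s))))"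
        unfolding I0_def by (rule integral_mult_right[symmetric])
      also have "\<dots> = integral {tau..T} (\<lambda>s. exp (- p * (tau / 2)) * (exp ((p - qq) * s) * Psi 0 s))"
      proof (rule integral_cong)
        fix s
        have "exp (p * (T - tau / 2)) * exp (- p * (T - s)) * exp (- qq * s) = exp (- p * (tau / 2)) * exp ((p - qq) * s)"
          by (simp add: algebra_simps flip: exp_add)
        then have "exp (p * (T - tau / 2)) * exp (- p * (T - s)) * exp (- qq * s) * Psi 0 s = exp (- p * (tau / 2)) * exp ((p - qq) * s) * Psi 0 s"
          by (rule arg_cong)
        then show "exp (p * (T - tau / 2)) * (exp (- p * (T - s)) * (Psi 0 s * exp (- qq * s))) = exp (- p * (tau / 2)) * (exp ((p - qq) * s) * Psi 0 s)"
          by (simp only: mult_ac)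
      qed
      finally have eq: "exp (p * (T - tau / 2)) * I0 p qq = integral {tau..T} (\<lambda>s. exp (- p * (tau / 2)) * (exp ((p - qq) * s) * Psi 0 s))" .
      have "norm (integral {tau..T} (\<lambda>s. exp (- p * (tau / 2)) * (exp ((p - qq) * s) * Psi 0 s))) \<le> (exp (5 * nu * T) * N) * (T - tau)"
      proof (rule integral_bound)
        fix s assume s: "s \<in> {tau..T}"
        have "(p - qq) * s \<le> C0 * s" using pq s tau by (intro mult_right_mono) auto
        also have "\<dots> \<le> C0 * T" using C0 s by (intro mult_left_mono) auto
        finally have "exp ((p - qq) * s) * \<bar>Psi 0 s\<bar> \<le> exp (C0 * T) * N"
          using N(2)[OF s] by (intro mult_mono) auto
        then have "exp (- p * (tau / 2)) * (exp ((p - qq) * s) * \<bar>Psi 0 s\<bar>) \<le> exp (- p * (tau / 2)) * (exp (C0 * T) * N)"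
          by (intro mult_left_mono) auto
        also have "\<dots> \<le> exp (5 * nu * T) * N" using E N(1) by (simp only: mult.assoc[symmetric]) (intro mult_right_mono)
        finally show "norm (exp (- p * (tau / 2)) * (exp ((p - qq) * s) * Psi 0 s)) \<le> exp (5 * nu * T) * N"
          by (simp add: abs_mult)
      qed (use tau in \<open>auto intro!: continuous_intros\<close>)
      also have "\<dots> \<le> (exp (5 * nu * T) * N) * T" using tau N(1) by (intro mult_left_mono) auto
      finally show ?thesis unfolding eq by (simp add: mult.assoc)
    qed
    have "\<bar>J k d\<bar> \<le> C"
      using 1 2 unfolding J_def C_def p_def[symmetric] qq_def[symmetric] right_diff_distrib distrib_left by linarith
    then have "\<bar>cw k d\<bar> * \<bar>J k d\<bar> \<le> 1 * C" using abs_cw_le[OF kd(2,3)] C by (intro mult_mono) auto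
    then show ?thesis by (simp add: abs_mult)
  qed
  then show ?thesis using C by (auto simp: symbol_bound_def)
qed

text \<open>The control costs b + 3/2 powers of |m| for \<Lambda>^b and for inverting \<Lambda>^b Q,
  and two more for the difference of rates in \<open>Xd\<close>; Gaussian decay over the time tau /
  2 pays for all of them.\<close>

lemma Xd_bounded: "\<exists>C\<ge>0. \<forall>s\<in>{tau..T}. symbol_bound (\<lambda>m d. freq_norm m powr (3 / 2) * Xd m d s) C"
proof -
  obtain C1 where C1: "0 \<le> C1" "\<And>m d s. s \<in> {tau..T} \<Longrightarrow> \<bar>bump 0 m d s\<bar> \<le> C1" "\<And>m d s. s \<in> {tau..T} \<Longrightarrow> \<bar>bump 1 m d s\<bar> \<le> C1"
    using bump_bounded by blast
  define c where "c = nu * (tau / 2)"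
  have c: "0 < c" using nu_pos tau by (simp add: c_def)
  define r where "r = b + 3 / 2"
  obtain C2 where C2: "0 \<le> C2" "\<And>x. 1 \<le> x \<Longrightarrow> x powr (r + 2) * exp (- c * x\<^sup>2) \<le> C2"
    using powr_exp_bounded[OF c, of "r + 2"] by blast
  \<comment> \<open>The factors come from |m| \<le> 2 |m + d|, from \<open>abs_weight_le\<close>,
    from the -1 in \<open>ka\<close>, from the time profile and the difference of rates, and from
    the Gaussian bound.\<close>
  define C where "C = 2 powr r * 4 * exp c * (C1 * (1 + 6 * nu)) * C2"
  have C: "0 \<le> C" using C1(1) C2(1) nu_pos by (simp add: C_def)
  have "\<bar>freq_norm m powr (3 / 2) * Xd m d s\<bar> \<le> C" if s: "s \<in> {tau..T}" and md: "m \<noteq> 0" "d \<in> offs" "m + d \<noteq> 0" for m d s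
  proof -
    define x where "x = freq_norm (m + d)"
    have x: "1 \<le> x" using freq_norm_ge_1[OF md(3)] by (simp add: x_def)
    have m1: "1 \<le> freq_norm m" by (rule freq_norm_ge_1[OF md(1)])
    have "freq_norm ((m + d) + - d) \<le> freq_norm (m + d) + 1" by (rule freq_norm_add_offs(2)) (simp add: md)
    then have mx: "freq_norm m \<le> 2 * x" using x by (simp add: x_def)
    have f: "freq_norm m powr r \<le> 2 powr r * x powr r"
      using mx m1 x b_ge powr_mono2[of r "freq_norm m" "2 * x"] by (simp add: powr_mult r_def)
    have e: "exp (- ka (m + d) * (s - tau / 2)) \<le> exp c * exp (- c * x\<^sup>2)"
    proof -
      have "ka (m + d) * (tau / 2) \<le> ka (m + d) * (s - tau / 2)"
        using ka_nonneg[OF md(3)] s by (intro mult_left_mono) auto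
      moreover have "ka (m + d) * (tau / 2) = c * x\<^sup>2 - c" by (simp add: ka_def c_def x_def algebra_simps)
      ultimately show ?thesis by (simp flip: exp_add)
    qed
    have a: "\<bar>al m - ka (m + d)\<bar> \<le> 6 * nu * x\<^sup>2"
    proof -
      have "(freq_norm m)\<^sup>2 \<le> (2 * x)\<^sup>2" using mx by (intro power_mono) auto
      moreover have "1 \<le> x\<^sup>2" using x by (simp add: one_le_power)
      moreover have "(2 * x)\<^sup>2 = 4 * x\<^sup>2" by simp
      moreover have "0 \<le> (freq_norm m)\<^sup>2" by (rule zero_le_power2)
      ultimately have "\<bar>(freq_norm m)\<^sup>2 - (x\<^sup>2 - 1)\<bar> \<le> 6 * x\<^sup>2"
        unfolding abs_le_iff by linarith
      then have "nu * \<bar>(freq_norm m)\<^sup>2 - (x\<^sup>2 - 1)\<bar> \<le> nu * (6 * x\<^sup>2)" using nu_pos by (intro mult_left_mono) auto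
      moreover have "al m - ka (m + d) = nu * ((freq_norm m)\<^sup>2 - (x\<^sup>2 - 1))" by (simp add: al_def ka_def x_def algebra_simps)
      ultimately show ?thesis using nu_pos by (simp add: abs_mult)
    qed
    have g: "\<bar>bump 1 m d s + (al m - ka (m + d)) * bump 0 m d s\<bar> \<le> C1 * (1 + 6 * nu) * x\<^sup>2"
    proof -
      have "\<bar>(al m - ka (m + d)) * bump 0 m d s\<bar> \<le> (6 * nu * x\<^sup>2) * C1"
        unfolding abs_mult using a C1(2)[OF s, of m d] nu_pos by (intro mult_mono) auto
      moreover have "\<bar>bump 1 m d s\<bar> \<le> C1 * x\<^sup>2"
        using C1(3)[OF s, of m d] C1(1) mult_left_mono[of 1 "x\<^sup>2" C1] x by (simp add: one_le_power)
      ultimately show ?thesis by (simp add: algebra_simps)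
    qed
    have "\<bar>freq_norm m powr (3 / 2) * Xd m d s\<bar> = freq_norm m powr r * \<bar>weight m d\<bar> * exp (- ka (m + d) * (s - tau / 2))
        * \<bar>bump 1 m d s + (al m - ka (m + d)) * bump 0 m d s\<bar>"
      using m1 by (simp add: Xd_def abs_mult r_def powr_add mult_ac)
    also have "\<dots> \<le> (2 powr r * x powr r) * 4 * (exp c * exp (- c * x\<^sup>2)) * (C1 * (1 + 6 * nu) * x\<^sup>2)"
      using C1(1) nu_pos by (intro mult_mono f abs_weight_le e g) auto
    also have "\<dots> = 2 powr r * 4 * exp c * (C1 * (1 + 6 * nu)) * (x powr (r + 2) * exp (- c * x\<^sup>2))"
      using x by (simp add: powr_add powr_numeral mult_ac)
    also have "\<dots> \<le> C"
      unfolding C_def using C1(1) C2(2)[OF x] nu_pos by (intro mult_left_mono) auto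
    finally show ?thesis .
  qed
  then show ?thesis using C by (intro exI[of _ C]) (simp add: symbol_bound_def)
qed

text \<open>Applying d/ds + al m to Psi 0 s exp (-al m s) leaves only the term with
  \<open>Psi 1\<close>; the power 3/2 compensates P B = \<Lambda>^(-3/2).\<close>

definition decay :: "int \<times> int \<Rightarrow> real \<Rightarrow> real" where
  "decay m s = freq_norm m powr (3 / 2) * (Psi 1 s * exp (- al m * s))"

lemma decay_bounded: "\<exists>C\<ge>0. \<forall>s\<in>{tau..T}. \<forall>m. m \<noteq> 0 \<longrightarrow> \<bar>decay m s\<bar> \<le> C"
proof -
  obtain N where N: "0 \<le> N" "\<And>s. s \<in> {tau..T} \<Longrightarrow> \<bar>Psi 1 s\<bar> \<le> N" using Psi_bounded by force
  have "0 < nu * tau" using nu_pos tau by simp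
  from powr_exp_bounded[OF this, of "3 / 2"] obtain C where C: "0 \<le> C" "\<And>x. 1 \<le> x \<Longrightarrow> x powr (3 / 2) * exp (- (nu * tau) * x\<^sup>2) \<le> C" by blast
  have "\<bar>decay m s\<bar> \<le> N * C" if s: "s \<in> {tau..T}" and m: "m \<noteq> 0" for m s
  proof -
    have "al m * tau \<le> al m * s" using al_nonneg[of m] s by (intro mult_left_mono) auto
    then have "exp (- al m * s) \<le> exp (- (nu * tau) * (freq_norm m)\<^sup>2)" by (simp add: al_def mult_ac)
    then have "freq_norm m powr (3 / 2) * exp (- al m * s) \<le> freq_norm m powr (3 / 2) * exp (- (nu * tau) * (freq_norm m)\<^sup>2)"
      by (intro mult_left_mono) auto
    also have "\<dots> \<le> C" by (rule C(2)[OF freq_norm_ge_1[OF m]])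
    finally have "\<bar>Psi 1 s\<bar> * (freq_norm m powr (3 / 2) * exp (- al m * s)) \<le> N * C"
      using N(2)[OF s] N(1) by (intro mult_mono) auto
    then show ?thesis by (simp add: decay_def abs_mult mult_ac)
  qed
  then show ?thesis using N(1) C(1) by (intro exI[of _ "N * C"]) auto
qed

end

context steering
begin

text \<open>The coefficient $e^{-\kappa_k (T - \tau/2)}\, y_0(k)$, with $\kappa_k =$ \<open>ka k\<close>, is the part of the $k$-th
  target coefficient of $\eta$ that the transition \<open>Psi 0\<close> of $\xi$ does not produce by itself.\<close>

definition y0 :: "H \<times> H \<Rightarrow> H" where
  "y0 w = band (diag (\<lambda>k. exp (- ka k * (tau / 2)))) (snd w) + band (\<lambda>k d. cw k d * J k d) (fst w)"

definition y :: "H \<times> H \<Rightarrow> H" where "y w = halve (y0 w)"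

text \<open>B after \<Lambda>^(3/2) is a right inverse of P, so P (K w s) is the prescribed forcing.
  The power 3/2 is placed in the symbols, where the decay keeps them bounded.\<close>

definition K :: "H \<times> H \<Rightarrow> real \<Rightarrow> H" where
  "K w s = indicat_real {tau<..<T} s *\<^sub>R B (band (\<lambda>m d. freq_norm m powr (3 / 2) * Xd m d s) (y w)
    + band (diag (\<lambda>m. decay m s)) (fst w))"

lemma even_cw_J: "even_symbol (\<lambda>k d. cw k d * J k d)"
  by (simp add: even_symbol_def J_uminus)

lemma fc_y0: "fc (y0 w) k = exp (- ka k * (tau / 2)) *\<^sub>R fc (snd w) k + (\<Sum>d\<in>offs. (cw k d * J k d) *\<^sub>R fc (fst w) (k + d))"
proof -
  obtain C where C: "symbol_bound (\<lambda>k d. cw k d * J k d) C" using J_bounded by blast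
  have "fc (band (diag (\<lambda>k. exp (- ka k * (tau / 2)))) (snd w)) k = exp (- ka k * (tau / 2)) *\<^sub>R fc (snd w) k"
    by (rule fc_band_diag[where M = 1]) (use exp_ka_le[of _ "tau / 2"] tau in auto)
  then show ?thesis by (simp add: y0_def fc_add fc_band[OF even_cw_J C])
qed

lemma bounded_linear_y: "bounded_linear y"
proof -
  obtain C where C: "0 \<le> C" "symbol_bound (\<lambda>k d. cw k d * J k d) C" using J_bounded by blast
  have s: "symbol_bound (diag (\<lambda>k. exp (- ka k * (tau / 2)))) 1"
    by (rule symbol_bound_diag) (use exp_ka_le[of _ "tau / 2"] tau in auto)
  have "bounded_linear y0"
    unfolding y0_def[abs_def]
    by (intro bounded_linear_add bounded_linear_compose[OF bounded_linear_band[OF _ s] bounded_linear_snd]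
        bounded_linear_compose[OF bounded_linear_band[OF even_cw_J C(2,1)] bounded_linear_fst]) auto
  then show ?thesis
    unfolding y_def[abs_def] halve_def by (rule bounded_linear_compose[OF halve.bounded_linear_real_diag])
qed

text \<open>The cancellation of \<open>R_in_Z\<close> again: at the modes of \<phi> the rate
  \<open>ka\<close> is 0, and \<open>J\<close> takes one and the same value at all diagonal
  neighbours.\<close>

lemma y0_perp:
  assumes "w \<in> Z"
  shows "y0 w \<bullet> phi = 0"
proof -
  have f1: "(freq_norm (1, 0))\<^sup>2 = 1" "(freq_norm (0, 1))\<^sup>2 = 1"
    and f2: "(freq_norm (1, 1))\<^sup>2 = 2" "(freq_norm (- 1, 1))\<^sup>2 = 2" "(freq_norm (1, - 1))\<^sup>2 = 2"
    by (simp_all add: freq_norm_sq)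
  have f3: "freq_norm (1, 1) = sqrt 2" "freq_norm (- 1, 1) = sqrt 2" "freq_norm (1, - 1) = sqrt 2"
    by (simp_all add: freq_norm_def)
  have k1: "ka (1, 0) = 0" "ka (0, 1) = 0" by (simp_all add: ka_def f1)
  define W where "W k d = freq_norm (k + d) powr (- b) * J k d" for k d
  have "Re (\<Sum>d\<in>offs. (coupling (1, 0) d * W (1, 0) d) *\<^sub>R fc (fst w) ((1, 0) + d))
      + Re (\<Sum>d\<in>offs. (coupling (0, 1) d * W (0, 1) d) *\<^sub>R fc (fst w) ((0, 1) + d)) = 0"
    by (rule coupling_sum_perp_phi[of _ "sqrt 2 powr (- b) * (duhamel 0 (nu * 2) T - I0 0 (nu * 2))"])
      (simp_all add: W_def J_def al_def k1 f2 f3)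
  then have "y0 w \<bullet> phi = snd w \<bullet> phi"
    by (simp add: inner_phi fc_y0 k1 cw_def W_def mult.assoc)
  then show ?thesis using assms by (simp add: Z_iff)
qed

lemma even_Xd: "even_symbol (\<lambda>m d. freq_norm m powr (3 / 2) * Xd m d s)"
  by (simp add: even_symbol_def Xd_uminus)

lemma even_decay: "decay (- m) s = decay m s"
  by (simp add: decay_def)

lemma fc_K:
  "fc (P (K w s)) m = indicat_real {tau<..<T} s *\<^sub>R ((\<Sum>d\<in>offs. Xd m d s *\<^sub>R fc (y w) (m + d)) + (Psi 1 s * exp (- al m * s)) *\<^sub>R fc (fst w) m)"
proof (cases "s \<in> {tau<..<T}")
  case True
  obtain C1 where C1: "\<And>s. s \<in> {tau..T} \<Longrightarrow> symbol_bound (\<lambda>m d. freq_norm m powr (3 / 2) * Xd m d s) C1" using Xd_bounded by blast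
  obtain C2 where C2: "\<And>s m. s \<in> {tau..T} \<Longrightarrow> m \<noteq> 0 \<Longrightarrow> \<bar>decay m s\<bar> \<le> C2" using decay_bounded by meson
  have s: "s \<in> {tau..T}" using True by auto
  have d: "fc (band (diag (\<lambda>m. decay m s)) (fst w)) m = decay m s *\<^sub>R fc (fst w) m"
    by (rule fc_band_diag[where M = C2]) (use C2[OF s] even_decay in auto)
  have "fc (P (K w s)) m = freq_norm m powr (- 3 / 2) *\<^sub>R (fc (band (\<lambda>m d. freq_norm m powr (3 / 2) * Xd m d s) (y w)) m + decay m s *\<^sub>R fc (fst w) m)"
    using True by (simp add: K_def fc_P_B fc_add d)
  also have "\<dots> = (\<Sum>d\<in>offs. Xd m d s *\<^sub>R fc (y w) (m + d)) + (Psi 1 s * exp (- al m * s)) *\<^sub>R fc (fst w) m"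
  proof (cases "m = 0")
    case True
    then show ?thesis by (simp add: Xd_def)
  next
    case False
    have c: "freq_norm m powr (- 3 / 2) * (freq_norm m powr (3 / 2) * z) = z" for z
      using freq_norm_ge_1[OF False] by (simp add: mult.assoc[symmetric] flip: powr_add)
    show ?thesis
      using False by (simp only: fc_band[OF even_Xd C1[OF s]] decay_def scaleR_add_right scaleR_sum_right scaleR_scaleR c if_False)
  qed
  finally show ?thesis using True by simp
next
  case False
  then show ?thesis by (simp add: K_def P.fc_real_diag complex_eq_iff)
qed

lemma K_linear: "K (v + w) s = K v s + K w s" "K (c *\<^sub>R w) s = c *\<^sub>R K w s"
  and K_bounded: "\<exists>M>0. \<forall>w s. norm (K w s) \<le> M * norm w"
proof -
  obtain C1 where C1: "0 \<le> C1" "\<And>s. s \<in> {tau..T} \<Longrightarrow> symbol_bound (\<lambda>m d. freq_norm m powr (3 / 2) * Xd m d s) C1" using Xd_bounded by blast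
  obtain C2 where C2: "0 \<le> C2" "\<And>s m. s \<in> {tau..T} \<Longrightarrow> m \<noteq> 0 \<Longrightarrow> \<bar>decay m s\<bar> \<le> C2" using decay_bounded by meson
  define L where "L s w = B (band (\<lambda>m d. freq_norm m powr (3 / 2) * Xd m d s) (y w) + band (diag (\<lambda>m. decay m s)) (fst w))" for s w
  have sb: "symbol_bound (diag (\<lambda>m. decay m s)) C2" if "s \<in> {tau..T}" for s
    by (rule symbol_bound_diag) (use C2 that in auto)
  have ed: "even_symbol (diag (\<lambda>m. decay m s))" for s by (simp add: even_decay)
  have lin: "bounded_linear (L s)" if s: "s \<in> {tau..T}" for s
    unfolding L_def[abs_def]
    by (intro bounded_linear_compose[OF B.bounded_linear_real_diag] bounded_linear_add
        bounded_linear_compose[OF bounded_linear_band[OF even_Xd C1(2)[OF s] C1(1)] bounded_linear_y]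
        bounded_linear_compose[OF bounded_linear_band[OF ed sb[OF s] C2(1)] bounded_linear_fst])
  have K: "K w s = indicat_real {tau<..<T} s *\<^sub>R L s w" for w s by (simp add: K_def L_def)
  show "K (v + w) s = K v s + K w s" "K (c *\<^sub>R w) s = c *\<^sub>R K w s"
    using linear_add[OF bounded_linear.linear[OF lin], of s v w] linear_scale[OF bounded_linear.linear[OF lin], of s c w]
    by (cases "s \<in> {tau<..<T}"; simp add: K)+
  obtain M0 where M0: "0 < M0" "\<And>w. norm (y w) \<le> norm w * M0"
    using bounded_linear.pos_bounded[OF bounded_linear_y] by blast
  define M where "M = 1 / cQ * (5 * C1 * M0 + 5 * C2)"
  have M: "0 \<le> M" using cQ_pos C1 C2 M0 by (simp add: M_def)
  have "norm (K w s) \<le> M * norm w" for w s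
  proof (cases "s \<in> {tau<..<T}")
    case True
    then have s: "s \<in> {tau..T}" by auto
    have "norm (L s w) \<le> 1 / cQ * norm (band (\<lambda>m d. freq_norm m powr (3 / 2) * Xd m d s) (y w) + band (diag (\<lambda>m. decay m s)) (fst w))"
      unfolding L_def by (rule B.norm_real_diag)
    also have "\<dots> \<le> 1 / cQ * (5 * C1 * (norm w * M0) + 5 * C2 * norm w)"
    proof (intro mult_left_mono order_trans[OF norm_triangle_ineq] add_mono)
      show "norm (band (\<lambda>m d. freq_norm m powr (3 / 2) * Xd m d s) (y w)) \<le> 5 * C1 * (norm w * M0)"
        by (rule order_trans[OF norm_band_le[OF even_Xd C1(2)[OF s] C1(1)]]) (use mult_left_mono[OF M0(2)[of w], of "5 * C1"] C1(1) in simp)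
      show "norm (band (diag (\<lambda>m. decay m s)) (fst w)) \<le> 5 * C2 * norm w"
        by (rule order_trans[OF norm_band_le[OF ed sb[OF s] C2(1)]])
          (use C2 norm_fst_le[of "fst w" "snd w"] in \<open>auto intro: mult_left_mono\<close>)
    qed (use cQ_pos in simp)
    finally show ?thesis using True by (simp add: K M_def algebra_simps)
  qed (use M in \<open>simp add: K\<close>)
  moreover have "M * norm w \<le> (M + 1) * norm w" for w :: "H \<times> H" by (simp add: algebra_simps)
  ultimately have "norm (K w s) \<le> (M + 1) * norm w" for w s by (rule order_trans)
  then show "\<exists>M>0. \<forall>w s. norm (K w s) \<le> M * norm w"
    using M by (intro exI[of _ "M + 1"]) simp
qed

lemma K_measurable: "K w \<in> borel_measurable lborel"
proof (rule borel_measurable_fcI)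
  fix k
  obtain C1 where C1: "\<And>s. s \<in> {tau..T} \<Longrightarrow> symbol_bound (\<lambda>m d. freq_norm m powr (3 / 2) * Xd m d s) C1" using Xd_bounded by blast
  obtain C2 where C2: "\<And>s m. s \<in> {tau..T} \<Longrightarrow> m \<noteq> 0 \<Longrightarrow> \<bar>decay m s\<bar> \<le> C2" using decay_bounded by meson
  define g where "g s = (if k = 0 then 0 else \<Sum>d\<in>offs. (freq_norm k powr (3 / 2) * Xd k d s) *\<^sub>R fc (y w) (k + d)) + decay k s *\<^sub>R fc (fst w) k" for s
  have eq: "fc (K w s) k = indicat_real {tau<..<T} s *\<^sub>R Complex (Bu Cos k * Re (g s)) (Bu Sin k * Im (g s))" for s
  proof (cases "s \<in> {tau<..<T}")
    case True
    then have s: "s \<in> {tau..T}" by auto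
    have "fc (band (diag (\<lambda>m. decay m s)) (fst w)) k = decay k s *\<^sub>R fc (fst w) k"
      by (rule fc_band_diag[where M = C2]) (use C2[OF s] even_decay in auto)
    then show ?thesis using True by (simp add: K_def B.fc_real_diag fc_add fc_band[OF even_Xd C1[OF s]] g_def)
  qed (simp add: K_def)
  have [measurable]: "Xd k d \<in> borel_measurable borel" "Psi i \<in> borel_measurable borel" for d i
    by (intro borel_measurable_continuous_onI continuous_intros)+
  have [measurable]: "g \<in> borel_measurable borel" unfolding g_def decay_def by measurable
  have "(\<lambda>s. Complex (Bu Cos k * Re (g s)) (Bu Sin k * Im (g s))) \<in> borel_measurable borel"
    unfolding Complex_eq by measurable
  then show "(\<lambda>s. fc (K w s) k) \<in> borel_measurable lborel" unfolding eq by measurable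
qed

text \<open>The $k$-th coefficients of $\Lambda^b \xi$ along the controlled trajectory, which passes from $0$ at
  \<open>tau\<close> to the target at \<open>T\<close>; \<open>forcing\<close> is its image under $\partial_s - \nu\Delta$.\<close>

definition path :: "H \<times> H \<Rightarrow> int \<times> int \<Rightarrow> real \<Rightarrow> complex" where
  "path w m s = (\<Sum>d\<in>offs. X m d s *\<^sub>R fc (y w) (m + d)) + (Psi 0 s * exp (- al m * s)) *\<^sub>R fc (fst w) m"

definition forcing :: "H \<times> H \<Rightarrow> int \<times> int \<Rightarrow> real \<Rightarrow> complex" where
  "forcing w m s = (\<Sum>d\<in>offs. Xd m d s *\<^sub>R fc (y w) (m + d)) + (Psi 1 s * exp (- al m * s)) *\<^sub>R fc (fst w) m"

lemma path_deriv: "(path w m has_vector_derivative forcing w m s - al m *\<^sub>R path w m s) (at s within A)"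
proof -
  have X: "((\<lambda>s. X m d s *\<^sub>R fc (y w) (m + d)) has_vector_derivative (Xd m d s - al m * X m d s) *\<^sub>R fc (y w) (m + d)) (at s within A)" for d
    using has_vector_derivative_scaleR[OF has_field_derivative_at_within[OF X_deriv] has_vector_derivative_const] by simp
  have "((\<lambda>s. Psi 0 s * exp (- al m * s)) has_real_derivative Psi 1 s * exp (- al m * s) - al m * (Psi 0 s * exp (- al m * s))) (at s)"
    by (rule derivative_eq_intros Psi_deriv refl)+ (simp add: algebra_simps)
  from has_vector_derivative_scaleR[OF has_field_derivative_at_within[OF this] has_vector_derivative_const]
  have P: "((\<lambda>s. (Psi 0 s * exp (- al m * s)) *\<^sub>R fc (fst w) m) has_vector_derivative
      (Psi 1 s * exp (- al m * s) - al m * (Psi 0 s * exp (- al m * s))) *\<^sub>R fc (fst w) m) (at s within A)" by simp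
  show ?thesis
    unfolding path_def[abs_def] forcing_def
    by (rule has_vector_derivative_eq_rhs[OF has_vector_derivative_add[OF has_vector_derivative_sum[OF X] P]])
      (simp add: scaleR_diff_left sum_subtractf scaleR_sum_right scaleR_add_right)
qed

lemma path_ends: "path w m tau = 0" "path w m T = exp (- al m * T) *\<^sub>R fc (fst w) m"
  using Psi_ends by (simp_all add: path_def X_def tau_def[symmetric])

lemma continuous_path [continuous_intros]: "continuous_on A (path w m)" "continuous_on A (forcing w m)"
  unfolding path_def forcing_def by (intro continuous_intros)+

lemma set_integral_forcing:
  assumes p: "continuous_on {tau..T} p"
  shows "(LINT s:{0<..<T}|lborel. p s *\<^sub>R (indicat_real {tau<..<T} s *\<^sub>R forcing w m s)) = integral {tau..T} (\<lambda>s. p s *\<^sub>R forcing w m s)"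
proof -
  have "(LINT s:{0<..<T}|lborel. p s *\<^sub>R (indicat_real {tau<..<T} s *\<^sub>R forcing w m s)) = (LINT s:{tau<..<T}|lborel. p s *\<^sub>R forcing w m s)"
    unfolding set_lebesgue_integral_def
    by (intro Bochner_Integration.integral_cong refl) (use tau in \<open>auto simp: indicator_def\<close>)
  also have "\<dots> = integral {tau..T} (\<lambda>s. p s *\<^sub>R forcing w m s)"
    by (rule set_integral_Ioo_eq_integral(2)) (intro continuous_intros p)
  finally show ?thesis .
qed

text \<open>What the neighbour k + d adds to \<eta> at k. By \<open>bump_moment\<close> each X
  integrates to 0 or to a constant, according to whether |k + d + e| = |k|; the part with
  \<open>Psi 0\<close> is \<open>I0\<close>.\<close>

lemma integral_path:
  assumes k: "k \<noteq> 0" and d: "d \<in> offs"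
  shows "cw k d *\<^sub>R integral {tau..T} (\<lambda>s. exp (- ka k * (T - s)) *\<^sub>R path w (k + d) s)
    = exp (- ka k * (T - tau / 2)) *\<^sub>R (\<Sum>e\<in>offs. (coupling k d * weight (k + d) e * of_bool (isq (k + d + e) = isq k)) *\<^sub>R fc (y w) (k + d + e))
      + (cw k d * I0 (ka k) (al (k + d))) *\<^sub>R fc (fst w) (k + d)"
proof -
  let ?m = "k + d"
  define A where "A e = integral {tau..T} (\<lambda>s. exp (- ka k * (T - s)) * X ?m e s)" for e
  have int: "(\<lambda>s. exp (- ka k * (T - s)) * X ?m e s) integrable_on {tau..T}" "(\<lambda>s. exp (- ka k * (T - s)) * (Psi 0 s * exp (- al ?m * s))) integrable_on {tau..T}" for e
    by (intro integrable_continuous_real continuous_intros)+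
  have "((\<lambda>s. (\<Sum>e\<in>offs. (exp (- ka k * (T - s)) * X ?m e s) *\<^sub>R fc (y w) (?m + e)) + (exp (- ka k * (T - s)) * (Psi 0 s * exp (- al ?m * s))) *\<^sub>R fc (fst w) ?m)
      has_integral (\<Sum>e\<in>offs. A e *\<^sub>R fc (y w) (?m + e)) + I0 (ka k) (al ?m) *\<^sub>R fc (fst w) ?m) {tau..T}"
    unfolding A_def I0_def
    by (intro has_integral_add has_integral_sum has_integral_scaleR_left integrable_integral int finite_offs)
  then have 1: "integral {tau..T} (\<lambda>s. exp (- ka k * (T - s)) *\<^sub>R path w ?m s)
      = (\<Sum>e\<in>offs. A e *\<^sub>R fc (y w) (?m + e)) + I0 (ka k) (al ?m) *\<^sub>R fc (fst w) ?m"
    unfolding path_def scaleR_add_right scaleR_sum_right scaleR_scaleR by (rule integral_unique)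
  have 2: "cw k d * A e = exp (- ka k * (T - tau / 2)) * (coupling k d * weight ?m e * of_bool (isq (?m + e) = isq k))" if e: "e \<in> offs" for e
  proof (cases "d = 0 \<or> e = 0 \<or> ?m = 0")
    case True
    have "coupling k d = 0" if "?m = 0"
    proof -
      have "d = - k" using that by (simp add: eq_neg_iff_add_eq_0 add.commute)
      then show ?thesis by (simp add: coupling_def mult.commute)
    qed
    then show ?thesis using True by (auto simp: cw_def A_def X_def weight_def)
  next
    case False
    \<comment> \<open>Seen from m = k + d, the receiving mode k is the neighbour with offset
      -d.\<close>
    have rate: "rate ?m e (- d) = ka k - ka (?m + e)" by (simp add: rate_def)
    have "A e = integral {tau..T} (\<lambda>s. (freq_norm ?m powr b * weight ?m e * exp (- ka k * T + ka (?m + e) * (tau / 2))) * (exp (rate ?m e (- d) * s) * bump 0 ?m e s))"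
      unfolding A_def
    proof (rule integral_cong)
      fix s
      have "exp (- ka k * (T - s)) * exp (- ka (?m + e) * (s - tau / 2)) = exp (- ka k * T + ka (?m + e) * (tau / 2)) * exp (rate ?m e (- d) * s)"
        unfolding rate by (simp add: algebra_simps flip: exp_add)
      then have "freq_norm ?m powr b * weight ?m e * (exp (- ka k * (T - s)) * exp (- ka (?m + e) * (s - tau / 2))) * bump 0 ?m e s
          = freq_norm ?m powr b * weight ?m e * (exp (- ka k * T + ka (?m + e) * (tau / 2)) * exp (rate ?m e (- d) * s)) * bump 0 ?m e s" by (simp only:)
      then show "exp (- ka k * (T - s)) * X ?m e s = (freq_norm ?m powr b * weight ?m e * exp (- ka k * T + ka (?m + e) * (tau / 2))) * (exp (rate ?m e (- d) * s) * bump 0 ?m e s)"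
        unfolding X_def by (simp only: mult_ac)
    qed
    also have "\<dots> = freq_norm ?m powr b * weight ?m e * exp (- ka k * T + ka (?m + e) * (tau / 2)) * of_bool (rate ?m e (- d) = 0)"
      using False d e by (subst integral_mult_right) (simp add: bump_moment)
    also have "\<dots> = freq_norm ?m powr b * weight ?m e * exp (- ka k * (T - tau / 2)) * of_bool (isq (?m + e) = isq k)"
      unfolding rate using ka_eq_iff[of k "?m + e"] by (auto simp: algebra_simps)
    finally have A: "A e = freq_norm ?m powr b * (weight ?m e * exp (- ka k * (T - tau / 2)) * of_bool (isq (?m + e) = isq k))" by (simp only: mult.assoc)
    have "cw k d * A e = coupling k d * (freq_norm ?m powr b * freq_norm ?m powr - b) * (weight ?m e * exp (- ka k * (T - tau / 2)) * of_bool (isq (?m + e) = isq k))"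
      unfolding cw_def A by (simp only: mult_ac)
    then show ?thesis using freq_powr_cancel[of ?m] False by (simp only: mult_1_right de_Morgan_disj simp_thms not_False_eq_True) (simp only: mult_ac)
  qed
  have "cw k d *\<^sub>R (\<Sum>e\<in>offs. A e *\<^sub>R fc (y w) (?m + e)) = (\<Sum>e\<in>offs. (cw k d * A e) *\<^sub>R fc (y w) (?m + e))"
    by (simp add: scaleR_sum_right)
  also have "\<dots> = (\<Sum>e\<in>offs. (exp (- ka k * (T - tau / 2)) * (coupling k d * weight ?m e * of_bool (isq (?m + e) = isq k))) *\<^sub>R fc (y w) (?m + e))"
    by (intro sum.cong refl) (simp only: 2)
  also have "\<dots> = exp (- ka k * (T - tau / 2)) *\<^sub>R (\<Sum>e\<in>offs. (coupling k d * weight ?m e * of_bool (isq (?m + e) = isq k)) *\<^sub>R fc (y w) (?m + e))"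
    by (simp only: scaleR_sum_right scaleR_scaleR)
  finally show ?thesis unfolding 1 by (simp add: scaleR_add_right)
qed

text \<open>The source produced by K w is \<open>forcing\<close>. In both components, integration by
  parts in time replaces it by \<open>path\<close>, whose end values and weighted time integrals are
  known.\<close>

lemma control_map_K:
  assumes w: "w \<in> Z"
  shows "control_map nu b Q T (K w) = lift (R T w)"
proof -
  obtain M where M: "\<And>s. norm (K w s) \<le> M * norm w" using K_bounded by blast
  have T0: "0 \<le> T" using T_pos by simp
  have L2: "K w \<in> L2_time T" by (rule L2_time_bounded(1)[OF K_measurable _ T0]) (rule M)
  define h where "h s = indicat_real {0<..<T} s *\<^sub>R P (K w s)" for s
  have h: "integrable lborel h" "control_map nu b Q T (K w) = lift (U h T)"
    using control_map_P[OF L2 T0] by (simp_all add: h_def[abs_def])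
  have fch: "fc (h s) m = indicat_real {tau<..<T} s *\<^sub>R forcing w m s" for s m
  proof -
    have "indicat_real {0<..<T} s * indicat_real {tau<..<T} s = indicat_real {tau<..<T} s"
      using tau by (auto simp: indicator_def)
    then show ?thesis by (simp add: h_def fc_scaleR fc_K forcing_def)
  qed
  have "U h T = R T w"
  proof (rule H_pair_eqI)
    fix k
    \<comment> \<open>The integrand is the derivative of exp (-al k (T - s)) path, so \<xi> arrives
      at the value prescribed by \<open>path_ends\<close>.\<close>
    have "((\<lambda>s. exp (- al k * (T - s)) *\<^sub>R forcing w k s) has_integral
        exp (- al k * (T - T)) *\<^sub>R path w k T - exp (- al k * (T - tau)) *\<^sub>R path w k tau) {tau..T}"
    proof (rule fundamental_theorem_of_calculus)
      fix s
      have "((\<lambda>s. exp (- al k * (T - s))) has_real_derivative al k * exp (- al k * (T - s))) (at s within {tau..T})"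
        by (auto intro!: derivative_eq_intros)
      from has_vector_derivative_scaleR[OF this path_deriv[of w k s "{tau..T}"]]
      show "((\<lambda>s. exp (- al k * (T - s)) *\<^sub>R path w k s) has_vector_derivative exp (- al k * (T - s)) *\<^sub>R forcing w k s) (at s within {tau..T})"
        by (simp add: scaleR_diff_right mult.commute)
    qed (use tau in simp)
    then show "fc (fst (U h T)) k = fc (fst (R T w)) k"
      unfolding fc_U_fst[OF h(1)] fch
      by (subst set_integral_forcing) (auto intro!: continuous_intros simp: path_ends fc_R_fst T0 integral_unique)
  next
    fix k
    show "fc (snd (U h T)) k = fc (snd (R T w)) k"
    proof (cases "k = 0")
      case False
      have dc: "continuous_on A (\<lambda>s. duh k d (T - s))" for A d
        unfolding duh_def by (intro continuous_on_compose2[OF continuous_on_duhamel[of UNIV]] continuous_intros) auto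
      \<comment> \<open>By \<open>DERIV_duhamel'\<close>, differentiating the kernel trades the rate
        \<open>al\<close> of the source for the relaxation exp (-ka k (T - s)). The boundary terms
        vanish: the kernel is 0 at s = T, the path is 0 at tau.\<close>
      have 1: "(LINT s:{0<..<T}|lborel. duh k d (T - s) *\<^sub>R fc (h s) (k + d)) = integral {tau..T} (\<lambda>s. exp (- ka k * (T - s)) *\<^sub>R path w (k + d) s)" for d
      proof -
        have "((\<lambda>s. duh k d (T - s) *\<^sub>R forcing w (k + d) s - exp (- ka k * (T - s)) *\<^sub>R path w (k + d) s) has_integral
            duh k d (T - T) *\<^sub>R path w (k + d) T - duh k d (T - tau) *\<^sub>R path w (k + d) tau) {tau..T}"
        proof (rule fundamental_theorem_of_calculus)
          fix s
          have "(duh k d has_real_derivative exp (- ka k * (T - s)) - al (k + d) * duh k d (T - s)) (at (T - s))"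
            unfolding duh_def using DERIV_duhamel'[of "ka k" "al (k + d)" "T - s" UNIV] by simp
          then have "((\<lambda>s. duh k d (T - s)) has_real_derivative (exp (- ka k * (T - s)) - al (k + d) * duh k d (T - s)) * - 1) (at s within {tau..T})"
            by (rule DERIV_chain2) (auto intro!: derivative_eq_intros)
          from has_vector_derivative_scaleR[OF this path_deriv[of w "k + d" s "{tau..T}"]]
          show "((\<lambda>s. duh k d (T - s) *\<^sub>R path w (k + d) s) has_vector_derivative
              duh k d (T - s) *\<^sub>R forcing w (k + d) s - exp (- ka k * (T - s)) *\<^sub>R path w (k + d) s) (at s within {tau..T})"
            by (simp add: algebra_simps)
        qed (use tau in simp)
        then have "integral {tau..T} (\<lambda>s. duh k d (T - s) *\<^sub>R forcing w (k + d) s - exp (- ka k * (T - s)) *\<^sub>R path w (k + d) s) = 0"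
          by (simp add: integral_unique path_ends(1) duh_def)
        moreover have "integral {tau..T} (\<lambda>s. duh k d (T - s) *\<^sub>R forcing w (k + d) s - exp (- ka k * (T - s)) *\<^sub>R path w (k + d) s)
            = integral {tau..T} (\<lambda>s. duh k d (T - s) *\<^sub>R forcing w (k + d) s) - integral {tau..T} (\<lambda>s. exp (- ka k * (T - s)) *\<^sub>R path w (k + d) s)"
          by (intro Henstock_Kurzweil_Integration.integral_diff integrable_continuous_real continuous_intros dc)
        ultimately show ?thesis
          unfolding fch by (subst set_integral_forcing[OF dc]) simp
      qed
      have "fc (snd (U h T)) k = (\<Sum>d\<in>offs. exp (- ka k * (T - tau / 2)) *\<^sub>R (\<Sum>e\<in>offs. (coupling k d * weight (k + d) e * of_bool (isq (k + d + e) = isq k)) *\<^sub>R fc (y w) (k + d + e))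
          + (cw k d * I0 (ka k) (al (k + d))) *\<^sub>R fc (fst w) (k + d))"
        unfolding fc_U_snd[OF h(1)] 1 by (intro sum.cong refl integral_path False)
      \<comment> \<open>The double sum over d and e is \<open>weight_inverts_coupling\<close>,
        applicable because \<open>y0 w\<close> is orthogonal to \<phi>.\<close>
      also have "\<dots> = exp (- ka k * (T - tau / 2)) *\<^sub>R fc (y0 w) k + (\<Sum>d\<in>offs. (cw k d * I0 (ka k) (al (k + d))) *\<^sub>R fc (fst w) (k + d))"
        unfolding sum.distrib scaleR_sum_right[symmetric] y_def weight_inverts_coupling[OF y0_perp[OF w] False] ..
      \<comment> \<open>The definition of \<open>J\<close> makes the terms with \<open>I0\<close>
        cancel and leaves the Duhamel coefficients of \<open>R T\<close>.\<close>
      also have "\<dots> = exp (- ka k * T) *\<^sub>R fc (snd w) k + (\<Sum>d\<in>offs. (cw k d * duh k d T) *\<^sub>R fc (fst w) (k + d))"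
      proof -
        have e1: "exp (- ka k * (T - tau / 2)) * exp (- ka k * (tau / 2)) = exp (- ka k * T)"
          by (simp add: algebra_simps flip: exp_add)
        have "exp (- ka k * (T - tau / 2)) * exp (ka k * (T - tau / 2)) = 1" by (simp flip: exp_add)
        then have "exp (- ka k * (T - tau / 2)) * J k d = duh k d T - I0 (ka k) (al (k + d))" for d
          unfolding J_def duh_def mult.assoc[symmetric] by simp
        then have e2: "exp (- ka k * (T - tau / 2)) * (cw k d * J k d) = cw k d * (duh k d T - I0 (ka k) (al (k + d)))" for d
          by (metis mult.left_commute)
        show ?thesis
          unfolding fc_y0 scaleR_add_right scaleR_sum_right scaleR_scaleR e1 e2
          by (simp add: right_diff_distrib scaleR_diff_left sum_subtractf)
      qed
      finally show ?thesis by (simp add: fc_R_snd T0)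
    qed simp
  qed
  then show ?thesis using h(2) by simp
qed

end

theorem theorem5p3:
  fixes \<nu> c\<^sub>Q C\<^sub>Q a b T :: real
    and q :: "int \<times> int \<Rightarrow> parity \<Rightarrow> real"
    and Q :: "H \<Rightarrow> H"
  assumes "\<nu> > 0"
    and "0 < c\<^sub>Q" and "c\<^sub>Q \<le> C\<^sub>Q"
    and "a > 14" and "b = (a - 3) / 2"
    and "bounded_linear Q"
    and "\<And>k \<iota>. k \<in> Z2_plus \<Longrightarrow> Q (mode k \<iota>) = q k \<iota> *\<^sub>R mode k \<iota>"
    and "\<And>k \<iota>. k \<in> Z2_plus \<Longrightarrow>
           c\<^sub>Q * freq_norm k powr (- a / 2) \<le> \<bar>q k \<iota>\<bar> \<and> \<bar>q k \<iota>\<bar> \<le> C\<^sub>Q * freq_norm k powr (- a / 2)"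
    and "T > 0"
  shows "\<exists>C\<ge>0.
    (\<forall>\<xi>\<in>E b. (E_norm b (flow_adjoint \<nu> b T \<xi>))\<^sup>2
        \<le> C * (L2_time_norm T (control_adjoint \<nu> b Q T \<xi>))\<^sup>2)
    \<and> (\<exists>K. bounded_op_E_L2 b T K
        \<and> (\<forall>x\<in>E b. flow \<nu> b T x = control_map \<nu> b Q T (K x))
        \<and> op_norm_E_L2 b T K \<le> sqrt C)"
proof -
  have a: "a = 2 * b + 3" using assms(5) by simp
  have "T / 2 < T" using \<open>T > 0\<close> by simp
  from smooth_step_exists[OF this] obtain Psi :: "nat \<Rightarrow> real \<Rightarrow> real" where
    "(\<forall>i s. (Psi i has_real_derivative Psi (Suc i) s) (at s))
      \<and> Psi 0 (T / 2) = 0 \<and> Psi 0 T = 1 \<and> (\<forall>i\<in>{1..4}. Psi i (T / 2) = 0 \<and> Psi i T = 0)" by (rule exE)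
  then have Psi: "\<And>i s. (Psi i has_real_derivative Psi (Suc i) s) (at s)" "Psi 0 (T / 2) = 0" "Psi 0 T = 1"
    "\<And>i. i \<in> {1..4} \<Longrightarrow> Psi i (T / 2) = 0" "\<And>i. i \<in> {1..4} \<Longrightarrow> Psi i T = 0" by simp_all
  interpret steering \<nu> b Q q c\<^sub>Q C\<^sub>Q T Psi
  proof (intro steering.intro controlled.intro linearised_vorticity.intro controlled_axioms.intro steering_axioms.intro)
    show "0 < \<nu>" "1 \<le> b" "0 < c\<^sub>Q" "bounded_linear Q" "0 < T" using assms(1-6,9) by simp_all
    show "Q (mode k \<iota>) = q k \<iota> *\<^sub>R mode k \<iota>" if "k \<in> Z2_plus" for k \<iota> using assms(7) that .
    show "c\<^sub>Q * freq_norm k powr (- (2 * b + 3) / 2) \<le> \<bar>q k \<iota>\<bar>" "\<bar>q k \<iota>\<bar> \<le> C\<^sub>Q * freq_norm k powr (- (2 * b + 3) / 2)"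
      if "k \<in> Z2_plus" for k \<iota> using assms(8)[OF that] by (simp_all add: a)
  qed (fact Psi)+
  obtain M where "0 < M" "\<And>w s. norm (K w s) \<le> M * norm w" using K_bounded by blast
  then show ?thesis
    by (intro observability_of_right_inverse[where K = K] K_linear K_measurable control_map_K)
      (use \<open>T > 0\<close> in simp_all)
qed

end
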